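(* For each pure braid $A\in\ker\phi\subset PB(4)$ and all $t_1,t_2\in\mathbb{Z}$, the spatial theta graph $G(A,t_1,t_2)\subset S^3$ (defined in the context) has the Brunnian property, i.e. for each of its three edges $e$, the knot obtained by removing the interior of $e$ from $G(A,t_1,t_2)$ is the unknot.
   Context: Work in the PL or smooth category. A \emph{spatial theta graph} is a graph with two vertices and three edges, each edge joining the two vertices, embedded in $S^3$. A spatial theta graph $G$ has the \emph{Brunnian property} if for each edge $e$ of $G$ the knot $K_e$ obtained from $G$ by removing the interior of $e$ is the unknot. \textbf{Braids.} $PB(k)$ is the pure braid group on $k$ strands. Braids are drawn vertically with strands numbered $1,\dots,k$ from left to right, and $\sigma\rho$ is the braid with $\sigma$ stacked on top of $\rho$. Two adjacent strands have \emph{$t$ full twists} ($t\in\mathbb{Z}$) if, when both are oriented downward, they form a twist region with $2|t|$ crossings which are left-handed (negative) if $t>0$ and right-handed (positive) if $t<0$. Let $\phi\colon PB(4)\to PB(2)$ be the homomorphism forgetting the last two strands. Let $\rho\colon PB(4)\to PB(6)$ be the monomorphism which replaces each of the 3rd and 4th strands by two parallel copies using the blackboard framing of a braid diagram. Thus strands 1 and 2 of $\rho(A)$ are strands 1 and 2 of $A$, strands 3,4 of $\rho(A)$ are parallel copies of strand 3 of $A$, and strands 5,6 of $\rho(A)$ are parallel copies of strand 4 of $A$. \textbf{The graph $G(A,t_1,t_2)$}, for $A\in\ker\phi$ and $t_1,t_2\in\mathbb{Z}$, is given by the following diagram, read from top to bottom. (a) There are two vertices: an upper vertex $v_+$, whose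 three edges descend to positions 1, 5, 6, and below it (nested inside) a lower vertex $v_-$, whose three edges descend to positions 2, 3, 4. There are no crossings in this part. (b) The six strands pass through the braid $\rho(A)$. (c) The strands in positions 4 and 5 cross once, the strand coming from position 5 passing in front of the strand coming from position 4; thus the strand from position 5 is now in position 4 and vice versa. (d) The strands in positions 1,2,3,4 pass through the braid $A^{-1}$; those in positions 5, 6 run straight down. (e) The strands in positions 2 and 3 are given $t_1$ full twists. (f) The strands in positions 3 and 4 are joined by a crossingless local minimum. The strands in positions 5, 6 then move left, without crossings, to positions 3, 4 respectively. (g) The strands in positions 1,2,3,4 pass through the braid $A^{-1}$. (h) The strands in positions 2 and 3 are given $t_2$ full twists. (i) Positions 1 and 2 are joined by a crossingless local minimum, and positions 3 and 4 are joined by a crossingless local minimum. The result is a spatial theta graph: one edge starts at positions 1 and 2 of $\rho(A)$, one at positions 3 and 5, and one at positions 4 and 6. *)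

theory Defs
  imports "HOL-Analysis.Analysis" "HOL-Combinatorics.Transposition"
begin

section \<open>Braid diagrams and braids\<close>

text \<open>
  A braid diagram is a word of crossings, read from top to bottom. The letter \<open>(i, f)\<close> is a
  crossing between the strands in positions \<open>i\<close> and \<open>i + 1\<close> (positions are numbered from 1, left
  to right); the strand coming from position \<open>i\<close> passes in front iff \<open>f\<close>. With both strands
  oriented downward, the crossing is left-handed (negative) if \<open>f\<close> holds and right-handed
  (positive) otherwise. Stacking a braid \<open>u\<close> on top of \<open>v\<close> is \<open>u @ v\<close>.
\<close>

type_synonym crossing = "nat \<times> bool"
type_synonym braid_word = "crossing list"

definition braid_words :: "nat \<Rightarrow> braid_word set" where
  "braid_words n = {w. \<forall>(i, f) \<in> set w. 1 \<le> i \<and> i < n}"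

text \<open>Artin's relations; two words represent the same element of the braid group on \<open>n\<close> strands
  iff they are related by \<open>braid_eq n\<close>.\<close>

inductive braid_step :: "nat \<Rightarrow> braid_word \<Rightarrow> braid_word \<Rightarrow> bool" for n where
  cancel: "1 \<le> i \<Longrightarrow> i < n \<Longrightarrow> braid_step n (u @ [(i, f), (i, \<not> f)] @ v) (u @ v)"
| far: "1 \<le> i \<Longrightarrow> i + 1 < j \<Longrightarrow> j < n \<Longrightarrow>
    braid_step n (u @ [(i, f), (j, g)] @ v) (u @ [(j, g), (i, f)] @ v)"
| triple: "1 \<le> i \<Longrightarrow> i + 1 < n \<Longrightarrow>
    braid_step n (u @ [(i, f), (i + 1, f), (i, f)] @ v) (u @ [(i + 1, f), (i, f), (i + 1, f)] @ v)"

definition braid_eq :: "nat \<Rightarrow> braid_word \<Rightarrow> braid_word \<Rightarrow> bool" where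
  "braid_eq n = equivclp (braid_step n)"

definition braid_inverse :: "braid_word \<Rightarrow> braid_word" where
  "braid_inverse w = rev (map (\<lambda>(i, f). (i, \<not> f)) w)"

text \<open>An arrangement maps each position to the strand that occupies it. If \<open>\<pi>\<close> is the
  arrangement above \<open>w\<close>, then \<open>arrangement_below \<pi> w\<close> is the one below \<open>w\<close>.\<close>

fun arrangement_below :: "(nat \<Rightarrow> nat) \<Rightarrow> braid_word \<Rightarrow> (nat \<Rightarrow> nat)" where
  "arrangement_below \<pi> [] = \<pi>"
| "arrangement_below \<pi> ((i, f) # w) = arrangement_below (\<pi> \<circ> Transposition.transpose i (i + 1)) w"

definition pure_braid_words :: "nat \<Rightarrow> braid_word set" where
  "pure_braid_words n = {w \<in> braid_words n. arrangement_below id w = id}"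

text \<open>Deletion of all strands outside \<open>K\<close>. A crossing between two strands of \<open>K\<close> survives; its new
  position is the rank of its left strand among the strands of \<open>K\<close>.\<close>

fun keep_strands :: "nat set \<Rightarrow> (nat \<Rightarrow> nat) \<Rightarrow> braid_word \<Rightarrow> braid_word" where
  "keep_strands K \<pi> [] = []"
| "keep_strands K \<pi> ((i, f) # w) =
    (if \<pi> i \<in> K \<and> \<pi> (i + 1) \<in> K then [(card {j \<in> {1..i}. \<pi> j \<in> K}, f)] else [])
    @ keep_strands K (\<pi> \<circ> Transposition.transpose i (i + 1)) w"

definition phi :: "braid_word \<Rightarrow> braid_word" where
  "phi A = keep_strands {1, 2} id A"

definition ker_phi :: "braid_word set" where
  "ker_phi = {A \<in> pure_braid_words 4. braid_eq 2 (phi A) []}"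

text \<open>
  Blackboard parallels: strand \<open>s\<close> is replaced by \<open>m s\<close> parallel copies. A crossing becomes a
  crossing of two ribbons: after \<open>p\<close> further strands on the left come \<open>a\<close> parallel strands, then
  \<open>c\<close> parallel strands, and the latter are moved one by one to the left across the former. All
  \<open>a * c\<close> crossings have the type \<open>f\<close> of the original crossing.
\<close>

definition ribbon_crossing :: "nat \<Rightarrow> nat \<Rightarrow> nat \<Rightarrow> bool \<Rightarrow> braid_word" where
  "ribbon_crossing p a c f =
    concat (map (\<lambda>k. map (\<lambda>j. (j, f)) (rev [p + k ..< p + k + a])) [1 ..< c + 1])"

fun cable :: "(nat \<Rightarrow> nat) \<Rightarrow> (nat \<Rightarrow> nat) \<Rightarrow> braid_word \<Rightarrow> braid_word" where
  "cable m \<pi> [] = []"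
| "cable m \<pi> ((i, f) # w) =
    ribbon_crossing (\<Sum>j = 1..<i. m (\<pi> j)) (m (\<pi> i)) (m (\<pi> (i + 1))) f
    @ cable m (\<pi> \<circ> Transposition.transpose i (i + 1)) w"

definition rho :: "braid_word \<Rightarrow> braid_word" where
  "rho A = cable (\<lambda>s. if s \<in> {3, 4} then 2 else 1) id A"

definition full_twists :: "nat \<Rightarrow> int \<Rightarrow> braid_word" where
  "full_twists i t = replicate (2 * nat \<bar>t\<bar>) (i, t > 0)"


section \<open>Spatial theta graphs and the unknot\<close>

text \<open>
  The 3-sphere is regarded as the one-point compactification of 3-space via stereographic
  projection. A point \<open>(x, y, z)\<close> of 3-space has horizontal coordinate \<open>x\<close>, depth \<open>y\<close>
  (increasing away from the viewer) and height \<open>z\<close>.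
\<close>

type_synonym point = "real \<times> real \<times> real"

definition S3 :: "(point \<times> real) set" where
  "S3 = sphere 0 1"

definition to_S3 :: "point \<Rightarrow> point \<times> real" where
  "to_S3 p = ((2 / ((norm p)\<^sup>2 + 1)) *\<^sub>R p, ((norm p)\<^sup>2 - 1) / ((norm p)\<^sup>2 + 1))"

definition ambient_isotopic_S3 :: "(point \<times> real) set \<Rightarrow> (point \<times> real) set \<Rightarrow> bool" where
  "ambient_isotopic_S3 K L \<longleftrightarrow>
    (\<exists>h. homotopic_with_canon (\<lambda>f. \<exists>g. homeomorphism S3 S3 f g) S3 S3 id h \<and> h ` K = L)"

definition standard_circle :: "(point \<times> real) set" where
  "standard_circle = {((x, y, 0), 0) |x y. x\<^sup>2 + y\<^sup>2 = 1}"

definition is_unknot :: "(point \<times> real) set \<Rightarrow> bool" where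
  "is_unknot K \<longleftrightarrow> ambient_isotopic_S3 K standard_circle"

fun polyline :: "point list \<Rightarrow> point set" where
  "polyline [] = {}"
| "polyline [p] = {p}"
| "polyline (p # q # ps) = closed_segment p q \<union> polyline (q # ps)"

text \<open>A PL spatial theta graph with vertices \<open>v\<close>, \<open>w\<close> and set of edges \<open>E\<close>; edges are closed arcs,
  so the interior of an edge \<open>e\<close> is \<open>e - {v, w}\<close>.\<close>

type_synonym theta = "point \<times> point \<times> point set set"

fun spatial_theta :: "theta \<Rightarrow> bool" where
  "spatial_theta (v, w, E) \<longleftrightarrow>
    v \<noteq> w \<and> card E = 3 \<and>
    (\<forall>e\<in>E. (\<exists>ps. e = polyline ps) \<and>
           (\<exists>g. arc g \<and> pathstart g = v \<and> pathfinish g = w \<and> path_image g = e)) \<and>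
    (\<forall>e\<in>E. \<forall>e'\<in>E. e \<noteq> e' \<longrightarrow> e \<inter> e' = {v, w})"

fun edges :: "theta \<Rightarrow> point set set" where
  "edges (v, w, E) = E"

fun remove_edge :: "theta \<Rightarrow> point set \<Rightarrow> point set" where
  "remove_edge (v, w, E) e = \<Union>E - (e - {v, w})"

definition brunnian :: "theta \<Rightarrow> bool" where
  "brunnian G \<longleftrightarrow> spatial_theta G \<and> (\<forall>e\<in>edges G. is_unknot (to_S3 ` remove_edge G e))"


section \<open>The graph \<open>G(A, t\<^sub>1, t\<^sub>2)\<close>\<close>

text \<open>
  The vertices, from top to bottom, of the polygonal strand that enters the braid diagram \<open>w\<close> in
  position \<open>p\<close> at height \<open>h\<close>. Each crossing takes up height 1. Halfway through a crossing its two
  strands have the same horizontal coordinate, the one in front having depth -1/2 and the one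
  behind depth 1/2; elsewhere position \<open>p\<close> is the vertical line over \<open>x = p\<close>, \<open>y = 0\<close>.
\<close>

fun strand :: "braid_word \<Rightarrow> nat \<Rightarrow> real \<Rightarrow> point list" where
  "strand [] p h = [(real p, 0, h)]"
| "strand ((i, f) # w) p h = (real p, 0, h) #
    (if p = i then
       (real i + 1/2, if f then - 1/2 else 1/2, h - 1/2) # strand w (i + 1) (h - 1)
     else if p = i + 1 then
       (real i + 1/2, if f then 1/2 else - 1/2, h - 1/2) # strand w i (h - 1)
     else strand w p (h - 1))"

definition upper_braid :: "braid_word \<Rightarrow> int \<Rightarrow> braid_word" where
  "upper_braid A t1 = rho A @ [(4, False)] @ braid_inverse A @ full_twists 2 t1"

definition lower_braid :: "braid_word \<Rightarrow> int \<Rightarrow> braid_word" where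
  "lower_braid A t2 = braid_inverse A @ full_twists 2 t2"

text \<open>
  The six-strand braid \<open>upper_braid\<close> occupies the heights from 0 down to \<open>h1\<close>. Between \<open>h1\<close> and
  \<open>h1 - 1\<close>, positions 3 and 4 are joined by a minimum and positions 5 and 6 move to 3 and 4. The
  four-strand braid \<open>lower_braid\<close> occupies the heights from \<open>h1 - 1\<close> down to \<open>h2\<close>, where positions
  1, 2 and positions 3, 4 are joined by minima. The strands of the upper braid that start in
  positions 1, 2, 3, 4, 5, 6 end in positions 1, 2, 3, 5, 4, 6, because \<open>A\<close> is pure and the letter
  \<open>(4, False)\<close> exchanges positions 4 and 5.
\<close>

definition theta_graph :: "braid_word \<Rightarrow> int \<Rightarrow> int \<Rightarrow> theta" where
  "theta_graph A t1 t2 =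
    (let
       h1 = - real (length (upper_braid A t1));
       h2 = h1 - 1 - real (length (lower_braid A t2));
       upper = (\<lambda>p. strand (upper_braid A t1) p 0);
       lower = (\<lambda>p. strand (lower_braid A t2) p (h1 - 1));
       vplus = (3, 0, 2);
       vminus = (3, 0, 1);
       e12 = polyline ([vplus] @ upper 1 @ lower 1 @ [(3/2, 0, h2 - 1/2)]
                       @ rev (lower 2) @ rev (upper 2) @ [vminus]);
       e35 = polyline ([vminus] @ upper 3 @ [(7/2, 0, h1 - 1/2)] @ rev (upper 5) @ [vplus]);
       e46 = polyline ([vminus] @ upper 4 @ lower 3 @ [(7/2, 0, h2 - 1/2)]
                       @ rev (lower 4) @ rev (upper 6) @ [vplus])
     in (vplus, vminus, {e12, e35, e46}))"

end

theory Submission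
  imports Defs
begin

text \<open>
  The graph consists of six strands that descend from the two vertices and are joined in pairs by the
  three minima. They are numbered by the positions in which they enter \<open>\<rho>(A)\<close>, so that the edges are
  the pairs 1, 2 and 3, 5 and 4, 6. Removing an edge leaves four of them, and in
  each of the three cases there are enough cancellations to reach a plane quadrilateral.

  Without 3, 5 one copy of each strand of \<open>A\<close> is left, and \<open>\<rho>(A)\<close> becomes \<open>A\<close>. In the first
  \<open>A\<inverse>\<close> below it only the strands 1 and 2 take part, because 4 and 6 run in positions 5 and 6. There it
  is a word in a single generator, and its exponent sum vanishes since \<open>\<phi>(A)\<close> is trivial and the
  exponent sum is an invariant of braids. So this word cancels, and then \<open>A\<close> cancels against the second
  \<open>A\<inverse>\<close>. The \<open>t\<^sub>2\<close> full twists are now twists of the two strands that leave the lower vertex, and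
  they are undone by rotating that cap. What is left is a plane quadrilateral.

  Without 4, 6 again \<open>\<rho>(A)\<close> becomes \<open>A\<close>, which cancels against the first \<open>A\<inverse>\<close>, and the \<open>t\<^sub>1\<close> full
  twists are undone at the lower vertex. Everything in the lower braid happens between the strands 1 and 2,
  and is undone by rotating the minimum that joins them.

  Without 1, 2 the parallel copies are left, and \<open>\<rho>(A)\<close> becomes a sequence of crossings of two
  ribbons, each of which ends in a vertex at the top. These crossings slide off over the top, one after the
  other. The two words \<open>A\<inverse>\<close> involve only two strands each, the pairs 3, 5 and 4, 6, which are joined below,
  and are undone from there. One single crossing remains, in which strand 4 passes behind strand 5.
  It can be moved behind the other three strands, which gives a plane quadrilateral again.

  All isotopies in this argument preserve heights. This makes it possible to describe a curve by the
  positions of its strands on finitely many horizontal levels, and to obtain ambient isotopies from one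
  analytic statement (\<open>strand_isotopy\<close>): strands may be moved along straight lines as long as the relative
  displacement of two strands is bounded by a multiple of their distance during the motion. For polygonal
  strands this is implied by a condition on pairs of levels (\<open>compatible\<close>, \<open>compatible_isotopic\<close>), and if
  some strands lie in front of others, then the layers may be moved independently of each other
  (\<open>layered_isotopy\<close>). The Reidemeister moves that are needed are instances of the latter:
  \<open>cancel_crossings\<close>, \<open>untwist_cap\<close>, \<open>untwist_cup\<close> and \<open>slide_ribbon\<close>.

  Deleting strands from a braid word replaces the crossings in which a deleted strand takes part by blanks
  (\<open>delete\<close>) and closes the gaps between the remaining strands, which is again a height-preserving
  isotopy (\<open>delete_separated\<close>, \<open>theta_compatible\<close>).
\<close>

section \<open>Ambient isotopies of the 3-sphere\<close>

abbreviation ambient_iso :: "point set \<Rightarrow> point set \<Rightarrow> bool" where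
  "ambient_iso K L \<equiv> ambient_isotopic_S3 (to_S3 ` K) (to_S3 ` L)"

lemma ambient_isotopic_S3_trans:
  assumes "ambient_isotopic_S3 K L" "ambient_isotopic_S3 L M"
  shows "ambient_isotopic_S3 K M"
proof -
  let ?P = "\<lambda>f. \<exists>g. homeomorphism S3 S3 f g"
  obtain h where h: "homotopic_with_canon ?P S3 S3 id h" "h ` K = L"
    using assms(1) unfolding ambient_isotopic_S3_def by auto
  obtain k where k: "homotopic_with_canon ?P S3 S3 id k" "k ` L = M"
    using assms(2) unfolding ambient_isotopic_S3_def by auto
  from homotopic_with_imp_property[OF h(1)] obtain h' where h': "homeomorphism S3 S3 h h'" by auto
  have ch: "continuous_on S3 h" "h \<in> S3 \<rightarrow> S3"
    using h' by (auto simp: homeomorphism_def)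
  have "homotopic_with_canon (\<lambda>f. ?P (f \<circ> h)) S3 S3 id k"
    by (rule homotopic_with_mono[OF k(1)]) (use homeomorphism_compose[OF h'] in blast)
  then have "homotopic_with_canon ?P S3 S3 (id \<circ> h) (k \<circ> h)"
    by (rule homotopic_with_compose_continuous_right[OF _ ch])
  then have "homotopic_with_canon ?P S3 S3 id (k \<circ> h)"
    using homotopic_with_trans h(1) by fastforce
  moreover have "(k \<circ> h) ` K = M" using h k by (metis image_comp)
  ultimately show ?thesis unfolding ambient_isotopic_S3_def by blast
qed

text \<open>The inverse of the stereographic projection \<open>to_S3\<close>, away from the north pole.\<close>

definition from_S3 :: "point \<times> real \<Rightarrow> point" where
  "from_S3 q = (1 / (1 - snd q)) *\<^sub>R fst q"

abbreviation north :: "point \<times> real" where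
  "north \<equiv> (0, 1)"

lemma S3_iff: "q \<in> S3 \<longleftrightarrow> (norm (fst q))\<^sup>2 + (snd q)\<^sup>2 = 1"
  by (simp add: S3_def norm_prod_def dist_norm case_prod_beta)

lemma S3_snd_less: assumes "q \<in> S3" "q \<noteq> north" shows "snd q < 1"
proof (rule ccontr)
  assume "\<not> snd q < 1"
  then have "(snd q)\<^sup>2 \<ge> 1" by (simp add: one_le_power)
  then have "(norm (fst q))\<^sup>2 \<le> 0" "(snd q)\<^sup>2 = 1"
    using assms(1) zero_le_power2[of "norm (fst q)"] unfolding S3_iff by linarith+
  then have "fst q = 0" "snd q = 1" using \<open>\<not> snd q < 1\<close> by (auto simp: power2_eq_1_iff)
  then show False using assms(2) by (simp add: prod_eq_iff)
qed

lemma to_S3_in_S3: "to_S3 p \<in> S3"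
proof -
  have pos: "(norm p)\<^sup>2 + 1 \<noteq> 0" by (smt (verit) zero_le_power2)
  show ?thesis unfolding S3_iff to_S3_def using pos
    by (simp add: power_divide power_mult_distrib divide_simps) (simp add: algebra_simps power2_eq_square)
qed

lemma to_S3_not_north: "to_S3 p \<noteq> north"
proof -
  have "((norm p)\<^sup>2 - 1) / ((norm p)\<^sup>2 + 1) < 1" by (simp add: divide_simps) (smt (verit) zero_le_power2)
  then show ?thesis by (auto simp: to_S3_def)
qed

lemma from_to_S3: "from_S3 (to_S3 p) = p"
proof -
  have pos: "(norm p)\<^sup>2 + 1 \<noteq> 0" by (smt (verit) zero_le_power2)
  have "1 - ((norm p)\<^sup>2 - 1) / ((norm p)\<^sup>2 + 1) = 2 / ((norm p)\<^sup>2 + 1)" using pos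
    by (simp add: divide_simps)
  then show ?thesis using pos unfolding from_S3_def to_S3_def snd_conv fst_conv
    by (metis (no_types, lifting) divide_eq_0_iff divide_self_if mult.commute scaleR_one scaleR_scaleR times_divide_eq_right
        mult.right_neutral zero_neq_numeral)
qed

lemma to_from_S3: assumes "q \<in> S3" "q \<noteq> north" shows "to_S3 (from_S3 q) = q"
proof -
  define t where "t = snd q"
  have t: "t < 1" using S3_snd_less[OF assms] by (simp add: t_def)
  have n: "(norm (fst q))\<^sup>2 = (1 - t) * (1 + t)"
    using assms(1) unfolding S3_iff t_def by (simp add: algebra_simps power2_eq_square)
  have nn: "(norm (from_S3 q))\<^sup>2 = (1 + t) / (1 - t)"
  proof -
    have "(norm (from_S3 q))\<^sup>2 = (norm (fst q))\<^sup>2 / (1 - t)\<^sup>2"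
      using t by (simp add: from_S3_def t_def[symmetric] power_divide)
    then show ?thesis using t unfolding n by (simp add: power2_eq_square)
  qed
  have 1: "(1 + t) / (1 - t) + 1 = 2 / (1 - t)" using t by (simp add: divide_simps)
  have 2: "(1 + t) / (1 - t) - 1 = 2 * t / (1 - t)" using t by (simp add: divide_simps)
  show ?thesis unfolding to_S3_def nn 1 2 using t
    by (simp add: from_S3_def t_def[symmetric] prod_eq_iff)
qed

text \<open>
  A neighbourhood of the north pole corresponds to the complement of a ball. This formula gives the
  quantitative form that the continuity of extended isotopies at the north pole needs.
\<close>

lemma dist_to_S3_north: "dist (to_S3 p) north = 2 / sqrt ((norm p)\<^sup>2 + 1)"
proof -
  have pos: "(norm p)\<^sup>2 + 1 > 0" by (smt (verit) zero_le_power2)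
  have "(dist (to_S3 p) north)\<^sup>2 = (2 * norm p / ((norm p)\<^sup>2 + 1))\<^sup>2
     + (((norm p)\<^sup>2 - 1) / ((norm p)\<^sup>2 + 1) - 1)\<^sup>2"
    by (simp add: to_S3_def dist_norm norm_Pair power_mult_distrib power_divide del: scaleR_Pair)
  also have "((norm p)\<^sup>2 - 1) / ((norm p)\<^sup>2 + 1) - 1 = -2 / ((norm p)\<^sup>2 + 1)"
    using pos by (simp add: divide_simps)
  also have "(2 * norm p / ((norm p)\<^sup>2 + 1))\<^sup>2 + (-2 / ((norm p)\<^sup>2 + 1))\<^sup>2
     = (4 * ((norm p)\<^sup>2 + 1)) / ((norm p)\<^sup>2 + 1)\<^sup>2"
    by (simp add: power_divide power_mult_distrib add_divide_distrib[symmetric] algebra_simps)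
  also have "\<dots> = 4 / ((norm p)\<^sup>2 + 1)"
  proof -
    have "4 * a / a\<^sup>2 = 4 / a" if "a > 0" for a :: real using that by (simp add: power2_eq_square)
    from this[OF pos] show ?thesis .
  qed
  also have "\<dots> = (2 / sqrt ((norm p)\<^sup>2 + 1))\<^sup>2" using pos by (simp add: power_divide)
  finally show ?thesis using pos by (simp add: power2_eq_iff_nonneg)
qed

lemma to_S3_near_north:
  assumes "0 < e" shows "\<exists>B. \<forall>p. B \<le> norm p \<longrightarrow> dist (to_S3 p) north < e"
proof (intro exI allI impI)
  fix p :: point assume B: "2 / e \<le> norm p"
  have "2 / e < sqrt ((norm p)\<^sup>2 + 1)"
    using B real_less_rsqrt[of "norm p" "(norm p)\<^sup>2 + 1"] by simp
  then show "dist (to_S3 p) north < e" unfolding dist_to_S3_north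
    using assms by (smt (verit) divide_less_eq mult.commute zero_less_divide_iff)
qed

lemma near_north_to_S3:
  assumes "0 < C" shows "\<exists>d>0. \<forall>p. dist (to_S3 p) north < d \<longrightarrow> C \<le> norm p"
proof (intro exI conjI allI impI)
  show "0 < 2 / sqrt (C\<^sup>2 + 1)" by (smt (verit) divide_pos_pos real_sqrt_gt_zero zero_le_power2)
  fix p :: point assume "dist (to_S3 p) north < 2 / sqrt (C\<^sup>2 + 1)"
  then have "2 / sqrt ((norm p)\<^sup>2 + 1) < 2 / sqrt (C\<^sup>2 + 1)" unfolding dist_to_S3_north .
  moreover have "2 / b \<le> 2 / a" if "a \<le> b" "0 < a" for a b :: real
    using that by (simp add: frac_le)
  moreover have "0 < sqrt ((norm p)\<^sup>2 + 1)"
    by (smt (verit) real_sqrt_gt_zero zero_le_power2)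
  ultimately have "sqrt (C\<^sup>2 + 1) < sqrt ((norm p)\<^sup>2 + 1)"
    by (meson linorder_not_less)
  then have "C\<^sup>2 < (norm p)\<^sup>2" by simp
  then show "C \<le> norm p" using assms by (meson less_eq_real_def norm_ge_zero power_less_imp_less_base)
qed

lemma continuous_to_S3: "continuous_on UNIV to_S3"
proof -
  have "(norm p)\<^sup>2 + 1 \<noteq> 0" for p :: point by (smt (verit) zero_le_power2)
  then show ?thesis unfolding to_S3_def by (intro continuous_intros) auto
qed

text \<open>
  An isotopy of 3-space extends to the 3-sphere by fixing the north pole. Continuity there is the
  assumption that points far away stay far away, uniformly in time. The homeomorphism property is then
  automatic, because a continuous bijection of a compact Hausdorff space is a homeomorphism.
\<close>

lemma proper_isotopy_lift:
  fixes h :: "real \<Rightarrow> point \<Rightarrow> point"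
  assumes cont: "continuous_on ({0..1} \<times> UNIV) (\<lambda>(s, x). h s x)"
    and bij: "\<And>s. s \<in> {0..1} \<Longrightarrow> bij (h s)"
    and proper: "\<And>B. \<exists>C>0. \<forall>s\<in>{0..1}. \<forall>x. C \<le> norm x \<longrightarrow> B \<le> norm (h s x)"
    and id: "\<And>x. h 0 x = x"
  shows "ambient_iso K (h 1 ` K)"
proof -
  define F where "F z = (if snd z = north then north else to_S3 (h (fst z) (from_S3 (snd z))))"
    for z :: "real \<times> (point \<times> real)"
  let ?T = "{0..1::real} \<times> S3"
  have F_S3: "F z \<in> S3" for z
    unfolding F_def by (auto simp: to_S3_in_S3) (simp add: S3_iff)
  have F_north: "F z = north \<longleftrightarrow> snd z = north" for z
    using to_S3_not_north by (simp only: F_def split: if_split) blast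
  have contF: "continuous_on ?T F"
    unfolding continuous_on_eq_continuous_within
  proof
    fix z assume z: "z \<in> ?T"
    show "continuous (at z within ?T) F"
    proof (cases "snd z = north")
      case True
      show ?thesis unfolding continuous_within_eps_delta
      proof (intro allI impI)
        fix e :: real assume e: "0 < e"
        obtain B where B: "\<And>p. B \<le> norm p \<Longrightarrow> dist (to_S3 p) north < e"
          using to_S3_near_north[OF e] by auto
        obtain C where C: "C > 0" "\<And>s x. s \<in> {0..1} \<Longrightarrow> C \<le> norm x \<Longrightarrow> B \<le> norm (h s x)"
          using proper[of B] by auto
        obtain d where d: "d > 0" "\<And>p. dist (to_S3 p) north < d \<Longrightarrow> C \<le> norm p"
          using near_north_to_S3[OF C(1)] by auto
        show "\<exists>d>0. \<forall>w\<in>?T. dist w z < d \<longrightarrow> dist (F w) (F z) < e"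
        proof (intro exI[of _ d] conjI ballI impI d(1))
          fix w assume w: "w \<in> ?T" "dist w z < d"
          have "dist (snd w) north < d"
            using w(2) True dist_snd_le[of w z] by auto
          then show "dist (F w) (F z) < e"
          proof (cases "snd w = north")
            case False
            have "dist (to_S3 (from_S3 (snd w))) north < d"
              using \<open>dist (snd w) north < d\<close> to_from_S3[OF _ False] w(1) by (simp add: mem_Times_iff)
            then have "B \<le> norm (h (fst w) (from_S3 (snd w)))"
              using d(2) C(2) w(1) by (simp add: mem_Times_iff)
            then show ?thesis using B True False by (simp add: F_def)
          qed (use e True in \<open>simp add: F_def\<close>)
        qed
      qed
    next
      case False
      let ?G = "\<lambda>w. to_S3 ((\<lambda>(s, x). h s x) (fst w, from_S3 (snd w)))"
      have sn: "snd (snd z) < 1" using S3_snd_less[of "snd z"] z False by auto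
      have c1: "continuous (at z within ?T) (\<lambda>w. (fst w, from_S3 (snd w)))"
        unfolding from_S3_def using sn by (intro continuous_intros) auto
      have "(fst z, from_S3 (snd z)) \<in> {0..1} \<times> UNIV" using z by (simp add: mem_Times_iff)
      then have "continuous (at (fst z, from_S3 (snd z)) within {0..1} \<times> UNIV) (\<lambda>(s, x). h s x)"
        using cont unfolding continuous_on_eq_continuous_within by blast
      then have "continuous (at (fst z, from_S3 (snd z)) within (\<lambda>w. (fst w, from_S3 (snd w))) ` ?T) (\<lambda>(s, x). h s x)"
        by (rule continuous_within_subset) (simp add: image_subset_iff mem_Times_iff)
      from continuous_within_compose[OF c1 this]
      have c2: "continuous (at z within ?T) (\<lambda>w. (\<lambda>(s, x). h s x) (fst w, from_S3 (snd w)))"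
        by (simp only: o_def)
      have "isCont to_S3 y" for y using continuous_to_S3 unfolding continuous_on_eq_continuous_at[OF open_UNIV] by blast
      then have cG: "continuous (at z within ?T) ?G"
        by (rule continuous_within_compose3[OF _ c2])
      show ?thesis
      proof (rule continuous_transform_within[OF cG, of "dist (snd z) north"])
        show "0 < dist (snd z) north" using False by simp
        fix w assume "w \<in> ?T" "dist w z < dist (snd z) north"
        then have "snd w \<noteq> north" using dist_snd_le[of w z] by (auto simp: dist_commute)
        then show "?G w = F w" by (simp add: F_def)
      qed (use z in auto)
    qed
  qed
  have hom: "\<exists>g. homeomorphism S3 S3 (\<lambda>x. F (s, x)) g" if s: "s \<in> {0..1}" for s
  proof (rule homeomorphism_compact)
    show "compact S3" by (simp add: S3_def)
    show "continuous_on S3 (\<lambda>x. F (s, x))"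
      using s by (intro continuous_on_compose2[OF contF] continuous_intros) auto
    show "inj_on (\<lambda>x. F (s, x)) S3"
    proof (rule inj_onI)
      fix x y assume xy: "x \<in> S3" "y \<in> S3" "F (s, x) = F (s, y)"
      show "x = y"
      proof (cases "x = north \<or> y = north")
        case True
        then show ?thesis using xy(3) F_north[of "(s, x)"] F_north[of "(s, y)"] by (simp only: snd_conv) metis
      next
        case False
        then have "h s (from_S3 x) = h s (from_S3 y)"
          using xy(3) from_to_S3 unfolding F_def by (metis fst_conv snd_conv)
        then have "from_S3 x = from_S3 y" using bij[OF s] by (meson bij_is_inj injD)
        then show ?thesis using False xy to_from_S3 by metis
      qed
    qed
    show "(\<lambda>x. F (s, x)) ` S3 = S3"
    proof
      show "(\<lambda>x. F (s, x)) ` S3 \<subseteq> S3" using F_S3 by auto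
      show "S3 \<subseteq> (\<lambda>x. F (s, x)) ` S3"
      proof
        fix y assume y: "y \<in> S3"
        show "y \<in> (\<lambda>x. F (s, x)) ` S3"
        proof (cases "y = north")
          case True
          then show ?thesis using y by (intro image_eqI[of _ _ north]) (simp_all add: F_def)
        next
          case False
          obtain x where x: "h s x = from_S3 y" using bij[OF s] by (metis bij_is_surj surjD)
          have "F (s, to_S3 x) = y"
            using False y by (simp add: F_def to_S3_not_north from_to_S3 x to_from_S3)
          then show ?thesis using to_S3_in_S3 by (intro image_eqI[of _ _ "to_S3 x"]) simp_all
        qed
      qed
    qed
  qed
  have "homotopic_with_canon (\<lambda>f. \<exists>g. homeomorphism S3 S3 f g) S3 S3 id (\<lambda>x. F (1, x))"
  proof (subst homotopic_with)
    show "(\<exists>g. homeomorphism S3 S3 h g) = (\<exists>g. homeomorphism S3 S3 k g)"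
      if "\<And>x. x \<in> topspace (top_of_set S3) \<Longrightarrow> h x = k x" for h k :: "point \<times> real \<Rightarrow> point \<times> real"
    proof -
      have eq: "h x = k x" if "x \<in> S3" for x using \<open>\<And>x. x \<in> topspace (top_of_set S3) \<Longrightarrow> h x = k x\<close>[of x] that by simp
      have "homeomorphism S3 S3 h g = homeomorphism S3 S3 k g" for g
        unfolding homeomorphism_def continuous_on_cong[OF refl eq] image_cong[OF refl eq]
        using eq by (simp add: image_subset_iff) (metis (mono_tags) image_iff)
      then show ?thesis by simp
    qed
    show "\<exists>h. continuous_map (prod_topology (top_of_set {0..1::real}) (top_of_set S3)) (top_of_set S3) h \<and>
              (\<forall>x \<in> topspace (top_of_set S3). h(0,x) = id x) \<and>
              (\<forall>x \<in> topspace (top_of_set S3). h(1,x) = F (1, x)) \<and>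
              (\<forall>t \<in> {0..1::real}. \<exists>g. homeomorphism S3 S3 (\<lambda>x. h(t, x)) g)"
    proof (rule exI[of _ F], intro conjI ballI)
      show "continuous_map (prod_topology (top_of_set {0..1::real}) (top_of_set S3)) (top_of_set S3) F"
        using contF F_S3 unfolding prod_topology_subtopology_eu
        by (simp add: continuous_map_in_subtopology image_subset_iff Pi_iff)
      show "F (0, x) = id x" if "x \<in> topspace (top_of_set S3)" for x
        using that by (simp add: F_def id to_from_S3)
    qed (use hom in auto)
  qed
  moreover have "(\<lambda>x. F (1, x)) ` (to_S3 ` K) = to_S3 ` (h 1 ` K)"
  proof -
    have "F (1, to_S3 x) = to_S3 (h 1 x)" for x using to_S3_not_north by (simp add: F_def from_to_S3)
    then show ?thesis unfolding image_image by simp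
  qed
  ultimately show ?thesis unfolding ambient_isotopic_S3_def by blast
qed

text \<open>
  McShane's formula: the infimum of all cones of slope \<open>L\<close> that stand on the graph of
  \<open>d\<close>.
\<close>

lemma lipschitz_extension_real:
  fixes d :: "'a::metric_space \<Rightarrow> real"
  assumes K: "K \<noteq> {}" and L: "0 \<le> L"
    and lip: "\<And>x y. x \<in> K \<Longrightarrow> y \<in> K \<Longrightarrow> \<bar>d x - d y\<bar> \<le> L * dist x y"
  obtains D where "\<And>x. x \<in> K \<Longrightarrow> D x = d x" "\<And>x y. \<bar>D x - D y\<bar> \<le> L * dist x y"
proof -
  define D where "D x = (INF y\<in>K. d y + L * dist x y)" for x
  obtain y0 where y0: "y0 \<in> K" using K by auto
  have bdd: "bdd_below ((\<lambda>y. d y + L * dist x y) ` K)" for x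
  proof (rule bdd_belowI2)
    fix y assume y: "y \<in> K"
    have "L * dist y y0 \<le> L * dist x y + L * dist x y0"
      using L by (metis distrib_left mult_left_mono dist_triangle3)
    then show "d y0 - L * dist x y0 \<le> d y + L * dist x y"
      using lip[OF y y0] by linarith
  qed
  have le: "D x \<le> D x' + L * dist x x'" for x x'
  proof -
    have "D x - L * dist x x' \<le> D x'"
      unfolding D_def[of x']
    proof (rule cINF_greatest[OF K])
      fix y assume y: "y \<in> K"
      have "D x \<le> d y + L * dist x y" unfolding D_def by (rule cINF_lower[OF bdd y])
      moreover have "L * dist x y \<le> L * dist x x' + L * dist x' y"
        using L by (metis distrib_left mult_left_mono dist_triangle)
      ultimately show "D x - L * dist x x' \<le> d y + L * dist x' y" by linarith
    qed
    then show ?thesis by linarith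
  qed
  show ?thesis
  proof
    show "\<bar>D x - D y\<bar> \<le> L * dist x y" for x y
      using le[of x y] le[of y x] by (simp add: dist_commute abs_le_iff)
    fix x assume x: "x \<in> K"
    show "D x = d x"
    proof (rule antisym)
      show "D x \<le> d x" using cINF_lower[OF bdd x, of x] by (simp add: D_def)
      show "d x \<le> D x" unfolding D_def
      proof (rule cINF_greatest[OF K])
        fix y assume "y \<in> K"
        then show "d x \<le> d y + L * dist x y" using lip[OF x, of y] by linarith
      qed
    qed
  qed
qed

lemma norm_triple_le: "norm (p :: point) \<le> \<bar>fst p\<bar> + \<bar>fst (snd p)\<bar> + \<bar>snd (snd p)\<bar>"
proof -
  have "norm p \<le> norm (fst p) + norm (snd p)" using norm_Pair_le[of "fst p" "snd p"] by simp
  moreover have "norm (snd p) \<le> norm (fst (snd p)) + norm (snd (snd p))"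
    using norm_Pair_le[of "fst (snd p)" "snd (snd p)"] by simp
  ultimately show ?thesis by simp
qed

lemma norm_fst_le_norm: "norm (fst v) \<le> norm v" and norm_snd_le_norm: "norm (snd v) \<le> norm v"
  for v :: "'a::real_normed_vector \<times> 'b::real_normed_vector"
  using norm_fst_le[of "fst v" "snd v"] norm_snd_le[of "snd v" "fst v"] unfolding prod.collapse by auto

text \<open>
  A displacement that is defined on \<open>K\<close> only extends to 3-space, coordinate by coordinate,
  with a Lipschitz constant below 1. Then \<open>x \<mapsto> x + s D(x)\<close> is a perturbation of the
  identity by a contraction, and hence bijective by the fixed point theorem of Banach.
\<close>

lemma small_lipschitz_displacement_isotopy:
  fixes d :: "point \<Rightarrow> point"
  assumes K: "K \<noteq> {}" and L: "0 \<le> L" "3 * L < 1"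
    and lip: "\<And>x y. x \<in> K \<Longrightarrow> y \<in> K \<Longrightarrow> norm (d x - d y) \<le> L * norm (x - y)"
  shows "ambient_iso K ((\<lambda>x. x + d x) ` K)"
proof -
  have comp: "\<exists>D. (\<forall>x\<in>K. D x = c (d x)) \<and> (\<forall>x y. \<bar>D x - D y\<bar> \<le> L * dist x y)"
    if c: "\<And>p q. \<bar>c p - c q\<bar> \<le> norm (p - q)" for c :: "point \<Rightarrow> real"
  proof -
    have "\<bar>c (d x) - c (d y)\<bar> \<le> L * dist x y" if "x \<in> K" "y \<in> K" for x y
      using c[of "d x" "d y"] lip[OF that] by (simp add: dist_norm)
    from lipschitz_extension_real[of K L "\<lambda>x. c (d x)", OF K L(1) this] show ?thesis by metis
  qed
  have "\<bar>fst p - fst q\<bar> \<le> norm (p - q)" for p q :: point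
    using norm_fst_le_norm[of "p - q"] by simp
  from comp[OF this] obtain D1 where D1: "\<And>x. x \<in> K \<Longrightarrow> D1 x = fst (d x)"
    "\<And>x y. \<bar>D1 x - D1 y\<bar> \<le> L * dist x y" by blast
  have "\<bar>fst (snd p) - fst (snd q)\<bar> \<le> norm (p - q)" for p q :: point
    using norm_fst_le_norm[of "snd (p - q)"] norm_snd_le_norm[of "p - q"] by simp
  from comp[OF this] obtain D2 where D2: "\<And>x. x \<in> K \<Longrightarrow> D2 x = fst (snd (d x))"
    "\<And>x y. \<bar>D2 x - D2 y\<bar> \<le> L * dist x y" by blast
  have "\<bar>snd (snd p) - snd (snd q)\<bar> \<le> norm (p - q)" for p q :: point
    using norm_snd_le_norm[of "snd (p - q)"] norm_snd_le_norm[of "p - q"] by simp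
  from comp[OF this] obtain D3 where D3: "\<And>x. x \<in> K \<Longrightarrow> D3 x = snd (snd (d x))"
    "\<And>x y. \<bar>D3 x - D3 y\<bar> \<le> L * dist x y" by blast
  define D :: "point \<Rightarrow> point" where "D x = (D1 x, D2 x, D3 x)" for x
  have DK: "D x = d x" if "x \<in> K" for x using D1(1) D2(1) D3(1) that by (simp add: D_def)
  have Dlip: "dist (D x) (D y) \<le> (3 * L) * dist x y" for x y
    using norm_triple_le[of "D x - D y"] D1(2)[of x y] D2(2)[of x y] D3(2)[of x y]
    by (simp add: D_def dist_norm)
  define h where "h s x = x + s *\<^sub>R D x" for s x
  have "continuous_on UNIV D"
    by (rule lipschitz_on_continuous_on[of "3 * L"]) (use Dlip L in \<open>simp add: lipschitz_on_def\<close>)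
  then have "continuous_on ({0..1::real} \<times> UNIV) (\<lambda>z. D (snd z))"
    by (rule continuous_on_compose2[OF _ continuous_on_snd[OF continuous_on_id]]) simp
  then have cont: "continuous_on ({0..1} \<times> UNIV) (\<lambda>(s, x). h s x)"
    unfolding h_def case_prod_beta
    by (intro continuous_on_add continuous_on_scaleR continuous_on_fst continuous_on_snd continuous_on_id)
  have bij: "bij (h s)" if s: "s \<in> {0..1}" for s
    unfolding bij_iff
  proof
    fix y
    have "\<exists>!x. y - s *\<^sub>R D x = x"
    proof (rule banach_fix_type[of "3 * L"])
      show "\<forall>a b. dist (y - s *\<^sub>R D a) (y - s *\<^sub>R D b) \<le> 3 * L * dist a b"
      proof (intro allI)
        fix a b
        have "dist (y - s *\<^sub>R D a) (y - s *\<^sub>R D b) = s * dist (D a) (D b)"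
        proof -
          have "(y - s *\<^sub>R D a) - (y - s *\<^sub>R D b) = s *\<^sub>R (D b - D a)" by (simp add: scaleR_diff_right)
          then show ?thesis using s by (simp add: dist_norm norm_minus_commute[of "D a"])
        qed
        also have "\<dots> \<le> 1 * dist (D a) (D b)" using s by (intro mult_right_mono) auto
        finally show "dist (y - s *\<^sub>R D a) (y - s *\<^sub>R D b) \<le> 3 * L * dist a b"
          using Dlip[of a b] by linarith
      qed
    qed (use L in auto)
    moreover have "(y - s *\<^sub>R D x = x) = (h s x = y)" for x
      unfolding h_def diff_eq_eq by (rule eq_commute)
    ultimately show "\<exists>!x. h s x = y" unfolding \<open>\<And>x. (y - s *\<^sub>R D x = x) = (h s x = y)\<close> by blast
  qed
  have proper: "\<exists>C>0. \<forall>s\<in>{0..1}. \<forall>x. C \<le> norm x \<longrightarrow> B \<le> norm (h s x)" for B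
  proof (intro exI[of _ "max 1 ((B + norm (D 0)) / (1 - 3 * L))"] conjI ballI allI impI)
    fix s :: real and x :: point assume s: "s \<in> {0..1}" and "max 1 ((B + norm (D 0)) / (1 - 3 * L)) \<le> norm x"
    then have "(B + norm (D 0)) / (1 - 3 * L) \<le> norm x" by simp
    then have 1: "B + norm (D 0) \<le> norm x * (1 - 3 * L)" using L by (simp add: pos_divide_le_eq)
    have "norm (D x) \<le> norm (D 0) + 3 * L * norm x"
      using Dlip[of x 0] norm_triangle_ineq2[of "D x" "D 0"] by (simp add: dist_norm)
    moreover have "norm (s *\<^sub>R D x) \<le> 1 * norm (D x)"
      using s unfolding norm_scaleR by (intro mult_right_mono) auto
    moreover have "norm x - norm (s *\<^sub>R D x) \<le> norm (h s x)"
      unfolding h_def using norm_diff_ineq[of x "s *\<^sub>R D x"] by simp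
    ultimately show "B \<le> norm (h s x)" using 1 by (simp add: algebra_simps)
  qed simp
  have "ambient_iso K (h 1 ` K)"
    by (rule proper_isotopy_lift[OF cont bij proper]) (simp_all add: h_def)
  also have "h 1 ` K = (\<lambda>x. x + d x) ` K" by (simp add: h_def DK)
  finally show ?thesis .
qed

lemma norm_diff_triangle3:
  "norm (u - v) \<le> norm (u - x) + norm (x - y) + norm (y - (v :: 'a::real_normed_vector))"
  using dist_triangle[of u v x] dist_triangle[of x v y] by (simp add: dist_norm)

text \<open>
  The strands \<open>f j\<close> move along straight lines to the strands \<open>g j\<close>. Since all of
  them are graphs over the direction \<open>e\<close>, two points of different strands at different
  heights are never closer than a multiple of their difference in height, so it suffices to compare
  strands at the same height (\<open>comp\<close>). This makes the displacement \<open>M\<close>-Lipschitz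
  on the union of the strands at any time, with \<open>M\<close> not depending on the time, and a
  subdivision of the motion into sufficiently many steps makes each step small enough for
  \<open>small_lipschitz_displacement_isotopy\<close>.
\<close>

lemma strand_isotopy:
  fixes f g :: "'j \<Rightarrow> real \<Rightarrow> point" and a b :: "'j \<Rightarrow> real" and e :: point and \<beta> :: real
  assumes J: "J \<noteq> {}"
    and overlap: "\<And>i j. i \<in> J \<Longrightarrow> j \<in> J \<Longrightarrow> a i \<le> b j"
    and timef: "\<And>j t. j \<in> J \<Longrightarrow> t \<in> {a j..b j} \<Longrightarrow> e \<bullet> f j t = t + \<beta>"
    and timeg: "\<And>j t. j \<in> J \<Longrightarrow> t \<in> {a j..b j} \<Longrightarrow> e \<bullet> g j t = t + \<beta>"
    and R: "0 \<le> R"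
    and lipf: "\<And>j t u. j \<in> J \<Longrightarrow> t \<in> {a j..b j} \<Longrightarrow> u \<in> {a j..b j} \<Longrightarrow> norm (f j t - f j u) \<le> R * \<bar>t - u\<bar>"
    and lipg: "\<And>j t u. j \<in> J \<Longrightarrow> t \<in> {a j..b j} \<Longrightarrow> u \<in> {a j..b j} \<Longrightarrow> norm (g j t - g j u) \<le> R * \<bar>t - u\<bar>"
    and C: "0 \<le> C"
    and comp: "\<And>i j t s. i \<in> J \<Longrightarrow> j \<in> J \<Longrightarrow> t \<in> {a i..b i} \<Longrightarrow> t \<in> {a j..b j} \<Longrightarrow> s \<in> {0..1} \<Longrightarrow>
      norm ((g i t - f i t) - (g j t - f j t))
        \<le> C * norm ((1 - s) *\<^sub>R (f i t - f j t) + s *\<^sub>R (g i t - g j t))"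
  shows "ambient_iso (\<Union>j\<in>J. f j ` {a j..b j}) (\<Union>j\<in>J. g j ` {a j..b j})"
proof -
  define F where "F s j t = (1 - s) *\<^sub>R f j t + s *\<^sub>R g j t" for s j t
  define D where "D j t = g j t - f j t" for j t
  define K where "K s = (\<Union>j\<in>J. F s j ` {a j..b j})" for s
  define M where "M = (2 * R + C * R) * norm e + C"
  have M: "0 \<le> M" using R C by (simp add: M_def)
  have timeF: "e \<bullet> F s j t = t + \<beta>" if "j \<in> J" "t \<in> {a j..b j}" for s j t
    using timef[OF that] timeg[OF that] by (simp add: F_def inner_add_right inner_scaleR_right algebra_simps)
  have lipF: "norm (F s j t - F s j u) \<le> R * \<bar>t - u\<bar>"
    if "j \<in> J" "t \<in> {a j..b j}" "u \<in> {a j..b j}" "s \<in> {0..1}" for s j t u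
  proof -
    have "F s j t - F s j u = (1 - s) *\<^sub>R (f j t - f j u) + s *\<^sub>R (g j t - g j u)"
      by (simp add: F_def scaleR_diff_right)
    also have "norm \<dots> \<le> (1 - s) * norm (f j t - f j u) + s * norm (g j t - g j u)"
      using that(4) by (intro order_trans[OF norm_triangle_ineq]) auto
    also have "\<dots> \<le> (1 - s) * (R * \<bar>t - u\<bar>) + s * (R * \<bar>t - u\<bar>)"
      using that lipf[OF that(1-3)] lipg[OF that(1-3)] by (intro add_mono mult_left_mono) auto
    finally show ?thesis by (simp add: algebra_simps)
  qed
  have lipD: "norm (D j t - D j u) \<le> 2 * R * \<bar>t - u\<bar>"
    if "j \<in> J" "t \<in> {a j..b j}" "u \<in> {a j..b j}" for j t u
  proof -
    have "norm (D j t - D j u) \<le> norm (g j t - g j u) + norm (f j t - f j u)"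
      using norm_triangle_ineq4[of "g j t - g j u" "f j t - f j u"] by (simp add: D_def algebra_simps)
    then show ?thesis using lipf[OF that] lipg[OF that] by linarith
  qed
  have compF: "norm (D i t - D j t) \<le> C * norm (F s i t - F s j t)"
    if "i \<in> J" "j \<in> J" "t \<in> {a i..b i}" "t \<in> {a j..b j}" "s \<in> {0..1}" for i j t s
  proof -
    have "F s i t - F s j t = (1 - s) *\<^sub>R (f i t - f j t) + s *\<^sub>R (g i t - g j t)"
      by (simp add: F_def scaleR_diff_right)
    then show ?thesis using comp[OF that] by (simp add: D_def)
  qed
  have main: "norm (D i t - D j u) \<le> M * norm (F s i t - F s j u)"
    if i: "i \<in> J" and j: "j \<in> J" and t: "t \<in> {a i..b i}" and u: "u \<in> {a j..b j}" and s: "s \<in> {0..1}"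
    for i j t u s
  proof -
    define x y where "x = F s i t" and "y = F s j u"
    \<comment> \<open>A height between \<open>t\<close> and \<open>u\<close> at which both strands exist.\<close>
    define r where "r = max (min t u) (max (a i) (a j))"
    have ov: "a i \<le> b j" "a j \<le> b i" using overlap i j by auto
    have r: "r \<in> {a i..b i}" "r \<in> {a j..b j}" "\<bar>t - r\<bar> + \<bar>r - u\<bar> = \<bar>t - u\<bar>"
      using t u ov by (auto simp: r_def max_def min_def)
    have "t - u = e \<bullet> (x - y)" using timeF[OF i t] timeF[OF j u] by (simp add: x_def y_def inner_diff_right)
    then have tu: "\<bar>t - u\<bar> \<le> norm e * norm (x - y)" using Cauchy_Schwarz_ineq2[of e "x - y"] by simp
    have "norm (F s i r - F s j r) \<le> norm (F s i r - x) + norm (x - y) + norm (y - F s j r)"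
      by (rule norm_diff_triangle3)
    also have "\<dots> \<le> R * \<bar>r - t\<bar> + norm (x - y) + R * \<bar>u - r\<bar>"
      using lipF[OF i r(1) t s] lipF[OF j u r(2) s] unfolding x_def y_def by linarith
    also have "\<dots> = R * \<bar>t - u\<bar> + norm (x - y)"
    proof -
      have "R * \<bar>r - t\<bar> + X + R * \<bar>u - r\<bar> = R * (\<bar>t - r\<bar> + \<bar>r - u\<bar>) + X" for X
        by (simp add: distrib_left abs_minus_commute)
      then show ?thesis unfolding r(3) .
    qed
    finally have 1: "norm (D i r - D j r) \<le> C * (R * \<bar>t - u\<bar> + norm (x - y))"
      using compF[OF i j r(1,2) s] C by (meson mult_left_mono order_trans)
    have "norm (D i t - D j u) \<le> norm (D i t - D i r) + norm (D i r - D j r) + norm (D j r - D j u)"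
      by (rule norm_diff_triangle3)
    also have "\<dots> \<le> 2 * R * \<bar>t - r\<bar> + C * (R * \<bar>t - u\<bar> + norm (x - y)) + 2 * R * \<bar>r - u\<bar>"
      using lipD[OF i t r(1)] lipD[OF j r(2) u] 1 by linarith
    also have "\<dots> = 2 * R * \<bar>t - u\<bar> + C * (R * \<bar>t - u\<bar> + norm (x - y))"
    proof -
      have "2 * R * \<bar>t - r\<bar> + X + 2 * R * \<bar>r - u\<bar> = 2 * R * (\<bar>t - r\<bar> + \<bar>r - u\<bar>) + X" for X
        by (simp only: distrib_left)
      then show ?thesis unfolding r(3) .
    qed
    also have "\<dots> = (2 * R + C * R) * \<bar>t - u\<bar> + C * norm (x - y)" by (simp add: algebra_simps)
    also have "\<dots> \<le> (2 * R + C * R) * (norm e * norm (x - y)) + C * norm (x - y)"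
      using tu R C by (intro add_right_mono mult_left_mono) auto
    finally show ?thesis by (simp add: M_def x_def y_def algebra_simps)
  qed
  have ab: "a j \<le> b j" if "j \<in> J" for j using overlap that by auto
  have step: "ambient_iso (K s) (K s')"
    if s: "s \<in> {0..1}" and small: "3 * (\<bar>s' - s\<bar> * M) < 1" for s s'
  proof -
    \<comment> \<open>A point that lies on several strands has the same displacement on all of them.\<close>
    have "\<forall>x\<in>K s. \<exists>v. \<forall>j\<in>J. \<forall>t\<in>{a j..b j}. x = F s j t \<longrightarrow> v = D j t"
    proof
      fix x assume "x \<in> K s"
      then obtain i t where it: "i \<in> J" "t \<in> {a i..b i}" "x = F s i t" by (auto simp: K_def)
      have "D i t = D j u" if "j \<in> J" "u \<in> {a j..b j}" "x = F s j u" for j u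
        using main[OF it(1) that(1) it(2) that(2) s] it(3) that(3) by simp
      then show "\<exists>v. \<forall>j\<in>J. \<forall>t\<in>{a j..b j}. x = F s j t \<longrightarrow> v = D j t" by blast
    qed
    from bchoice[OF this] obtain d0
      where d0: "\<And>x j t. x \<in> K s \<Longrightarrow> j \<in> J \<Longrightarrow> t \<in> {a j..b j} \<Longrightarrow> x = F s j t \<Longrightarrow> d0 x = D j t" by blast
    have d0F: "d0 (F s j t) = D j t" if "j \<in> J" "t \<in> {a j..b j}" for j t
    proof (rule d0[OF _ that refl])
      show "F s j t \<in> K s" unfolding K_def using that by blast
    qed
    have "ambient_iso (K s) ((\<lambda>x. x + (s' - s) *\<^sub>R d0 x) ` K s)"
    proof (rule small_lipschitz_displacement_isotopy[where L = "\<bar>s' - s\<bar> * M"])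
      obtain j where "j \<in> J" using J by auto
      then have "F s j (a j) \<in> K s" unfolding K_def using ab by (intro UN_I imageI) auto
      then show "K s \<noteq> {}" by blast
      fix x y assume "x \<in> K s" "y \<in> K s"
      then obtain i t j u where it: "i \<in> J" "t \<in> {a i..b i}" "x = F s i t"
        and ju: "j \<in> J" "u \<in> {a j..b j}" "y = F s j u" by (auto simp: K_def)
      have "norm ((s' - s) *\<^sub>R d0 x - (s' - s) *\<^sub>R d0 y) = \<bar>s' - s\<bar> * norm (D i t - D j u)"
        using it ju by (simp only: d0F flip: scaleR_diff_right) simp
      also have "\<dots> \<le> \<bar>s' - s\<bar> * (M * norm (x - y))"
        using main[OF it(1) ju(1) it(2) ju(2) s] it ju by (intro mult_left_mono) auto
      finally show "norm ((s' - s) *\<^sub>R d0 x - (s' - s) *\<^sub>R d0 y) \<le> \<bar>s' - s\<bar> * M * norm (x - y)" by simp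
    qed (use M small in auto)
    also have "(\<lambda>x. x + (s' - s) *\<^sub>R d0 x) ` K s = K s'"
    proof -
      have "F s j t + (s' - s) *\<^sub>R d0 (F s j t) = F s' j t" if "j \<in> J" "t \<in> {a j..b j}" for j t
        using that by (simp add: d0F) (simp add: F_def D_def algebra_simps)
      then show ?thesis unfolding K_def image_UN image_image by simp
    qed
    finally show ?thesis .
  qed
  obtain N :: nat where N: "3 * M < real N" using reals_Archimedean2 by blast
  have Npos: "0 < real N" using N M by linarith
  have many: "ambient_iso (K 0) (K (real m / real N))" if "m \<le> N" for m
    using that
  proof (induction m)
    case 0
    show ?case using step[of 0 0] by simp
  next
    case (Suc m)
    have "\<bar>real (Suc m) / real N - real m / real N\<bar> = 1 / real N"
      by (simp add: diff_divide_distrib[symmetric])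
    moreover have "3 * (1 / real N * M) < 1" using N Npos by (simp add: divide_simps)
    moreover have "real m / real N \<in> {0..1}" using Suc Npos by simp
    ultimately have "ambient_iso (K (real m / real N)) (K (real (Suc m) / real N))"
      by (intro step) auto
    with Suc show ?case using ambient_isotopic_S3_trans by (meson Suc_leD)
  qed
  have "ambient_iso (K 0) (K 1)" using many[of N] Npos by simp
  then show ?thesis by (simp add: K_def F_def)
qed

section \<open>Curves given by the positions of their strands on horizontal levels\<close>

text \<open>
  The polygonal path through the points \<open>p k\<close>, with \<open>p k\<close> at time
  \<open>k\<close>.
\<close>

definition level_path :: "(nat \<Rightarrow> point) \<Rightarrow> real \<Rightarrow> point" where
  "level_path p t = (let k = nat \<lfloor>t\<rfloor> in (1 - (t - real k)) *\<^sub>R p k + (t - real k) *\<^sub>R p (Suc k))"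

lemma level_path_between:
  assumes "real k \<le> t" "t \<le> real (Suc k)"
  shows "level_path p t = (1 - (t - real k)) *\<^sub>R p k + (t - real k) *\<^sub>R p (Suc k)"
proof (cases "t = real (Suc k)")
  case True
  then have "nat \<lfloor>t\<rfloor> = Suc k" by simp
  then show ?thesis unfolding level_path_def Let_def using True by simp
next
  case False
  with assms have "\<lfloor>t\<rfloor> = int k" by (intro floor_unique) auto
  then show ?thesis unfolding level_path_def Let_def by simp
qed

lemma level_path_real [simp]: "level_path p (real k) = p k"
  using level_path_between[of k "real k" p] by simp

lemma level_path_segment:
  "level_path p ` {real k..real (Suc k)} = closed_segment (p k) (p (Suc k))"
proof (intro set_eqI iffI)
  fix x assume "x \<in> level_path p ` {real k..real (Suc k)}"
  then obtain t where t: "real k \<le> t" "t \<le> real (Suc k)" "x = level_path p t" by auto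
  then show "x \<in> closed_segment (p k) (p (Suc k))"
    unfolding level_path_between[OF t(1,2)] in_segment by (intro exI[of _ "t - real k"]) auto
next
  fix x assume "x \<in> closed_segment (p k) (p (Suc k))"
  then obtain u where u: "0 \<le> u" "u \<le> 1" "x = (1 - u) *\<^sub>R p k + u *\<^sub>R p (Suc k)"
    by (auto simp only: in_segment)
  then have "x = level_path p (real k + u)" using level_path_between[of k "real k + u" p] by simp
  then show "x \<in> level_path p ` {real k..real (Suc k)}" using u by auto
qed

lemma level_path_image:
  assumes "a < b"
  shows "level_path p ` {real a..real b} = (\<Union>k\<in>{a..<b}. closed_segment (p k) (p (Suc k)))"
proof -
  have "{real a..real b} = (\<Union>k\<in>{a..<b}. {real k..real (Suc k)})"
  proof (intro set_eqI iffI)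
    fix t assume t: "t \<in> {real a..real b}"
    show "t \<in> (\<Union>k\<in>{a..<b}. {real k..real (Suc k)})"
    proof (cases "t = real b")
      case True
      then show ?thesis using assms by (intro UN_I[of "b - 1"]) auto
    next
      case False
      then have "nat \<lfloor>t\<rfloor> \<in> {a..<b}" using t by (auto simp: le_nat_iff nat_less_iff floor_less_iff le_floor_iff)
      moreover have "t \<in> {real (nat \<lfloor>t\<rfloor>)..real (Suc (nat \<lfloor>t\<rfloor>))}" using t
        by (auto intro: order_trans) linarith+
      ultimately show ?thesis by blast
    qed
  next
    fix t assume "t \<in> (\<Union>k\<in>{a..<b}. {real k..real (Suc k)})"
    then obtain k where k: "a \<le> k" "k < b" "real k \<le> t" "t \<le> real (Suc k)" by auto
    then have "real a \<le> real k" "real (Suc k) \<le> real b" by (simp_all only: of_nat_le_iff Suc_le_eq)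
    with k show "t \<in> {real a..real b}" by simp
  qed
  then show ?thesis by (simp only: image_UN level_path_segment)
qed

lemma level_path_lipschitz:
  assumes "a \<le> b" "0 \<le> R" "\<And>k. a \<le> k \<Longrightarrow> k < b \<Longrightarrow> norm (p (Suc k) - p k) \<le> R"
  shows "R-lipschitz_on {real a..real b} (level_path p)"
  using assms
proof (induction b rule: dec_induct)
  case base
  then show ?case by (simp add: lipschitz_on_def)
next
  case (step b)
  have 1: "R-lipschitz_on {real b..real (Suc b)} (level_path p)"
  proof (rule lipschitz_onI)
    fix t u assume tu: "t \<in> {real b..real (Suc b)}" "u \<in> {real b..real (Suc b)}"
    have "level_path p t - level_path p u = (t - u) *\<^sub>R (p (Suc b) - p b)"
    proof -
      have "level_path p x = p b + (x - real b) *\<^sub>R (p (Suc b) - p b)" if "x \<in> {real b..real (Suc b)}" for x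
        using that by (simp add: level_path_between[of b x p] algebra_simps)
      then have "level_path p t = p b + (t - real b) *\<^sub>R (p (Suc b) - p b)"
        "level_path p u = p b + (u - real b) *\<^sub>R (p (Suc b) - p b)" using tu by blast+
      then show ?thesis by (simp only:) (simp add: algebra_simps)
    qed
    then have "dist (level_path p t) (level_path p u) = \<bar>t - u\<bar> * norm (p (Suc b) - p b)"
      by (simp add: dist_norm)
    also have "\<dots> \<le> \<bar>t - u\<bar> * R" using step by (intro mult_left_mono) auto
    finally show "dist (level_path p t) (level_path p u) \<le> R * dist t u" by (simp add: dist_norm mult.commute)
  qed (use step in simp)
  have 2: "R-lipschitz_on {real a..real b} (level_path p)" using step by simp
  from lipschitz_on_concat[OF 2 1 refl] show ?case by simp
qed

text \<open>
  A configuration \<open>c\<close> gives the horizontal position \<open>c j k\<close> of strand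
  \<open>j\<close> on level \<open>k\<close>. Levels are counted downwards in steps of height 1/2, so that
  a crossing of height 1 occupies three of them. Level 0 contains the upper vertex and level 2 the lower
  one.
\<close>

type_synonym config = "nat \<Rightarrow> nat \<Rightarrow> real \<times> real"

text \<open>The strands 1, 5, 6 leave the upper vertex and 2, 3, 4 the lower one.\<close>

definition start :: "nat \<Rightarrow> nat" where
  "start j = (if j \<in> {1, 5, 6} then 0 else 2)"

text \<open>
  Strands with the same value are joined by a minimum. The levels \<open>n j\<close> on which the strands
  end are a parameter of all that follows.
\<close>

definition cup :: "nat \<Rightarrow> nat" where
  "cup j = (if j \<in> {1, 2} then 1 else if j \<in> {3, 5} then 2 else 3)"

definition joined :: "(nat \<Rightarrow> nat) \<Rightarrow> nat \<Rightarrow> nat \<Rightarrow> nat \<Rightarrow> bool" where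
  "joined n a b k \<longleftrightarrow> k = start a \<and> k = start b \<or> k = n a \<and> k = n b \<and> cup a = cup b"

definition at_level :: "config \<Rightarrow> nat \<Rightarrow> nat \<Rightarrow> point" where
  "at_level c j k = (fst (c j k), snd (c j k), 2 - real k / 2)"

definition curve :: "(nat \<Rightarrow> nat) \<Rightarrow> nat set \<Rightarrow> config \<Rightarrow> point set" where
  "curve n J c = (\<Union>j\<in>J. \<Union>k\<in>{start j..<n j}. closed_segment (at_level c j k) (at_level c j (Suc k)))"

definition alive :: "(nat \<Rightarrow> nat) \<Rightarrow> nat \<Rightarrow> nat \<Rightarrow> nat \<Rightarrow> bool" where
  "alive n a b k \<longleftrightarrow> start a \<le> k \<and> start b \<le> k \<and> k < n a \<and> k < n b"

definition gap :: "config \<Rightarrow> nat \<Rightarrow> nat \<Rightarrow> nat \<Rightarrow> real \<times> real" where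
  "gap c a b k = c b k - c a k"

text \<open>
  On level \<open>k\<close> the strand \<open>b\<close> is beyond \<open>a\<close> in the direction
  \<open>l\<close> in both configurations, unless they meet there in both.
\<close>

definition ordered_at :: "(nat \<Rightarrow> nat) \<Rightarrow> config \<Rightarrow> config \<Rightarrow> real \<times> real \<Rightarrow> nat \<Rightarrow> nat \<Rightarrow> nat \<Rightarrow> bool" where
  "ordered_at n c c' l a b k \<longleftrightarrow>
     joined n a b k \<and> gap c a b k = 0 \<and> gap c' a b k = 0 \<or> l \<bullet> gap c a b k > 0 \<and> l \<bullet> gap c' a b k > 0"

definition separated :: "(nat \<Rightarrow> nat) \<Rightarrow> config \<Rightarrow> config \<Rightarrow> nat \<Rightarrow> nat \<Rightarrow> nat \<Rightarrow> bool" where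
  "separated n c c' a b k \<longleftrightarrow> (\<exists>l. ordered_at n c c' l a b k \<and> ordered_at n c c' l a b (Suc k))"

text \<open>
  The condition under which the straight-line motion from \<open>c\<close> to \<open>c'\<close> does not
  produce collisions: for any two strands and any two consecutive levels, a single linear form separates
  the strands on both levels and in both configurations. In particular \<open>compatible n J c c\<close>
  implies that the strands of \<open>c\<close> are disjoint apart from their common end points.
\<close>

definition compatible :: "(nat \<Rightarrow> nat) \<Rightarrow> nat set \<Rightarrow> config \<Rightarrow> config \<Rightarrow> bool" where
  "compatible n J c c' \<longleftrightarrow> (\<forall>a\<in>J. \<forall>b\<in>J. \<forall>k. a \<noteq> b \<longrightarrow> alive n a b k \<longrightarrow> separated n c c' a b k)"

lemma gap_swap: "gap c b a k = - gap c a b k"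
  by (simp add: gap_def)

lemma joined_commute: "joined n a b k = joined n b a k"
  by (auto simp: joined_def)

lemma alive_commute: "alive n a b k = alive n b a k"
  by (auto simp: alive_def)

lemma ordered_at_swap: "ordered_at n c c' l b a k = ordered_at n c c' (- l) a b k"
  unfolding ordered_at_def gap_swap[of _ b a] joined_commute[of n b a] by simp

lemma separated_swap: "separated n c c' b a k = separated n c c' a b k"
  unfolding separated_def ordered_at_swap[of n c c' _ b a] by (metis minus_minus)

lemma compatibleI:
  assumes "\<And>a b k. a \<in> J \<Longrightarrow> b \<in> J \<Longrightarrow> a < b \<Longrightarrow> alive n a b k \<Longrightarrow> separated n c c' a b k"
  shows "compatible n J c c'"
  unfolding compatible_def
  by (intro ballI allI impI) (metis alive_commute assms linorder_neqE_nat separated_swap)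

lemma compatibleD:
  "compatible n J c c' \<Longrightarrow> a \<in> J \<Longrightarrow> b \<in> J \<Longrightarrow> a \<noteq> b \<Longrightarrow> alive n a b k \<Longrightarrow> separated n c c' a b k"
  by (auto simp: compatible_def)

lemma compatible_refl_right: "compatible n J c c' \<Longrightarrow> compatible n J c' c'"
  unfolding compatible_def separated_def ordered_at_def by meson

text \<open>
  Positivity of \<open>l\<close> survives convex combinations both in time and between the two levels, and
  bounds the norm of the combination from below. The case of vanishing gaps covers a common end point of
  two strands.
\<close>

lemma interpolation_ratio:
  fixes v0 v1 w0 w1 l :: "'a::real_inner"
  assumes 0: "v0 = 0 \<and> w0 = 0 \<or> l \<bullet> v0 > 0 \<and> l \<bullet> w0 > 0"
    and 1: "v1 = 0 \<and> w1 = 0 \<or> l \<bullet> v1 > 0 \<and> l \<bullet> w1 > 0"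
  shows "\<exists>C\<ge>0. \<forall>\<tau>\<in>{0..1}. \<forall>s\<in>{0..1}.
    norm ((1 - \<tau>) *\<^sub>R (w0 - v0) + \<tau> *\<^sub>R (w1 - v1))
      \<le> C * norm ((1 - \<tau>) *\<^sub>R ((1 - s) *\<^sub>R v0 + s *\<^sub>R w0) + \<tau> *\<^sub>R ((1 - s) *\<^sub>R v1 + s *\<^sub>R w1))"
proof -
  have "\<exists>C\<ge>0. \<forall>s\<in>{0..1}. norm (w - v) \<le> C * (l \<bullet> ((1 - s) *\<^sub>R v + s *\<^sub>R w)) \<and> 0 \<le> l \<bullet> ((1 - s) *\<^sub>R v + s *\<^sub>R w)"
    if "v = 0 \<and> w = 0 \<or> l \<bullet> v > 0 \<and> l \<bullet> w > 0" for v w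
  proof (cases "v = 0 \<and> w = 0")
    case True
    then show ?thesis by (intro exI[of _ 0]) simp
  next
    case False
    define m where "m = min (l \<bullet> v) (l \<bullet> w)"
    have m: "0 < m" using that False by (simp add: m_def)
    show ?thesis
    proof (intro exI[of _ "norm (w - v) / m"] conjI ballI)
      fix s :: real assume s: "s \<in> {0..1}"
      have "(1 - s) * m + s * m \<le> (1 - s) * (l \<bullet> v) + s * (l \<bullet> w)"
        using s by (intro add_mono mult_left_mono) (auto simp: m_def)
      then have *: "m \<le> l \<bullet> ((1 - s) *\<^sub>R v + s *\<^sub>R w)"
        by (simp add: inner_add_right algebra_simps)
      then show "0 \<le> l \<bullet> ((1 - s) *\<^sub>R v + s *\<^sub>R w)" using m by linarith
      have "norm (w - v) = norm (w - v) / m * m" using m by simp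
      also have "\<dots> \<le> norm (w - v) / m * (l \<bullet> ((1 - s) *\<^sub>R v + s *\<^sub>R w))"
        using * m by (intro mult_left_mono) auto
      finally show "norm (w - v) \<le> norm (w - v) / m * (l \<bullet> ((1 - s) *\<^sub>R v + s *\<^sub>R w))" .
    qed (use m in auto)
  qed
  note * = this
  obtain C0 where C0: "C0 \<ge> 0" "\<And>s. s \<in> {0..1} \<Longrightarrow> norm (w0 - v0) \<le> C0 * (l \<bullet> ((1 - s) *\<^sub>R v0 + s *\<^sub>R w0))"
    "\<And>s. s \<in> {0..1} \<Longrightarrow> 0 \<le> l \<bullet> ((1 - s) *\<^sub>R v0 + s *\<^sub>R w0)" using *[OF 0] by blast
  obtain C1 where C1: "C1 \<ge> 0" "\<And>s. s \<in> {0..1} \<Longrightarrow> norm (w1 - v1) \<le> C1 * (l \<bullet> ((1 - s) *\<^sub>R v1 + s *\<^sub>R w1))"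
    "\<And>s. s \<in> {0..1} \<Longrightarrow> 0 \<le> l \<bullet> ((1 - s) *\<^sub>R v1 + s *\<^sub>R w1)" using *[OF 1] by blast
  show ?thesis
  proof (intro exI[of _ "(C0 + C1) * norm l"] conjI ballI)
    show "0 \<le> (C0 + C1) * norm l" using C0 C1 by simp
    fix \<tau> s :: real assume \<tau>: "\<tau> \<in> {0..1}" and s: "s \<in> {0..1}"
    let ?A = "(1 - s) *\<^sub>R v0 + s *\<^sub>R w0" and ?B = "(1 - s) *\<^sub>R v1 + s *\<^sub>R w1"
    have a: "norm (w0 - v0) \<le> (C0 + C1) * (l \<bullet> ?A)" "norm (w1 - v1) \<le> (C0 + C1) * (l \<bullet> ?B)"
      using C0(2)[OF s] C1(2)[OF s] mult_nonneg_nonneg[OF C1(1) C0(3)[OF s]] mult_nonneg_nonneg[OF C0(1) C1(3)[OF s]]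
      unfolding distrib_right by linarith+
    have "norm ((1 - \<tau>) *\<^sub>R (w0 - v0) + \<tau> *\<^sub>R (w1 - v1)) \<le> (1 - \<tau>) * norm (w0 - v0) + \<tau> * norm (w1 - v1)"
      using \<tau> by (intro order_trans[OF norm_triangle_ineq]) simp
    also have "\<dots> \<le> (1 - \<tau>) * ((C0 + C1) * (l \<bullet> ?A)) + \<tau> * ((C0 + C1) * (l \<bullet> ?B))"
      using a \<tau> by (intro add_mono mult_left_mono) auto
    also have "\<dots> = (C0 + C1) * (l \<bullet> ((1 - \<tau>) *\<^sub>R ?A + \<tau> *\<^sub>R ?B))"
      unfolding inner_add_right inner_scaleR_right by (simp add: algebra_simps)
    also have "\<dots> \<le> (C0 + C1) * (norm l * norm ((1 - \<tau>) *\<^sub>R ?A + \<tau> *\<^sub>R ?B))"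
      using C0 C1 by (intro mult_left_mono norm_cauchy_schwarz) auto
    finally show "norm ((1 - \<tau>) *\<^sub>R (w0 - v0) + \<tau> *\<^sub>R (w1 - v1))
      \<le> (C0 + C1) * norm l * norm ((1 - \<tau>) *\<^sub>R ?A + \<tau> *\<^sub>R ?B)" by (simp add: mult.assoc)
  qed
qed

lemma at_level_gap:
  "at_level c b k - at_level c a k = (fst (gap c a b k), snd (gap c a b k), 0)"
  by (simp add: at_level_def gap_def)

text \<open>
  The Lipschitz constant comes from the finitely many segments, and the constant for the relative
  displacement is the largest of those that \<open>interpolation_ratio\<close> gives for the finitely many
  pairs of strands and levels.
\<close>

lemma compatible_isotopic:
  assumes J: "finite J" "J \<noteq> {}"
    and n: "\<And>j. j \<in> J \<Longrightarrow> 2 < n j"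
    and comp: "compatible n J c c'"
  shows "ambient_iso (curve n J c) (curve n J c')"
proof -
  let ?f = "\<lambda>j. level_path (at_level c j)" and ?g = "\<lambda>j. level_path (at_level c' j)"
  have st: "start j \<le> 2" for j by (simp add: start_def)
  have curve: "curve n J d = (\<Union>j\<in>J. level_path (at_level d j) ` {real (start j)..real (n j)})" for d
  proof -
    have "level_path (at_level d j) ` {real (start j)..real (n j)}
        = (\<Union>k\<in>{start j..<n j}. closed_segment (at_level d j k) (at_level d j (Suc k)))" if "j \<in> J" for j
      by (rule level_path_image) (use st[of j] n[OF that] in linarith)
    then show ?thesis by (simp add: curve_def)
  qed
  have time: "(0, 0, - 2) \<bullet> level_path (at_level d j) t = t + (- 4)" if "0 \<le> t" for d j t
  proof -
    define k where "k = nat \<lfloor>t\<rfloor>"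
    have e: "(0, 0, - 2) \<bullet> at_level d j k = real k - 4" for k by (simp add: at_level_def)
    have "real k \<le> t" "t \<le> real (Suc k)" using that unfolding k_def by linarith+
    then have "(0, 0, - 2) \<bullet> level_path (at_level d j) t
        = (1 - (t - real k)) * (real k - 4) + (t - real k) * (real (Suc k) - 4)"
      by (simp only: level_path_between[of k t] inner_add_right inner_scaleR_right e)
    then show ?thesis by (simp add: algebra_simps)
  qed
  have "\<exists>R\<ge>0. \<forall>d\<in>{c, c'}. \<forall>j\<in>J. \<forall>k\<in>{start j..<n j}. norm (at_level d j (Suc k) - at_level d j k) \<le> R"
  proof (intro exI[of _ "\<Sum>d\<in>{c,c'}. \<Sum>j\<in>J. \<Sum>k\<in>{start j..<n j}. norm (at_level d j (Suc k) - at_level d j k)"] conjI ballI)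
    fix d j k assume d: "d \<in> {c, c'}" and j: "j \<in> J" and k: "k \<in> {start j..<n j}"
    have "norm (at_level d j (Suc k) - at_level d j k) \<le> (\<Sum>k\<in>{start j..<n j}. norm (at_level d j (Suc k) - at_level d j k))"
      using k by (intro member_le_sum) auto
    also have "\<dots> \<le> (\<Sum>j\<in>J. \<Sum>k\<in>{start j..<n j}. norm (at_level d j (Suc k) - at_level d j k))"
      using j J by (intro member_le_sum[of j J "\<lambda>j. \<Sum>k\<in>{start j..<n j}. norm (at_level d j (Suc k) - at_level d j k)"] sum_nonneg) auto
    also have "\<dots> \<le> (\<Sum>d\<in>{c,c'}. \<Sum>j\<in>J. \<Sum>k\<in>{start j..<n j}. norm (at_level d j (Suc k) - at_level d j k))"
      using d by (intro member_le_sum[of d "{c, c'}" "\<lambda>d. \<Sum>j\<in>J. \<Sum>k\<in>{start j..<n j}. norm (at_level d j (Suc k) - at_level d j k)"] sum_nonneg) auto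
    finally show "norm (at_level d j (Suc k) - at_level d j k) \<le> (\<Sum>d\<in>{c,c'}. \<Sum>j\<in>J. \<Sum>k\<in>{start j..<n j}. norm (at_level d j (Suc k) - at_level d j k))" .
  qed (auto intro!: sum_nonneg)
  then obtain R where R: "0 \<le> R"
    "\<And>d j k. d \<in> {c, c'} \<Longrightarrow> j \<in> J \<Longrightarrow> k \<in> {start j..<n j} \<Longrightarrow> norm (at_level d j (Suc k) - at_level d j k) \<le> R"
    by metis
  have lip: "norm (level_path (at_level d j) t - level_path (at_level d j) u) \<le> R * \<bar>t - u\<bar>"
    if d: "d \<in> {c, c'}" and j: "j \<in> J" and "t \<in> {real (start j)..real (n j)}" "u \<in> {real (start j)..real (n j)}"
    for d j t u
  proof -
    have "R-lipschitz_on {real (start j)..real (n j)} (level_path (at_level d j))"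
      using R(1) R(2)[OF d j] st[of j] n[OF j] by (intro level_path_lipschitz) auto
    then show ?thesis using that by (auto simp: lipschitz_on_def dist_norm)
  qed
  define Q where "Q C i j t s \<longleftrightarrow> norm ((?g i t - ?f i t) - (?g j t - ?f j t))
    \<le> C * norm ((1 - s) *\<^sub>R (?f i t - ?f j t) + s *\<^sub>R (?g i t - ?g j t))" for C i j t s
  define N where "N = Max (n ` J)"
  have "\<forall>\<^sub>F C in at_top. \<forall>k\<in>{..N}. alive n i j k \<longrightarrow> (\<forall>t\<in>{real k..real (Suc k)}. \<forall>s\<in>{0..1}. Q C i j t s)"
    if ij: "i \<in> J" "j \<in> J" "i \<noteq> j" for i j
  proof (rule eventually_ball_finite, simp, intro ballI)
    fix k
    show "\<forall>\<^sub>F C in at_top. alive n i j k \<longrightarrow> (\<forall>t\<in>{real k..real (Suc k)}. \<forall>s\<in>{0..1}. Q C i j t s)"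
    proof (cases "alive n i j k")
      case True
      have "separated n c c' j i k"
        using compatibleD[OF comp ij(2,1) ij(3)[symmetric]] True alive_commute by blast
      then obtain l where l: "ordered_at n c c' l j i k" "ordered_at n c c' l j i (Suc k)"
        unfolding separated_def by blast
      let ?v = "\<lambda>d k. at_level d i k - at_level d j k"
      have *: "?v c \<kappa> = 0 \<and> ?v c' \<kappa> = 0 \<or> (fst l, snd l, 0) \<bullet> ?v c \<kappa> > 0 \<and> (fst l, snd l, 0) \<bullet> ?v c' \<kappa> > 0"
        if "ordered_at n c c' l j i \<kappa>" for \<kappa>
        using that unfolding ordered_at_def at_level_gap
        by (cases l) (auto simp: zero_prod_def inner_prod_def)
      obtain C0 where C0: "C0 \<ge> 0" "\<And>\<tau> s. \<tau> \<in> {0..1} \<Longrightarrow> s \<in> {0..1} \<Longrightarrow>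
        norm ((1 - \<tau>) *\<^sub>R (?v c' k - ?v c k) + \<tau> *\<^sub>R (?v c' (Suc k) - ?v c (Suc k)))
          \<le> C0 * norm ((1 - \<tau>) *\<^sub>R ((1 - s) *\<^sub>R ?v c k + s *\<^sub>R ?v c' k)
              + \<tau> *\<^sub>R ((1 - s) *\<^sub>R ?v c (Suc k) + s *\<^sub>R ?v c' (Suc k)))"
        using interpolation_ratio[OF *[OF l(1)] *[OF l(2)]] by blast
      have "Q C i j t s" if C: "C0 \<le> C" and t: "t \<in> {real k..real (Suc k)}" and s: "s \<in> {0..1}" for C t s
      proof -
        define \<tau> where "\<tau> = t - real k"
        have \<tau>: "\<tau> \<in> {0..1}" using t by (simp add: \<tau>_def)
        have p: "level_path (at_level d m) t = (1 - \<tau>) *\<^sub>R at_level d m k + \<tau> *\<^sub>R at_level d m (Suc k)" for d m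
          using t by (simp add: level_path_between[of k t] \<tau>_def)
        have e1: "(?g i t - ?f i t) - (?g j t - ?f j t)
            = (1 - \<tau>) *\<^sub>R (?v c' k - ?v c k) + \<tau> *\<^sub>R (?v c' (Suc k) - ?v c (Suc k))"
          unfolding p by (simp add: algebra_simps)
        have e2: "(1 - s) *\<^sub>R (?f i t - ?f j t) + s *\<^sub>R (?g i t - ?g j t)
            = (1 - \<tau>) *\<^sub>R ((1 - s) *\<^sub>R ?v c k + s *\<^sub>R ?v c' k)
              + \<tau> *\<^sub>R ((1 - s) *\<^sub>R ?v c (Suc k) + s *\<^sub>R ?v c' (Suc k))"
          unfolding p by (simp add: algebra_simps)
        show ?thesis unfolding Q_def e1 e2
          using C0(2)[OF \<tau> s] C by (meson mult_right_mono norm_ge_zero order_trans)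
      qed
      then show ?thesis unfolding eventually_at_top_linorder by blast
    qed simp
  qed
  then have "\<forall>\<^sub>F C in at_top. \<forall>i\<in>J. \<forall>j\<in>J. i \<noteq> j \<longrightarrow>
    (\<forall>k\<in>{..N}. alive n i j k \<longrightarrow> (\<forall>t\<in>{real k..real (Suc k)}. \<forall>s\<in>{0..1}. Q C i j t s))"
    using J(1) by (intro eventually_ball_finite ballI) auto
  then have "\<forall>\<^sub>F C in at_top. 0 \<le> C \<and> (\<forall>i\<in>J. \<forall>j\<in>J. i \<noteq> j \<longrightarrow>
    (\<forall>k\<in>{..N}. alive n i j k \<longrightarrow> (\<forall>t\<in>{real k..real (Suc k)}. \<forall>s\<in>{0..1}. Q C i j t s)))"
    by (intro eventually_conj eventually_ge_at_top)
  from eventually_happens'[OF trivial_limit_at_top_linorder this]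
  obtain C where CC: "0 \<le> C \<and> (\<forall>i\<in>J. \<forall>j\<in>J. i \<noteq> j \<longrightarrow>
    (\<forall>k\<in>{..N}. alive n i j k \<longrightarrow> (\<forall>t\<in>{real k..real (Suc k)}. \<forall>s\<in>{0..1}. Q C i j t s)))" ..
  then have C: "0 \<le> C" "\<And>i j k t s. i \<in> J \<Longrightarrow> j \<in> J \<Longrightarrow> i \<noteq> j \<Longrightarrow> k \<le> N \<Longrightarrow> alive n i j k \<Longrightarrow>
      t \<in> {real k..real (Suc k)} \<Longrightarrow> s \<in> {0..1} \<Longrightarrow> Q C i j t s"
    unfolding atMost_iff[symmetric, of _ N] by blast+
  show ?thesis
    unfolding curve
  proof (rule strand_isotopy[where R = R and C = C and e = "(0, 0, - 2)" and \<beta> = "- 4"])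
    show "real (start i) \<le> real (n j)" if "j \<in> J" for i j
      using st[of i] n[OF that] by linarith
    fix i j t s assume ij: "i \<in> J" "j \<in> J" and t: "t \<in> {real (start i)..real (n i)}" "t \<in> {real (start j)..real (n j)}"
      and s: "s \<in> {0..1::real}"
    show "norm ((?g i t - ?f i t) - (?g j t - ?f j t))
        \<le> C * norm ((1 - s) *\<^sub>R (?f i t - ?f j t) + s *\<^sub>R (?g i t - ?g j t))"
    proof (cases "i = j")
      case True
      then show ?thesis using C(1) by simp
    next
      case False
      have m: "max (start i) (start j) < min (n i) (n j)" using st[of i] st[of j] n[OF ij(1)] n[OF ij(2)] by simp
      have "t \<in> {real (max (start i) (start j))..real (min (n i) (n j))}" using t by auto
      then obtain k where k: "max (start i) (start j) \<le> k" "k < min (n i) (n j)" "t \<in> {real k..real (Suc k)}"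
      proof -
        assume t: "t \<in> {real (max (start i) (start j))..real (min (n i) (n j))}" and
          *: "\<And>k. max (start i) (start j) \<le> k \<Longrightarrow> k < min (n i) (n j) \<Longrightarrow> t \<in> {real k..real (Suc k)} \<Longrightarrow> thesis"
        show thesis
        proof (cases "t = real (min (n i) (n j))")
          case True
          show ?thesis by (rule *[of "min (n i) (n j) - 1"]) (use True m in auto)
        next
          case False
          show ?thesis
          proof (rule *[of "nat \<lfloor>t\<rfloor>"])
            show "max (start i) (start j) \<le> nat \<lfloor>t\<rfloor>" 
              using t by (intro le_nat_floor) simp
            have "nat \<lfloor>t\<rfloor> < m" if "0 \<le> t" "t < real m" for m using that by linarith
            moreover have "0 \<le> t" using t of_nat_0_le_iff order_trans unfolding atLeastAtMost_iff by blast
            moreover have "t < real (min (n i) (n j))" using t False by simp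
            ultimately show "nat \<lfloor>t\<rfloor> < min (n i) (n j)" by blast
            show "t \<in> {real (nat \<lfloor>t\<rfloor>)..real (Suc (nat \<lfloor>t\<rfloor>))}" using t by (simp) linarith
          qed
        qed
      qed
      have "n i \<le> N" unfolding N_def using J ij by simp
      then have "Q C i j t s" using k by (intro C(2)[OF ij False _ _ k(3) s]) (auto simp: alive_def)
      then show ?thesis by (simp only: Q_def)
    qed
  qed (use J R C(1) time lip in auto)
qed

text \<open>
  The depth of strand \<open>j\<close> is increased by \<open>\<Lambda> * \<delta> j\<close> on the levels
  in \<open>I\<close>.
\<close>

definition raised :: "nat set \<Rightarrow> (nat \<Rightarrow> real) \<Rightarrow> real \<Rightarrow> config \<Rightarrow> config" where
  "raised I \<delta> \<Lambda> c = (\<lambda>j k. if k \<in> I then (fst (c j k), snd (c j k) + \<Lambda> * \<delta> j) else c j k)"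

text \<open>
  The form \<open>(\<epsilon>, 1)\<close> sees the strand \<open>a\<close> in front of \<open>b\<close>.
  The horizontal coefficient \<open>\<epsilon>\<close> is arbitrary, so strands of equal depth may also
  qualify if they are side by side.
\<close>

definition in_front :: "(nat \<Rightarrow> nat) \<Rightarrow> config \<Rightarrow> nat \<Rightarrow> nat \<Rightarrow> nat \<Rightarrow> bool" where
  "in_front n c a b k \<longleftrightarrow> (\<exists>\<epsilon>. ordered_at n c c (\<epsilon>, 1) a b k \<and> ordered_at n c c (\<epsilon>, 1) a b (Suc k))"

lemma gap_raised: "gap (raised I \<delta> \<Lambda> c) a b k
  = (if k \<in> I then gap c a b k + (0, \<Lambda> * (\<delta> b - \<delta> a)) else gap c a b k)"
  by (simp add: gap_def raised_def prod_eq_iff algebra_simps)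

text \<open>
  Let \<open>\<delta>\<close> assign a layer to each strand, and suppose that strands of a lower layer
  pass in front of those of a higher layer in \<open>c\<close> as well as in \<open>c'\<close>. Then the
  layers can be pulled apart in the direction of sight until they are so far apart that they no longer
  interfere. There each layer moves from its position in \<open>c\<close> to that in \<open>c'\<close>,
  and then the layers are pushed together again. Only strands of the same layer have to be compared
  directly.
\<close>

lemma layered_isotopy:
  fixes \<delta> :: "nat \<Rightarrow> real"
  assumes J: "finite J"
    and same: "\<And>a b k. a \<in> J \<Longrightarrow> b \<in> J \<Longrightarrow> a \<noteq> b \<Longrightarrow> alive n a b k \<Longrightarrow>
      \<delta> a = \<delta> b \<or> k \<notin> I \<and> Suc k \<notin> I \<Longrightarrow> separated n c c' a b k"
    and front: "\<And>a b k. a \<in> J \<Longrightarrow> b \<in> J \<Longrightarrow> \<delta> a < \<delta> b \<Longrightarrow> alive n a b k \<Longrightarrow>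
      k \<in> I \<or> Suc k \<in> I \<Longrightarrow> in_front n c a b k \<and> in_front n c' a b k"
    and edge: "\<And>a b k \<kappa>. a \<in> J \<Longrightarrow> b \<in> J \<Longrightarrow> \<delta> a < \<delta> b \<Longrightarrow> alive n a b k \<Longrightarrow>
      k \<in> I \<or> Suc k \<in> I \<Longrightarrow> \<kappa> \<in> {k, Suc k} \<Longrightarrow> \<kappa> \<notin> I \<Longrightarrow> \<exists>\<epsilon>. ordered_at n c c' (\<epsilon>, 1) a b \<kappa>"
    and joint: "\<And>a b k. a \<in> J \<Longrightarrow> b \<in> J \<Longrightarrow> joined n a b k \<Longrightarrow> k \<in> I \<Longrightarrow> \<delta> a = \<delta> b"
  shows "(compatible n J)\<^sup>*\<^sup>* c c'"
proof -
  have symI: "compatible n J d d'"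
    if eq: "\<And>a b k. a \<in> J \<Longrightarrow> b \<in> J \<Longrightarrow> a \<noteq> b \<Longrightarrow> alive n a b k \<Longrightarrow>
        \<delta> a = \<delta> b \<or> k \<notin> I \<and> Suc k \<notin> I \<Longrightarrow> separated n d d' a b k"
      and lt: "\<And>a b k. a \<in> J \<Longrightarrow> b \<in> J \<Longrightarrow> \<delta> a < \<delta> b \<Longrightarrow> alive n a b k \<Longrightarrow>
        k \<in> I \<or> Suc k \<in> I \<Longrightarrow> separated n d d' a b k" for d d'
    unfolding compatible_def
  proof (intro ballI allI impI)
    fix a b k assume ab: "a \<in> J" "b \<in> J" "a \<noteq> b" "alive n a b k"
    consider "\<delta> a = \<delta> b \<or> k \<notin> I \<and> Suc k \<notin> I" | "\<delta> a < \<delta> b" "k \<in> I \<or> Suc k \<in> I"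
      | "\<delta> b < \<delta> a" "k \<in> I \<or> Suc k \<in> I"
      using linorder_less_linear[of "\<delta> a" "\<delta> b"] by blast
    then show "separated n d d' a b k"
    proof cases
      case 1 then show ?thesis using eq ab by blast
    next
      case 2 then show ?thesis using lt ab by blast
    next
      case 3 then show ?thesis using lt[of b a k] ab separated_swap alive_commute by metis
    qed
  qed
  have lift: "compatible n J d (raised I \<delta> \<Lambda> d) \<and> compatible n J (raised I \<delta> \<Lambda> d) d"
    if "0 \<le> \<Lambda>" and eq: "\<And>a b k. a \<in> J \<Longrightarrow> b \<in> J \<Longrightarrow> a \<noteq> b \<Longrightarrow> alive n a b k \<Longrightarrow>
        \<delta> a = \<delta> b \<or> k \<notin> I \<and> Suc k \<notin> I \<Longrightarrow> separated n d d a b k"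
      and lt: "\<And>a b k. a \<in> J \<Longrightarrow> b \<in> J \<Longrightarrow> \<delta> a < \<delta> b \<Longrightarrow> alive n a b k \<Longrightarrow>
        k \<in> I \<or> Suc k \<in> I \<Longrightarrow> in_front n d a b k" for d \<Lambda>
  proof -
    have e: "gap (raised I \<delta> \<Lambda> d) a b \<kappa> = gap d a b \<kappa>"
      if "\<delta> a = \<delta> b \<or> k \<notin> I \<and> Suc k \<notin> I" "\<kappa> \<in> {k, Suc k}" for a b k \<kappa>
      using that by (auto simp: gap_raised simp flip: zero_prod_def)
    have eq': "separated n d (raised I \<delta> \<Lambda> d) a b k \<and> separated n (raised I \<delta> \<Lambda> d) d a b k"
      if "a \<in> J" "b \<in> J" "a \<noteq> b" "alive n a b k" "\<delta> a = \<delta> b \<or> k \<notin> I \<and> Suc k \<notin> I" for a b k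
      using eq[OF that] e[OF that(5)] unfolding separated_def ordered_at_def by auto
    have lt': "separated n d (raised I \<delta> \<Lambda> d) a b k \<and> separated n (raised I \<delta> \<Lambda> d) d a b k"
      if ab: "a \<in> J" "b \<in> J" "\<delta> a < \<delta> b" "alive n a b k" "k \<in> I \<or> Suc k \<in> I" for a b k
    proof -
      obtain \<epsilon> where \<epsilon>: "ordered_at n d d (\<epsilon>, 1) a b k" "ordered_at n d d (\<epsilon>, 1) a b (Suc k)"
        using lt[OF ab] by (auto simp: in_front_def)
      have "ordered_at n d (raised I \<delta> \<Lambda> d) (\<epsilon>, 1) a b \<kappa> \<and> ordered_at n (raised I \<delta> \<Lambda> d) d (\<epsilon>, 1) a b \<kappa>"
        if o: "ordered_at n d d (\<epsilon>, 1) a b \<kappa>" for \<kappa>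
      proof (cases "\<kappa> \<in> I")
        case True
        then have nj: "\<not> joined n a b \<kappa>" using joint[OF ab(1,2)] ab(3) by fastforce
        then have "(\<epsilon>, 1) \<bullet> gap d a b \<kappa> > 0" using o by (simp add: ordered_at_def)
        moreover have "0 \<le> \<Lambda> * (\<delta> b - \<delta> a)" using ab(3) \<open>0 \<le> \<Lambda>\<close> by simp
        ultimately show ?thesis using True unfolding ordered_at_def gap_raised
          by (simp add: inner_prod_def)
      next
        case False
        then show ?thesis using o unfolding ordered_at_def gap_raised by simp
      qed
      with \<epsilon> show ?thesis unfolding separated_def by blast
    qed
    show ?thesis using symI eq' lt' by blast
  qed
  define N where "N = Max (n ` J)"
  have good: "\<forall>\<^sub>F \<Lambda> in at_top. \<delta> a < \<delta> b \<and> alive n a b k \<and> (k \<in> I \<or> Suc k \<in> I)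
      \<longrightarrow> separated n (raised I \<delta> \<Lambda> c) (raised I \<delta> \<Lambda> c') a b k"
    if ab: "a \<in> J" "b \<in> J" for a b k
  proof (cases "\<delta> a < \<delta> b \<and> alive n a b k \<and> (k \<in> I \<or> Suc k \<in> I)")
    case True
    then have h: "\<delta> a < \<delta> b" "alive n a b k" "k \<in> I \<or> Suc k \<in> I" by auto
    obtain \<epsilon> where \<epsilon>: "\<And>\<kappa>. \<kappa> \<in> {k, Suc k} \<Longrightarrow> \<kappa> \<notin> I \<Longrightarrow> ordered_at n c c' (\<epsilon>, 1) a b \<kappa>"
    proof (cases "k \<in> I")
      case True
      then show ?thesis
      proof (cases "Suc k \<in> I")
        case False
        then show ?thesis using edge[OF ab h, of "Suc k"] that True by auto
      qed (use that True in blast)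
    next
      case False
      then show ?thesis using edge[OF ab h, of k] that h(3) by auto
    qed
    have ev: "\<forall>\<^sub>F \<Lambda> in at_top. ordered_at n (raised I \<delta> \<Lambda> c) (raised I \<delta> \<Lambda> c') (\<epsilon>, 1) a b \<kappa>"
      if \<kappa>: "\<kappa> \<in> {k, Suc k}" for \<kappa>
    proof (cases "\<kappa> \<in> I")
      case True
      have "\<forall>\<^sub>F \<Lambda> in at_top. (\<epsilon>, 1) \<bullet> gap (raised I \<delta> \<Lambda> d) a b \<kappa> > 0" for d
      proof -
        have "\<forall>\<^sub>F \<Lambda> in at_top. \<Lambda> > - ((\<epsilon>, 1) \<bullet> gap d a b \<kappa>) / (\<delta> b - \<delta> a)"
          by (rule eventually_gt_at_top)
        then show ?thesis
        proof (eventually_elim)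
          case (elim \<Lambda>)
          then have "\<Lambda> * (\<delta> b - \<delta> a) > - ((\<epsilon>, 1) \<bullet> gap d a b \<kappa>)"
            using h(1) by (simp only: pos_divide_less_eq diff_gt_0_iff_gt)
          then show ?case using True unfolding gap_raised by (simp add: inner_prod_def)
        qed
      qed
      from eventually_conj[OF this[of c] this[of c']] show ?thesis
        by (rule eventually_mono) (simp add: ordered_at_def)
    next
      case False
      then show ?thesis using \<epsilon>[OF \<kappa>] by (simp add: ordered_at_def gap_raised)
    qed
    from eventually_conj[OF ev[of k] ev[of "Suc k"]] show ?thesis
      by (simp) (auto elim!: eventually_mono simp: separated_def)
  qed (auto intro!: always_eventually)
  have "\<forall>\<^sub>F \<Lambda> in at_top. 0 \<le> \<Lambda> \<and> (\<forall>a\<in>J. \<forall>b\<in>J. \<forall>k\<in>{..N}. \<delta> a < \<delta> b \<and> alive n a b k \<and> (k \<in> I \<or> Suc k \<in> I)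
      \<longrightarrow> separated n (raised I \<delta> \<Lambda> c) (raised I \<delta> \<Lambda> c') a b k)"
    using J good by (intro eventually_conj eventually_ge_at_top eventually_ball_finite ballI) auto
  from eventually_happens'[OF trivial_limit_at_top_linorder this]
  obtain \<Lambda> where LL: "0 \<le> \<Lambda> \<and> (\<forall>a\<in>J. \<forall>b\<in>J. \<forall>k\<in>{..N}. \<delta> a < \<delta> b \<and> alive n a b k \<and> (k \<in> I \<or> Suc k \<in> I)
      \<longrightarrow> separated n (raised I \<delta> \<Lambda> c) (raised I \<delta> \<Lambda> c') a b k)" ..
  then have \<Lambda>: "0 \<le> \<Lambda>" "\<And>a b k. a \<in> J \<Longrightarrow> b \<in> J \<Longrightarrow> k \<le> N \<Longrightarrow> \<delta> a < \<delta> b \<Longrightarrow> alive n a b k \<Longrightarrow>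
      k \<in> I \<or> Suc k \<in> I \<Longrightarrow> separated n (raised I \<delta> \<Lambda> c) (raised I \<delta> \<Lambda> c') a b k"
    unfolding atMost_iff[symmetric, of _ N] by blast+
  have sep_left: "separated n c c a b k" and sep_right: "separated n c' c' a b k" if "separated n c c' a b k" for a b k
    using that unfolding separated_def ordered_at_def by blast+
  have "compatible n J c (raised I \<delta> \<Lambda> c)"
    using lift[OF \<Lambda>(1), of c] same sep_left front by blast
  moreover have "compatible n J (raised I \<delta> \<Lambda> c) (raised I \<delta> \<Lambda> c')"
  proof (rule symI)
    fix a b k assume ab: "a \<in> J" "b \<in> J" "\<delta> a < \<delta> b" "alive n a b k" "k \<in> I \<or> Suc k \<in> I"
    have "n a \<le> N" unfolding N_def using J ab by simp
    then have "k \<le> N" using ab(4) by (simp add: alive_def)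
    then show "separated n (raised I \<delta> \<Lambda> c) (raised I \<delta> \<Lambda> c') a b k" using \<Lambda>(2) ab by blast
  next
    fix a b k assume ab: "a \<in> J" "b \<in> J" "a \<noteq> b" "alive n a b k" "\<delta> a = \<delta> b \<or> k \<notin> I \<and> Suc k \<notin> I"
    have "gap (raised I \<delta> \<Lambda> d) a b \<kappa> = gap d a b \<kappa>" if "\<kappa> \<in> {k, Suc k}" for d \<kappa>
      using ab(5) that by (auto simp: gap_raised simp flip: zero_prod_def)
    then show "separated n (raised I \<delta> \<Lambda> c) (raised I \<delta> \<Lambda> c') a b k"
      using same[OF ab] unfolding separated_def ordered_at_def by simp
  qed
  moreover have "compatible n J (raised I \<delta> \<Lambda> c') c'"
    using lift[OF \<Lambda>(1), of c'] same sep_right front by blast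
  ultimately show ?thesis by (meson converse_rtranclp_into_rtranclp rtranclp.rtrancl_refl)
qed

lemma compatible_steps_isotopic:
  assumes "(compatible n J)\<^sup>*\<^sup>* c c'" "compatible n J c c"
    and J: "finite J" "J \<noteq> {}" "\<And>j. j \<in> J \<Longrightarrow> 2 < n j"
  shows "ambient_iso (curve n J c) (curve n J c') \<and> compatible n J c' c'"
  using assms(1)
proof (induction rule: rtranclp_induct)
  case base
  then show ?case using compatible_isotopic[OF J assms(2)] assms(2) by simp
next
  case (step d d')
  then show ?case using compatible_isotopic[OF J step(2)] ambient_isotopic_S3_trans compatible_refl_right by blast
qed

section \<open>Plane quadrilaterals are unknotted\<close>

text \<open>
  Radial rescaling by the ratio of the two norms turns the unit circle of the 1-norm into that of the
  Euclidean norm.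
\<close>

lemma diamond_is_unknot: "is_unknot (to_S3 ` {(x, y, 0) |x y. \<bar>x\<bar> + \<bar>y\<bar> = 1})"
proof -
  let ?D = "{(x, y, 0) |x y. \<bar>x\<bar> + \<bar>y\<bar> = (1::real)} :: point set"
  let ?C = "{(x, y, 0) |x y. x\<^sup>2 + y\<^sup>2 = (1::real)} :: point set"
  define m :: "point \<Rightarrow> real" where "m p = \<bar>fst p\<bar> + \<bar>fst (snd p)\<bar> + \<bar>snd (snd p)\<bar>" for p
  define r where "r s p = (1 - s) + s * (m p / norm p)" for s :: real and p :: point
  define h where "h s p = r s p *\<^sub>R p" for s p
  have m_ge: "norm p \<le> m p" for p unfolding m_def by (rule norm_triple_le)
  have m_le: "m p \<le> 3 * norm p" for p
    using norm_fst_le_norm[of p] norm_fst_le_norm[of "snd p"] norm_snd_le_norm[of p] norm_snd_le_norm[of "snd p"]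
    unfolding m_def real_norm_def by linarith
  have m_scale: "m (a *\<^sub>R p) = \<bar>a\<bar> * m p" for a p by (simp add: m_def abs_mult algebra_simps)
  have r_bounds: "1 \<le> r s p" "r s p \<le> 3" if "s \<in> {0..1}" "p \<noteq> 0" for s p
  proof -
    have "1 \<le> m p / norm p" "m p / norm p \<le> 3" using m_ge[of p] m_le[of p] that(2) by (simp_all add: divide_simps)
    then have "s * 1 \<le> s * (m p / norm p)" "s * (m p / norm p) \<le> s * 3" using that(1) by (intro mult_left_mono; simp)+
    then show "1 \<le> r s p" "r s p \<le> 3" using that(1) unfolding r_def by auto
  qed
  have r_scale: "r s (a *\<^sub>R p) = r s p" if "0 < a" for s a p
    using that by (simp add: r_def m_scale)
  have h0: "h s 0 = 0" for s by (simp add: h_def)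
  have norm_h: "norm p \<le> norm (h s p)" "norm (h s p) \<le> 3 * norm p" if "s \<in> {0..1}" for s p
  proof -
    have "norm (h s p) = r s p * norm p" if "p \<noteq> 0"
      using r_bounds[OF \<open>s \<in> {0..1}\<close> that] by (simp add: h_def)
    moreover have "1 * norm p \<le> r s p * norm p" "r s p * norm p \<le> 3 * norm p" if "p \<noteq> 0"
      using r_bounds[OF \<open>s \<in> {0..1}\<close> that] by (intro mult_right_mono; simp)+
    ultimately show "norm p \<le> norm (h s p)" "norm (h s p) \<le> 3 * norm p"
      by (cases "p = 0"; simp add: h0)+
  qed
  have bij: "bij (h s)" if s: "s \<in> {0..1}" for s
  proof (rule o_bij)
    define g where "g p = (1 / r s p) *\<^sub>R p" for p
    have pos: "0 < r s p" if "p \<noteq> 0" for p using r_bounds(1)[OF s that] by linarith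
    have "g (h s p) = p" for p
    proof (cases "p = 0")
      case False
      then show ?thesis using pos[OF False] unfolding g_def h_def by (simp add: r_scale)
    qed (simp add: h0 g_def)
    then show "g \<circ> h s = id" by (simp only: fun_eq_iff o_apply id_apply) blast
    have "h s (g p) = p" for p
    proof (cases "p = 0")
      case False
      then show ?thesis using pos[OF False] unfolding g_def h_def by (simp add: r_scale)
    qed (simp add: h0 g_def)
    then show "h s \<circ> g = id" by (simp only: fun_eq_iff o_apply id_apply) blast
  qed
  have cont: "continuous_on ({0..1} \<times> UNIV) (\<lambda>(s, p). h s p)"
    unfolding continuous_on_eq_continuous_within
  proof
    fix z :: "real \<times> point" assume z: "z \<in> {0..1} \<times> UNIV"
    show "continuous (at z within {0..1} \<times> UNIV) (\<lambda>(s, p). h s p)"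
    proof (cases "snd z = 0")
      case True
      show ?thesis unfolding continuous_within_eps_delta case_prod_beta
      proof (intro allI impI)
        fix e :: real assume e: "0 < e"
        show "\<exists>d>0. \<forall>w\<in>{0..1} \<times> UNIV. dist w z < d \<longrightarrow> dist (h (fst w) (snd w)) (h (fst z) (snd z)) < e"
        proof (intro exI[of _ "e / 3"] conjI ballI impI)
          fix w :: "real \<times> point" assume w: "w \<in> {0..1} \<times> UNIV" "dist w z < e / 3"
          have "norm (snd w) < e / 3" using w(2) dist_snd_le[of w z] True by simp
          then show "dist (h (fst w) (snd w)) (h (fst z) (snd z)) < e"
            using norm_h(2)[of "fst w" "snd w"] w(1) True by (simp add: h0 mem_Times_iff)
        qed (use e in simp)
      qed
    next
      case False
      then show ?thesis unfolding case_prod_beta h_def r_def m_def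
        by (intro continuous_intros) auto
    qed
  qed
  have "ambient_iso ?D (h 1 ` ?D)"
  proof (rule proper_isotopy_lift[OF cont bij])
    show "\<exists>C>0. \<forall>s\<in>{0..1}. \<forall>x. C \<le> norm x \<longrightarrow> B \<le> norm (h s x)" for B
      using norm_h(1) by (intro exI[of _ "max 1 B"]) (auto intro: order_trans)
    show "h 0 x = x" for x by (simp add: h_def r_def)
  qed
  also have "h 1 ` ?D = ?C"
  proof (intro set_eqI iffI)
    fix p assume "p \<in> h 1 ` ?D"
    then obtain x y where xy: "\<bar>x\<bar> + \<bar>y\<bar> = 1" "p = h 1 (x, y, 0)" by auto
    have nz: "x\<^sup>2 + y\<^sup>2 \<noteq> 0" using xy(1) by (auto simp: sum_power2_eq_zero_iff)
    then have pos: "0 < x\<^sup>2 + y\<^sup>2" by (smt (verit) zero_le_power2)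
    have "norm (x, y, 0::real) = sqrt (x\<^sup>2 + y\<^sup>2)" by (simp add: norm_Pair)
    then have "p = (x / sqrt (x\<^sup>2 + y\<^sup>2), y / sqrt (x\<^sup>2 + y\<^sup>2), 0)"
      using xy by (simp add: h_def r_def m_def)
    moreover have "x\<^sup>2 / (x\<^sup>2 + y\<^sup>2) + y\<^sup>2 / (x\<^sup>2 + y\<^sup>2) = 1"
      using nz by (metis add_divide_distrib divide_self)
    ultimately show "p \<in> ?C" using pos by (simp add: power_divide)
  next
    fix p assume "p \<in> ?C"
    then obtain x y where xy: "x\<^sup>2 + y\<^sup>2 = 1" "p = (x, y, 0)" by auto
    define a where "a = \<bar>x\<bar> + \<bar>y\<bar>"
    have a: "0 < a" using xy(1) by (auto simp: a_def) (smt (verit) zero_power2)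
    have "norm (x, y, 0::real) = 1" using xy by (simp add: norm_Pair)
    then have "r 1 p = a" by (simp add: r_def m_def xy(2) a_def)
    then have hp: "h 1 ((1 / a) *\<^sub>R p) = p" using a r_scale[of "1 / a" 1 p] by (simp add: h_def)
    have "(1 / a) *\<^sub>R p \<in> ?D"
      using a by (simp add: xy(2) abs_mult flip: add_divide_distrib) (simp add: a_def)
    from imageI[OF this, of "h 1"] show "p \<in> h 1 ` ?D" unfolding hp .
  qed
  also have "to_S3 ` ?C = standard_circle"
  proof -
    have "to_S3 (x, y, 0) = ((x, y, 0), 0)" if "x\<^sup>2 + y\<^sup>2 = 1" for x y
      using that by (simp add: to_S3_def norm_Pair)
    then show ?thesis unfolding standard_circle_def by (force simp: image_iff)
  qed
  finally show ?thesis by (simp only: is_unknot_def)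
qed

text \<open>
  Both the quadrilateral and the diamond consist of two graphs over the horizontal coordinate, an upper
  and a lower one, which meet over the end points only.
\<close>

lemma quadrilateral_is_unknot:
  fixes a b c d :: real
  assumes cd: "d < c"
  shows "is_unknot (to_S3 ` (closed_segment (-1, 0, a) (0, 0, c) \<union> closed_segment (0, 0, c) (1, 0, b)
    \<union> closed_segment (-1, 0, a) (0, 0, d) \<union> closed_segment (0, 0, d) (1, 0, b)))"
proof -
  define hh where "hh u = (if u then c else d) - (a + b) / 2" for u
  define f :: "bool \<Rightarrow> real \<Rightarrow> point"
    where "f u t = (t, 0, (a + b) / 2 + t * ((b - a) / 2) + (1 - \<bar>t\<bar>) * hh u)" for u t
  define g :: "bool \<Rightarrow> real \<Rightarrow> point"
    where "g u t = (t, if u then 1 - \<bar>t\<bar> else - (1 - \<bar>t\<bar>), 0)" for u t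
  define R where "R = 2 + \<bar>(b - a) / 2\<bar> + \<bar>hh True\<bar> + \<bar>hh False\<bar>"
  have Rh: "1 + \<bar>(b - a) / 2\<bar> + \<bar>hh u\<bar> \<le> R" "2 \<le> R" for u by (cases u; simp add: R_def)+
  have iso: "ambient_iso (\<Union>u\<in>UNIV. f u ` {-1..1}) (\<Union>u\<in>UNIV. g u ` {-1..1})"
  proof (rule strand_isotopy[where e = "(1, 0, 0)" and \<beta> = 0 and R = R and C = "(2 + (c - d)) / min 1 ((c - d) / 2)"])
    show "norm (f u t - f u t') \<le> R * \<bar>t - t'\<bar>" for u t t'
    proof -
      have "norm (f u t - f u t') \<le> \<bar>t - t'\<bar> + \<bar>(t - t') * ((b - a) / 2) + (\<bar>t'\<bar> - \<bar>t\<bar>) * hh u\<bar>"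
      proof -
        have "f u t - f u t' = (t - t', 0, (t - t') * ((b - a) / 2) + (\<bar>t'\<bar> - \<bar>t\<bar>) * hh u)"
          by (simp add: f_def field_simps)
        then show ?thesis using norm_triple_le[of "f u t - f u t'"] by (simp only: fst_conv snd_conv) simp
      qed
      also have "\<dots> \<le> \<bar>t - t'\<bar> + (\<bar>t - t'\<bar> * \<bar>(b - a) / 2\<bar> + \<bar>\<bar>t'\<bar> - \<bar>t\<bar>\<bar> * \<bar>hh u\<bar>)"
        by (intro add_left_mono order_trans[OF abs_triangle_ineq]) (simp add: abs_mult)
      also have "\<dots> \<le> \<bar>t - t'\<bar> + (\<bar>t - t'\<bar> * \<bar>(b - a) / 2\<bar> + \<bar>t - t'\<bar> * \<bar>hh u\<bar>)"
        by (intro add_left_mono mult_right_mono) auto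
      also have "\<dots> = (1 + \<bar>(b - a) / 2\<bar> + \<bar>hh u\<bar>) * \<bar>t - t'\<bar>" by (simp add: algebra_simps)
      also have "\<dots> \<le> R * \<bar>t - t'\<bar>" using Rh by (intro mult_right_mono) auto
      finally show ?thesis .
    qed
    show "norm (g u t - g u t') \<le> R * \<bar>t - t'\<bar>" for u t t'
    proof -
      have "norm (g u t - g u t') \<le> \<bar>t - t'\<bar> + \<bar>t - t'\<bar>"
        by (rule order_trans[OF norm_triple_le]) (auto simp: g_def)
      also have "\<dots> \<le> R * \<bar>t - t'\<bar>" using mult_right_mono[OF Rh(2), of "\<bar>t - t'\<bar>"] by simp
      finally show ?thesis .
    qed
    fix u v :: bool and t s :: real assume t: "t \<in> {-1..1}" and s: "s \<in> {0..1}"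
    show "norm ((g u t - f u t) - (g v t - f v t)) \<le> (2 + (c - d)) / min 1 ((c - d) / 2) *
       norm ((1 - s) *\<^sub>R (f u t - f v t) + s *\<^sub>R (g u t - g v t))"
    proof (cases "u = v")
      case True
      then show ?thesis using cd by (simp del: min_divide_distrib_right)
    next
      case False
      define w where "w = 1 - \<bar>t\<bar>"
      define \<mu> where "\<mu> = min 1 ((c - d) / 2)"
      have w: "0 \<le> w" using t by (auto simp: w_def)
      have \<mu>: "0 < \<mu>" using cd by (simp add: \<mu>_def)
      define \<sigma> :: real where "\<sigma> = (if u then 1 else -1)"
      have \<sigma>: "\<bar>\<sigma>\<bar> = 1" by (simp add: \<sigma>_def)
      have fd: "f u t - f v t = (0, 0, \<sigma> * (w * (c - d)))" and gd: "g u t - g v t = (0, \<sigma> * (2 * w), 0)"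
        using False by (cases u; cases v; simp add: f_def g_def hh_def \<sigma>_def w_def algebra_simps)+
      have "(g u t - f u t) - (g v t - f v t) = (g u t - g v t) - (f u t - f v t)" by simp
      also have "\<dots> = (0, \<sigma> * (2 * w), - \<sigma> * (w * (c - d)))" by (simp add: fd gd)
      finally have "norm ((g u t - f u t) - (g v t - f v t)) \<le> 2 * w + w * (c - d)"
        using norm_triple_le[of "(0, \<sigma> * (2 * w), - \<sigma> * (w * (c - d)))"] w cd by (simp add: abs_mult \<sigma>)
      also have "\<dots> = (2 + (c - d)) * w" by (simp add: algebra_simps)
      also have "\<dots> = (2 + (c - d)) / \<mu> * (\<mu> * w)" using \<mu> by simp
      also have "\<dots> \<le> (2 + (c - d)) / \<mu> * norm ((1 - s) *\<^sub>R (f u t - f v t) + s *\<^sub>R (g u t - g v t))"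
      proof (rule mult_left_mono)
        have e: "(1 - s) *\<^sub>R (f u t - f v t) + s *\<^sub>R (g u t - g v t) = (0, \<sigma> * (s * (2 * w)), \<sigma> * ((1 - s) * (w * (c - d))))"
          by (simp add: fd gd)
        have "norm (0::real, \<sigma> * (s * (2 * w)), \<sigma> * ((1 - s) * (w * (c - d)))) \<ge> \<bar>\<sigma> * (s * (2 * w))\<bar>"
          using norm_snd_le_norm[of "(0::real, \<sigma> * (s * (2 * w)), \<sigma> * ((1 - s) * (w * (c - d))))"]
            norm_fst_le_norm[of "(\<sigma> * (s * (2 * w)), \<sigma> * ((1 - s) * (w * (c - d))))"] by simp
        then have n1: "norm (0::real, \<sigma> * (s * (2 * w)), \<sigma> * ((1 - s) * (w * (c - d)))) \<ge> s * (2 * w)"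
          using w s by (simp add: abs_mult \<sigma>)
        have "norm (0::real, \<sigma> * (s * (2 * w)), \<sigma> * ((1 - s) * (w * (c - d)))) \<ge> \<bar>\<sigma> * ((1 - s) * (w * (c - d)))\<bar>"
          using norm_snd_le_norm[of "(0::real, \<sigma> * (s * (2 * w)), \<sigma> * ((1 - s) * (w * (c - d))))"]
            norm_snd_le_norm[of "(\<sigma> * (s * (2 * w)), \<sigma> * ((1 - s) * (w * (c - d))))"] by simp
        then have n2: "norm (0::real, \<sigma> * (s * (2 * w)), \<sigma> * ((1 - s) * (w * (c - d)))) \<ge> (1 - s) * (w * (c - d))"
          using w s cd by (simp add: abs_mult \<sigma>)
        show "\<mu> * w \<le> norm ((1 - s) *\<^sub>R (f u t - f v t) + s *\<^sub>R (g u t - g v t))"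
          unfolding e
        proof (cases "1 / 2 \<le> s")
          case True
          have "\<mu> * w \<le> 1 * w" using w by (intro mult_right_mono) (auto simp: \<mu>_def)
          also have "\<dots> \<le> (2 * s) * w" using w True by (intro mult_right_mono) auto
          finally show "\<mu> * w \<le> norm (0::real, \<sigma> * (s * (2 * w)), \<sigma> * ((1 - s) * (w * (c - d))))" using n1 by (simp add: mult_ac)
        next
          case False
          have "\<mu> \<le> (c - d) / 2" unfolding \<mu>_def by (rule min.cobounded2)
          then have "\<mu> * w \<le> (c - d) / 2 * w" using w by (intro mult_right_mono)
          also have "\<dots> \<le> ((c - d) * (1 - s)) * w"
            using w False cd mult_left_mono[of "1/2" "1 - s" "c - d"] by (intro mult_right_mono) auto
          finally show "\<mu> * w \<le> norm (0::real, \<sigma> * (s * (2 * w)), \<sigma> * ((1 - s) * (w * (c - d))))" using n2 by (simp add: mult_ac)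
        qed
        show "0 \<le> (2 + (c - d)) / \<mu>" using \<mu> cd by simp
      qed
      finally show ?thesis by (simp only: \<mu>_def)
    qed
  qed (use cd in \<open>auto simp: f_def g_def R_def simp del: min_divide_distrib_right\<close>)
  have f_left: "f u ` {-1..0} = closed_segment (-1, 0, a) (0, 0, if u then c else d)" for u
  proof -
    have "f u t = (1 - (t + 1)) *\<^sub>R (-1, 0, a) + (t + 1) *\<^sub>R (0, 0, if u then c else d)" if "t \<le> 0" for t
      using that by (simp add: f_def hh_def algebra_simps) (simp add: field_simps)?
    then have "f u ` {-1..0} = (\<lambda>t. (1 - (t + 1)) *\<^sub>R (-1, 0, a) + (t + 1) *\<^sub>R (0, 0, if u then c else d)) ` {-1..0}"
      by (intro image_cong) auto
    also have "\<dots> = (\<lambda>t. (1 - t) *\<^sub>R (-1, 0, a) + t *\<^sub>R (0, 0, if u then c else d)) ` ((\<lambda>t. t + 1) ` {-1..0})"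
      unfolding image_image ..
    also have "(\<lambda>t. t + 1) ` {-1..0} = {0..1::real}" by simp
    finally show ?thesis by (simp only: closed_segment_image_interval)
  qed
  have f_right: "f u ` {0..1} = closed_segment (0, 0, if u then c else d) (1, 0, b)" for u
  proof -
    have "f u t = (1 - t) *\<^sub>R (0, 0, if u then c else d) + t *\<^sub>R (1, 0, b)" if "t \<ge> 0" for t
      using that by (simp add: f_def hh_def algebra_simps) (simp add: field_simps)?
    then have "f u ` {0..1} = (\<lambda>t. (1 - t) *\<^sub>R (0, 0, if u then c else d) + t *\<^sub>R (1, 0, b)) ` {0..1}"
      by (intro image_cong) auto
    then show ?thesis by (simp only: closed_segment_image_interval)
  qed
  have "{-1..1} = {-1..0} \<union> {0..1::real}" by auto
  then have F: "(\<Union>u\<in>UNIV. f u ` {-1..1}) = closed_segment (-1, 0, a) (0, 0, c) \<union> closed_segment (0, 0, c) (1, 0, b)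
    \<union> closed_segment (-1, 0, a) (0, 0, d) \<union> closed_segment (0, 0, d) (1, 0, b)"
    by (simp only: image_Un f_left f_right UNIV_bool) auto
  have G: "(\<Union>u\<in>UNIV. g u ` {-1..1}) = {(x, y, 0) |x y. \<bar>x\<bar> + \<bar>y\<bar> = 1}"
  proof (intro set_eqI iffI)
    fix p assume "p \<in> (\<Union>u\<in>UNIV. g u ` {-1..1})"
    then show "p \<in> {(x, y, 0) |x y. \<bar>x\<bar> + \<bar>y\<bar> = 1}" by (auto simp: g_def)
  next
    fix p :: point assume "p \<in> {(x, y, 0) |x y. \<bar>x\<bar> + \<bar>y\<bar> = 1}"
    then obtain x y where xy: "p = (x, y, 0)" "\<bar>x\<bar> + \<bar>y\<bar> = 1" by auto
    then have "p = g (0 \<le> y) x" "x \<in> {-1..1}" by (auto simp: g_def)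
    then show "p \<in> (\<Union>u\<in>UNIV. g u ` {-1..1})" by blast
  qed
  show ?thesis
    using ambient_isotopic_S3_trans[OF iso] diamond_is_unknot unfolding is_unknot_def F G by blast
qed

section \<open>Reidemeister moves for braid words with blanks\<close>

text \<open>
  The letter \<open>None\<close> is a layer of height 1 without a crossing. Blanks keep all other
  crossings at their heights when strands are deleted or crossings are removed.
\<close>

type_synonym padded_word = "crossing option list"

definition move :: "crossing option \<Rightarrow> nat \<Rightarrow> nat" where
  "move x p = (case x of None \<Rightarrow> p | Some (i, f) \<Rightarrow> Transposition.transpose i (i + 1) p)"

definition moves :: "padded_word \<Rightarrow> nat \<Rightarrow> nat" where
  "moves W p = fold move W p"

definition halfway :: "crossing option \<Rightarrow> nat \<Rightarrow> real \<times> real" where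
  "halfway x p = (case x of None \<Rightarrow> (real p, 0) | Some (i, f) \<Rightarrow>
     if p = i then (real i + 1/2, if f then - 1/2 else 1/2)
     else if p = i + 1 then (real i + 1/2, if f then 1/2 else - 1/2)
     else (real p, 0))"

text \<open>
  The horizontal position, at \<open>k\<close> half steps below the top of the word, of the strand that
  enters in position \<open>p\<close>.
\<close>

fun place :: "padded_word \<Rightarrow> nat \<Rightarrow> nat \<Rightarrow> real \<times> real" where
  "place W p 0 = (real p, 0)"
| "place [] p (Suc k) = (real p, 0)"
| "place (x # W) p (Suc 0) = halfway x p"
| "place (x # W) p (Suc (Suc k)) = place W (move x p) k"

abbreviation blanks :: "nat \<Rightarrow> padded_word" where
  "blanks m \<equiv> replicate m None"

lemma moves_simps [simp]: "moves [] p = p" "moves (x # W) p = moves W (move x p)"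
  "moves (U @ V) p = moves V (moves U p)"
  by (simp_all add: moves_def)

lemma move_None [simp]: "move None p = p" and halfway_None [simp]: "halfway None p = (real p, 0)"
  by (simp_all add: move_def halfway_def)

lemma move_Some: "move (Some (i, f)) p = (if p = i then i + 1 else if p = i + 1 then i else p)"
  by (simp add: move_def Transposition.transpose_def)

lemma halfway_left [simp]: "halfway (Some (i, f)) i = (real i + 1/2, if f then - 1/2 else 1/2)"
  and halfway_right [simp]: "halfway (Some (i, f)) (Suc i) = (real i + 1/2, if f then 1/2 else - 1/2)"
  by (simp_all add: halfway_def)

lemma moves_blanks [simp]: "moves (blanks m) p = p"
  by (induction m) auto

lemma move_inj: "move x p = move x p' \<longleftrightarrow> p = p'"
  by (cases x) (auto simp: move_def dest: Transposition.transpose_eq_imp_eq)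

lemma moves_inj: "moves W p = moves W p' \<longleftrightarrow> p = p'"
  by (induction W arbitrary: p p') (auto simp: move_inj)

lemma place_blanks [simp]: "place (blanks m) p k = (real p, 0)"
proof (induction m arbitrary: k)
  case 0 show ?case by (cases k) auto
next
  case (Suc m)
  show ?case
  proof (cases k)
    case (Suc k') then show ?thesis by (cases k') (auto simp: Suc.IH)
  qed simp
qed

lemma place_append: "place (U @ V) p k =
  (if k < 2 * length U then place U p k else place V (moves U p) (k - 2 * length U))"
proof (induction U arbitrary: p k)
  case (Cons x U)
  show ?case
  proof (cases k)
    case (Suc k') then show ?thesis by (cases k') (auto simp: Cons.IH)
  qed simp
qed simp

lemma place_blanks_append: "place (blanks m @ V) p k = (if k < 2 * m then (real p, 0) else place V p (k - 2 * m))"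
  by (simp add: place_append)

lemma place_Cons: "place (x # V) p k =
  (if k = 0 then (real p, 0) else if k = 1 then halfway x p else place V (move x p) (k - 2))"
proof (cases k)
  case (Suc k') then show ?thesis by (cases k') auto
qed simp

definition bounded_word :: "padded_word \<Rightarrow> bool" where
  "bounded_word W \<longleftrightarrow> (\<forall>i f. Some (i, f) \<in> set W \<longrightarrow> 1 \<le> i \<and> i \<le> 3)"

lemma bounded_word_simps [simp]: "bounded_word []" "bounded_word (None # W) = bounded_word W"
  "bounded_word (Some (i, f) # W) \<longleftrightarrow> 1 \<le> i \<and> i \<le> 3 \<and> bounded_word W"
  "bounded_word (U @ V) \<longleftrightarrow> bounded_word U \<and> bounded_word V" "bounded_word (blanks m)"
  by (auto simp: bounded_word_def)

lemma moves_image: "bounded_word W \<Longrightarrow> moves W ` {1..4} = {1..4}"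
proof (induction W)
  case (Cons x W)
  have "move x p \<in> {1..4}" if "p \<in> {1..4}" for p
  proof (cases x)
    case (Some y)
    obtain i f where "y = (i, f)" by force
    then show ?thesis using Cons.prems that by (simp add: Some move_Some)
  qed (use that in simp)
  then have "move x ` {1..4} = {1..4}"
    by (intro endo_inj_surj) (auto simp: inj_on_def move_inj)
  moreover have "bounded_word W" using Cons.prems by (simp add: bounded_word_def)
  moreover have "moves (x # W) ` {1..4} = moves W ` (move x ` {1..4})" by (simp add: image_image)
  ultimately show ?case using Cons.IH by simp
qed simp

text \<open>
  The strands follow the word \<open>W\<close> from the initial positions \<open>q\<close>, except that
  \<open>\<alpha>\<close> gives the positions of their end points. Since \<open>place\<close> ignores
  where a strand starts, the word is read from level 0 on for all strands.
\<close>

definition normal_form :: "(nat \<Rightarrow> nat) \<Rightarrow> (nat \<Rightarrow> nat \<Rightarrow> real \<times> real) \<Rightarrow> padded_word \<Rightarrow> (nat \<Rightarrow> nat) \<Rightarrow> config" where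
  "normal_form n \<alpha> W q j k = (if k = start j \<or> k = n j then \<alpha> j k else place W (q j) k)"

text \<open>
  Validity of the first configuration is a premise here, rather than an assumption of each move, so that
  it is inherited along a sequence of moves.
\<close>

definition leads_to :: "(nat \<Rightarrow> nat) \<Rightarrow> nat set \<Rightarrow> config \<Rightarrow> config \<Rightarrow> bool" where
  "leads_to n J c c' \<longleftrightarrow> (compatible n J c c \<longrightarrow> (compatible n J)\<^sup>*\<^sup>* c c')"

lemma compatible_steps_valid:
  "(compatible n J)\<^sup>*\<^sup>* c c' \<Longrightarrow> compatible n J c c \<Longrightarrow> compatible n J c' c'"
  by (induction rule: rtranclp_induct) (auto dest: compatible_refl_right)

lemma leads_to_refl: "leads_to n J c c"
  by (simp add: leads_to_def)

lemma leads_to_trans [trans]: "leads_to n J c d \<Longrightarrow> leads_to n J d e \<Longrightarrow> leads_to n J c e"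
  unfolding leads_to_def using compatible_steps_valid by (meson rtranclp_trans)

lemma start_le: "start j \<le> 2"
  by (simp add: start_def)

lemma ordered_at_frontI:
  assumes "\<epsilon> * fst (gap c a b k) + snd (gap c a b k) > 0" "\<epsilon> * fst (gap c' a b k) + snd (gap c' a b k) > 0"
  shows "ordered_at n c c' (\<epsilon>, 1) a b k"
  using assms by (simp add: ordered_at_def inner_prod_def)

text \<open>
  The common pattern of the moves below. Only the strands \<open>A\<close> and \<open>B\<close> move,
  \<open>A\<close> in front of \<open>B\<close>, and both stay in the strip over \<open>[i, i +
  1]\<close>. All other strands are at rest outside a wider strip, hence they form a layer between
  \<open>A\<close> and \<open>B\<close>.
\<close>

lemma two_strand_move:
  fixes i :: real
  assumes J: "finite J" and valid: "compatible n J c c"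
    and AB: "A \<in> J" "B \<in> J" "A \<noteq> B"
    and eq: "\<And>j k. j \<in> J \<Longrightarrow> start j \<le> k \<Longrightarrow> k \<le> n j \<Longrightarrow> j \<notin> {A, B} \<or> k \<notin> I \<Longrightarrow> c' j k = c j k"
    and inner: "\<And>j k. j \<in> {A, B} \<Longrightarrow> k \<in> I \<Longrightarrow> k \<noteq> start j \<and> k \<noteq> n j"
    and front: "\<And>k. alive n A B k \<Longrightarrow> k \<in> I \<or> Suc k \<in> I \<Longrightarrow> in_front n c A B k \<and> in_front n c' A B k"
    and box: "\<And>j k \<kappa>. j \<in> {A, B} \<Longrightarrow> start j \<le> k \<Longrightarrow> k < n j \<Longrightarrow> k \<in> I \<or> Suc k \<in> I \<Longrightarrow> \<kappa> \<in> {k, Suc k} \<Longrightarrow>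
      i \<le> fst (c j \<kappa>) \<and> fst (c j \<kappa>) \<le> i + 1 \<and> \<bar>snd (c j \<kappa>)\<bar> \<le> 1/2 \<and>
      i \<le> fst (c' j \<kappa>) \<and> fst (c' j \<kappa>) \<le> i + 1 \<and> \<bar>snd (c' j \<kappa>)\<bar> \<le> 1/2"
    and others: "\<And>j m k. j \<in> {A, B} \<Longrightarrow> m \<in> J \<Longrightarrow> m \<notin> {A, B} \<Longrightarrow> alive n j m k \<Longrightarrow> k \<in> I \<or> Suc k \<in> I \<Longrightarrow>
      (\<forall>\<kappa>\<in>{k, Suc k}. snd (c m \<kappa>) = 0 \<and> fst (c m \<kappa>) \<le> i - 1) \<or>
      (\<forall>\<kappa>\<in>{k, Suc k}. snd (c m \<kappa>) = 0 \<and> fst (c m \<kappa>) \<ge> i + 2)"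
  shows "(compatible n J)\<^sup>*\<^sup>* c c'"
\<comment> \<open>Three layers, with all strands other than \<open>A\<close> and \<open>B\<close> in the middle one.\<close>
proof (rule layered_isotopy[where \<delta> = "\<lambda>j. if j = A then -1 else if j = B then 1 else 0" and I = I])
  let ?\<delta> = "\<lambda>j. if j = A then -1 else if j = B then 1 else (0::real)"
  have eq_gap: "gap c' a b \<kappa> = gap c a b \<kappa>"
    if "a \<in> J" "b \<in> J" "alive n a b k" "\<kappa> \<in> {k, Suc k}" "a \<notin> {A, B} \<and> b \<notin> {A, B} \<or> \<kappa> \<notin> I" for a b k \<kappa>
    using that eq[of a \<kappa>] eq[of b \<kappa>] by (auto simp: alive_def gap_def)
  have eq_ord: "ordered_at n c c' l a b \<kappa> = ordered_at n c c l a b \<kappa>"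
    if "a \<in> J" "b \<in> J" "alive n a b k" "\<kappa> \<in> {k, Suc k}" "a \<notin> {A, B} \<and> b \<notin> {A, B} \<or> \<kappa> \<notin> I" for a b k \<kappa> l
    unfolding ordered_at_def eq_gap[OF that] by blast
  have other_front: "\<exists>\<epsilon>. \<forall>\<kappa>\<in>{k, Suc k}. (\<forall>d\<in>{c, c'}. \<epsilon> * fst (gap d j m \<kappa>) + snd (gap d j m \<kappa>) > 0)
      \<and> (\<forall>d\<in>{c, c'}. (- \<epsilon>) * fst (gap d m j \<kappa>) + snd (gap d m j \<kappa>) > 0)"
    if jm: "j \<in> {A, B}" "m \<in> J" "m \<notin> {A, B}" "alive n j m k" "k \<in> I \<or> Suc k \<in> I" for j m k
  proof -
    have sk: "start j \<le> k" "k < n j" using jm(4) by (auto simp: alive_def)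
    have same: "c' m \<kappa> = c m \<kappa>" if "\<kappa> \<in> {k, Suc k}" for \<kappa>
      using eq[OF jm(2), of \<kappa>] jm(3,4) that by (auto simp: alive_def)
    from others[OF jm] show ?thesis
    proof
      assume L: "\<forall>\<kappa>\<in>{k, Suc k}. snd (c m \<kappa>) = 0 \<and> fst (c m \<kappa>) \<le> i - 1"
      show ?thesis
      \<comment> \<open>The other strand is to the left of the strip, where a slope of 4 dominates the depths of at most 1/2.\<close>
      proof (intro exI[of _ "- 4"] ballI conjI)
        fix \<kappa> d assume \<kappa>: "\<kappa> \<in> {k, Suc k}" and d: "d \<in> {c, c'}"
        have "snd (d m \<kappa>) = 0" "fst (d m \<kappa>) \<le> i - 1" using L \<kappa> d same by auto
        moreover have "i \<le> fst (d j \<kappa>)" "\<bar>snd (d j \<kappa>)\<bar> \<le> 1/2" using box[OF jm(1) sk jm(5) \<kappa>] d by auto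
        ultimately show "- 4 * fst (gap d j m \<kappa>) + snd (gap d j m \<kappa>) > 0"
          "- (- 4) * fst (gap d m j \<kappa>) + snd (gap d m j \<kappa>) > 0" by (auto simp: gap_def)
      qed
    next
      assume L: "\<forall>\<kappa>\<in>{k, Suc k}. snd (c m \<kappa>) = 0 \<and> fst (c m \<kappa>) \<ge> i + 2"
      show ?thesis
      proof (intro exI[of _ 4] ballI conjI)
        fix \<kappa> d assume \<kappa>: "\<kappa> \<in> {k, Suc k}" and d: "d \<in> {c, c'}"
        have "snd (d m \<kappa>) = 0" "fst (d m \<kappa>) \<ge> i + 2" using L \<kappa> d same by auto
        moreover have "fst (d j \<kappa>) \<le> i + 1" "\<bar>snd (d j \<kappa>)\<bar> \<le> 1/2" using box[OF jm(1) sk jm(5) \<kappa>] d by auto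
        ultimately show "4 * fst (gap d j m \<kappa>) + snd (gap d j m \<kappa>) > 0"
          "- 4 * fst (gap d m j \<kappa>) + snd (gap d m j \<kappa>) > 0" by (auto simp: gap_def)
      qed
    qed
  qed
  have key: "(\<exists>\<epsilon>. \<forall>\<kappa>\<in>{k, Suc k}. ordered_at n c c (\<epsilon>, 1) a b \<kappa>) \<and> (\<exists>\<epsilon>. \<forall>\<kappa>\<in>{k, Suc k}. ordered_at n c' c' (\<epsilon>, 1) a b \<kappa>)
      \<and> (\<forall>\<kappa>\<in>{k, Suc k}. \<kappa> \<notin> I \<longrightarrow> (\<exists>\<epsilon>. ordered_at n c c' (\<epsilon>, 1) a b \<kappa>))"
    if ab: "a \<in> J" "b \<in> J" "?\<delta> a < ?\<delta> b" "alive n a b k" "k \<in> I \<or> Suc k \<in> I" for a b k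
  proof -
    consider "a = A" "b = B" | "a = A" "b \<notin> {A, B}" | "b = B" "a \<notin> {A, B}"
      using ab(3) AB(3) by (auto split: if_splits)
    then show ?thesis
    proof cases
      case 1
      have f: "in_front n c a b k" "in_front n c' a b k" using front[of k] ab(4,5) 1 by auto
      moreover have "\<exists>\<epsilon>. ordered_at n c c' (\<epsilon>, 1) a b \<kappa>" if "\<kappa> \<in> {k, Suc k}" "\<kappa> \<notin> I" for \<kappa>
        using f(1) that eq_ord[OF ab(1,2,4) that(1)] by (auto simp: in_front_def)
      ultimately show ?thesis by (auto simp: in_front_def)
    next
      case 2
      from other_front[of a b k] obtain \<epsilon> where \<epsilon>: "\<And>d \<kappa>. d \<in> {c, c'} \<Longrightarrow> \<kappa> \<in> {k, Suc k} \<Longrightarrow>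
        \<epsilon> * fst (gap d a b \<kappa>) + snd (gap d a b \<kappa>) > 0" using 2 ab by blast
      then have "ordered_at n d d' (\<epsilon>, 1) a b \<kappa>" if "d \<in> {c, c'}" "d' \<in> {c, c'}" "\<kappa> \<in> {k, Suc k}" for d d' \<kappa>
        using that by (intro ordered_at_frontI) auto
      then show ?thesis by blast
    next
      case 3
      from other_front[of b a k] obtain \<epsilon> where \<epsilon>: "\<And>d \<kappa>. d \<in> {c, c'} \<Longrightarrow> \<kappa> \<in> {k, Suc k} \<Longrightarrow>
        (- \<epsilon>) * fst (gap d a b \<kappa>) + snd (gap d a b \<kappa>) > 0" using 3 ab alive_commute by blast
      then have "ordered_at n d d' (- \<epsilon>, 1) a b \<kappa>" if "d \<in> {c, c'}" "d' \<in> {c, c'}" "\<kappa> \<in> {k, Suc k}" for d d' \<kappa>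
        using that by (intro ordered_at_frontI) auto
      then show ?thesis by blast
    qed
  qed
  show "finite J" by (rule J)
  show "separated n c c' a b k"
    if ab: "a \<in> J" "b \<in> J" "a \<noteq> b" "alive n a b k" "?\<delta> a = ?\<delta> b \<or> k \<notin> I \<and> Suc k \<notin> I" for a b k
  proof -
    have s: "separated n c c a b k" using compatibleD[OF valid ab(1-4)] .
    have "a \<notin> {A, B} \<and> b \<notin> {A, B} \<or> \<kappa> \<notin> I" if "\<kappa> \<in> {k, Suc k}" for \<kappa>
      using that ab(3,5) AB(3) by (auto split: if_splits)
    then show ?thesis using s eq_ord[OF ab(1,2,4)] unfolding separated_def by blast
  qed
  show "in_front n c a b k \<and> in_front n c' a b k"
    if ab: "a \<in> J" "b \<in> J" "?\<delta> a < ?\<delta> b" "alive n a b k" "k \<in> I \<or> Suc k \<in> I" for a b k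
    using key[OF ab] unfolding in_front_def by blast
  show "\<exists>\<epsilon>. ordered_at n c c' (\<epsilon>, 1) a b \<kappa>"
    if ab: "a \<in> J" "b \<in> J" "?\<delta> a < ?\<delta> b" "alive n a b k" "k \<in> I \<or> Suc k \<in> I" "\<kappa> \<in> {k, Suc k}" "\<kappa> \<notin> I" for a b k \<kappa>
    using key[OF ab(1-5)] ab(6,7) by blast
  show "?\<delta> a = ?\<delta> b" if "a \<in> J" "b \<in> J" "joined n a b k" "k \<in> I" for a b k
    using that inner[of a k] inner[of b k] by (auto simp: joined_def split: if_splits)
qed

lemma four_Suc: "Suc (Suc (Suc (Suc k))) = k + 4"
  by simp

text \<open>
  The second Reidemeister move, with a blank region of any length between the two crossings. The strand
  that passes in front is the same in both crossings, so the two strands are in different layers.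
\<close>

lemma cancel_crossings:
  assumes J: "finite J" and q: "inj_on q J"
    and AB: "A \<in> J" "B \<in> J" "moves U (q A) = i" "moves U (q B) = i + 1"
    and U: "2 \<le> length U" and n: "\<And>j. j \<in> J \<Longrightarrow> 2 * length U + 2 * m + 4 < n j"
  shows "leads_to n J (normal_form n \<alpha> (U @ [Some (i, f)] @ blanks m @ [Some (i, \<not> f)] @ V) q)
    (normal_form n \<alpha> (U @ blanks (m + 2) @ V) q)"
proof -
  define w where "w = U @ [Some (i, f)] @ blanks m @ [Some (i, \<not> f)] @ V"
  define w' where "w' = U @ blanks (m + 2) @ V"
  have "leads_to n J (normal_form n \<alpha> w q) (normal_form n \<alpha> w' q)"
  unfolding leads_to_def
  proof
  let ?c = "normal_form n \<alpha> w q" and ?c' = "normal_form n \<alpha> w' q"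
  define L where "L = 2 * length U"
  let ?I = "{L<..<L + 2 * m + 4}"
  \<comment> \<open>The sign \<open>f\<close> decides which of the two strands is in front.\<close>
  let ?A = "if f then A else B" and ?B = "if f then B else A"
  assume valid: "compatible n J ?c ?c"
  have diff: "A \<noteq> B" using AB by auto
  have L4: "4 \<le> L" using U by (simp add: L_def)
  have nL: "L + 2 * m + 4 < n j" if "j \<in> J" for j using n[OF that] by (simp add: L_def)
  have W': "place w' p k = (if k < L then place U p k else if k < L + 2 * m + 4 then (real (moves U p), 0)
      else place V (moves U p) (k - (L + 2 * m + 4)))" for p k
  proof -
    have "k - 2 * length U - 2 * (m + 2) = k - (2 * length U + 2 * m + 4)"
      "\<not> k < 2 * length U \<Longrightarrow> (k - 2 * length U < 2 * (m + 2)) = (k < 2 * length U + 2 * m + 4)" by auto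
    then show ?thesis unfolding w'_def place_append[of U] place_blanks_append[of "m + 2"] moves_blanks L_def
      by (cases "k < 2 * length U") (simp_all only: if_True if_False simp_thms)
  qed
  have W: "place w p k = place w' p k" if "moves U p \<noteq> i" "moves U p \<noteq> i + 1" for p k
    unfolding W' using that
    by (auto simp: w_def place_append place_Cons halfway_def move_Some place_blanks_append L_def four_Suc)
  have W2: "place w p k = (if k < L then place U p k else if k = L then (real (moves U p), 0)
      else if k = L + 1 \<or> k = L + 2 * m + 3 then halfway (Some (i, f)) (moves U p)
      else if k < L + 2 * m + 3 then (real (2 * i + 1 - moves U p), 0)
      else place V (moves U p) (k - (L + 2 * m + 4)))"
    if "moves U p = i \<or> moves U p = i + 1" for p k
    using that
    by (auto simp: w_def place_append place_Cons halfway_def move_Some place_blanks_append L_def four_Suc)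
  have cL: "?c j k = place w (q j) k" "?c' j k = place w' (q j) k" if "j \<in> J" "L \<le> k" "k \<le> L + 2 * m + 4" for j k
    using that L4 start_le[of j] nL[OF that(1)] by (auto simp: normal_form_def)
  have A: "?c A k = (if k = L then (real i, 0) else if k = L + 1 \<or> k = L + 2 * m + 3 then halfway (Some (i, f)) i
      else if k < L + 2 * m + 3 then (real i + 1, 0) else (real i, 0))"
    and B: "?c B k = (if k = L then (real i + 1, 0) else if k = L + 1 \<or> k = L + 2 * m + 3 then halfway (Some (i, f)) (i + 1)
      else if k < L + 2 * m + 3 then (real i, 0) else (real i + 1, 0))"
    and A': "?c' A k = (real i, 0)" and B': "?c' B k = (real i + 1, 0)"
    if "L \<le> k" "k \<le> L + 2 * m + 4" for k
    using that AB by (auto simp: cL W' W2)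
  have layer: "L \<le> k \<and> Suc k \<le> L + 2 * m + 4" if "k \<in> ?I \<or> Suc k \<in> ?I" for k using that by auto
  show "(compatible n J)\<^sup>*\<^sup>* ?c ?c'"
  proof (rule two_strand_move[where A = ?A and B = ?B and I = ?I and i = "real i"])
    show "?c' j k = ?c j k" if "j \<in> J" "start j \<le> k" "k \<le> n j" "j \<notin> {?A, ?B} \<or> k \<notin> ?I" for j k
    proof (cases "j \<in> {A, B}")
      case True
      then have "k \<le> L \<or> L + 2 * m + 4 \<le> k" using that(4) by (auto split: if_splits)
      then show ?thesis using True AB unfolding normal_form_def by (auto simp: W' W2)
    next
      case False
      then have "moves U (q j) \<noteq> i" "moves U (q j) \<noteq> i + 1"
        using AB q that(1) by (metis inj_on_def insertI1 insertI2 moves_inj)+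
      from W[OF this] show ?thesis unfolding normal_form_def by presburger
    qed
    show "k \<noteq> start j \<and> k \<noteq> n j" if "j \<in> {?A, ?B}" "k \<in> ?I" for j k
      using that L4 start_le[of j] nL[of j] AB by (auto split: if_splits)
    show "in_front n ?c ?A ?B k \<and> in_front n ?c' ?A ?B k" if "alive n ?A ?B k" "k \<in> ?I \<or> Suc k \<in> ?I" for k
    proof
      note k = layer[OF that(2)]
      show "in_front n ?c' ?A ?B k"
        unfolding in_front_def using k
        by (intro exI[of _ "if f then 1 else -1"] conjI ordered_at_frontI) (auto simp: gap_def A' B')
      have g: "gap ?c A B \<kappa> = (if \<kappa> = L \<or> \<kappa> = L + 2 * m + 4 then (1, 0)
          else if \<kappa> = L + 1 \<or> \<kappa> = L + 2 * m + 3 then (0, if f then 1 else -1) else (- 1, 0))"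
        if "L \<le> \<kappa>" "\<kappa> \<le> L + 2 * m + 4" for \<kappa> using that by (auto simp: gap_def A B)
      have "gap ?c ?A ?B \<kappa> = (if f then gap ?c A B \<kappa> else - gap ?c A B \<kappa>)" for \<kappa>
        by (simp add: gap_def)
      note g2 = this
      have "ordered_at n ?c ?c ((if f then 1 else -1) * (if k = L \<or> k = L + 2 * m + 3 then 1 else -1), 1) ?A ?B \<kappa>"
        if "\<kappa> \<in> {k, Suc k}" for \<kappa>
      proof (rule ordered_at_frontI)
        have \<kappa>: "L \<le> \<kappa>" "\<kappa> \<le> L + 2 * m + 4" using that k by auto
        have "\<kappa> = k \<or> \<kappa> = Suc k" using that by auto
        then show "(if f then 1 else -1) * (if k = L \<or> k = L + 2 * m + 3 then 1 else -1) * fst (gap ?c ?A ?B \<kappa>) + snd (gap ?c ?A ?B \<kappa>) > 0"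
          "(if f then 1 else -1) * (if k = L \<or> k = L + 2 * m + 3 then 1 else -1) * fst (gap ?c ?A ?B \<kappa>) + snd (gap ?c ?A ?B \<kappa>) > 0"
          unfolding g2 g[OF \<kappa>] using k by (cases f; auto)+
      qed
      then show "in_front n ?c ?A ?B k" unfolding in_front_def by blast
    qed
    show "real i \<le> fst (?c j \<kappa>) \<and> fst (?c j \<kappa>) \<le> real i + 1 \<and> \<bar>snd (?c j \<kappa>)\<bar> \<le> 1/2 \<and>
      real i \<le> fst (?c' j \<kappa>) \<and> fst (?c' j \<kappa>) \<le> real i + 1 \<and> \<bar>snd (?c' j \<kappa>)\<bar> \<le> 1/2"
      if "j \<in> {?A, ?B}" "k \<in> ?I \<or> Suc k \<in> ?I" "\<kappa> \<in> {k, Suc k}" for j k \<kappa>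
    proof -
      have k: "L \<le> \<kappa>" "\<kappa> \<le> L + 2 * m + 4" using layer[OF that(2)] that(3) by auto
      have "j = A \<or> j = B" using that(1) by (auto split: if_splits)
      then show ?thesis using A[OF k] B[OF k] A'[OF k] B'[OF k] by auto
    qed
    show "(\<forall>\<kappa>\<in>{k, Suc k}. snd (?c r \<kappa>) = 0 \<and> fst (?c r \<kappa>) \<le> real i - 1) \<or>
      (\<forall>\<kappa>\<in>{k, Suc k}. snd (?c r \<kappa>) = 0 \<and> fst (?c r \<kappa>) \<ge> real i + 2)"
      if "r \<in> J" "r \<notin> {?A, ?B}" "k \<in> ?I \<or> Suc k \<in> ?I" for r k
    proof -
      have "r \<notin> {A, B}" using that(2) by (auto split: if_splits)
      then have ne: "moves U (q r) \<noteq> i" "moves U (q r) \<noteq> i + 1"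
        using AB q that(1) by (metis inj_on_def insertI1 insertI2 moves_inj)+
      have "?c r \<kappa> = (real (moves U (q r)), 0)" if "\<kappa> \<in> {k, Suc k}" for \<kappa>
      proof -
        have "L \<le> \<kappa>" "\<kappa> \<le> L + 2 * m + 4" using layer \<open>k \<in> ?I \<or> Suc k \<in> ?I\<close> that by auto
        then show ?thesis using cL(1)[OF \<open>r \<in> J\<close>, of \<kappa>] unfolding W[OF ne] W' by auto
      qed
      moreover have "moves U (q r) < i \<or> i + 2 \<le> moves U (q r)" using ne by linarith
      ultimately show ?thesis by auto
    qed
  qed (use J valid AB diff in auto)
  qed
  then show ?thesis by (simp only: w_def w'_def)
qed

text \<open>Words that reduce to blanks by removing pairs of mutually inverse letters, innermost pairs first.\<close>

inductive trivial_word :: "padded_word \<Rightarrow> bool" where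
  nil: "trivial_word []"
| blank: "trivial_word [None]"
| append: "trivial_word U \<Longrightarrow> trivial_word V \<Longrightarrow> trivial_word (U @ V)"
| cancel: "1 \<le> i \<Longrightarrow> i \<le> 3 \<Longrightarrow> trivial_word W \<Longrightarrow> trivial_word (Some (i, f) # W @ [Some (i, \<not> f)])"

lemma remove_trivial_word:
  assumes "trivial_word W" and J: "finite J" and q: "inj_on q J" "q ` J = {1..4}"
    and "bounded_word U" "2 \<le> length U" "\<And>j. j \<in> J \<Longrightarrow> 2 * length U + 2 * length W < n j"
  shows "leads_to n J (normal_form n \<alpha> (U @ W @ V) q) (normal_form n \<alpha> (U @ blanks (length W) @ V) q)"
  using assms(1,5-)
proof (induction W arbitrary: U V)
  case nil
  then show ?case by (simp add: leads_to_refl)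
next
  case blank
  then show ?case by (simp add: leads_to_refl)
next
  case (append W1 W2)
  have n12: "2 * length U + 2 * length W1 < n j" "2 * length U + 2 * length W1 + 2 * length W2 < n j" if "j \<in> J" for j
    using append.prems(3)[OF that] by simp_all
  have "leads_to n J (normal_form n \<alpha> (U @ W1 @ (W2 @ V)) q) (normal_form n \<alpha> (U @ blanks (length W1) @ (W2 @ V)) q)"
    using append.prems(1,2) n12 by (intro append.IH) (auto simp: algebra_simps)
  moreover have "leads_to n J (normal_form n \<alpha> ((U @ blanks (length W1)) @ W2 @ V) q)
     (normal_form n \<alpha> ((U @ blanks (length W1)) @ blanks (length W2) @ V) q)"
    using append.prems(1,2) n12 by (intro append.IH) (auto simp: algebra_simps)
  ultimately show ?case using leads_to_trans unfolding append_assoc length_append replicate_add by blast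
next
  case (cancel i W f)
  have n1: "2 * length U + 2 * length W + 4 < n j" if "j \<in> J" for j
    using cancel.prems(3)[OF that] by simp
  have 1: "leads_to n J (normal_form n \<alpha> ((U @ [Some (i, f)]) @ W @ ([Some (i, \<not> f)] @ V)) q)
     (normal_form n \<alpha> ((U @ [Some (i, f)]) @ blanks (length W) @ ([Some (i, \<not> f)] @ V)) q)"
  proof (rule cancel.IH)
    show "2 * length (U @ [Some (i, f)]) + 2 * length W < n j" if "j \<in> J" for j using n1[OF that] by simp
  qed (use cancel.hyps cancel.prems(1,2) in auto)
  have "i \<in> moves U ` q ` J" "i + 1 \<in> moves U ` q ` J"
    unfolding q(2) moves_image[OF cancel.prems(1)] using cancel.hyps by auto
  then obtain A B where AB: "A \<in> J" "B \<in> J" "moves U (q A) = i" "moves U (q B) = i + 1" by auto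
  have 2: "leads_to n J (normal_form n \<alpha> (U @ [Some (i, f)] @ blanks (length W) @ [Some (i, \<not> f)] @ V) q)
     (normal_form n \<alpha> (U @ blanks (length W + 2) @ V) q)"
    by (rule cancel_crossings[OF J q(1) AB cancel.prems(2)]) (use n1 in auto)
  have "leads_to n J (normal_form n \<alpha> (U @ [Some (i, f)] @ W @ [Some (i, \<not> f)] @ V) q)
     (normal_form n \<alpha> (U @ blanks (length W + 2) @ V) q)"
    using leads_to_trans[OF 1[unfolded append_assoc] 2] .
  then show ?case by simp
qed

text \<open>
  The first Reidemeister move at the lower vertex: the two strands that leave it exchange their initial
  positions instead of crossing. All other strands start at the upper vertex. Everything between the
  vertex and the crossing has to be blank.
\<close>

lemma untwist_cap:
  assumes J: "finite J" and q: "inj_on q J"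
    and AB: "A \<in> J" "B \<in> J" "q A = i" "q B = i + 1" "start A = 2" "start B = 2"
    and others: "\<And>j. j \<in> J \<Longrightarrow> j \<notin> {A, B} \<Longrightarrow> start j = 0"
    and m: "2 \<le> m" and n: "\<And>j. j \<in> J \<Longrightarrow> 2 * m + 2 < n j"
    and \<alpha>: "\<alpha> A 2 = (x, 0)" "\<alpha> B 2 = (x, 0)" "real i \<le> x" "x \<le> real i + 1"
  shows "leads_to n J (normal_form n \<alpha> (blanks m @ Some (i, f) # V) q)
    (normal_form n \<alpha> (blanks (m + 1) @ V) (Transposition.transpose i (i + 1) \<circ> q))"
proof -
  define w where "w = blanks m @ Some (i, f) # V"
  define w' where "w' = blanks (m + 1) @ V"
  define q' where "q' = Transposition.transpose i (i + 1) \<circ> q"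
  have "leads_to n J (normal_form n \<alpha> w q) (normal_form n \<alpha> w' q')"
  unfolding leads_to_def
  proof
  let ?c = "normal_form n \<alpha> w q" and ?c' = "normal_form n \<alpha> w' q'"
  let ?I = "{2<..<2 * m + 2}"
  let ?A = "if f then A else B" and ?B = "if f then B else A"
  assume valid: "compatible n J ?c ?c"
  have diff: "A \<noteq> B" using AB by auto
  have qA: "q' A = i + 1" "q' B = i" using AB by (auto simp: q'_def)
  have W': "place w' p k = (if k < 2 * m + 2 then (real p, 0) else place V p (k - (2 * m + 2)))" for p k
    unfolding w'_def place_blanks_append by auto
  have W: "place w p k = (if k \<le> 2 * m then (real p, 0) else if k = 2 * m + 1 then halfway (Some (i, f)) p
      else place V (Transposition.transpose i (i + 1) p) (k - (2 * m + 2)))" for p k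
    by (auto simp: w_def place_blanks_append place_Cons move_def)
  have cA: "?c A k = (if k = 2 then (x, 0) else if k \<le> 2 * m then (real i, 0) else if k = 2 * m + 1
      then halfway (Some (i, f)) i else (real i + 1, 0))"
    and cB: "?c B k = (if k = 2 then (x, 0) else if k \<le> 2 * m then (real i + 1, 0) else if k = 2 * m + 1
      then halfway (Some (i, f)) (i + 1) else (real i, 0))"
    and cA': "?c' A k = (if k = 2 then (x, 0) else (real i + 1, 0))"
    and cB': "?c' B k = (if k = 2 then (x, 0) else (real i, 0))"
    if "2 \<le> k" "k \<le> 2 * m + 2" for k
    using that AB \<alpha> m n[OF AB(1)] n[OF AB(2)] qA by (auto simp: normal_form_def W W')
  have layer: "2 \<le> k \<and> Suc k \<le> 2 * m + 2" if "k \<in> ?I \<or> Suc k \<in> ?I" for k using that by auto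
  have other_q: "q j \<noteq> i \<and> q j \<noteq> i + 1" if "j \<in> J" "j \<notin> {A, B}" for j
    using that AB q by (metis inj_on_def insertI1 insertI2)
  have jAB: "joined n A B 2" "joined n B A 2" using AB by (auto simp: joined_def)
  show "(compatible n J)\<^sup>*\<^sup>* ?c ?c'"
  proof (rule two_strand_move[where A = ?A and B = ?B and I = ?I and i = "real i"])
    show "?c' j k = ?c j k" if "j \<in> J" "start j \<le> k" "k \<le> n j" "j \<notin> {?A, ?B} \<or> k \<notin> ?I" for j k
    proof (cases "j \<in> {A, B}")
      case True
      then have "k \<le> 2 \<or> 2 * m + 2 \<le> k" "2 \<le> k" using that(2,4) AB by (auto split: if_splits)
      then show ?thesis using True AB qA unfolding normal_form_def by (auto simp: W W')
    next
      case False
      then have "q j \<noteq> i" "q j \<noteq> i + 1" using other_q[OF that(1)] by auto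
      then have "place w (q j) k = place w' (q' j) k"
        unfolding W W' by (auto simp: halfway_def q'_def)
      then show ?thesis by (simp only: normal_form_def)
    qed
    show "k \<noteq> start j \<and> k \<noteq> n j" if "j \<in> {?A, ?B}" "k \<in> ?I" for j k
      using that n[of j] AB by (auto split: if_splits)
    show "in_front n ?c ?A ?B k \<and> in_front n ?c' ?A ?B k" if "alive n ?A ?B k" "k \<in> ?I \<or> Suc k \<in> ?I" for k
    proof -
      have k: "2 \<le> k" "k \<le> 2 * m + 2" "2 \<le> Suc k" "Suc k \<le> 2 * m + 2" using layer[OF that(2)] by auto
      have joint: "ordered_at n d d l ?A ?B 2" if "d \<in> {?c, ?c'}" for d l
        using that jAB cA[of 2] cB[of 2] cA'[of 2] cB'[of 2] by (auto simp: ordered_at_def gap_def)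
      let ?s = "if f then 1 else -1 :: real"
      have "ordered_at n ?c' ?c' (- ?s, 1) ?A ?B \<kappa>" if "\<kappa> \<in> {k, Suc k}" for \<kappa>
      proof (cases "\<kappa> = 2")
        case False
        then show ?thesis using that k by (intro ordered_at_frontI) (auto simp: gap_def cA' cB')
      qed (use joint in simp)
      moreover have "ordered_at n ?c ?c (?s * (if k = 2 * m + 1 then -1 else 1), 1) ?A ?B \<kappa>" if "\<kappa> \<in> {k, Suc k}" for \<kappa>
      proof (cases "\<kappa> = 2")
        case False
        then show ?thesis using that k by (intro ordered_at_frontI) (auto simp: gap_def cA cB)
      qed (use joint in simp)
      ultimately show ?thesis unfolding in_front_def by blast
    qed
    show "real i \<le> fst (?c j \<kappa>) \<and> fst (?c j \<kappa>) \<le> real i + 1 \<and> \<bar>snd (?c j \<kappa>)\<bar> \<le> 1/2 \<and>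
      real i \<le> fst (?c' j \<kappa>) \<and> fst (?c' j \<kappa>) \<le> real i + 1 \<and> \<bar>snd (?c' j \<kappa>)\<bar> \<le> 1/2"
      if "j \<in> {?A, ?B}" "k \<in> ?I \<or> Suc k \<in> ?I" "\<kappa> \<in> {k, Suc k}" for j k \<kappa>
    proof -
      have k: "2 \<le> \<kappa>" "\<kappa> \<le> 2 * m + 2" using layer[OF that(2)] that(3) by auto
      have "j = A \<or> j = B" using that(1) by (auto split: if_splits)
      then show ?thesis using cA[OF k] cB[OF k] cA'[OF k] cB'[OF k] \<alpha>(3,4) by auto
    qed
    show "(\<forall>\<kappa>\<in>{k, Suc k}. snd (?c r \<kappa>) = 0 \<and> fst (?c r \<kappa>) \<le> real i - 1) \<or>
      (\<forall>\<kappa>\<in>{k, Suc k}. snd (?c r \<kappa>) = 0 \<and> fst (?c r \<kappa>) \<ge> real i + 2)"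
      if "r \<in> J" "r \<notin> {?A, ?B}" "k \<in> ?I \<or> Suc k \<in> ?I" for r k
    proof -
      have r: "r \<notin> {A, B}" using that(2) by (auto split: if_splits)
      have ne: "q r \<noteq> i" "q r \<noteq> i + 1" using other_q[OF that(1) r] by auto
      have "?c r \<kappa> = (real (q r), 0)" if "\<kappa> \<in> {k, Suc k}" for \<kappa>
      proof -
        have "2 \<le> \<kappa>" "\<kappa> \<le> 2 * m + 2" using layer \<open>k \<in> ?I \<or> Suc k \<in> ?I\<close> that by auto
        then show ?thesis using others[OF \<open>r \<in> J\<close> r] n[OF \<open>r \<in> J\<close>] ne
          by (auto simp: normal_form_def W halfway_def)
      qed
      moreover have "q r < i \<or> i + 2 \<le> q r" using ne by linarith
      ultimately show ?thesis by auto
    qed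
  qed (use J valid AB diff in auto)
  qed
  then show ?thesis by (simp only: w_def w'_def q'_def)
qed

text \<open>
  The first Reidemeister move at a minimum. The other strands either have ended above the crossing or
  continue below the minimum at a distance from it.
\<close>

lemma untwist_cup:
  assumes J: "finite J" and q: "inj_on q J"
    and AB: "A \<in> J" "B \<in> J" "moves U (q A) = i" "moves U (q B) = i + 1" "n A = E" "n B = E" "cup A = cup B"
    and others: "\<And>j. j \<in> J \<Longrightarrow> j \<notin> {A, B} \<Longrightarrow> E < n j \<or> n j \<le> 2 * length U"
    and U: "2 \<le> length U" and E: "2 * length U + 2 < E"
    and \<alpha>: "\<alpha> A E = (x, 0)" "\<alpha> B E = (x, 0)" "real i \<le> x" "x \<le> real i + 1"
  shows "leads_to n J (normal_form n \<alpha> (U @ Some (i, f) # blanks m) q)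
    (normal_form n \<alpha> (U @ blanks (m + 1)) q)"
proof -
  define w where "w = U @ Some (i, f) # blanks m"
  define w' where "w' = U @ blanks (m + 1)"
  have "leads_to n J (normal_form n \<alpha> w q) (normal_form n \<alpha> w' q)"
  unfolding leads_to_def
  proof
  let ?c = "normal_form n \<alpha> w q" and ?c' = "normal_form n \<alpha> w' q"
  define L where "L = 2 * length U"
  let ?I = "{L<..<E}"
  let ?A = "if f then A else B" and ?B = "if f then B else A"
  assume valid: "compatible n J ?c ?c"
  have diff: "A \<noteq> B" using AB by auto
  have L4: "4 \<le> L" using U by (simp add: L_def)
  have LE: "L + 2 < E" using E by (simp add: L_def)
  have W': "place w' p k = (if k < L then place U p k else (real (moves U p), 0))" for p k
    unfolding w'_def place_append place_blanks L_def by simp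
  have W: "place w p k = (if k < L then place U p k else if k = L then (real (moves U p), 0)
      else if k = L + 1 then halfway (Some (i, f)) (moves U p) else (real (move (Some (i, f)) (moves U p)), 0))" for p k
    by (auto simp: w_def place_append place_Cons L_def)
  have cA: "?c A k = (if k = E then (x, 0) else if k = L then (real i, 0) else if k = L + 1
      then halfway (Some (i, f)) i else (real i + 1, 0))"
    and cB: "?c B k = (if k = E then (x, 0) else if k = L then (real i + 1, 0) else if k = L + 1
      then halfway (Some (i, f)) (i + 1) else (real i, 0))"
    and cA': "?c' A k = (if k = E then (x, 0) else (real i, 0))"
    and cB': "?c' B k = (if k = E then (x, 0) else (real i + 1, 0))"
    if "L \<le> k" "k \<le> E" for k
    using that AB \<alpha> L4 start_le[of A] start_le[of B] LE unfolding normal_form_def W W' by (auto simp: move_Some)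
  have layer: "L \<le> k \<and> Suc k \<le> E" if "k \<in> ?I \<or> Suc k \<in> ?I" for k using that by auto
  have other_q: "moves U (q j) \<noteq> i \<and> moves U (q j) \<noteq> i + 1" if "j \<in> J" "j \<notin> {A, B}" for j
    using that AB q by (metis inj_on_def insertI1 insertI2 moves_inj)
  have jAB: "joined n A B E" "joined n B A E" using AB by (auto simp: joined_def)
  show "(compatible n J)\<^sup>*\<^sup>* ?c ?c'"
  proof (rule two_strand_move[where A = ?A and B = ?B and I = ?I and i = "real i"])
    show "?c' j k = ?c j k" if "j \<in> J" "start j \<le> k" "k \<le> n j" "j \<notin> {?A, ?B} \<or> k \<notin> ?I" for j k
    proof (cases "j \<in> {A, B}")
      case True
      then have "k \<le> L \<or> k = n j" using that(3,4) AB by (auto split: if_splits)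
      then show ?thesis using True AB unfolding normal_form_def W W' by auto
    next
      case False
      then have "moves U (q j) \<noteq> i" "moves U (q j) \<noteq> i + 1" using other_q[OF that(1)] by auto
      then have "place w (q j) k = place w' (q j) k"
        unfolding W W' by (auto simp: halfway_def move_Some)
      then show ?thesis by (simp only: normal_form_def)
    qed
    show "k \<noteq> start j \<and> k \<noteq> n j" if "j \<in> {?A, ?B}" "k \<in> ?I" for j k
      using that AB L4 start_le[of j] by (auto split: if_splits)
    show "in_front n ?c ?A ?B k \<and> in_front n ?c' ?A ?B k" if "alive n ?A ?B k" "k \<in> ?I \<or> Suc k \<in> ?I" for k
    proof -
      have k: "L \<le> k" "k \<le> E" "L \<le> Suc k" "Suc k \<le> E" using layer[OF that(2)] by auto
      have joint: "ordered_at n d d l ?A ?B E" if "d \<in> {?c, ?c'}" for d l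
        using that jAB cA[of E] cB[of E] cA'[of E] cB'[of E] LE by (auto simp: ordered_at_def gap_def)
      let ?s = "if f then 1 else -1 :: real"
      have "ordered_at n ?c' ?c' (?s, 1) ?A ?B \<kappa>" if "\<kappa> \<in> {k, Suc k}" for \<kappa>
      proof (cases "\<kappa> = E")
        case False
        then show ?thesis using that k by (intro ordered_at_frontI) (auto simp: gap_def cA' cB')
      qed (use joint in simp)
      moreover have "ordered_at n ?c ?c (?s * (if k = L then 1 else -1), 1) ?A ?B \<kappa>" if "\<kappa> \<in> {k, Suc k}" for \<kappa>
      proof (cases "\<kappa> = E")
        case False
        then show ?thesis using that k by (intro ordered_at_frontI) (auto simp: gap_def cA cB)
      qed (use joint in simp)
      ultimately show ?thesis unfolding in_front_def by blast
    qed
    show "real i \<le> fst (?c j \<kappa>) \<and> fst (?c j \<kappa>) \<le> real i + 1 \<and> \<bar>snd (?c j \<kappa>)\<bar> \<le> 1/2 \<and>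
      real i \<le> fst (?c' j \<kappa>) \<and> fst (?c' j \<kappa>) \<le> real i + 1 \<and> \<bar>snd (?c' j \<kappa>)\<bar> \<le> 1/2"
      if "j \<in> {?A, ?B}" "k \<in> ?I \<or> Suc k \<in> ?I" "\<kappa> \<in> {k, Suc k}" for j k \<kappa>
    proof -
      have k: "L \<le> \<kappa>" "\<kappa> \<le> E" using layer[OF that(2)] that(3) by auto
      have "j = A \<or> j = B" using that(1) by (auto split: if_splits)
      then show ?thesis using cA[OF k] cB[OF k] cA'[OF k] cB'[OF k] \<alpha>(3,4) by auto
    qed
    show "(\<forall>\<kappa>\<in>{k, Suc k}. snd (?c r \<kappa>) = 0 \<and> fst (?c r \<kappa>) \<le> real i - 1) \<or>
      (\<forall>\<kappa>\<in>{k, Suc k}. snd (?c r \<kappa>) = 0 \<and> fst (?c r \<kappa>) \<ge> real i + 2)"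
      if "j \<in> {?A, ?B}" "r \<in> J" "r \<notin> {?A, ?B}" "alive n j r k" "k \<in> ?I \<or> Suc k \<in> ?I" for j r k
    proof -
      have r: "r \<notin> {A, B}" using that(3) by (auto split: if_splits)
      have ne: "moves U (q r) \<noteq> i" "moves U (q r) \<noteq> i + 1" using other_q[OF that(2) r] by auto
      have "E < n r" using others[OF \<open>r \<in> J\<close> r] layer[OF that(5)] that(4) by (auto simp: alive_def L_def)
      have "?c r \<kappa> = (real (moves U (q r)), 0)" if "\<kappa> \<in> {k, Suc k}" for \<kappa>
      proof -
        have "L \<le> \<kappa>" "\<kappa> \<le> E" using layer \<open>k \<in> ?I \<or> Suc k \<in> ?I\<close> that by auto
        then show ?thesis using ne \<open>E < n r\<close> L4 start_le[of r]
          unfolding normal_form_def W by (auto simp: halfway_def move_Some)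
      qed
      moreover have "moves U (q r) < i \<or> i + 2 \<le> moves U (q r)" using ne by linarith
      ultimately show ?thesis by auto
    qed
  qed (use J valid AB diff in auto)
  qed
  then show ?thesis by (simp only: w_def w'_def)
qed

text \<open>A crossing of the ribbon in positions 1, 2 with that in positions 3, 4.\<close>

definition ribbon_letters :: "bool \<Rightarrow> padded_word" where
  "ribbon_letters f = [Some (2, f), Some (1, f), Some (3, f), Some (2, f)]"

definition ribbon_swap :: "nat \<Rightarrow> nat" where
  "ribbon_swap p = (if p \<le> 2 then p + 2 else p - 2)"

definition midpoint_of :: "(nat \<Rightarrow> nat) \<Rightarrow> nat \<Rightarrow> nat \<Rightarrow> real \<times> real" where
  "midpoint_of q a b = ((real (q a) + real (q b)) / 2, 0)"

text \<open>
  The horizontal coordinates on the nine levels of the crossing of two ribbons, for the strand that enters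
  in position \<open>p\<close>; \<open>ribbon_y\<close> lists the depths for \<open>f = True\<close>.
\<close>

definition ribbon_x :: "nat \<Rightarrow> real list" where
  "ribbon_x p = (if p = 1 then [1, 1, 1, 3/2, 2, 2, 2, 5/2, 3] else if p = 2 then [2, 5/2, 3, 3, 3, 7/2, 4, 4, 4]
     else if p = 3 then [3, 5/2, 2, 3/2, 1, 1, 1, 1, 1] else [4, 4, 4, 4, 4, 7/2, 3, 5/2, 2])"

definition ribbon_y :: "nat \<Rightarrow> real list" where
  "ribbon_y p = (if p = 1 then [0, 0, 0, -1/2, 0, 0, 0, -1/2, 0] else if p = 2 then [0, -1/2, 0, 0, 0, -1/2, 0, 0, 0]
     else if p = 3 then [0, 1/2, 0, 1/2, 0, 0, 0, 0, 0] else [0, 0, 0, 0, 0, 1/2, 0, 1/2, 0])"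

lemma le_8_cases:
  assumes "r \<le> (8::nat)"
  obtains "r = 0" | "r = 1" | "r = 2" | "r = 3" | "r = 4" | "r = 5" | "r = 6" | "r = 7" | "r = 8"
  using assms by linarith

lemma place_ribbon:
  assumes p: "p \<in> {1, 2, 3, 4}" and r: "r \<le> 8"
  shows "place (ribbon_letters f @ V) p r = (ribbon_x p ! r, (if f then 1 else -1) * ribbon_y p ! r)"
proof -
  have "p = 1 \<or> p = 2 \<or> p = 3 \<or> p = 4" using p by auto
  then show ?thesis
    apply -
    apply (elim disjE; rule le_8_cases[OF r])
    apply (simp_all add: ribbon_letters_def ribbon_x_def ribbon_y_def place_Cons halfway_def move_Some)
    done
qed

lemma moves_ribbon: "p \<in> {1, 2, 3, 4} \<Longrightarrow> moves (ribbon_letters f) p = ribbon_swap p"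
  by (auto simp: ribbon_letters_def ribbon_swap_def move_Some)

lemma ribbon_x_mono:
  assumes "r \<le> 8" shows "ribbon_x 1 ! r < ribbon_x 2 ! r" "ribbon_x 3 ! r < ribbon_x 4 ! r"
  by (rule le_8_cases[OF assms]; simp add: ribbon_x_def)+

text \<open>
  The ribbon from the left is in front. For a given pair of strands the sign of \<open>\<epsilon>\<close>
  changes at the layer in which these two strands cross each other.
\<close>

lemma ribbon_front:
  assumes p: "p \<in> {1, 2}" "p' \<in> {3, 4}" and r: "r < 8"
  shows "\<exists>\<epsilon>. \<forall>\<rho>\<in>{r, Suc r}. \<epsilon> * (ribbon_x p' ! \<rho> - ribbon_x p ! \<rho>) + (ribbon_y p' ! \<rho> - ribbon_y p ! \<rho>) > 0"
proof -
  have c: "p = 1 \<and> p' = 3 \<or> p = 1 \<and> p' = 4 \<or> p = 2 \<and> p' = 3 \<or> p = 2 \<and> p' = 4" using p by auto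
  have r8: "r \<le> 8" using r by simp
  show ?thesis
    apply (rule exI[of _ "if r < (if p' = 3 then if p = 2 then 1 else 3 else if p = 2 then 5 else 7) then 1 else -1"])
    apply (insert c r, elim disjE; elim conjE; rule le_8_cases[OF r8])
    apply (simp_all add: ribbon_x_def ribbon_y_def)
    done
qed

lemma midpoint_of_bounds:
  "q x \<le> 2 \<Longrightarrow> q y \<le> 2 \<Longrightarrow> fst (midpoint_of q x y) \<le> 2"
  "3 \<le> q x \<Longrightarrow> 3 \<le> q y \<Longrightarrow> 3 \<le> fst (midpoint_of q x y)" "snd (midpoint_of q x y) = 0"
  by (auto simp: midpoint_of_def)

text \<open>
  Each of the two ribbons is a cap, since its strands leave the same vertex. One ribbon lies in front of
  the other, so that the layers can be moved independently: both caps move to the side to which the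
  crossing would bring them. Within a ribbon the strands keep their order from left to right.
\<close>

lemma slide_ribbon:
  assumes n: "\<And>j. j \<in> {3, 4, 5, 6} \<Longrightarrow> 2 * m + 8 < n j" and m: "2 \<le> m"
    and q: "q ` {3, 4} = {1, 2} \<and> q ` {5, 6} = {3, 4} \<or> q ` {3, 4} = {3, 4} \<and> q ` {5, 6} = {1, 2}"
    and \<alpha>: "\<alpha> 3 2 = midpoint_of q 3 4" "\<alpha> 4 2 = midpoint_of q 3 4" "\<alpha> 5 0 = midpoint_of q 5 6" "\<alpha> 6 0 = midpoint_of q 5 6"
    and \<alpha>': "\<alpha>' 3 2 = midpoint_of (ribbon_swap \<circ> q) 3 4" "\<alpha>' 4 2 = midpoint_of (ribbon_swap \<circ> q) 3 4"
      "\<alpha>' 5 0 = midpoint_of (ribbon_swap \<circ> q) 5 6" "\<alpha>' 6 0 = midpoint_of (ribbon_swap \<circ> q) 5 6"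
    and ends: "\<And>j. j \<in> {3, 4, 5, 6} \<Longrightarrow> \<alpha>' j (n j) = \<alpha> j (n j)"
  shows "leads_to n {3, 4, 5, 6} (normal_form n \<alpha> (blanks m @ ribbon_letters f @ V) q)
    (normal_form n \<alpha>' (blanks (m + 4) @ V) (ribbon_swap \<circ> q))"
proof -
  define w where "w = blanks m @ ribbon_letters f @ V"
  define w' where "w' = blanks (m + 4) @ V"
  define q' where "q' = ribbon_swap \<circ> q"
  define J where "J = {3, 4, 5, 6 :: nat}"
  define c where "c = normal_form n \<alpha> w q"
  define c' where "c' = normal_form n \<alpha>' w' q'"
  define N where "N = 2 * m + 8"
  let ?\<sigma> = "if f then 1 else -1 :: real"
  define \<delta> where "\<delta> j = (if q j \<le> 2 then - ?\<sigma> else ?\<sigma>)" for j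
  have qJ: "q j \<in> {1, 2, 3, 4}" if "j \<in> J" for j using q that unfolding J_def by auto
  have J_cases: "j = 3 \<or> j = 4 \<or> j = 5 \<or> j = 6" if "j \<in> J" for j using that by (auto simp: J_def)
  have q'J: "q' j = (if q j \<le> 2 then q j + 2 else q j - 2)" for j by (simp add: q'_def ribbon_swap_def)
  have nJ: "N < n j" if "j \<in> J" for j using n that by (simp add: J_def N_def)
  have w: "place w (q j) k = (if k < 2 * m then (real (q j), 0)
      else if k \<le> N then (ribbon_x (q j) ! (k - 2 * m), ?\<sigma> * ribbon_y (q j) ! (k - 2 * m))
      else place V (q' j) (k - N))" if "j \<in> J" for j k
  proof -
    have r: "place (ribbon_letters f @ V) (q j) i = place V (q' j) (i - 8)" if "8 \<le> i" for i
      using that moves_ribbon[OF qJ[OF \<open>j \<in> J\<close>], of f]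
      by (subst place_append) (simp add: ribbon_letters_def q'_def)
    show ?thesis unfolding w_def place_blanks_append N_def
      using place_ribbon[OF qJ[OF that], of "k - 2 * m" f V] r[of "k - 2 * m"] by auto
  qed
  have w': "place w' (q' j) k = (if k < N then (real (q' j), 0) else place V (q' j) (k - N))" for j k
  proof -
    have "2 * (m + 4) = N" by (simp add: N_def)
    then show ?thesis unfolding w'_def place_blanks_append by simp
  qed
  have ends8: "(ribbon_x p ! 8, ?\<sigma> * ribbon_y p ! 8) = (real (ribbon_swap p), 0)"
    and ends0: "(ribbon_x p ! 0, ?\<sigma> * ribbon_y p ! 0) = (real p, 0)" if "p \<in> {1, 2, 3, 4}" for p
    using that by (auto simp: ribbon_x_def ribbon_y_def ribbon_swap_def)
  have eq: "c j k = c' j k" if "j \<in> J" "N \<le> k" for j k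
  proof -
    have "k \<noteq> start j" using that(2) start_le[of j] by (simp add: N_def)
    moreover have "place w (q j) k = place w' (q' j) k"
      unfolding w[OF that(1)] w' using that(2) ends8[OF qJ[OF that(1)]]
      by (auto simp: N_def q'_def)
    ultimately show ?thesis using ends that(1) by (simp add: c_def c'_def normal_form_def J_def)
  qed
  have c_mid: "c j k = (ribbon_x (q j) ! (k - 2 * m), ?\<sigma> * ribbon_y (q j) ! (k - 2 * m))"
    if "j \<in> J" "2 * m \<le> k" "k \<le> N" for j k
    using that start_le[of j] m nJ[OF that(1)] w[OF that(1), of k] by (auto simp: c_def normal_form_def)
  have c_start: "c j (start j) = midpoint_of q 3 4 \<and> c' j (start j) = midpoint_of q' 3 4" if "j = 3 \<or> j = 4" for j
    using that \<alpha> \<alpha>' by (auto simp: c_def c'_def normal_form_def start_def q'_def)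
  have c_start': "c j (start j) = midpoint_of q 5 6 \<and> c' j (start j) = midpoint_of q' 5 6" if "j = 5 \<or> j = 6" for j
    using that \<alpha> \<alpha>' by (auto simp: c_def c'_def normal_form_def start_def q'_def)
  have c_top: "c j k = (real (q j), 0)" if "j \<in> J" "k \<le> 2 * m" "k \<noteq> start j" for j k
    using that m nJ[OF that(1)] w[OF that(1), of k] ends0[OF qJ[OF that(1)]]
    by (auto simp: c_def normal_form_def N_def)
  have c'_top: "c' j k = (real (q' j), 0)" if "j \<in> J" "k \<le> N" "k \<noteq> start j" for j k
    using that m nJ[OF that(1)] by (auto simp: c'_def normal_form_def w' N_def)
  have group: "(q 3 \<le> 2) = (q 4 \<le> 2)" "(q 5 \<le> 2) = (q 6 \<le> 2)" "(q 3 \<le> 2) \<noteq> (q 5 \<le> 2)"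
    "q 3 \<noteq> q 4" "q 5 \<noteq> q 6"
    using q by (auto simp: doubleton_eq_iff)
  have mate: "\<exists>x y. c j (start j) = midpoint_of q x y \<and> c' j (start j) = midpoint_of q' x y \<and> x \<in> J \<and> y \<in> J
      \<and> (q x \<le> 2) = (q j \<le> 2) \<and> (q y \<le> 2) = (q j \<le> 2)" if "j \<in> J" for j
  proof (cases "j = 3 \<or> j = 4")
    case True
    then show ?thesis using c_start[OF True] group(1)
      by (intro exI[of _ 3] exI[of _ 4]) (auto simp: J_def)
  next
    case False
    then have j: "j = 5 \<or> j = 6" using J_cases[OF that] by simp
    then show ?thesis using c_start'[OF j] group(2)
      by (intro exI[of _ 5] exI[of _ 6]) (auto simp: J_def)
  qed
  have c_low: "snd (c j k) = 0 \<and> (if q j \<le> 2 then fst (c j k) \<le> 2 else fst (c j k) \<ge> 3)"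
    if "j \<in> J" "start j \<le> k" "k \<le> 2 * m" for j k
  proof (cases "k = start j")
    case True
    obtain x y where xy: "c j (start j) = midpoint_of q x y" "x \<in> J" "y \<in> J" "(q x \<le> 2) = (q j \<le> 2)" "(q y \<le> 2) = (q j \<le> 2)"
      using mate[OF \<open>j \<in> J\<close>] by blast
    show ?thesis unfolding True xy(1) midpoint_of_bounds(3)
      using midpoint_of_bounds(1,2)[of q x y] xy(4,5) by (cases "q j \<le> 2") simp_all
  next
    case False
    then show ?thesis using c_top[OF that(1,3)] qJ[OF that(1)] by auto
  qed
  have c'_low: "snd (c' j k) = 0 \<and> (if q j \<le> 2 then fst (c' j k) \<ge> 3 else fst (c' j k) \<le> 2)"
    if "j \<in> J" "start j \<le> k" "k \<le> N" for j k
  proof (cases "k = start j")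
    case True
    obtain x y where xy: "c' j (start j) = midpoint_of q' x y" "x \<in> J" "y \<in> J" "(q x \<le> 2) = (q j \<le> 2)" "(q y \<le> 2) = (q j \<le> 2)"
      using mate[OF \<open>j \<in> J\<close>] by blast
    have "q j \<le> 2 \<Longrightarrow> 3 \<le> q' x \<and> 3 \<le> q' y" "\<not> q j \<le> 2 \<Longrightarrow> q' x \<le> 2 \<and> q' y \<le> 2"
      using xy(4,5) qJ[OF xy(2)] qJ[OF xy(3)] unfolding q'J by auto
    then show ?thesis unfolding True xy(1) midpoint_of_bounds(3)
      using midpoint_of_bounds(1,2)[of q' x y] by (cases "q j \<le> 2") simp_all
  next
    case False
    then show ?thesis using c'_top[OF that(1,3)] qJ[OF that(1)] by (auto simp: q'J)
  qed
  have signs: "q (if f then a else b) \<le> 2 \<and> \<not> q (if f then b else a) \<le> 2" if "\<delta> a < \<delta> b" for a b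
    using that by (auto simp: \<delta>_def split: if_splits)
  have "leads_to n J c c'"
    unfolding leads_to_def
  proof
    assume valid: "compatible n J c c"
    show "(compatible n J)\<^sup>*\<^sup>* c c'"
    proof (rule layered_isotopy[where \<delta> = \<delta> and I = "{..<N}"])
      show "finite J" by (simp add: J_def)
      fix a b k
      assume ab: "a \<in> J" "b \<in> J"
      show "\<delta> a = \<delta> b" if "joined n a b k" "k \<in> {..<N}"
      proof -
        have "start a = start b" using that nJ[OF ab(1)] by (auto simp: joined_def)
        then show ?thesis using J_cases[OF ab(1)] J_cases[OF ab(2)] group(1,2) by (auto simp: \<delta>_def start_def)
      qed
      assume al: "alive n a b k"
      then have sk: "start a \<le> k" "start b \<le> k" "start a \<le> Suc k" "start b \<le> Suc k" by (auto simp: alive_def)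
      {
        assume dl: "\<delta> a < \<delta> b" and kI: "k \<in> {..<N} \<or> Suc k \<in> {..<N}"
        have kN: "k \<le> N" "Suc k \<le> N" using kI by auto
        define A B where "A = (if f then a else b)" and "B = (if f then b else a)"
        have AB: "A \<in> J" "B \<in> J" "start A \<le> k" "start B \<le> k" using ab sk by (auto simp: A_def B_def)
        have qA: "q A \<le> 2" and qB: "\<not> q B \<le> 2" using signs[OF dl] by (auto simp: A_def B_def)
        have gap: "gap d a b \<kappa> = ?\<sigma> *\<^sub>R gap d A B \<kappa>" for d \<kappa> by (simp add: gap_def A_def B_def)
        have ord: "ordered_at n d d' (?\<sigma> * \<epsilon>, 1) a b \<kappa>"
          if "\<epsilon> * fst (gap d A B \<kappa>) + ?\<sigma> * snd (gap d A B \<kappa>) > 0" "\<epsilon> * fst (gap d' A B \<kappa>) + ?\<sigma> * snd (gap d' A B \<kappa>) > 0" for d d' \<kappa> \<epsilon>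
          using that by (intro ordered_at_frontI) (auto simp: gap)
        have c': "ordered_at n c' c' (?\<sigma> * (-1), 1) a b \<kappa>" if "\<kappa> \<in> {k, Suc k}" for \<kappa>
          using that kN AB c'_low[OF AB(1), of \<kappa>] c'_low[OF AB(2), of \<kappa>] qA qB
          by (intro ord) (auto simp: gap_def)
        have "\<exists>\<epsilon>. \<forall>\<kappa>\<in>{k, Suc k}. \<epsilon> * fst (gap c A B \<kappa>) + ?\<sigma> * snd (gap c A B \<kappa>) > 0"
        proof (cases "k < 2 * m")
          case True
          then show ?thesis using AB c_low[OF AB(1), of k] c_low[OF AB(2), of k]
              c_low[OF AB(1), of "Suc k"] c_low[OF AB(2), of "Suc k"] qA qB
            by (intro exI[of _ 1]) (auto simp: gap_def)
        next
          case False
          define r where "r = k - 2 * m"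
          have r: "r < 8" "k = 2 * m + r" "Suc k = 2 * m + Suc r" using False kN by (auto simp: r_def N_def)
          have p: "q A \<in> {1, 2}" "q B \<in> {3, 4}" using qJ[OF AB(1)] qJ[OF AB(2)] qA qB by auto
          obtain \<epsilon> where \<epsilon>: "\<And>\<rho>. \<rho> \<in> {r, Suc r} \<Longrightarrow>
            \<epsilon> * (ribbon_x (q B) ! \<rho> - ribbon_x (q A) ! \<rho>) + (ribbon_y (q B) ! \<rho> - ribbon_y (q A) ! \<rho>) > 0"
            using ribbon_front[OF p r(1)] by blast
          have "\<epsilon> * fst (gap c A B \<kappa>) + ?\<sigma> * snd (gap c A B \<kappa>) > 0" if \<kappa>: "\<kappa> \<in> {k, Suc k}" for \<kappa>
          proof -
            have "2 * m \<le> \<kappa>" "\<kappa> \<le> N" "\<kappa> - 2 * m \<in> {r, Suc r}" using \<kappa> r kN by auto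
            then show ?thesis using \<epsilon>[of "\<kappa> - 2 * m"]
              by (cases f) (simp_all add: gap_def c_mid[OF AB(1)] c_mid[OF AB(2)])
          qed
          then show ?thesis by blast
        qed
        then obtain \<epsilon> where "\<And>\<kappa>. \<kappa> \<in> {k, Suc k} \<Longrightarrow> \<epsilon> * fst (gap c A B \<kappa>) + ?\<sigma> * snd (gap c A B \<kappa>) > 0" by blast
        then have c: "ordered_at n c c (?\<sigma> * \<epsilon>, 1) a b \<kappa>" if "\<kappa> \<in> {k, Suc k}" for \<kappa>
          using that by (intro ord) auto
        show "in_front n c a b k \<and> in_front n c' a b k"
          unfolding in_front_def using c c' by blast
        fix \<kappa> assume \<kappa>: "\<kappa> \<in> {k, Suc k}" "\<kappa> \<notin> {..<N}"
        then have "N \<le> \<kappa>" by auto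
        then have "gap c a b \<kappa> = gap c' a b \<kappa>" using eq ab by (simp add: gap_def)
        then show "\<exists>\<epsilon>. ordered_at n c c' (\<epsilon>, 1) a b \<kappa>"
          using c'[OF \<kappa>(1)] unfolding ordered_at_def by auto
      }
      assume ne: "a \<noteq> b" and same: "\<delta> a = \<delta> b \<or> k \<notin> {..<N} \<and> Suc k \<notin> {..<N}"
      show "separated n c c' a b k"
      proof (cases "N \<le> k")
        case True
        then have "gap c a b \<kappa> = gap c' a b \<kappa>" if "\<kappa> \<in> {k, Suc k}" for \<kappa>
          using eq ab that by (auto simp: gap_def)
        then show ?thesis using compatibleD[OF valid ab ne al] unfolding separated_def ordered_at_def by auto
      next
        case False
        then have sd: "\<delta> a = \<delta> b" and kN: "k \<le> N" "Suc k \<le> N" using same by auto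
        then have g: "(q a \<le> 2) = (q b \<le> 2)" by (auto simp: \<delta>_def split: if_splits)
        have st: "start a = start b" and qab: "q a \<noteq> q b" using g group ne J_cases[OF ab(1)] J_cases[OF ab(2)] by (auto simp: start_def)
        have less: "fst (c x \<kappa>) < fst (c y \<kappa>) \<and> fst (c' x \<kappa>) < fst (c' y \<kappa>)"
          if xy: "x \<in> J" "y \<in> J" "q x < q y" "(q x \<le> 2) = (q y \<le> 2)" "start x = start y" "\<kappa> \<le> N" "\<kappa> \<noteq> start x" for x y \<kappa>
        proof -
          have p: "q x = 1 \<and> q y = 2 \<or> q x = 3 \<and> q y = 4" using qJ[OF xy(1)] qJ[OF xy(2)] xy(3,4) by auto
          have "fst (c x \<kappa>) < fst (c y \<kappa>)"
          proof (cases "\<kappa> < 2 * m")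
            case True
            then show ?thesis using xy c_top by auto
          next
            case False
            then have "2 * m \<le> \<kappa>" "\<kappa> - 2 * m \<le> 8" using xy(6) by (auto simp: N_def)
            then show ?thesis using p ribbon_x_mono[of "\<kappa> - 2 * m"] c_mid[OF xy(1)] c_mid[OF xy(2)] xy(6) by auto
          qed
          then show ?thesis using xy c'_top by (auto simp: q'J)
        qed
        have joint: "joined n a b (start a) \<and> gap c a b (start a) = 0 \<and> gap c' a b (start a) = 0"
        proof -
          have "(a = 3 \<or> a = 4) \<and> (b = 3 \<or> b = 4) \<or> (a = 5 \<or> a = 6) \<and> (b = 5 \<or> b = 6)"
            using st J_cases[OF ab(1)] J_cases[OF ab(2)] by (elim disjE) (simp_all add: start_def)
          then have "c a (start a) = c b (start b) \<and> c' a (start a) = c' b (start b)"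
          proof
            assume "(a = 3 \<or> a = 4) \<and> (b = 3 \<or> b = 4)"
            then show ?thesis using c_start by (simp only:) 
          next
            assume "(a = 5 \<or> a = 6) \<and> (b = 5 \<or> b = 6)"
            then show ?thesis using c_start' by (simp only:)
          qed
          then show ?thesis using st by (simp add: joined_def gap_def)
        qed
        define l :: "real \<times> real" where "l = (if q a < q b then 1 else -1, 0)"
        have "ordered_at n c c' l a b \<kappa>" if "\<kappa> \<in> {k, Suc k}" for \<kappa>
        proof (cases "\<kappa> = start a")
          case True
          then show ?thesis using joint by (simp add: ordered_at_def)
        next
          case False
          have "\<kappa> \<le> N" using that kN by auto
          then show ?thesis using less[of a b \<kappa>] less[of b a \<kappa>] ab g st qab False
            unfolding ordered_at_def l_def by (cases "q a < q b") (auto simp: gap_def inner_prod_def)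
        qed
        then show ?thesis unfolding separated_def by blast
      qed
    qed
  qed
  then show ?thesis by (simp only: c_def c'_def w_def w'_def q'_def J_def)
qed

section \<open>Four strands without twists\<close>

text \<open>
  All strands are straight segments in the plane of depth 0, from \<open>u j\<close> to \<open>v
  j\<close>.
\<close>

definition straight :: "(nat \<Rightarrow> nat) \<Rightarrow> (nat \<Rightarrow> real) \<Rightarrow> (nat \<Rightarrow> real) \<Rightarrow> config" where
  "straight n u v j k = (u j + (v j - u j) * ((real k - real (start j)) / (real (n j) - real (start j))), 0)"

lemma affine_chain:
  fixes p :: "nat \<Rightarrow> point"
  assumes "a < b" "\<And>k. a \<le> k \<Longrightarrow> k \<le> b \<Longrightarrow> p k = P + real k *\<^sub>R Q"
  shows "(\<Union>k\<in>{a..<b}. closed_segment (p k) (p (Suc k))) = closed_segment (p a) (p b)"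
proof -
  have "b \<le> b' \<longrightarrow> (\<Union>k\<in>{a..<b}. closed_segment (p k) (p (Suc k))) = closed_segment (p a) (p b)"
    if "Suc a \<le> b" "\<And>k. a \<le> k \<Longrightarrow> k \<le> b' \<Longrightarrow> p k = P + real k *\<^sub>R Q" for b b'
    using that(1)
  proof (induction b rule: dec_induct)
    case base
    then show ?case by simp
  next
    case (step b)
    show ?case
    proof
      assume b': "Suc b \<le> b'"
      have u: "{a..<Suc b} = insert b {a..<b}" using step by auto
      have "p b \<in> closed_segment (p a) (p (Suc b))"
        unfolding in_segment
      proof (intro exI[of _ "(real b - real a) / (real (Suc b) - real a)"] conjI)
        let ?t = "(real b - real a) / (real (Suc b) - real a)"
        show "0 \<le> ?t" "?t \<le> 1" using step by (simp_all add: divide_simps)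
        have t: "real a + ?t * (real (Suc b) - real a) = real b" using step by simp
        have "(1 - ?t) *\<^sub>R (P + real a *\<^sub>R Q) + ?t *\<^sub>R (P + real (Suc b) *\<^sub>R Q)
            = P + (real a + ?t * (real (Suc b) - real a)) *\<^sub>R Q"
        proof -
          have "(1 - t) *\<^sub>R (P + x *\<^sub>R Q) + t *\<^sub>R (P + y *\<^sub>R Q) = P + (x + t * (y - x)) *\<^sub>R Q" for t x y
            by (simp add: algebra_simps)
          then show ?thesis .
        qed
        then show "p b = (1 - ?t) *\<^sub>R p a + ?t *\<^sub>R p (Suc b)"
          unfolding t using that(2)[of a] that(2)[of b] that(2)[of "Suc b"] b' step by simp
      qed
      from Un_closed_segment[OF this]
      show "(\<Union>k\<in>{a..<Suc b}. closed_segment (p k) (p (Suc k))) = closed_segment (p a) (p (Suc b))"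
        using step b' unfolding u by (simp add: Un_commute)
    qed
  qed
  from this[of b b] assms show ?thesis by auto
qed

lemma curve_straight:
  assumes "\<And>j. j \<in> J \<Longrightarrow> 2 < n j"
  shows "curve n J (straight n u v) =
    (\<Union>j\<in>J. closed_segment (u j, 0, 2 - real (start j) / 2) (v j, 0, 2 - real (n j) / 2))"
  unfolding curve_def
proof (rule SUP_cong[OF refl])
  fix j assume j: "j \<in> J"
  have lt: "start j < n j" using assms[OF j] start_le[of j] by simp
  define D where "D = real (n j) - real (start j)"
  have D: "D \<noteq> 0" using lt by (simp add: D_def)
  have "at_level (straight n u v) j k = (u j - (v j - u j) * (real (start j) / D), 0, 2) + real k *\<^sub>R ((v j - u j) / D, 0, - 1/2)" for k
    by (simp add: at_level_def straight_def D_def[symmetric] diff_divide_distrib algebra_simps)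
  from affine_chain[OF lt, of "at_level (straight n u v) j", OF this]
  have "(\<Union>k\<in>{start j..<n j}. closed_segment (at_level (straight n u v) j k) (at_level (straight n u v) j (Suc k)))
    = closed_segment (at_level (straight n u v) j (start j)) (at_level (straight n u v) j (n j))" .
  also have "at_level (straight n u v) j (start j) = (u j, 0, 2 - real (start j) / 2)"
    by (simp add: at_level_def straight_def)
  also have "at_level (straight n u v) j (n j) = (v j, 0, 2 - real (n j) / 2)"
    using D by (simp add: at_level_def straight_def D_def)
  finally show "(\<Union>k\<in>{start j..<n j}. closed_segment (at_level (straight n u v) j k) (at_level (straight n u v) j (Suc k)))
    = closed_segment (u j, 0, 2 - real (start j) / 2) (v j, 0, 2 - real (n j) / 2)" .
qed

lemma leads_to_unknot:
  assumes "leads_to n J c c'" "compatible n J c c" "finite J" "J \<noteq> {}" "\<And>j. j \<in> J \<Longrightarrow> 2 < n j"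
    "is_unknot (to_S3 ` curve n J c')"
  shows "is_unknot (to_S3 ` curve n J c)"
  using compatible_steps_isotopic[of n J c c'] assms ambient_isotopic_S3_trans
  unfolding leads_to_def is_unknot_def by blast

lemma separated_xI:
  assumes "\<And>\<kappa>. \<kappa> \<in> {k, Suc k} \<Longrightarrow> joined n a b \<kappa> \<and> c a \<kappa> = c b \<kappa> \<and> c' a \<kappa> = c' b \<kappa> \<or>
    fst (c a \<kappa>) < fst (c b \<kappa>) \<and> fst (c' a \<kappa>) < fst (c' b \<kappa>)"
  shows "separated n c c' a b k"
proof -
  have "ordered_at n c c' (1, 0) a b \<kappa>" if "\<kappa> \<in> {k, Suc k}" for \<kappa>
    using assms[OF that] by (auto simp: ordered_at_def gap_def inner_prod_def)
  then show ?thesis unfolding separated_def by blast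
qed

lemma slope_less:
  fixes a b k E :: real
  assumes "0 \<le> a" "a < b" "b \<le> k" "k < E"
  shows "(k - b) / (E - b) < (k - a) / (E - a)"
proof -
  have "(k - b) * (E - a) < (k - a) * (E - b)"
  proof -
    have "(k - a) * (E - b) - (k - b) * (E - a) = (b - a) * (E - k)" by (simp add: algebra_simps)
    moreover have "0 < (b - a) * (E - k)" using assms by simp
    ultimately show ?thesis by linarith
  qed
  then show ?thesis using assms by (simp add: divide_simps mult.commute)
qed

text \<open>
  Without crossings, two nested caps are closed by two cups side by side. The order of the strands from
  left to right is that of the quadrilateral whose caps are on the axis and whose cups are at -1 and 1.
\<close>

lemma nested_caps_unknot:
  assumes ab: "a = 4 \<and> b = 6 \<or> a = 3 \<and> b = 5"
    and n: "n 2 = n 1" "n b = n a" "2 < n 1" "2 < n a"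
    and q: "q 1 = 1" "q 2 = 2" "q a = 3" "q b = 4"
    and \<alpha>: "\<alpha> b 0 = \<alpha> 1 0" "\<alpha> 2 2 = (5/2, 0)" "\<alpha> a 2 = (5/2, 0)"
      "\<alpha> 1 (n 1) = (3/2, 0)" "\<alpha> 2 (n 1) = (3/2, 0)" "\<alpha> a (n a) = (7/2, 0)" "\<alpha> b (n a) = (7/2, 0)"
    and valid: "compatible n {1, 2, a, b} (normal_form n \<alpha> (blanks m) q) (normal_form n \<alpha> (blanks m) q)"
  shows "is_unknot (to_S3 ` curve n {1, 2, a, b} (normal_form n \<alpha> (blanks m) q))"
proof -
  note One_nat_def [simp del]
  define c where "c = normal_form n \<alpha> (blanks m) q"
  \<comment> \<open>Caps over 0, at the heights 2 and 1, and cups over -1 and 1.\<close>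
  define c' where "c' = straight n (\<lambda>_. 0) (\<lambda>j. if j \<le> 2 then -1 else 1)"
  have st: "start 1 = 0" "start 2 = 2" "start a = 2" "start b = 0" using ab by (auto simp: start_def)
  have lt: "2 < a" "a < b" "2 < b" using ab by auto
  have cups: "cup 1 = cup 2" "cup a = cup b" using ab by (auto simp: cup_def)
  have c1: "c 1 k = (if k = 0 then \<alpha> 1 0 else if k = n 1 then (3/2, 0) else (1, 0))"
    and c2: "c 2 k = (if k = 2 then (5/2, 0) else if k = n 1 then (3/2, 0) else (2, 0))"
    and ca: "c a k = (if k = 2 then (5/2, 0) else if k = n a then (7/2, 0) else (3, 0))"
    and cb: "c b k = (if k = 0 then \<alpha> 1 0 else if k = n a then (7/2, 0) else (4, 0))" for k
    using \<alpha> n q st by (auto simp: c_def normal_form_def)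
  have s1: "c' 1 k = (- (real k / real (n 1)), 0)"
    and s2: "c' 2 k = (- ((real k - 2) / (real (n 1) - 2)), 0)"
    and sa: "c' a k = ((real k - 2) / (real (n a) - 2), 0)"
    and sb: "c' b k = (real k / real (n a), 0)" for k
    using st lt n minus_divide_left[of "real k - 2" "real (n 1) - 2"] by (simp_all add: c'_def straight_def)
  have ends: "c' 1 (n 1) = (-1, 0)" "c' 2 (n 1) = (-1, 0)" "c' a (n a) = (1, 0)" "c' b (n a) = (1, 0)"
    using n by (simp_all add: s1 s2 sa sb)
  have pos: "0 \<le> (real k - 2) / (real (n x) - 2)" if "2 \<le> k" "x = 1 \<or> x = a" for k x
    using that n by auto
  have pos': "0 < (real k - 2) / (real (n x) - 2)" if "2 < k" "x = 1 \<or> x = a" for k x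
    using that n by auto
  have pos0: "0 < real k / real (n x)" if "0 < k" "x = 1 \<or> x = a" for k x
    using that n by auto
  have neg1: "fst (c' 1 k) < 0" and pos_b: "0 < fst (c' b k)" if "0 < k" for k
    using pos0[OF that] by (simp_all add: s1 sb)
  have neg2: "fst (c' 2 k) \<le> 0" and pos_a: "0 \<le> fst (c' a k)" if "2 \<le> k" for k
    using pos[OF that] by (simp_all add: s2 sa)
  have neg2': "fst (c' 2 k) < 0" and pos_a': "0 < fst (c' a k)" if "2 < k" for k
    using pos'[OF that] by (simp_all add: s2 sa)
  have steep: "(real k - 2) / (real (n x) - 2) < real k / real (n x)" if "2 \<le> k" "k < n x" for k x
    using slope_less[of 0 2 "real k" "real (n x)"] that by simp
  have comp: "compatible n {1, 2, a, b} c c'"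
  proof (rule compatibleI)
    fix x y k assume xy: "x \<in> {1, 2, a, b}" "y \<in> {1, 2, a, b}" "x < y" "alive n x y k"
    show "separated n c c' x y k"
    proof (rule separated_xI)
      fix \<kappa> assume \<kappa>: "\<kappa> \<in> {k, Suc k}"
      have r: "start x \<le> \<kappa>" "start y \<le> \<kappa>" "\<kappa> \<le> n x" "\<kappa> \<le> n y" using xy(4) \<kappa> by (auto simp: alive_def)
      have "x = 1 \<and> y = 2 \<or> x = 1 \<and> y = a \<or> x = 1 \<and> y = b \<or> x = 2 \<and> y = a \<or> x = 2 \<and> y = b \<or> x = a \<and> y = b"
        using xy(1-3) lt by auto
      then consider "x = 1" "y = 2" | "x = 1" "y = a" | "x = 1" "y = b" | "x = 2" "y = a" | "x = 2" "y = b" | "x = a" "y = b"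
        by blast
      then show "joined n x y \<kappa> \<and> c x \<kappa> = c y \<kappa> \<and> c' x \<kappa> = c' y \<kappa> \<or> fst (c x \<kappa>) < fst (c y \<kappa>) \<and> fst (c' x \<kappa>) < fst (c' y \<kappa>)"
      proof cases
        case 1
        show ?thesis
        proof (cases "\<kappa> = n 1")
          case True
          then show ?thesis using 1 n cups ends by (simp add: joined_def c1 c2)
        next
          case False
          then show ?thesis using 1 r st n steep[of \<kappa> 1] by (simp add: c1 c2 s1 s2)
        qed
      next
        case 2
        then show ?thesis using r st n neg1[of \<kappa>] pos_a[of \<kappa>] by (auto simp: c1 ca)
      next
        case 3
        show ?thesis
        proof (cases "\<kappa> = 0")
          case True
          then show ?thesis using 3 st by (simp add: joined_def c1 cb s1 sb)
        next
          case False
          then show ?thesis using 3 neg1[of \<kappa>] pos_b[of \<kappa>] by (auto simp: c1 cb)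
        qed
      next
        case 4
        show ?thesis
        proof (cases "\<kappa> = 2")
          case True
          then show ?thesis using 4 st by (simp add: joined_def c2 ca s2 sa)
        next
          case False
          then show ?thesis using 4 r st neg2'[of \<kappa>] pos_a'[of \<kappa>] by (auto simp: c2 ca)
        qed
      next
        case 5
        then show ?thesis using r st neg2[of \<kappa>] pos_b[of \<kappa>] by (auto simp: c2 cb)
      next
        case 6
        show ?thesis
        proof (cases "\<kappa> = n a")
          case True
          then show ?thesis using 6 n cups ends by (simp add: joined_def ca cb)
        next
          case False
          then show ?thesis using 6 r st n steep[of \<kappa> a] by (simp add: ca cb sa sb)
        qed
      qed
    qed
  qed
  have n2: "2 < n j" if "j \<in> {1, 2, a, b}" for j using that n by auto
  have not2: "\<not> a \<le> 2" "\<not> b \<le> 2" using lt by auto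
  have cs: "curve n {1, 2, a, b} c' = (\<Union>j\<in>{1, 2, a, b}. closed_segment (0, 0, 2 - real (start j) / 2)
      (if j \<le> 2 then -1 else 1, 0, 2 - real (n j) / 2))"
    unfolding c'_def by (rule curve_straight) (rule n2)
  have "curve n {1, 2, a, b} c' = closed_segment (0, 0, 2) (-1, 0, 2 - real (n 1) / 2)
      \<union> closed_segment (0, 0, 1) (-1, 0, 2 - real (n 1) / 2)
      \<union> closed_segment (0, 0, 1) (1, 0, 2 - real (n a) / 2) \<union> closed_segment (0, 0, 2) (1, 0, 2 - real (n a) / 2)"
    unfolding cs by (simp add: st n not2 Un_assoc)
  also have "\<dots> = closed_segment (-1, 0, 2 - real (n 1) / 2) (0, 0, 2) \<union> closed_segment (0, 0, 2) (1, 0, 2 - real (n a) / 2)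
      \<union> closed_segment (-1, 0, 2 - real (n 1) / 2) (0, 0, 1) \<union> closed_segment (0, 0, 1) (1, 0, 2 - real (n a) / 2)"
    by (simp only: closed_segment_commute[of "(0, 0, _)" "(-1, 0, _)"]) blast
  finally have "is_unknot (to_S3 ` curve n {1, 2, a, b} c')"
    using quadrilateral_is_unknot[of 1 2 "2 - real (n 1) / 2" "2 - real (n a) / 2"] by simp
  moreover have "leads_to n {1, 2, a, b} c c'" using comp by (simp add: leads_to_def r_into_rtranclp)
  ultimately show ?thesis
    using leads_to_unknot[of n "{1, 2, a, b}" c c'] valid n2 unfolding c_def by blast
qed

text \<open>
  The cap of strands 3, 4 is to the left of the cap of strands 5, 6, and the crossing connects them to the
  cups 3, 5 and 4, 6. Strand 4 crosses strand 5 only, and behind it. So it is a layer of its own, and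
  moves independently of the other three strands, which keep their order from left to right. The caps of
  the quadrilateral are at -1 and 1, and the cups on the axis.
\<close>

lemma side_caps_unknot:
  assumes n: "n 3 = E1" "n 5 = E1" "n 4 = E2" "n 6 = E2" "2 * m + 2 < E1" "E1 < E2" and m: "2 \<le> m"
    and q: "q 3 = 1" "q 4 = 2" "q 5 = 3" "q 6 = 4"
    and \<alpha>: "\<alpha> 3 2 = (3/2, 0)" "\<alpha> 4 2 = (3/2, 0)" "\<alpha> 5 0 = \<alpha> 6 0"
      "\<alpha> 3 E1 = (3/2, 0)" "\<alpha> 5 E1 = (3/2, 0)" "\<alpha> 4 E2 = (7/2, 0)" "\<alpha> 6 E2 = (7/2, 0)"
    and valid: "compatible n {3, 4, 5, 6} (normal_form n \<alpha> (blanks m @ Some (2, False) # blanks m') q)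
       (normal_form n \<alpha> (blanks m @ Some (2, False) # blanks m') q)"
  shows "is_unknot (to_S3 ` curve n {3, 4, 5, 6} (normal_form n \<alpha> (blanks m @ Some (2, False) # blanks m') q))"
proof -
  define w where "w = blanks m @ Some (2, False) # blanks m'"
  define J where "J = {3, 4, 5, 6 :: nat}"
  define c where "c = normal_form n \<alpha> w q"
  \<comment> \<open>Caps over -1 and 1, and both cups over 0, the one of 4, 6 below that of 3, 5.\<close>
  define c' where "c' = straight n (\<lambda>j. if j \<le> 4 then -1 else 1) (\<lambda>_. 0)"
  have st: "start 3 = 2" "start 4 = 2" "start 5 = 0" "start 6 = 0" by (auto simp: start_def)
  have w: "place w p k = (if k \<le> 2 * m then (real p, 0) else if k = 2 * m + 1 then halfway (Some (2, False)) p
      else (real (move (Some (2, False)) p), 0))" for p k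
    by (auto simp: w_def place_blanks_append place_Cons)
  have c3: "c 3 k = (if k = 2 \<or> k = E1 then (3/2, 0) else (1, 0))"
    and c4: "c 4 k = (if k = 2 then (3/2, 0) else if k = E2 then (7/2, 0) else if k \<le> 2 * m then (2, 0)
      else if k = 2 * m + 1 then (5/2, 1/2) else (3, 0))"
    and c5: "c 5 k = (if k = 0 then \<alpha> 6 0 else if k = E1 then (3/2, 0) else if k \<le> 2 * m then (3, 0)
      else if k = 2 * m + 1 then (5/2, - 1/2) else (2, 0))"
    and c6: "c 6 k = (if k = 0 then \<alpha> 6 0 else if k = E2 then (7/2, 0) else (4, 0))" for k
    using \<alpha> n q st by (auto simp: c_def normal_form_def w halfway_def move_Some)
  have s3: "c' 3 k = (- 1 + (real k - 2) / (real E1 - 2), 0)"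
    and s4: "c' 4 k = (- 1 + (real k - 2) / (real E2 - 2), 0)"
    and s5: "c' 5 k = (1 - real k / real E1, 0)"
    and s6: "c' 6 k = (1 - real k / real E2, 0)" for k
    using st n by (simp_all add: c'_def straight_def)
  have E: "2 < E1" "2 < E2" using n by auto
  have J_cases: "j = 3 \<or> j = 4 \<or> j = 5 \<or> j = 6" if "j \<in> J" for j using that by (auto simp: J_def)
  have s35: "fst (c' 3 k) < fst (c' 5 k)" if "2 \<le> k" "k < E1" for k
  proof -
    have "(real k - 2) / (real E1 - 2) < 1" "real k / real E1 < 1" using that E by (auto simp: divide_simps)
    then show ?thesis by (simp add: s3 s5)
  qed
  have s56: "fst (c' 5 k) < fst (c' 6 k)" if "0 < k" for k
  proof -
    have "real k / real E2 < real k / real E1" using that n E by (intro divide_strict_left_mono) auto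
    then show ?thesis by (simp add: s5 s6)
  qed
  have s3_neg: "fst (c' 3 k) \<le> 0" if "k \<le> E1" for k
    using that E by (simp add: s3 divide_simps)
  have s4_neg: "fst (c' 4 k) < 0" if "k < E2" for k
    using that E by (simp add: s4 divide_simps)
  have s5_pos: "0 \<le> fst (c' 5 k)" if "k \<le> E1" for k
    using that E by (simp add: s5 divide_simps)
  have s6_pos: "0 < fst (c' 6 k)" if "k < E2" for k
    using that E by (simp add: s6 divide_simps)
  have s43: "fst (c' 4 k) < fst (c' 3 k)" if "2 < k" for k
  proof -
    have "(real k - 2) / (real E2 - 2) < (real k - 2) / (real E1 - 2)"
      using that n E by (intro divide_strict_left_mono) auto
    then show ?thesis by (simp add: s3 s4)
  qed
  have y0: "snd (c' j k) = 0" for j k by (simp add: c'_def straight_def)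
  let ?\<delta> = "\<lambda>j. if j = 4 then 1 else 0 :: real"
  have "(compatible n J)\<^sup>*\<^sup>* c c'" if valid: "compatible n J c c"
  proof (rule layered_isotopy[where \<delta> = ?\<delta> and I = "{2<..<E2}"])
    show "finite J" by (simp add: J_def)
    fix a b k
    assume ab: "a \<in> J" "b \<in> J"
    show "?\<delta> a = ?\<delta> b" if "joined n a b k" "k \<in> {2<..<E2}"
      using that J_cases[OF ab(1)] J_cases[OF ab(2)]
      by (elim disjE) (simp_all add: joined_def st n cup_def)
    assume al: "alive n a b k"
    then have r: "start a \<le> k" "start b \<le> k" "Suc k \<le> n a" "Suc k \<le> n b" by (auto simp: alive_def)
    {
      assume d: "?\<delta> a < ?\<delta> b" and kI: "k \<in> {2<..<E2} \<or> Suc k \<in> {2<..<E2}"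
      have b: "b = 4" using d by (auto split: if_splits)
      have a: "a = 3 \<or> a = 5 \<or> a = 6" using d b J_cases[OF ab(1)] by auto
      have k2: "2 \<le> k" using r b st by simp
      have kE: "Suc k \<le> E2" using r b n by simp
      have kE1: "Suc k \<le> E1" if "a \<noteq> 6" using r a that n by auto
      \<comment> \<open>Strand 4 is to the right of strand 3 and to the left of strand 6, and it changes from the left to the right of strand 5 at the crossing.\<close>
      define e where "e = (if a = 3 \<or> a = 5 \<and> 2 * m < k then 1 else -1 :: real)"
      have oc: "ordered_at n c c (e, 1) a b \<kappa>" if \<kappa>: "\<kappa> \<in> {k, Suc k}" for \<kappa>
      proof -
        have \<kappa>': "\<kappa> = k \<or> \<kappa> = Suc k" using \<kappa> by auto
        consider "a = 3" | "a = 5" | "a = 6" using a by blast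
        then show ?thesis
        proof cases
          case 1
          have "\<kappa> \<le> E1" using \<kappa>' kE1 1 by auto
          show ?thesis
          proof (cases "\<kappa> = 2")
            case True
            then show ?thesis using 1 b by (simp add: ordered_at_def joined_def st gap_def c3 c4)
          next
            case False
            then show ?thesis using 1 b \<kappa>' k2 \<open>\<kappa> \<le> E1\<close> n
              by (intro ordered_at_frontI) (auto simp: e_def gap_def c3 c4)
          qed
        next
          case 2
          have "\<kappa> \<le> E1" using \<kappa>' kE1 2 by auto
          then show ?thesis using 2 b \<kappa>' k2 n m
            by (intro ordered_at_frontI) (auto simp: e_def gap_def c4 c5)
        next
          case 3
          show ?thesis
          proof (cases "\<kappa> = E2")
            case True
            then show ?thesis using 3 b n E by (simp add: ordered_at_def joined_def gap_def c4 c6 cup_def)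
          next
            case False
            then show ?thesis using 3 b \<kappa>' k2 kE n
              by (intro ordered_at_frontI) (auto simp: e_def gap_def c4 c6)
          qed
        qed
      qed
      have oc': "ordered_at n c' c' (-1, 1) a b \<kappa>" if \<kappa>: "\<kappa> \<in> {k, Suc k}" for \<kappa>
      proof -
        have \<kappa>': "\<kappa> = k \<or> \<kappa> = Suc k" using \<kappa> by auto
        consider "a = 3" | "a = 5" | "a = 6" using a by blast
        then show ?thesis
        proof cases
          case 1
          show ?thesis
          proof (cases "\<kappa> = 2")
            case True
            then show ?thesis using 1 b by (simp add: ordered_at_def joined_def st gap_def s3 s4)
          next
            case False
            then show ?thesis using 1 b \<kappa>' k2 s43[of \<kappa>] y0
              by (intro ordered_at_frontI) (auto simp: gap_def)
          qed
        next
          case 2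
          have "\<kappa> \<le> E1" using \<kappa>' kE1 2 by auto
          then show ?thesis using 2 b n s4_neg[of \<kappa>] s5_pos[of \<kappa>] y0
            by (intro ordered_at_frontI) (auto simp: gap_def)
        next
          case 3
          show ?thesis
          proof (cases "\<kappa> = E2")
            case True
            then show ?thesis using 3 b n E by (simp add: ordered_at_def joined_def gap_def s4 s6 cup_def)
          next
            case False
            then show ?thesis using 3 b \<kappa>' kE s4_neg[of \<kappa>] s6_pos[of \<kappa>] y0
              by (intro ordered_at_frontI) (auto simp: gap_def)
          qed
        qed
      qed
      show "in_front n c a b k \<and> in_front n c' a b k"
        unfolding in_front_def using oc oc' by blast
      fix \<kappa> assume \<kappa>: "\<kappa> \<in> {k, Suc k}" "\<kappa> \<notin> {2<..<E2}"
      then have "\<kappa> = 2 \<or> \<kappa> = E2" using k2 kE by auto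
      then show "\<exists>\<epsilon>. ordered_at n c c' (\<epsilon>, 1) a b \<kappa>"
      proof
        assume 2: "\<kappa> = 2"
        show ?thesis
        proof (cases "a = 3")
          case True
          then show ?thesis using 2 b by (simp add: ordered_at_def joined_def st gap_def c3 c4 s3 s4)
        next
          case False
          then have "a = 5 \<or> a = 6" using a by auto
          then have "fst (c a 2) > 2 \<and> snd (c a 2) = 0 \<and> fst (c' a 2) > 0 \<and> snd (c' a 2) = 0"
            using n E m y0 s6_pos[of 2] s56[of 2] s35[of 2] by (auto simp: c5 c6 s5 divide_simps)
          then show ?thesis using 2 b y0 s4_neg[of 2] E
            by (intro exI[of _ "-1"] ordered_at_frontI) (auto simp: gap_def c4)
        qed
      next
        assume e: "\<kappa> = E2"
        then have "a = 6" using a \<kappa>(1) kE1 n kE by auto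
        then show ?thesis using e b n E by (simp add: ordered_at_def joined_def gap_def c4 c6 s4 s6 cup_def)
      qed
    }
    assume ne: "a \<noteq> b" and same: "?\<delta> a = ?\<delta> b \<or> k \<notin> {2<..<E2} \<and> Suc k \<notin> {2<..<E2}"
    have base: "separated n c c' x y k"
      if xy: "x < y" "x \<in> {3, 5, 6}" "y \<in> {3, 5, 6}" "alive n x y k" for x y
    proof (rule separated_xI)
      fix \<kappa> assume \<kappa>: "\<kappa> \<in> {k, Suc k}"
      have r: "start x \<le> \<kappa>" "start y \<le> \<kappa>" "\<kappa> \<le> n x" "\<kappa> \<le> n y" using xy(4) \<kappa> by (auto simp: alive_def)
      consider "x = 3" "y = 5" | "x = 3" "y = 6" | "x = 5" "y = 6" using xy(1-3) by auto
      then show "joined n x y \<kappa> \<and> c x \<kappa> = c y \<kappa> \<and> c' x \<kappa> = c' y \<kappa> \<or> fst (c x \<kappa>) < fst (c y \<kappa>) \<and> fst (c' x \<kappa>) < fst (c' y \<kappa>)"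
      proof cases
        case 1
        show ?thesis
        proof (cases "\<kappa> = E1")
          case True
          then show ?thesis using 1 n E by (simp add: joined_def cup_def c3 c5 s3 s5)
        next
          case False
          then show ?thesis using 1 r st n m s35[of \<kappa>] by (auto simp: c3 c5)
        qed
      next
        case 2
        then show ?thesis using r st n E s3_neg[of \<kappa>] s6_pos[of \<kappa>] by (auto simp: c3 c6)
      next
        case 3
        show ?thesis
        proof (cases "\<kappa> = 0")
          case True
          then show ?thesis using 3 by (simp add: joined_def st c5 c6 s5 s6)
        next
          case False
          then show ?thesis using 3 r n s56[of \<kappa>] by (auto simp: c5 c6)
        qed
      qed
    qed
    have "\<not> (k \<notin> {2<..<E2} \<and> Suc k \<notin> {2<..<E2})" if "a = 4 \<or> b = 4"
      using that r st n E by auto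
    then have "a \<noteq> 4" "b \<noteq> 4" using same ne by (auto split: if_splits)
    then have "a \<in> {3, 5, 6}" "b \<in> {3, 5, 6}" using J_cases ab by auto
    then show "separated n c c' a b k"
      using base[of a b] base[of b a] ne al separated_swap alive_commute linorder_neqE_nat by metis
  qed
  then have lead: "leads_to n J c c'" by (simp add: leads_to_def)
  have n2: "2 < n j" if "j \<in> J" for j using that n E by (auto simp: J_def)
  have cs: "curve n J c' = (\<Union>j\<in>J. closed_segment (if j \<le> 4 then -1 else 1, 0, 2 - real (start j) / 2)
      (0, 0, 2 - real (n j) / 2))"
    unfolding c'_def by (rule curve_straight) (rule n2)
  have "curve n J c' = closed_segment (-1, 0, 1) (0, 0, 2 - real E1 / 2) \<union> closed_segment (-1, 0, 1) (0, 0, 2 - real E2 / 2)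
      \<union> closed_segment (1, 0, 2) (0, 0, 2 - real E1 / 2) \<union> closed_segment (1, 0, 2) (0, 0, 2 - real E2 / 2)"
    unfolding cs by (simp add: J_def st n Un_assoc)
  also have "\<dots> = closed_segment (-1, 0, 1) (0, 0, 2 - real E1 / 2) \<union> closed_segment (0, 0, 2 - real E1 / 2) (1, 0, 2)
      \<union> closed_segment (-1, 0, 1) (0, 0, 2 - real E2 / 2) \<union> closed_segment (0, 0, 2 - real E2 / 2) (1, 0, 2)"
    by (simp only: closed_segment_commute[of "(1, 0, _)" "(0, 0, _)"]) blast
  finally have "is_unknot (to_S3 ` curve n J c')"
    using quadrilateral_is_unknot[of "2 - real E2 / 2" "2 - real E1 / 2" 1 2] n by simp
  then show ?thesis
    using leads_to_unknot[OF lead] valid n2 unfolding c_def w_def J_def by blast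
qed

section \<open>Deleting strands from a braid word\<close>

text \<open>
  The strands in \<open>Js\<close> have the positions \<open>q\<close> among all strands and the positions
  \<open>r\<close> after the others have been deleted. A crossing survives if both of its strands belong
  to \<open>Js\<close>, and leaves a blank otherwise.
\<close>

fun delete :: "nat list \<Rightarrow> (nat \<Rightarrow> nat) \<Rightarrow> (nat \<Rightarrow> nat) \<Rightarrow> braid_word \<Rightarrow> padded_word" where
  "delete Js q r [] = []"
| "delete Js q r ((i, f) # w) =
    (case (find (\<lambda>a. q a = i) Js, find (\<lambda>b. q b = i + 1) Js) of
       (Some a, Some b) \<Rightarrow> Some (r a, f) # delete Js (\<lambda>l. move (Some (i, f)) (q l)) (\<lambda>l. move (Some (r a, f)) (r l)) w
     | _ \<Rightarrow> None # delete Js (\<lambda>l. move (Some (i, f)) (q l)) r w)"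

lemma delete_cross:
  assumes "a \<in> set Js" "b \<in> set Js" "q a = i" "q b = i + 1" "inj_on q (set Js)"
  shows "delete Js q r ((i, f) # w) =
    Some (r a, f) # delete Js (\<lambda>l. move (Some (i, f)) (q l)) (\<lambda>l. move (Some (r a, f)) (r l)) w"
proof -
  have "find (\<lambda>x. q x = q c) Js = Some c" if "c \<in> set Js" for c
  proof (cases "find (\<lambda>x. q x = q c) Js")
    case None then show ?thesis using that by (auto simp: find_None_iff)
  next
    case (Some d)
    then have "d \<in> set Js" "q d = q c" by (auto simp: find_Some_iff)
    then show ?thesis using Some that assms(5) by (auto dest: inj_onD)
  qed
  from this[OF assms(1)] this[OF assms(2)] show ?thesis using assms by simp
qed

lemma delete_skip:
  assumes "\<not> (\<exists>a\<in>set Js. \<exists>b\<in>set Js. q a = i \<and> q b = i + 1)"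
  shows "delete Js q r ((i, f) # w) = None # delete Js (\<lambda>l. move (Some (i, f)) (q l)) r w"
proof (cases "find (\<lambda>a. q a = i) Js")
  case (Some a)
  then have "a \<in> set Js" "q a = i" by (auto simp: find_Some_iff)
  then have "find (\<lambda>b. q b = i + 1) Js = None" using assms unfolding find_None_iff by blast
  then show ?thesis using Some by simp
qed simp

lemma length_delete [simp]: "length (delete Js q r w) = length w"
  by (induction Js q r w rule: delete.induct) (auto split: option.splits)

lemma delete_append:
  "delete Js q r (u @ v) = delete Js q r u @ delete Js (\<lambda>l. moves (map Some u) (q l)) (\<lambda>l. moves (delete Js q r u) (r l)) v"
proof (induction u arbitrary: q r)
  case (Cons x u)
  obtain i f where x: "x = (i, f)" by force
  show ?case unfolding x append_Cons delete.simps list.map(2) moves_simps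
    by (auto simp: Cons.IH split: option.splits)
qed simp

lemma delete_cong:
  assumes "\<And>l. l \<in> set Js \<Longrightarrow> q l = q' l" "\<And>l. l \<in> set Js \<Longrightarrow> r l = r' l"
  shows "delete Js q r w = delete Js q' r' w"
  using assms
proof (induction w arbitrary: q r q' r')
  case (Cons x w)
  obtain i f where x: "x = (i, f)" by force
  have e: "find (\<lambda>a. q a = k) Js = find (\<lambda>a. q' a = k) Js" for k
    using Cons.prems(1) by (intro find_cong) auto
  have s: "a \<in> set Js" if "find P Js = Some a" for a P using that by (auto simp: find_Some_iff)
  have 1: "delete Js (\<lambda>l. move y (q l)) r w = delete Js (\<lambda>l. move y (q' l)) r' w" for y
    using Cons.prems by (intro Cons.IH) auto
  have 2: "delete Js (\<lambda>l. move y (q l)) (\<lambda>l. move z (r l)) w = delete Js (\<lambda>l. move y (q' l)) (\<lambda>l. move z (r' l)) w" for y z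
    using Cons.prems by (intro Cons.IH) auto
  show ?case unfolding x delete.simps e 1 2
    using Cons.prems(2) by (auto simp: 1 2 split: option.splits dest!: s)
qed simp

declare delete.simps(2) [simp del]

text \<open>
  The positions \<open>r\<close> arise from \<open>q\<close> by closing the gaps: they have the same order
  and are consecutive.
\<close>

definition same_order :: "nat set \<Rightarrow> (nat \<Rightarrow> nat) \<Rightarrow> (nat \<Rightarrow> nat) \<Rightarrow> bool" where
  "same_order J q r \<longleftrightarrow> inj_on q J \<and> (\<forall>a\<in>J. \<forall>b\<in>J. q a < q b \<longleftrightarrow> r a < r b) \<and>
     (\<forall>a\<in>J. \<forall>b\<in>J. \<forall>z. r a < z \<longrightarrow> z < r b \<longrightarrow> z \<in> r ` J)"

lemma same_order_adjacent:
  assumes "same_order J q r" "a \<in> J" "b \<in> J" "q b = q a + 1"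
  shows "r b = r a + 1"
proof (rule ccontr)
  assume "r b \<noteq> r a + 1"
  moreover have "r a < r b"
  proof -
    have "q a < q b" using assms(4) by simp
    then show ?thesis using assms(1-3) unfolding same_order_def by blast
  qed
  ultimately have less: "r a < r a + 1" "r a + 1 < r b" by auto
  have "\<forall>z. r a < z \<longrightarrow> z < r b \<longrightarrow> z \<in> r ` J" using assms(1-3) unfolding same_order_def by blast
  then have "r a + 1 \<in> r ` J" using less by blast
  then obtain d where "d \<in> J" "r d = r a + 1" by (auto elim!: imageE)
  then have "q a < q d" "q d < q b" using assms(1-3) less by (auto simp: same_order_def)
  then show False using assms(4) by simp
qed

lemma halfway_less:
  assumes "p < p'" "\<not> (p = i \<and> p' = i + 1)"
  shows "fst (halfway (Some (i, f)) p) < fst (halfway (Some (i, f)) p')" "move (Some (i, f)) p < move (Some (i, f)) p'"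
proof -
  have "real p + 1 \<le> real p'" using assms(1) by linarith
  then show "fst (halfway (Some (i, f)) p) < fst (halfway (Some (i, f)) p')" using assms by (auto simp: halfway_def)
  show "move (Some (i, f)) p < move (Some (i, f)) p'" using assms by (auto simp: move_Some)
qed

lemma same_order_skip:
  assumes so: "same_order J q r" and no: "\<not> (\<exists>a\<in>J. \<exists>b\<in>J. q a = i \<and> q b = i + 1)"
  shows "same_order J (\<lambda>l. move (Some (i, f)) (q l)) r"
proof -
  have "(move (Some (i, f)) (q a) < move (Some (i, f)) (q b)) = (q a < q b)" if "a \<in> J" "b \<in> J" for a b
    using halfway_less(2)[of "q a" "q b" i f] halfway_less(2)[of "q b" "q a" i f] no that
    by (metis linorder_less_linear order_less_asym)
  then show ?thesis using so by (auto simp: same_order_def inj_on_def move_inj)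
qed

lemma same_order_cross:
  assumes so: "same_order J q r" and ab: "a \<in> J" "b \<in> J" "q a = i" "q b = i + 1"
  shows "same_order J (\<lambda>l. move (Some (i, f)) (q l)) (\<lambda>l. move (Some (r a, f)) (r l))"
proof -
  have rb: "r b = r a + 1" using same_order_adjacent[OF so ab(1,2)] ab(3,4) by simp
  have inj: "q x = q y \<longleftrightarrow> x = y" if "x \<in> J" "y \<in> J" for x y using so that by (auto simp: same_order_def inj_on_def)
  have rinj: "r x = r y \<longleftrightarrow> x = y" if "x \<in> J" "y \<in> J" for x y
    using so that inj[OF that] unfolding same_order_def by (metis less_irrefl_nat linorder_neqE_nat)
  have ord: "(move (Some (i, f)) (q x) < move (Some (i, f)) (q y)) = (move (Some (r a, f)) (r x) < move (Some (r a, f)) (r y))"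
    if xy: "x \<in> J" "y \<in> J" "q x < q y" for x y
  proof (cases "x = a \<and> y = b")
    case True
    then show ?thesis using ab rb by (simp add: move_Some)
  next
    case False
    then have "\<not> (q x = i \<and> q y = i + 1)" "\<not> (r x = r a \<and> r y = r a + 1)"
      using inj[OF xy(1) ab(1)] inj[OF xy(2) ab(2)] rinj[OF xy(1) ab(1)] rinj[OF xy(2) ab(2)] ab rb by auto
    moreover have "r x < r y" using so xy by (auto simp: same_order_def)
    ultimately show ?thesis using halfway_less(2)[of "q x" "q y" i f] halfway_less(2)[of "r x" "r y" "r a" f] xy(3) by simp
  qed
  have img: "(\<lambda>l. move (Some (r a, f)) (r l)) ` J = r ` J"
  proof
    show "(\<lambda>l. move (Some (r a, f)) (r l)) ` J \<subseteq> r ` J"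
      using ab rb by (auto simp: move_Some) (metis image_eqI)+
    show "r ` J \<subseteq> (\<lambda>l. move (Some (r a, f)) (r l)) ` J"
    proof
      fix z assume "z \<in> r ` J"
      then obtain c where c: "c \<in> J" "z = r c" by auto
      have "z = move (Some (r a, f)) (r (if c = a then b else if c = b then a else c))"
        using c rinj[OF c(1) ab(1)] rinj[OF c(1) ab(2)] rb by (auto simp: move_Some)
      then show "z \<in> (\<lambda>l. move (Some (r a, f)) (r l)) ` J" using c ab by auto
    qed
  qed
  have ord': "(move (Some (i, f)) (q x) < move (Some (i, f)) (q y)) = (move (Some (r a, f)) (r x) < move (Some (r a, f)) (r y))"
    if xy: "x \<in> J" "y \<in> J" for x y
  proof -
    consider "x = y" | "q x < q y" | "q y < q x" using inj[OF xy] by linarith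
    then show ?thesis
    proof cases
      case 3
      then have "move (Some (i, f)) (q x) \<noteq> move (Some (i, f)) (q y)" "move (Some (r a, f)) (r x) \<noteq> move (Some (r a, f)) (r y)"
        using rinj[OF xy] by (auto simp: move_inj)
      then show ?thesis using ord[OF xy(2,1) 3] by linarith
    qed (use ord[OF xy] in auto)
  qed
  show ?thesis unfolding same_order_def
  proof (intro conjI ballI allI impI)
    show "inj_on (\<lambda>l. move (Some (i, f)) (q l)) J" using so by (auto simp: same_order_def inj_on_def move_inj)
    fix x y z assume xy: "x \<in> J" "y \<in> J" and z: "move (Some (r a, f)) (r x) < z" "z < move (Some (r a, f)) (r y)"
    obtain x' y' where x': "x' \<in> J" "r x' = move (Some (r a, f)) (r x)" and y': "y' \<in> J" "r y' = move (Some (r a, f)) (r y)"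
      using img xy by (metis (no_types, lifting) imageE image_eqI)
    have "z \<in> r ` J" using so x' y' z unfolding same_order_def by metis
    then show "z \<in> (\<lambda>l. move (Some (r a, f)) (r l)) ` J" by (simp only: img)
  qed (use ord' in auto)
qed

lemma same_order_delete:
  "same_order (set Js) q r \<Longrightarrow> same_order (set Js) (\<lambda>l. moves (map Some w) (q l)) (\<lambda>l. moves (delete Js q r w) (r l))"
proof (induction w arbitrary: q r)
  case (Cons x w)
  obtain i f where x: "x = (i, f)" by force
  have inj: "inj_on q (set Js)" using Cons.prems by (simp add: same_order_def)
  show ?case
  proof (cases "\<exists>a\<in>set Js. \<exists>b\<in>set Js. q a = i \<and> q b = i + 1")
    case True
    then obtain a b where ab: "a \<in> set Js" "b \<in> set Js" "q a = i" "q b = i + 1" by blast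
    show ?thesis using Cons.IH[OF same_order_cross[OF Cons.prems ab, of f]]
      unfolding x delete_cross[OF ab inj] list.map(2) moves_simps .
  next
    case False
    show ?thesis using Cons.IH[OF same_order_skip[OF Cons.prems False, of f]]
      unfolding x delete_skip[OF False] list.map(2) moves_simps move_None .
  qed
qed simp

text \<open>
  The separation that \<open>compatible\<close> demands between two strands, for the strands of
  \<open>w\<close> and those of \<open>W\<close> at the same level.
\<close>

definition place_sep :: "real \<times> real \<Rightarrow> braid_word \<Rightarrow> padded_word \<Rightarrow> nat \<Rightarrow> nat \<Rightarrow> nat \<Rightarrow> nat \<Rightarrow> nat \<Rightarrow> bool" where
  "place_sep l w W p p' s s' k \<longleftrightarrow> l \<bullet> (place (map Some w) p' k - place (map Some w) p k) > 0 \<and> l \<bullet> (place W s' k - place W s k) > 0"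

text \<open>
  Closing the gaps is a straight-line motion that preserves the order from left to right on integer
  levels. In the middle of a crossing, two strands have the same horizontal coordinate only if they cross
  each other, in which case they do so before and after the deletion with the same strand in front.
\<close>

lemma delete_separated:
  assumes "same_order (set Js) q r" "a \<in> set Js" "b \<in> set Js" "q a < q b \<or> q b < q a" "k < 2 * length w"
  shows "\<exists>l. \<forall>\<kappa>\<in>{k, Suc k}. place_sep l w (delete Js q r w) (q a) (q b) (r a) (r b) \<kappa>"
  using assms
proof (induction w arbitrary: q r k)
  case (Cons x w)
  obtain i f where x: "x = (i, f)" by force
  define q' where "q' l = move (Some (i, f)) (q l)" for l
  have inj: "inj_on q (set Js)" using Cons.prems by (simp add: same_order_def)
  have swap: "place_sep l w W p' p s' s \<kappa> = place_sep (- l) w W p p' s s' \<kappa>" for l w W p p' s s' \<kappa>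
    by (auto simp: place_sep_def inner_diff_right)
  obtain y r' where del: "delete Js q r (x # w) = y # delete Js q' r' w" and so: "same_order (set Js) q' r'"
    and r': "\<And>l. r' l = move y (r l)"
    and y: "y = None \<and> \<not> (\<exists>a\<in>set Js. \<exists>b\<in>set Js. q a = i \<and> q b = i + 1) \<or>
       (\<exists>c\<in>set Js. \<exists>d\<in>set Js. q c = i \<and> q d = i + 1 \<and> r d = r c + 1 \<and> y = Some (r c, f))"
  proof (cases "\<exists>a\<in>set Js. \<exists>b\<in>set Js. q a = i \<and> q b = i + 1")
    case True
    then obtain c d where cd: "c \<in> set Js" "d \<in> set Js" "q c = i" "q d = i + 1" by blast
    have "r d = r c + 1" using same_order_adjacent[OF Cons.prems(1) cd(1,2)] cd by simp
    then show ?thesis using that[of "Some (r c, f)" "\<lambda>l. move (Some (r c, f)) (r l)"] cd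
        delete_cross[OF cd inj, of r f w] same_order_cross[OF Cons.prems(1) cd, of f]
      unfolding x q'_def by blast
  next
    case False
    then show ?thesis using that[of None r] delete_skip[OF False, of r f w] same_order_skip[OF Cons.prems(1) False, of f]
      unfolding x q'_def by simp
  qed
  show ?case
  proof (cases "k < 2")
    case False
    then obtain k' where k: "k = Suc (Suc k')" by (metis add_2_eq_Suc le_Suc_ex linorder_not_less)
    have "\<exists>l. \<forall>\<kappa>\<in>{k', Suc k'}. place_sep l w (delete Js q' r' w) (q' a) (q' b) (r' a) (r' b) \<kappa>"
    proof (rule Cons.IH[OF so Cons.prems(2,3)])
      have "q' a \<noteq> q' b" using Cons.prems(4) by (auto simp: q'_def move_inj)
      then show "q' a < q' b \<or> q' b < q' a" by linarith
      show "k' < 2 * length w" using Cons.prems(5) k by simp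
    qed
    then show ?thesis unfolding del k unfolding x by (simp add: place_sep_def r' q'_def)
  next
    case True
    have main: "\<exists>l. \<forall>\<kappa>\<in>{k, Suc k}. place_sep l (x # w) (y # delete Js q' r' w) (q a) (q b) (r a) (r b) \<kappa>"
      if ab: "a \<in> set Js" "b \<in> set Js" "q a < q b" for a b
    proof -
      have rab: "r a < r b" using Cons.prems(1) ab by (auto simp: same_order_def)
      have pl: "place (map Some (x # w)) p 0 = (real p, 0)" "place (map Some (x # w)) p 1 = halfway (Some (i, f)) p"
        "place (map Some (x # w)) p 2 = (real (move (Some (i, f)) p), 0)"
        "place (y # delete Js q' r' w) p 0 = (real p, 0)" "place (y # delete Js q' r' w) p 1 = halfway y p"
        "place (y # delete Js q' r' w) p 2 = (real (move y p), 0)" for p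
        by (simp_all add: x place_Cons)
      have k: "k = 0 \<or> k = 1" using True by auto
      show ?thesis
      proof (cases "q a = i \<and> q b = i + 1")
        case True
        then have "\<not> (y = None \<and> \<not> (\<exists>a\<in>set Js. \<exists>b\<in>set Js. q a = i \<and> q b = i + 1))" using ab by blast
        then obtain c d where cd: "c \<in> set Js" "d \<in> set Js" "q c = i" "q d = i + 1" "r d = r c + 1" "y = Some (r c, f)" using y by blast
        have cd': "c = a" "d = b"
          using inj_onD[OF inj, of c a] inj_onD[OF inj, of d b] True ab cd by simp_all
        have ra: "r b = Suc (r a)" "y = Some (r a, f)" using cd cd' by auto
        have qa: "q a = i" "q b = Suc i" using True by auto
        let ?l = "(if k = 0 then 1 else -1, if f then 1 else -1) :: real \<times> real"
        have "place_sep ?l (x # w) (y # delete Js q' r' w) (q a) (q b) (r a) (r b) \<kappa>" if "\<kappa> \<in> {k, Suc k}" for \<kappa>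
        proof -
          have "\<kappa> = 0 \<and> k = 0 \<or> \<kappa> = 1 \<or> \<kappa> = 2 \<and> k = 1" using that k by auto
          then show ?thesis unfolding place_sep_def
            by (elim disjE conjE) (simp_all only: pl, simp_all add: ra qa move_Some inner_prod_def)
        qed
        then show ?thesis by blast
      next
        case False
        have x1: "fst (halfway (Some (i, f)) (q a)) < fst (halfway (Some (i, f)) (q b))" "move (Some (i, f)) (q a) < move (Some (i, f)) (q b)"
          using halfway_less[OF ab(3) False] by auto
        have x2: "fst (halfway y (r a)) < fst (halfway y (r b)) \<and> move y (r a) < move y (r b)"
        proof (cases y)
          case None
          then show ?thesis using rab by simp
        next
          case (Some z)
          then obtain c d where cd: "c \<in> set Js" "d \<in> set Js" "q c = i" "q d = i + 1" "r d = r c + 1" "y = Some (r c, f)" using y by auto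
          have "\<not> (r a = r c \<and> r b = r c + 1)"
          proof
            assume "r a = r c \<and> r b = r c + 1"
            then have "r a = r c" "r b = r d" using cd by auto
            then have "q a = q c" "q b = q d"
              using Cons.prems(1) ab cd unfolding same_order_def by (metis less_irrefl_nat linorder_neqE_nat)+
            then show False using False cd by simp
          qed
          then show ?thesis using halfway_less[OF rab] cd(6) by simp
        qed
        have "place_sep (1, 0) (x # w) (y # delete Js q' r' w) (q a) (q b) (r a) (r b) \<kappa>" if "\<kappa> \<in> {k, Suc k}" for \<kappa>
        proof -
          have "\<kappa> = 0 \<or> \<kappa> = 1 \<or> \<kappa> = 2" using that k by auto
          then show ?thesis unfolding place_sep_def using x1 x2 rab ab
            by (elim disjE) (simp_all only: pl, simp_all add: inner_prod_def)
        qed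
        then show ?thesis by blast
      qed
    qed
    show ?thesis
    proof (cases "q a < q b")
      case True
      then show ?thesis using main[OF Cons.prems(2,3)] by (simp only: del)
    next
      case False
      then have "q b < q a" using Cons.prems(4) by simp
      from main[OF Cons.prems(3,2) this] obtain l where
        "\<forall>\<kappa>\<in>{k, Suc k}. place_sep l (x # w) (y # delete Js q' r' w) (q b) (q a) (r b) (r a) \<kappa>" by blast
      then show ?thesis unfolding del swap[of _ _ _ "q b"] by blast
    qed
  qed
qed simp

lemma delete_all:
  assumes "inj_on q (set Js)" "q ` set Js = {1..4}" "\<And>l. l \<in> set Js \<Longrightarrow> r l = q l" "w \<in> braid_words 4"
  shows "delete Js q r w = map Some w"
  using assms
proof (induction w arbitrary: q r)
  case (Cons x w)
  obtain i f where x: "x = (i, f)" by force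
  have i: "1 \<le> i" "i \<le> 3" and w: "w \<in> braid_words 4" using Cons.prems(4) by (auto simp: x braid_words_def)
  have "i \<in> q ` set Js" "i + 1 \<in> q ` set Js" unfolding Cons.prems(2) using i by auto
  then obtain a b where ab: "a \<in> set Js" "b \<in> set Js" "q a = i" "q b = i + 1" by auto
  have "delete Js (\<lambda>l. move (Some (i, f)) (q l)) (\<lambda>l. move (Some (r a, f)) (r l)) w = map Some w"
  proof (rule Cons.IH)
    show "inj_on (\<lambda>l. move (Some (i, f)) (q l)) (set Js)" using Cons.prems(1) by (auto simp: inj_on_def move_inj)
    have "move (Some (i, f)) ` {1..4} = {1..4}" using moves_image[of "[Some (i, f)]"] i by simp
    then show "(\<lambda>l. move (Some (i, f)) (q l)) ` set Js = {1..4}" using Cons.prems(2) by (metis image_image)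
  qed (use Cons.prems(3) ab w in auto)
  then show ?case unfolding x delete_cross[OF ab Cons.prems(1)] using Cons.prems(3) ab by simp
qed simp

section \<open>Words that cancel in the free group\<close>

definition signs :: "padded_word \<Rightarrow> int" where
  "signs W = sum_list (map (\<lambda>x. case x of None \<Rightarrow> 0 | Some (i, f) \<Rightarrow> if f then 1 else -1) W)"

definition writhe :: "braid_word \<Rightarrow> int" where
  "writhe w = sum_list (map (\<lambda>(i, f). if f then 1 else -1) w)"

lemma signs_simps [simp]: "signs [] = 0" "signs (None # W) = signs W"
  "signs (Some (i, f) # W) = (if f then 1 else -1) + signs W" "signs (U @ V) = signs U + signs V"
  by (simp_all add: signs_def)

lemma writhe_simps [simp]: "writhe [] = 0" "writhe ((i, f) # w) = (if f then 1 else -1) + writhe w"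
  "writhe (u @ v) = writhe u + writhe v"
  by (simp_all add: writhe_def)

lemma trivial_blanks: "trivial_word (blanks m)"
proof (induction m)
  case (Suc m)
  then show ?case using trivial_word.append[OF trivial_word.blank] by simp
qed (simp add: trivial_word.nil)

text \<open>
  The first letter at which the partial sums of the exponents, started at \<open>h\<close>, become
  negative.
\<close>

lemma first_return:
  assumes "set W \<subseteq> {None, Some (i, True), Some (i, False)}" "0 \<le> h" "h + (if f then signs W else - signs W) < 0"
  shows "\<exists>U V. W = U @ Some (i, \<not> f) # V \<and> h + (if f then signs U else - signs U) = 0"
  using assms
proof (induction W arbitrary: h)
  case (Cons x W)
  have W: "set W \<subseteq> {None, Some (i, True), Some (i, False)}" using Cons.prems(1) by simp
  consider "x = None" | "x = Some (i, f)" | "x = Some (i, \<not> f)" "h = 0" | "x = Some (i, \<not> f)" "0 < h"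
    using Cons.prems(1,2) by (cases f; cases "h = 0") auto
  then show ?case
  proof cases
    case 1
    with Cons.IH[OF W Cons.prems(2)] Cons.prems(3)[unfolded 1 signs_simps] obtain U V where "W = U @ Some (i, \<not> f) # V" "h + (if f then signs U else - signs U) = 0"
      by auto
    then show ?thesis using 1 by - (rule exI[of _ "x # U"], rule exI[of _ V], auto split: if_splits)
  next
    case 2
    with Cons.IH[OF W, of "h + 1"] Cons.prems(2) Cons.prems(3)[unfolded 2 signs_simps] obtain U V where "W = U @ Some (i, \<not> f) # V" "h + 1 + (if f then signs U else - signs U) = 0"
      by (auto split: if_splits)
    then show ?thesis using 2 by - (rule exI[of _ "x # U"], rule exI[of _ V], auto split: if_splits)
  next
    case 3
    then show ?thesis by - (rule exI[of _ "[]"], rule exI[of _ W], simp)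
  next
    case 4
    with Cons.IH[OF W, of "h - 1"] Cons.prems(2) Cons.prems(3)[unfolded 4 signs_simps] obtain U V where "W = U @ Some (i, \<not> f) # V" "h - 1 + (if f then signs U else - signs U) = 0"
      by (auto split: if_splits)
    then show ?thesis using 4 by - (rule exI[of _ "x # U"], rule exI[of _ V], auto split: if_splits)
  qed
qed (auto split: if_splits)

text \<open>
  The first letter cancels against the letter at which the exponent sum first returns to zero. Both the
  word between them and the rest of the word are again balanced.
\<close>

lemma balanced_trivial:
  assumes "set W \<subseteq> {None, Some (i, True), Some (i, False)}" "signs W = 0" "1 \<le> i" "i \<le> 3"
  shows "trivial_word W"
  using assms(1,2)
proof (induction "length W" arbitrary: W rule: less_induct)
  case less
  show ?case
  proof (cases W)
    case Nil
    then show ?thesis by (simp add: trivial_word.nil)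
  next
    case (Cons x W')
    show ?thesis
    proof (cases x)
      case None
      then have "trivial_word W'" using less Cons by auto
      then show ?thesis using trivial_word.append[OF trivial_word.blank] Cons None by simp
    next
      case (Some y)
      then obtain f where x: "x = Some (i, f)" using less.prems(1) Cons by auto
      have "0 + (if f then signs W' else - signs W') < 0" using less.prems(2) Cons x by (auto split: if_splits)
      then obtain U V where UV: "W' = U @ Some (i, \<not> f) # V" "signs U = 0"
        using first_return[of W' i 0 f] less.prems(1) Cons by (auto split: if_splits)
      have "trivial_word U" using less Cons UV by auto
      moreover have "trivial_word V"
        using less.prems UV Cons x by (intro less.hyps) (auto split: if_splits)
      ultimately have "trivial_word ((Some (i, f) # U @ [Some (i, \<not> f)]) @ V)"
        using trivial_word.cancel[OF assms(3,4)] trivial_word.append by blast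
      then show ?thesis using Cons x UV by simp
    qed
  qed
qed

definition erase :: "padded_word \<Rightarrow> braid_word" where
  "erase W = concat (map (\<lambda>x. case x of None \<Rightarrow> [] | Some y \<Rightarrow> [y]) W)"

lemma erase_simps [simp]: "erase [] = []" "erase (None # W) = erase W" "erase (Some y # W) = y # erase W"
  "erase (U @ V) = erase U @ erase V"
  by (simp_all add: erase_def)

lemma braid_inverse_Cons: "braid_inverse ((i, f) # w) = braid_inverse w @ [(i, \<not> f)]"
  by (simp add: braid_inverse_def)

text \<open>
  The letters of \<open>X\<close> cancel one by one against those of the inverse, from the inside
  outwards, starting around \<open>M\<close>.
\<close>

lemma sandwich_trivial:
  assumes "erase X = w" "w \<in> braid_words 4" "trivial_word M"
  shows "trivial_word (X @ M @ map Some (braid_inverse w))"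
  using assms
proof (induction X arbitrary: w)
  case Nil
  then show ?case by (simp add: braid_inverse_def)
next
  case (Cons x X)
  show ?case
  proof (cases x)
    case None
    then have "trivial_word ([None] @ (X @ M @ map Some (braid_inverse w)))"
      using Cons.prems by (intro trivial_word.append[OF trivial_word.blank Cons.IH]) (auto simp: None)
    then show ?thesis using None by simp
  next
    case (Some y)
    obtain i f where y: "y = (i, f)" by force
    then obtain w' where w: "w = (i, f) # w'" "erase X = w'" using Cons.prems(1) Some by auto
    have w': "w' \<in> braid_words 4" and i: "1 \<le> i" "i \<le> 3" using Cons.prems(2) w by (auto simp: braid_words_def)
    have "trivial_word (Some (i, f) # (X @ M @ map Some (braid_inverse w')) @ [Some (i, \<not> f)])"
      by (rule trivial_word.cancel[OF i Cons.IH[OF w(2) w' Cons.prems(3)]])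
    then show ?thesis by (simp add: Some y w(1) braid_inverse_Cons)
  qed
qed

section \<open>Two strands that are deleted to a single generator\<close>

text \<open>
  If \<open>a\<close> and \<open>b\<close> are the only strands of \<open>Js\<close> on which a word of
  four strands acts, then all surviving crossings are between these two, in the positions \<open>x\<close>
  and \<open>x + 1\<close>. Deleting all other strands with \<open>keep_strands\<close> leaves the same
  crossings.
\<close>

lemma delete_two:
  assumes "a \<in> set Js" "b \<in> set Js" "a \<noteq> b" "inj_on q (set Js)" "q a \<le> 4" "q b \<le> 4"
    and "\<And>l. l \<in> set Js \<Longrightarrow> l \<noteq> a \<Longrightarrow> l \<noteq> b \<Longrightarrow> 5 \<le> q l" "w \<in> braid_words 4"
    and "r a = x \<and> r b = x + 1 \<and> q a < q b \<or> r b = x \<and> r a = x + 1 \<and> q b < q a"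
    and "\<pi> (q a) = 1" "\<pi> (q b) = 2" "inj \<pi>"
  shows "set (delete Js q r w) \<subseteq> {None, Some (x, True), Some (x, False)} \<and>
     signs (delete Js q r w) = writhe (keep_strands {1, 2} \<pi> w)"
  using assms(4-)
proof (induction w arbitrary: q r \<pi>)
  case (Cons z w)
  obtain i f where z: "z = (i, f)" by force
  let ?q = "\<lambda>l. move (Some (i, f)) (q l)" and ?\<pi> = "\<pi> \<circ> Transposition.transpose i (i + 1)"
  have i: "1 \<le> i" "i \<le> 3" and w: "w \<in> braid_words 4" using Cons.prems(5) by (auto simp: z braid_words_def)
  have inj: "inj_on ?q (set Js)" using Cons.prems(1) by (auto simp: inj_on_def move_inj)
  have \<pi>: "?\<pi> (?q a) = 1" "?\<pi> (?q b) = 2" "inj ?\<pi>"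
    using Cons.prems(7,8,9) by (auto simp: move_def inj_compose)
  have q4: "?q a \<le> 4" "?q b \<le> 4" using Cons.prems(2,3) i by (auto simp: move_Some)
  have q5: "5 \<le> ?q l" if "l \<in> set Js" "l \<noteq> a" "l \<noteq> b" for l using Cons.prems(4)[OF that] i by (simp add: move_Some)
  have in12: "\<pi> p \<in> {1, 2} \<longleftrightarrow> p = q a \<or> p = q b" for p
    using inj_eq[OF Cons.prems(9), of p "q a"] inj_eq[OF Cons.prems(9), of p "q b"] Cons.prems(7,8) by simp
  show ?case
  proof (cases "{q a, q b} = {i, i + 1}")
    case True
    define c d where "c = (if q a = i then a else b)" and "d = (if q a = i then b else a)"
    have cd: "c \<in> set Js" "d \<in> set Js" "q c = i" "q d = i + 1" "r c = x"
      using True assms(1,2) Cons.prems(6) by (auto simp: c_def d_def doubleton_eq_iff)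
    have "?q a < ?q b \<longleftrightarrow> \<not> q a < q b" using True by (auto simp: doubleton_eq_iff move_Some)
    then have r': "(\<lambda>l. move (Some (r c, f)) (r l)) a = x \<and> (\<lambda>l. move (Some (r c, f)) (r l)) b = x + 1 \<and> ?q a < ?q b \<or>
      (\<lambda>l. move (Some (r c, f)) (r l)) b = x \<and> (\<lambda>l. move (Some (r c, f)) (r l)) a = x + 1 \<and> ?q b < ?q a"
      using Cons.prems(6) True by (auto simp: cd(5) move_Some doubleton_eq_iff)
    have k: "\<pi> i \<in> {1, 2} \<and> \<pi> (i + 1) \<in> {1, 2}" 
    proof -
      have "i = q a \<or> i = q b" "i + 1 = q a \<or> i + 1 = q b" using True by (auto simp: doubleton_eq_iff)
      then show ?thesis unfolding in12 by blast
    qed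
    show ?thesis
      using Cons.IH[OF inj q4 q5 w r' \<pi>] k unfolding z delete_cross[OF cd(1-4) Cons.prems(1)] by (cases f; simp add: cd(5) comp_def)
  next
    case False
    have no: "\<not> (\<exists>c\<in>set Js. \<exists>d\<in>set Js. q c = i \<and> q d = i + 1)"
    proof
      assume "\<exists>c\<in>set Js. \<exists>d\<in>set Js. q c = i \<and> q d = i + 1"
      then obtain c d where "c \<in> set Js" "d \<in> set Js" "q c = i" "q d = i + 1" by blast
      moreover from this have "c = a \<or> c = b" "d = a \<or> d = b" using Cons.prems(4)[of c] Cons.prems(4)[of d] i by auto
      ultimately show False using False by auto
    qed
    have F1: "\<not> (q a = i \<and> q b = i + 1)" and F2: "\<not> (q b = i \<and> q a = i + 1)"
      using False insert_commute by auto
    have r': "r a = x \<and> r b = x + 1 \<and> ?q a < ?q b \<or> r b = x \<and> r a = x + 1 \<and> ?q b < ?q a"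
      using Cons.prems(6) halfway_less(2)[OF _ F1, of f] halfway_less(2)[OF _ F2, of f] by blast
    have k: "\<not> (\<pi> i \<in> {1, 2} \<and> \<pi> (i + 1) \<in> {1, 2})"
      unfolding in12
    proof
      assume "(i = q a \<or> i = q b) \<and> (i + 1 = q a \<or> i + 1 = q b)"
      then have "i = q a \<and> i + 1 = q b \<or> i = q b \<and> i + 1 = q a" by linarith
      then have "{q a, q b} = {i, i + 1}" by (elim disjE conjE) (simp_all only: insert_commute)
      with False show False ..
    qed
    show ?thesis
      using Cons.IH[OF inj q4 q5 w r' \<pi>] k unfolding z delete_skip[OF no] by (auto simp: comp_def)
  qed
qed simp

lemma keep_append: "keep_strands K \<pi> (u @ v) = keep_strands K \<pi> u @ keep_strands K (arrangement_below \<pi> u) v"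
  by (induction K \<pi> u rule: keep_strands.induct) (auto simp: comp_def)

lemma arrangement_append: "arrangement_below \<pi> (u @ v) = arrangement_below (arrangement_below \<pi> u) v"
  by (induction \<pi> u rule: arrangement_below.induct) (auto simp: comp_def)

lemma arrangement_inverse: "arrangement_below (arrangement_below \<pi> w) (braid_inverse w) = \<pi>"
proof (induction w arbitrary: \<pi>)
  case (Cons x w)
  obtain i f where x: "x = (i, f)" by force
  show ?case by (simp add: x braid_inverse_Cons arrangement_append Cons.IH comp_assoc)
qed (simp add: braid_inverse_def)

lemma writhe_keep_inverse:
  "writhe (keep_strands K (arrangement_below \<pi> w) (braid_inverse w)) = - writhe (keep_strands K \<pi> w)"
proof (induction w arbitrary: \<pi>)
  case (Cons x w)
  obtain i f where x: "x = (i, f)" by force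
  show ?case by (simp add: x braid_inverse_Cons keep_append arrangement_inverse Cons.IH)
      (auto simp: comp_def)
qed (simp add: braid_inverse_def)

lemma arrangement_moves: "arrangement_below \<pi> w (moves (map Some w) p) = \<pi> p"
proof (induction w arbitrary: \<pi> p)
  case (Cons x w)
  obtain i f where x: "x = (i, f)" by force
  show ?case by (simp add: x Cons.IH move_def)
qed simp

text \<open>
  The exponent sum is a homomorphism from the braid group to the integers, because both sides of each
  relation have the same exponent sum.
\<close>

lemma writhe_braid_eq: "braid_eq n u v \<Longrightarrow> writhe u = writhe v"
proof -
  have step: "braid_step n u v \<Longrightarrow> writhe u = writhe v" for u v
    by (induction rule: braid_step.induct) auto
  show "braid_eq n u v \<Longrightarrow> writhe u = writhe v"
    unfolding braid_eq_def equivclp_def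
    by (induction rule: rtranclp_induct) (auto simp: symclp_def dest: step)
qed

section \<open>Crossings of parallel strands\<close>

definition width :: "nat \<Rightarrow> nat" where
  "width s = (if s \<in> {3, 4} then 2 else 1)"

text \<open>
  The strand of \<open>A\<close> of which strand \<open>l\<close> of \<open>\<rho>(A)\<close> is a copy;
  \<open>copy l\<close> is its number among the copies.
\<close>

definition parent :: "nat \<Rightarrow> nat" where
  "parent l = (if l = 1 then 1 else if l = 2 then 2 else if l \<le> 4 then 3 else 4)"

definition copy :: "nat \<Rightarrow> nat" where
  "copy l = (if l = 4 \<or> l = 6 then 2 else 1)"

text \<open>
  The position of strand \<open>l\<close> when the strands of \<open>A\<close> are arranged in the order
  \<open>xs\<close>. If one copy of each strand is kept, its position is \<open>rank_single\<close>; if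
  just the copies of the strands 3 and 4 are kept, it is \<open>rank_double\<close>.
\<close>

definition cable_pos :: "nat list \<Rightarrow> nat \<Rightarrow> nat" where
  "cable_pos xs l = sum_list (map width (takeWhile (\<lambda>s. s \<noteq> parent l) xs)) + copy l"

definition rank_single :: "nat list \<Rightarrow> nat \<Rightarrow> nat" where
  "rank_single xs l = length (takeWhile (\<lambda>s. s \<noteq> parent l) xs) + 1"

definition rank_double :: "nat list \<Rightarrow> nat \<Rightarrow> nat" where
  "rank_double xs l = sum_list (map (\<lambda>s. if s \<le> 2 then 0 else 2) (takeWhile (\<lambda>s. s \<noteq> parent l) xs)) + copy l"

lemma ribbon_cases:
  "ribbon_crossing N 1 1 f = [(N + 1, f)]"
  "ribbon_crossing N 2 1 f = [(N + 2, f), (N + 1, f)]"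
  "ribbon_crossing N 1 2 f = [(N + 1, f), (N + 2, f)]"
  "ribbon_crossing N 2 2 f = [(N + 2, f), (N + 1, f), (N + 3, f), (N + 2, f)]"
  by (simp_all add: ribbon_crossing_def upt_rec numeral_eq_Suc)

lemma width_cases: "width s = 1 \<or> width s = 2"
  by (simp add: width_def)

lemma ribbon_moves:
  assumes "a = 1 \<or> a = 2" "b = 1 \<or> b = 2"
  shows "moves (map Some (ribbon_crossing N a b f)) p =
    (if p \<le> N then p else if p \<le> N + a then p + b else if p \<le> N + a + b then p - a else p)"
proof -
  have "p \<le> N \<or> p = N + 1 \<or> p = N + 2 \<or> p = N + 3 \<or> p = N + 4 \<or> N + 5 \<le> p" by linarith
  then show ?thesis using assms
    by (elim disjE) (simp_all add: ribbon_cases[unfolded One_nat_def] move_Some)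
qed

text \<open>
  Among the positions from \<open>lo\<close> to \<open>hi\<close> only those of \<open>A\<close> and
  \<open>B\<close> are taken by strands of \<open>Js\<close>.
\<close>

definition only_two :: "nat list \<Rightarrow> (nat \<Rightarrow> nat) \<Rightarrow> nat \<Rightarrow> nat \<Rightarrow> nat \<Rightarrow> nat \<Rightarrow> bool" where
  "only_two Js q A B lo hi \<longleftrightarrow> A \<in> set Js \<and> B \<in> set Js \<and> inj_on q (set Js) \<and>
     (\<forall>l\<in>set Js. l \<noteq> A \<longrightarrow> l \<noteq> B \<longrightarrow> q l < lo \<or> hi < q l)"

lemma only_two_move:
  "only_two Js q A B lo hi \<Longrightarrow> lo \<le> j \<Longrightarrow> j < hi \<Longrightarrow> only_two Js (\<lambda>l. move (Some (j, f)) (q l)) A B lo hi"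
  unfolding only_two_def
proof (elim conjE, intro conjI ballI impI)
  assume "inj_on q (set Js)" then show "inj_on (\<lambda>l. move (Some (j, f)) (q l)) (set Js)"
    by (simp add: inj_on_def move_inj)
next
  fix l assume "lo \<le> j" "j < hi" "\<forall>l\<in>set Js. l \<noteq> A \<longrightarrow> l \<noteq> B \<longrightarrow> q l < lo \<or> hi < q l" "l \<in> set Js" "l \<noteq> A" "l \<noteq> B"
  then have "q l < lo \<or> hi < q l" "lo \<le> j" "j < hi" by blast+
  moreover from this have "move (Some (j, f)) (q l) = q l" by (auto simp: move_Some)
  ultimately show "move (Some (j, f)) (q l) < lo \<or> hi < move (Some (j, f)) (q l)" by simp
qed simp_all

lemma only_two_cross:
  assumes "only_two Js q A B lo hi" "q A = j" "q B = j + 1"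
  shows "delete Js q r ((j, f) # w) = Some (r A, f) # delete Js (\<lambda>l. move (Some (j, f)) (q l)) (\<lambda>l. move (Some (r A, f)) (r l)) w"
  using assms by (intro delete_cross) (auto simp: only_two_def)

lemma only_two_skip:
  assumes "only_two Js q A B lo hi" "lo \<le> j" "j < hi" "q A \<noteq> j \<or> q B \<noteq> j + 1" "q B \<noteq> j \<or> q A \<noteq> j + 1"
  shows "delete Js q r ((j, f) # w) = None # delete Js (\<lambda>l. move (Some (j, f)) (q l)) r w"
proof (rule delete_skip)
  show "\<not> (\<exists>a\<in>set Js. \<exists>b\<in>set Js. q a = j \<and> q b = j + 1)"
  proof
    assume "\<exists>a\<in>set Js. \<exists>b\<in>set Js. q a = j \<and> q b = j + 1"
    then obtain a b where ab: "a \<in> set Js" "b \<in> set Js" "q a = j" "q b = j + 1" by blast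
    have o: "l = A \<or> l = B" if "l \<in> set Js" "lo \<le> q l" "q l \<le> hi" for l
    proof -
      have "l \<noteq> A \<Longrightarrow> l \<noteq> B \<Longrightarrow> q l < lo \<or> hi < q l" using assms(1) that(1) by (simp add: only_two_def)
      then show ?thesis using that(2,3) by linarith
    qed
    have "a = A \<or> a = B" "b = A \<or> b = B" using o[OF ab(1)] o[OF ab(2)] ab(3,4) assms(2,3) by simp_all
    then show False using ab(3,4) assms(4,5) by auto
  qed
qed

text \<open>
  The deletion of all strands but two, as a function of their positions \<open>p\<close>,
  \<open>p'\<close> and ranks \<open>s\<close>, \<open>s'\<close> alone. Unlike \<open>delete\<close> it
  can be evaluated on the words \<open>ribbon_crossing\<close>.
\<close>

fun trace_two :: "nat \<Rightarrow> nat \<Rightarrow> nat \<Rightarrow> nat \<Rightarrow> braid_word \<Rightarrow> padded_word" where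
  "trace_two p p' s s' [] = []"
| "trace_two p p' s s' ((j, f) # w) =
    (if p = j \<and> p' = j + 1 then Some (s, f) # trace_two (move (Some (j, f)) p) (move (Some (j, f)) p') (move (Some (s, f)) s) (move (Some (s, f)) s') w
     else if p' = j \<and> p = j + 1 then Some (s', f) # trace_two (move (Some (j, f)) p) (move (Some (j, f)) p') (move (Some (s', f)) s) (move (Some (s', f)) s') w
     else None # trace_two (move (Some (j, f)) p) (move (Some (j, f)) p') s s' w)"

lemma delete_only_two:
  assumes "only_two Js q A B lo hi" "\<And>j f. (j, f) \<in> set w \<Longrightarrow> lo \<le> j \<and> j < hi"
  shows "delete Js q r w = trace_two (q A) (q B) (r A) (r B) w"
  using assms
proof (induction w arbitrary: q r)
  case (Cons x w)
  obtain j f where x: "x = (j, f)" by force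
  have j: "lo \<le> j" "j < hi" using Cons.prems(2)[of j f] by (simp_all add: x)
  note IH = Cons.IH[OF only_two_move[OF Cons.prems(1) j]]
  have w: "lo \<le> j \<and> j < hi" if "(j, f) \<in> set w" for j f using Cons.prems(2)[of j f] that by simp
  have swap: "only_two Js q B A lo hi" using Cons.prems(1) by (auto simp: only_two_def)
  consider "q A = j \<and> q B = j + 1" | "q B = j \<and> q A = j + 1" "\<not> (q A = j \<and> q B = j + 1)"
    | "\<not> (q A = j \<and> q B = j + 1)" "\<not> (q B = j \<and> q A = j + 1)" by blast
  then show ?case
  proof cases
    case 1
    then show ?thesis using only_two_cross[OF Cons.prems(1), of j r f w] IH[OF w] by (simp add: x)
  next
    case 2
    then show ?thesis using only_two_cross[OF swap, of j r f w] IH[OF w] by (simp add: x)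
  next
    case 3
    have "delete Js q r ((j, f) # w) = None # delete Js (\<lambda>l. move (Some (j, f)) (q l)) r w"
      by (rule only_two_skip[OF Cons.prems(1) j]) (use 3 in auto)
    then show ?thesis using 3 IH[OF w] by (auto simp: x)
  qed
qed simp

text \<open>Of the crossings of two ribbons just one survives if a single strand of each ribbon is kept.\<close>

lemma delete_ribbon_two:
  assumes two: "only_two Js q A B (N + 1) (N + a + b)"
    and ab: "a = 1 \<or> a = 2" "b = 1 \<or> b = 2"
    and A: "q A = N + x" "1 \<le> x" "x \<le> a" and B: "q B = N + a + y" "1 \<le> y" "y \<le> b"
  shows "erase (delete Js q r (ribbon_crossing N a b f)) = [(r A, f)] \<and>
    moves (delete Js q r (ribbon_crossing N a b f)) p = move (Some (r A, f)) p"
proof -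
  have x: "x = 1 \<or> x = 2 \<and> a = 2" using A(2,3) ab(1) by presburger
  have y: "y = 1 \<or> y = 2 \<and> b = 2" using B(2,3) ab(2) by presburger
  have "(j, g) \<in> set (ribbon_crossing N a b f) \<Longrightarrow> N + 1 \<le> j \<and> j < N + a + b" for j g
    using ab by (elim disjE) (auto simp: ribbon_cases[unfolded One_nat_def])
  then have d: "delete Js q r (ribbon_crossing N a b f) = trace_two (N + x) (N + a + y) (r A) (r B) (ribbon_crossing N a b f)"
    using delete_only_two[OF two, of "ribbon_crossing N a b f" r] A(1) B(1) by simp
  show ?thesis
    unfolding d using ab x y
    by (elim disjE conjE) (simp_all add: ribbon_cases[unfolded One_nat_def] move_Some)
qed

lemma delete_hole:
  assumes "\<And>l. l \<in> set Js \<Longrightarrow> q l \<noteq> h" "h = j \<or> h = j + 1"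
  shows "delete Js q r ((j, f) # w) = None # delete Js (\<lambda>l. move (Some (j, f)) (q l)) r w"
  using assms by (intro delete_skip) auto

text \<open>
  If one of the two ribbons is a single strand that is not kept, then this strand takes part in all
  crossings of the ribbons.
\<close>

lemma delete_ribbon_hole:
  assumes ab: "a = 1 \<and> (b = 1 \<or> b = 2) \<and> h = N + 1 \<or> b = 1 \<and> (a = 1 \<or> a = 2) \<and> h = N + a + 1"
    and hole: "\<And>l. l \<in> set Js \<Longrightarrow> q l \<noteq> h"
  shows "\<exists>m. delete Js q r (ribbon_crossing N a b f) = blanks m"
proof -
  have mv: "move (Some (j, f)) (q l) \<noteq> move (Some (j, f)) h" if "l \<in> set Js" for l j
    using hole[OF that] by (simp add: move_inj)
  have D1: "delete Js q r ((j, f) # w) = None # delete Js (\<lambda>l. move (Some (j, f)) (q l)) r w" if "h = j \<or> h = j + 1" for j w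
    by (rule delete_hole[OF hole that])
  have D2: "delete Js (\<lambda>l. move (Some (j', f)) (q l)) r ((j, f) # w) = None # delete Js (\<lambda>l. move (Some (j, f)) (move (Some (j', f)) (q l))) r w"
    if "move (Some (j', f)) h = j \<or> move (Some (j', f)) h = j + 1" for j j' w
    by (rule delete_hole[OF mv that])
  consider "a = 1" "b = 1" "h = N + 1 \<or> h = N + 2" | "a = 1" "b = 2" "h = N + 1" | "a = 2" "b = 1" "h = N + 3"
    using ab by auto
  then show ?thesis
  proof cases
    case 1
    then show ?thesis using D1[of "N + 1" "[]"]
      by (intro exI[of _ 1]) (simp only: ribbon_cases, simp)
  next
    case 2
    have "move (Some (N + 1, f)) h = N + 2" using 2 by (simp add: move_Some)
    then show ?thesis using 2 D1[of "N + 1"] D2[of "N + 1" "N + 2"]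
      by (intro exI[of _ 2]) (simp only: ribbon_cases, simp add: numeral_2_eq_2)
  next
    case 3
    have "move (Some (N + 2, f)) h = N + 2" using 3 by (simp add: move_Some)
    then show ?thesis using 3 D1[of "N + 2"] D2[of "N + 2" "N + 1"]
      by (intro exI[of _ 2]) (simp only: ribbon_cases, simp add: numeral_2_eq_2)
  qed
qed

definition before :: "nat list \<Rightarrow> nat \<Rightarrow> nat list" where
  "before xs s = takeWhile (\<lambda>s'. s' \<noteq> s) xs"

lemma before_append: "before (L @ M) s = (if s \<in> set L then before L s else L @ before M s)"
  unfolding before_def by (induction L) auto

lemma before_Cons: "before (x # M) s = (if x = s then [] else x # before M s)"
  by (simp add: before_def)

lemma sum_before: "s \<in> set L \<Longrightarrow> sum_list (map g (before L s)) + g s \<le> (sum_list (map g L) :: nat)"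
  unfolding before_def by (induction L) auto

lemma cable_pos_before: "cable_pos xs l = sum_list (map width (before xs (parent l))) + copy l"
  by (simp add: cable_pos_def before_def)

lemma rank_single_before: "rank_single xs l = length (before xs (parent l)) + 1"
  by (simp add: rank_single_def before_def)

lemma rank_double_before: "rank_double xs l = sum_list (map (\<lambda>s. if s \<le> 2 then 0 else 2) (before xs (parent l))) + copy l"
  by (simp add: rank_double_def before_def)

lemma copy_bounds: "1 \<le> copy l" "l \<in> {1..6} \<Longrightarrow> copy l \<le> width (parent l)"
proof -
  show "1 \<le> copy l" by (simp add: copy_def)
  assume "l \<in> {1..6}"
  then have "l = 1 \<or> l = 2 \<or> l = 3 \<or> l = 4 \<or> l = 5 \<or> l = 6" by auto
  then show "copy l \<le> width (parent l)" by (auto simp: copy_def width_def parent_def)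
qed

lemma cable_pos_cases:
  fixes L R :: "nat list"
  defines "N \<equiv> sum_list (map width L)"
  assumes "a \<noteq> b" "a \<notin> set L" "b \<notin> set L" "l \<in> {1..6}" "parent l \<in> set (L @ a # b # R)"
  shows "parent l = a \<Longrightarrow> cable_pos (L @ a # b # R) l = N + copy l"
    "parent l = b \<Longrightarrow> cable_pos (L @ a # b # R) l = N + width a + copy l"
    "parent l \<noteq> a \<Longrightarrow> parent l \<noteq> b \<Longrightarrow> cable_pos (L @ a # b # R) l = cable_pos (L @ b # a # R) l \<and>
       (cable_pos (L @ a # b # R) l < N + 1 \<or> N + width a + width b < cable_pos (L @ a # b # R) l)"
proof -
  have c: "1 \<le> copy l" "copy l \<le> width (parent l)" using copy_bounds assms(5) by auto
  show "parent l = a \<Longrightarrow> cable_pos (L @ a # b # R) l = N + copy l"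
    using assms by (simp add: cable_pos_before before_append before_Cons N_def)
  show "parent l = b \<Longrightarrow> cable_pos (L @ a # b # R) l = N + width a + copy l"
    using assms by (simp add: cable_pos_before before_append before_Cons N_def)
  assume ne: "parent l \<noteq> a" "parent l \<noteq> b"
  show "cable_pos (L @ a # b # R) l = cable_pos (L @ b # a # R) l \<and>
       (cable_pos (L @ a # b # R) l < N + 1 \<or> N + width a + width b < cable_pos (L @ a # b # R) l)"
  proof (cases "parent l \<in> set L")
    case True
    then show ?thesis using sum_before[OF True, of width] c ne by (simp add: cable_pos_before before_append N_def)
  next
    case False
    then show ?thesis using c ne by (auto simp: cable_pos_before before_append before_Cons N_def)
  qed
qed

lemma cable_pos_swap:
  assumes "a \<noteq> b" "a \<notin> set L" "b \<notin> set L" "l \<in> {1..6}" "parent l \<in> set (L @ a # b # R)"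
  shows "moves (map Some (ribbon_crossing (sum_list (map width L)) (width a) (width b) f)) (cable_pos (L @ a # b # R) l)
    = cable_pos (L @ b # a # R) l"
proof -
  have c: "1 \<le> copy l" "copy l \<le> width (parent l)" using copy_bounds assms(4) by auto
  have p: "parent l \<in> set (L @ b # a # R)" using assms(5) by auto
  note C = cable_pos_cases[OF assms] and C' = cable_pos_cases[OF assms(1)[symmetric] assms(3,2,4) p]
  consider "parent l = a" | "parent l = b" | "parent l \<noteq> a" "parent l \<noteq> b" by blast
  then show ?thesis
  proof cases
    case 1
    then show ?thesis using C(1) C'(2) c by (simp add: ribbon_moves[OF width_cases width_cases])
  next
    case 2
    then show ?thesis using C(2) C'(1) c by (simp add: ribbon_moves[OF width_cases width_cases])
  next
    case 3
    then show ?thesis using C(3) by (auto simp: ribbon_moves[OF width_cases width_cases])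
  qed
qed

lemma rank_single_swap:
  assumes "a \<noteq> b" "a \<notin> set L" "b \<notin> set L"
  shows "rank_single (L @ b # a # R) l = move (Some (length L + 1, f)) (rank_single (L @ a # b # R) l)"
proof -
  have "length (before L s) < length L" if "s \<in> set L" for s
    using that unfolding before_def by (induction L) auto
  from this[of "parent l"] show ?thesis using assms
    by (auto simp: rank_single_before before_append before_Cons move_Some)
qed

lemma rank_double_swap:
  assumes "a \<noteq> b" "a \<notin> set L" "b \<notin> set L" "a \<le> 2 \<or> b \<le> 2" "l \<in> {3..6}"
  shows "rank_double (L @ b # a # R) l = rank_double (L @ a # b # R) l"
proof -
  have "3 \<le> parent l" using assms(5) by (auto simp: parent_def)
  then show ?thesis using assms by (auto simp: rank_double_before before_append before_Cons)
qed

text \<open>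
  The order, from left to right, of the strands below a braid word, as a list. It is the list form of
  \<open>arrangement_below\<close>.
\<close>

fun arrange :: "nat list \<Rightarrow> braid_word \<Rightarrow> nat list" where
  "arrange xs [] = xs"
| "arrange xs ((i, f) # w) = arrange (take (i - 1) xs @ xs ! i # xs ! (i - 1) # drop (i + 1) xs) w"

lemma arrangement_split:
  fixes xs :: "nat list"
  assumes "set xs = {1..4}" "length xs = 4" "1 \<le> i" "i \<le> 3"
  obtains L a b R where "xs = L @ a # b # R" "length L + 1 = i" "a \<noteq> b" "a \<notin> set L" "b \<notin> set L"
    "set (L @ b # a # R) = {1..4}" "length (L @ b # a # R) = 4"
    "take (i - 1) xs @ xs ! i # xs ! (i - 1) # drop (i + 1) xs = L @ b # a # R"
proof -
  have d: "distinct xs" by (rule card_distinct) (use assms(1,2) in simp)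
  define L a b R where "L = take (i - 1) xs" and "a = xs ! (i - 1)" and "b = xs ! i" and "R = drop (i + 1) xs"
  have "drop (i - 1) xs = a # drop i xs" using assms(2-4) Cons_nth_drop_Suc[of "i - 1" xs] by (simp add: a_def)
  also have "drop i xs = b # R" using assms(2-4) Cons_nth_drop_Suc[of i xs] by (simp add: b_def R_def)
  finally have xs: "xs = L @ a # b # R" unfolding L_def by (metis append_take_drop_id)
  have len: "length L + 1 = i" using assms(2-4) by (simp add: L_def)
  have sw: "take (i - 1) xs @ xs ! i # xs ! (i - 1) # drop (i + 1) xs = L @ b # a # R"
    by (simp only: L_def a_def b_def R_def)
  have "set (L @ a # b # R) = {1..4}" "length (L @ a # b # R) = 4" "distinct (L @ a # b # R)"
    using assms(1,2) d by (simp_all only: xs)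
  then show ?thesis using that[OF xs len _ _ _ _ _ sw] by auto
qed

text \<open>
  The recursion of \<open>cable\<close> in terms of lists: \<open>L\<close> are the strands to the left of
  the two strands that cross.
\<close>

lemma cable_Cons:
  assumes xs: "set xs = {1..4}" "length xs = 4" and i: "1 \<le> i" "i \<le> 3"
    and \<pi>: "\<And>j. 1 \<le> j \<Longrightarrow> j \<le> 4 \<Longrightarrow> \<pi> j = xs ! (j - 1)"
    and sp: "xs = L @ a # b # R" "length L + 1 = i"
  shows "cable width \<pi> ((i, f) # w) = ribbon_crossing (sum_list (map width L)) (width a) (width b) f
      @ cable width (\<pi> \<circ> Transposition.transpose i (i + 1)) w"
    "\<And>j. 1 \<le> j \<Longrightarrow> j \<le> 4 \<Longrightarrow> (\<pi> \<circ> Transposition.transpose i (i + 1)) j = (L @ b # a # R) ! (j - 1)"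
proof -
  have ab: "a = xs ! (i - 1)" "b = xs ! i" using sp by (auto simp: nth_append)
  have "(\<Sum>j = 1..<i. width (\<pi> j)) = (\<Sum>j = 1..<i. width (xs ! (j - 1)))"
    using i \<pi> by (intro sum.cong) auto
  also have "\<dots> = (\<Sum>j<length L. width (L ! j))"
  proof -
    have "(\<Sum>j = 1..<i. width (xs ! (j - 1))) = (\<Sum>j = 0..<length L. width (xs ! j))"
      using sp(2) sum.shift_bounds_Suc_ivl[of "\<lambda>j. width (xs ! (j - 1))" 0 "length L"] by simp
    also have "\<dots> = (\<Sum>j = 0..<length L. width (L ! j))" by (intro sum.cong) (auto simp: sp(1) nth_append)
    finally show ?thesis by (simp add: atLeast0LessThan)
  qed
  also have "\<dots> = sum_list (map width L)" by (simp add: sum_list_sum_nth atLeast0LessThan)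
  finally show "cable width \<pi> ((i, f) # w) = ribbon_crossing (sum_list (map width L)) (width a) (width b) f
      @ cable width (\<pi> \<circ> Transposition.transpose i (i + 1)) w" using \<pi>[of i] \<pi>[of "i + 1"] i ab by simp
  fix j :: nat assume j: "1 \<le> j" "j \<le> 4"
  consider "j = i" | "j = i + 1" | "j < i" | "i + 1 < j" by linarith
  then show "(\<pi> \<circ> Transposition.transpose i (i + 1)) j = (L @ b # a # R) ! (j - 1)"
  proof cases
    case 1
    then show ?thesis using \<pi>[of "i + 1"] i ab sp(2) by (auto simp: nth_append)
  next
    case 2
    then show ?thesis using \<pi>[of i] i ab sp(2) by (auto simp: nth_append)
  next
    case 3
    then show ?thesis using \<pi>[OF j] sp j by (auto simp: nth_append)
  next
    case 4
    then have "j - 1 - length L = Suc (Suc (j - 3 - length L))" using sp(2) by simp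
    then show ?thesis using \<pi>[OF j] sp 4 by (auto simp: nth_append)
  qed
qed

lemma before_split: "s \<in> set xs \<Longrightarrow> \<exists>R. xs = before xs s @ s # R"
  unfolding before_def by (induction xs) auto

lemma cable_pos_less:
  assumes "parent l \<in> set xs" "parent l' \<in> set (before xs (parent l))" "l' \<in> {1..6}"
  shows "cable_pos xs l' < cable_pos xs l"
proof -
  obtain R where R: "xs = before xs (parent l) @ parent l # R" using before_split[OF assms(1)] by blast
  have "before xs (parent l') = before (before xs (parent l)) (parent l')"
    by (subst R) (simp add: before_append assms(2))
  then have "sum_list (map width (before xs (parent l'))) + width (parent l') \<le> sum_list (map width (before xs (parent l)))"
    using sum_before[OF assms(2), of width] by simp
  then show ?thesis unfolding cable_pos_before using copy_bounds(1)[of l] copy_bounds(2)[OF assms(3)] by linarith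
qed

lemma label_eqI:
  assumes "l \<in> {1..6}" "l' \<in> {1..6}" "parent l = parent l'" "copy l = copy l'" shows "l = l'"
proof -
  have "l = 1 \<or> l = 2 \<or> l = 3 \<or> l = 4 \<or> l = 5 \<or> l = 6" "l' = 1 \<or> l' = 2 \<or> l' = 3 \<or> l' = 4 \<or> l' = 5 \<or> l' = 6"
    using assms(1,2) by auto
  then show ?thesis using assms(3,4) by (elim disjE) (simp_all add: parent_def copy_def)
qed

lemma parent_range: "l \<in> {1..6} \<Longrightarrow> parent l \<in> {1..4}"
  by (auto simp: parent_def)

lemma cable_pos_inj:
  assumes "set xs = {1..4}" shows "inj_on (cable_pos xs) {1..6}"
proof (rule inj_onI)
  fix l l' assume l: "l \<in> {1..6}" "l' \<in> {1..6}" "cable_pos xs l = cable_pos xs l'"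
  have p: "parent l \<in> set xs" "parent l' \<in> set xs" using parent_range l assms by auto
  have nb: "s' \<in> set (before xs s) \<or> s \<in> set (before xs s')" if "s \<noteq> s'" "s \<in> set xs" "s' \<in> set xs" for s s'
    using that unfolding before_def by (induction xs) auto
  have "parent l = parent l'"
    using nb[OF _ p] cable_pos_less[OF p(1) _ l(2)] cable_pos_less[OF p(2) _ l(1)] l(3) by fastforce
  then show "l = l'" using l label_eqI unfolding cable_pos_before by simp
qed

lemma arrange_perm:
  "set xs = {1..4} \<Longrightarrow> length xs = 4 \<Longrightarrow> w \<in> braid_words 4 \<Longrightarrow> set (arrange xs w) = {1..4} \<and> length (arrange xs w) = 4"
proof (induction w arbitrary: xs)
  case (Cons x w)
  obtain i f where x: "x = (i, f)" by force
  have i: "1 \<le> i" "i \<le> 3" and w: "w \<in> braid_words 4" using Cons.prems(3) by (auto simp: x braid_words_def)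
  obtain L a b R where "set (L @ b # a # R) = {1..4}" "length (L @ b # a # R) = 4"
    "take (i - 1) xs @ xs ! i # xs ! (i - 1) # drop (i + 1) xs = L @ b # a # R"
    using arrangement_split[OF Cons.prems(1,2) i] by metis
  then show ?case using Cons.IH[OF _ _ w] by (simp add: x)
qed simp

text \<open>
  Induction along the letters of a braid word, in which each step sees the two strands \<open>a\<close>,
  \<open>b\<close> that cross and the ribbon crossing that replaces the letter.
\<close>

lemma cable_steps:
  assumes "set xs = {1..4}" "length xs = 4" "w \<in> braid_words 4" "\<And>j. 1 \<le> j \<Longrightarrow> j \<le> 4 \<Longrightarrow> \<pi> j = xs ! (j - 1)"
    and nil: "\<And>xs. P xs [] []"
    and step: "\<And>L a b R i f w v. length L + 1 = i \<Longrightarrow> a \<noteq> b \<Longrightarrow> a \<notin> set L \<Longrightarrow> b \<notin> set L \<Longrightarrow>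
       set (L @ a # b # R) = {1..4} \<Longrightarrow> P (L @ b # a # R) w v \<Longrightarrow>
       P (L @ a # b # R) ((i, f) # w) (ribbon_crossing (sum_list (map width L)) (width a) (width b) f @ v)"
  shows "P xs w (cable width \<pi> w)"
  using assms(1-4)
proof (induction w arbitrary: xs \<pi>)
  case Nil
  then show ?case by (simp add: nil)
next
  case (Cons x w)
  obtain i f where x: "x = (i, f)" by force
  have i: "1 \<le> i" "i \<le> 3" and w: "w \<in> braid_words 4" using Cons.prems(3) by (auto simp: x braid_words_def)
  obtain L a b R where sp: "xs = L @ a # b # R" "length L + 1 = i" "a \<noteq> b" "a \<notin> set L" "b \<notin> set L"
    "set (L @ b # a # R) = {1..4}" "length (L @ b # a # R) = 4"
    using arrangement_split[OF Cons.prems(1,2) i] by metis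
  note c = cable_Cons(2)[OF Cons.prems(1,2) i Cons.prems(4) sp(1,2)]
  have e: "cable width \<pi> ((i, f) # w) = ribbon_crossing (sum_list (map width L)) (width a) (width b) f
      @ cable width (\<pi> \<circ> Transposition.transpose i (i + 1)) w"
    by (rule cable_Cons(1)[OF Cons.prems(1,2) i Cons.prems(4) sp(1,2)])
  have "P (L @ b # a # R) w (cable width (\<pi> \<circ> Transposition.transpose i (i + 1)) w)"
    by (rule Cons.IH[OF sp(6,7) w c])
  from step[OF sp(2-5) Cons.prems(1)[unfolded sp(1)] this, of f] show ?case
    unfolding x e unfolding sp(1) .
qed

lemma arrange_split_Cons:
  "length L + 1 = i \<Longrightarrow> arrange (L @ a # b # R) ((i, f) # w) = arrange (L @ b # a # R) w"
  by (auto simp: nth_append)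

lemma cable_moves:
  assumes "set xs = {1..4}" "length xs = 4" "w \<in> braid_words 4" "\<And>j. 1 \<le> j \<Longrightarrow> j \<le> 4 \<Longrightarrow> \<pi> j = xs ! (j - 1)"
  shows "\<forall>l\<in>{1..6}. moves (map Some (cable width \<pi> w)) (cable_pos xs l) = cable_pos (arrange xs w) l"
proof (rule cable_steps[OF assms, where P = "\<lambda>xs w v. \<forall>l\<in>{1..6}. moves (map Some v) (cable_pos xs l) = cable_pos (arrange xs w) l"])
  fix L R :: "nat list" and a b i :: nat and f :: bool and w v :: braid_word
  assume h: "length L + 1 = i" "a \<noteq> b" "a \<notin> set L" "b \<notin> set L" "set (L @ a # b # R) = {1..4}"
    and IH: "\<forall>l\<in>{1..6}. moves (map Some v) (cable_pos (L @ b # a # R) l) = cable_pos (arrange (L @ b # a # R) w) l"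
  show "\<forall>l\<in>{1..6}. moves (map Some (ribbon_crossing (sum_list (map width L)) (width a) (width b) f @ v)) (cable_pos (L @ a # b # R) l)
      = cable_pos (arrange (L @ a # b # R) ((i, f) # w)) l"
  proof
    fix l :: nat assume l: "l \<in> {1..6}"
    have "parent l \<in> set (L @ a # b # R)" unfolding h(5) by (rule parent_range[OF l])
    from cable_pos_swap[OF h(2-4) l this, of f] IH l
    show "moves (map Some (ribbon_crossing (sum_list (map width L)) (width a) (width b) f @ v)) (cable_pos (L @ a # b # R) l)
      = cable_pos (arrange (L @ a # b # R) ((i, f) # w)) l"
      unfolding arrange_split_Cons[OF h(1)] map_append moves_simps by simp
  qed
next
  show "\<forall>l\<in>{1..6}. moves (map Some []) (cable_pos xs l) = cable_pos (arrange xs []) l" for xs by simp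
qed

text \<open>If one copy of each strand is kept, then \<open>\<rho>\<close> is undone, up to blanks.\<close>

lemma cable_single:
  assumes Js: "set Js \<subseteq> {1..6}" "inj_on parent (set Js)" "parent ` set Js = {1..4}"
    and "set xs = {1..4}" "length xs = 4" "w \<in> braid_words 4" "\<And>j. 1 \<le> j \<Longrightarrow> j \<le> 4 \<Longrightarrow> \<pi> j = xs ! (j - 1)"
  shows "erase (delete Js (cable_pos xs) (rank_single xs) (cable width \<pi> w)) = w \<and>
    (\<forall>l. moves (delete Js (cable_pos xs) (rank_single xs) (cable width \<pi> w)) (rank_single xs l) = rank_single (arrange xs w) l)"
proof (rule cable_steps[OF assms(4-), where P = "\<lambda>xs w v. erase (delete Js (cable_pos xs) (rank_single xs) v) = w \<and>
    (\<forall>l. moves (delete Js (cable_pos xs) (rank_single xs) v) (rank_single xs l) = rank_single (arrange xs w) l)"])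
  fix L R :: "nat list" and a b i :: nat and f :: bool and w v :: braid_word
  let ?xs = "L @ a # b # R" and ?ys = "L @ b # a # R"
  let ?r = "ribbon_crossing (sum_list (map width L)) (width a) (width b) f"
  assume h: "length L + 1 = i" "a \<noteq> b" "a \<notin> set L" "b \<notin> set L" "set ?xs = {1..4}"
    and IH: "erase (delete Js (cable_pos ?ys) (rank_single ?ys) v) = w \<and>
    (\<forall>l. moves (delete Js (cable_pos ?ys) (rank_single ?ys) v) (rank_single ?ys l) = rank_single (arrange ?ys w) l)"
  have "a \<in> parent ` set Js" "b \<in> parent ` set Js" unfolding Js(3) h(5)[symmetric] by auto
  then obtain A B where AB: "A \<in> set Js" "parent A = a" "B \<in> set Js" "parent B = b" by auto
  have l6: "l \<in> {1..6}" "parent l \<in> set ?xs" if "l \<in> set Js" for l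
  proof -
    show "l \<in> {1..6}" using Js(1) that by blast
    then show "parent l \<in> set ?xs" unfolding h(5) by (rule parent_range)
  qed
  note C = cable_pos_cases[OF h(2-4) l6]
  have two: "only_two Js (cable_pos ?xs) A B (sum_list (map width L) + 1) (sum_list (map width L) + width a + width b)"
    unfolding only_two_def
  proof (intro conjI ballI impI)
    show "inj_on (cable_pos ?xs) (set Js)" by (rule inj_on_subset[OF cable_pos_inj[OF h(5)] Js(1)])
    fix l assume l: "l \<in> set Js" "l \<noteq> A" "l \<noteq> B"
    have "parent l \<noteq> a" "parent l \<noteq> b" using inj_onD[OF Js(2)] l AB by blast+
    from C(3)[OF l(1) l(1) this] show "cable_pos ?xs l < sum_list (map width L) + 1 \<or> sum_list (map width L) + width a + width b < cable_pos ?xs l" by blast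
  qed (use AB in auto)
  have cA: "cable_pos ?xs A = sum_list (map width L) + copy A" and cB: "cable_pos ?xs B = sum_list (map width L) + width a + copy B"
    using C(1)[OF AB(1) AB(1,2)] C(2)[OF AB(3) AB(3,4)] by auto
  have rA: "rank_single ?xs A = i" using h AB(2) by (simp add: rank_single_before before_append before_Cons)
  have del: "erase (delete Js (cable_pos ?xs) (rank_single ?xs) ?r) = [(i, f)]"
    "moves (delete Js (cable_pos ?xs) (rank_single ?xs) ?r) p = move (Some (i, f)) p" for p
    using delete_ribbon_two[OF two width_cases width_cases cA _ _ cB, of "rank_single ?xs" f]
      copy_bounds(1) copy_bounds(2)[OF l6(1)[OF AB(1)]] copy_bounds(2)[OF l6(1)[OF AB(3)]] AB(2,4) rA by auto
  have mr: "moves (delete Js (cable_pos ?xs) (rank_single ?xs) ?r) (rank_single ?xs l) = rank_single ?ys l" for l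
    using rank_single_swap[OF h(2-4), of R l f] unfolding h(1) del(2) by simp
  have "delete Js (\<lambda>l. moves (map Some ?r) (cable_pos ?xs l)) (\<lambda>l. moves (delete Js (cable_pos ?xs) (rank_single ?xs) ?r) (rank_single ?xs l)) v
      = delete Js (cable_pos ?ys) (rank_single ?ys) v"
    by (rule delete_cong) (use cable_pos_swap[OF h(2-4) l6] mr in auto)
  then have "delete Js (cable_pos ?xs) (rank_single ?xs) (?r @ v)
      = delete Js (cable_pos ?xs) (rank_single ?xs) ?r @ delete Js (cable_pos ?ys) (rank_single ?ys) v"
    unfolding delete_append by simp
  then show "erase (delete Js (cable_pos ?xs) (rank_single ?xs) (?r @ v)) = (i, f) # w \<and>
    (\<forall>l. moves (delete Js (cable_pos ?xs) (rank_single ?xs) (?r @ v)) (rank_single ?xs l) = rank_single (arrange ?xs ((i, f) # w)) l)"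
    unfolding arrange_split_Cons[OF h(1)] using IH del(1) mr by simp
next
  show "erase (delete Js (cable_pos xs) (rank_single xs) []) = [] \<and>
    (\<forall>l. moves (delete Js (cable_pos xs) (rank_single xs) []) (rank_single xs l) = rank_single (arrange xs []) l)" for xs by (simp add: delete.simps)
qed

text \<open>What is left of \<open>\<rho>(A)\<close> when only the two ribbons are kept.\<close>

inductive ribbon_word :: "padded_word \<Rightarrow> bool" where
  nil: "ribbon_word []"
| blank: "ribbon_word W \<Longrightarrow> ribbon_word (None # W)"
| ribbon: "ribbon_word W \<Longrightarrow> ribbon_word (ribbon_letters f @ W)"

lemma ribbon_word_blanks: "ribbon_word W \<Longrightarrow> ribbon_word (blanks m @ W)"
  by (induction m) (auto intro: ribbon_word.blank)

text \<open>
  The four crossings survive, in the positions 1 to 4. The strands \<open>A\<close>, \<open>B\<close> form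
  the left ribbon and \<open>C\<close>, \<open>D\<close> the right one.
\<close>

lemma delete_double_ribbon:
  assumes Js: "set Js = {A, B, C, D}"
    and q: "q A = N + 1" "q B = N + 2" "q C = N + 3" "q D = N + 4"
    and r: "r A = 1" "r B = 2" "r C = 3" "r D = 4"
  shows "delete Js q r (ribbon_crossing N 2 2 f) = ribbon_letters f"
proof -
  have mem: "A \<in> set Js" "B \<in> set Js" "C \<in> set Js" "D \<in> set Js" unfolding Js by blast+
  have inj: "inj_on p (set Js)" if "p ` set Js = {N + 1, N + 2, N + 3, N + 4}" for p
  proof (rule eq_card_imp_inj_on)
    have "card {A, B, C, D} \<le> 4" by (simp add: card_insert_if)
    moreover have "card (p ` set Js) = 4" unfolding that by simp
    moreover have "card (p ` set Js) \<le> card (set Js)" by (rule card_image_le) simp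
    ultimately show "card (p ` set Js) = card (set Js)" unfolding Js by linarith
  qed simp
  define q1 where "q1 l = move (Some (N + 2, f)) (q l)" for l
  define r1 where "r1 l = move (Some (2, f)) (r l)" for l
  have v1: "q1 A = N + 1" "q1 B = N + 3" "q1 C = N + 2" "q1 D = N + 4" "r1 A = 1" "r1 B = 3" "r1 C = 2" "r1 D = 4"
    unfolding q1_def r1_def q r by (simp_all add: move_Some)
  define q2 where "q2 l = move (Some (N + 1, f)) (q1 l)" for l
  define r2 where "r2 l = move (Some (1, f)) (r1 l)" for l
  have v2: "q2 A = N + 2" "q2 B = N + 3" "q2 C = N + 1" "q2 D = N + 4" "r2 A = 2" "r2 B = 3" "r2 C = 1" "r2 D = 4"
    unfolding q2_def r2_def v1 by (simp_all add: move_Some)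
  define q3 where "q3 l = move (Some (N + 3, f)) (q2 l)" for l
  define r3 where "r3 l = move (Some (3, f)) (r2 l)" for l
  have v3: "q3 A = N + 2" "q3 B = N + 4" "q3 C = N + 1" "q3 D = N + 3" "r3 A = 2" "r3 B = 4" "r3 C = 1" "r3 D = 3"
    unfolding q3_def r3_def v2 by (simp_all add: move_Some)
  have i0: "inj_on q (set Js)" by (rule inj) (simp add: Js q)
  have i1: "inj_on q1 (set Js)" by (rule inj) (simp add: Js v1 insert_commute)
  have i2: "inj_on q2 (set Js)" by (rule inj) (simp add: Js v2 insert_commute)
  have i3: "inj_on q3 (set Js)" by (rule inj) (simp add: Js v3 insert_commute)
  have s0: "delete Js q r ((N + 2, f) # w) = Some (2, f) # delete Js q1 r1 w" for w
    using delete_cross[OF mem(2,3) q(2) _ i0, of r f w] unfolding r q1_def[symmetric] r1_def[symmetric] by (simp add: q)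
  have s1: "delete Js q1 r1 ((N + 1, f) # w) = Some (1, f) # delete Js q2 r2 w" for w
    using delete_cross[OF mem(1,3) v1(1) _ i1, of r1 f w] unfolding v1(5-8) q2_def[symmetric] r2_def[symmetric] by (simp add: v1)
  have s2: "delete Js q2 r2 ((N + 3, f) # w) = Some (3, f) # delete Js q3 r3 w" for w
    using delete_cross[OF mem(2,4) v2(2) _ i2, of r2 f w] unfolding v2(5-8) q3_def[symmetric] r3_def[symmetric] by (simp add: v2)
  have s3: "delete Js q3 r3 [(N + 2, f)] = [Some (2, f)]"
    using delete_cross[OF mem(1,4) v3(1) _ i3, of r3 f "[]"] unfolding v3(5-8) by (simp add: v3)
  show ?thesis unfolding ribbon_cases s0 s1 s2 s3 ribbon_letters_def ..
qed

text \<open>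
  A crossing of a ribbon with a strand that is not kept, or of two such strands, disappears. A crossing of
  strands 3 and 4 becomes a crossing of the two ribbons, which fill all four positions.
\<close>

lemma cable_double:
  assumes "set xs = {1..4}" "length xs = 4" "w \<in> braid_words 4" "\<And>j. 1 \<le> j \<Longrightarrow> j \<le> 4 \<Longrightarrow> \<pi> j = xs ! (j - 1)"
  shows "ribbon_word (delete [3, 4, 5, 6] (cable_pos xs) (rank_double xs) (cable width \<pi> w)) \<and>
    (\<forall>l\<in>{3..6}. moves (delete [3, 4, 5, 6] (cable_pos xs) (rank_double xs) (cable width \<pi> w)) (rank_double xs l) = rank_double (arrange xs w) l)"
proof (rule cable_steps[OF assms, where P = "\<lambda>xs w v. ribbon_word (delete [3, 4, 5, 6] (cable_pos xs) (rank_double xs) v) \<and>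
    (\<forall>l\<in>{3..6}. moves (delete [3, 4, 5, 6] (cable_pos xs) (rank_double xs) v) (rank_double xs l) = rank_double (arrange xs w) l)"])
  fix L R :: "nat list" and a b i :: nat and f :: bool and w v :: braid_word
  let ?Js = "[3, 4, 5, 6 :: nat]"
  let ?xs = "L @ a # b # R" and ?ys = "L @ b # a # R"
  let ?N = "sum_list (map width L)"
  let ?r = "ribbon_crossing ?N (width a) (width b) f"
  assume h: "length L + 1 = i" "a \<noteq> b" "a \<notin> set L" "b \<notin> set L" "set ?xs = {1..4}"
    and IH: "ribbon_word (delete ?Js (cable_pos ?ys) (rank_double ?ys) v) \<and>
    (\<forall>l\<in>{3..6}. moves (delete ?Js (cable_pos ?ys) (rank_double ?ys) v) (rank_double ?ys l) = rank_double (arrange ?ys w) l)"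
  have l6: "l \<in> {1..6}" "parent l \<in> set ?xs" if "l \<in> set ?Js" for l
  proof -
    show "l \<in> {1..6}" using that by auto
    then show "parent l \<in> set ?xs" unfolding h(5) by (rule parent_range)
  qed
  note C = cable_pos_cases[OF h(2-4) l6]
  have ab4: "a \<in> {1..4}" "b \<in> {1..4}" unfolding h(5)[symmetric] by auto
  have par: "parent 3 = 3" "parent 4 = 3" "parent 5 = 4" "parent 6 = 4" and cop: "copy 3 = 1" "copy 4 = 2" "copy 5 = 1" "copy 6 = 2"
    by (simp_all add: parent_def copy_def)
  have key: "(\<exists>m. delete ?Js (cable_pos ?xs) (rank_double ?xs) ?r = blanks m \<or> delete ?Js (cable_pos ?xs) (rank_double ?xs) ?r = ribbon_letters f)
    \<and> (\<forall>l\<in>{3..6}. moves (delete ?Js (cable_pos ?xs) (rank_double ?xs) ?r) (rank_double ?xs l) = rank_double ?ys l)"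
  proof (cases "a \<le> 2 \<or> b \<le> 2")
    case True
    define hh where "hh = (if a \<le> 2 then ?N + 1 else ?N + width a + 1)"
    have w: "width a = 1 \<and> (width b = 1 \<or> width b = 2) \<and> hh = ?N + 1 \<or> width b = 1 \<and> (width a = 1 \<or> width a = 2) \<and> hh = ?N + width a + 1"
      using True width_cases[of a] width_cases[of b] by (auto simp: hh_def width_def)
    have hole: "cable_pos ?xs l \<noteq> hh" if l: "l \<in> set ?Js" for l
    proof -
      have p3: "3 \<le> parent l" using l by (auto simp: parent_def)
      consider "parent l = a" | "parent l = b" | "parent l \<noteq> a" "parent l \<noteq> b" by blast
      then show ?thesis
      proof cases
        case 1
        then have "\<not> a \<le> 2" using p3 by simp
        then show ?thesis using C(1)[OF l l 1] copy_bounds(2)[OF l6(1)[OF l]] 1 by (simp add: hh_def)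
      next
        case 2
        then have "a \<le> 2" using p3 True by simp
        then have "hh = ?N + 1" by (simp add: hh_def)
        moreover have "1 \<le> width a" using width_cases[of a] by auto
        ultimately show ?thesis using C(2)[OF l l 2] copy_bounds(1)[of l] by linarith
      next
        case 3
        have "hh \<le> ?N + width a + width b" "?N + 1 \<le> hh" using width_cases[of b] by (auto simp: hh_def)
        then show ?thesis using C(3)[OF l l 3] by linarith
      qed
    qed
    obtain m where m: "delete ?Js (cable_pos ?xs) (rank_double ?xs) ?r = blanks m"
      using delete_ribbon_hole[where Js = ?Js and q = "cable_pos ?xs" and r = "rank_double ?xs" and f = f, OF w hole] by blast
    show ?thesis unfolding m using rank_double_swap[OF h(2-4) True, of _ R] by auto
  next
    case False
    then have ab: "a = 3 \<and> b = 4 \<or> a = 4 \<and> b = 3" using ab4 h(2) by auto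
    have LR: "s \<le> 2" if "s \<in> set L" for s
    proof -
      have "s \<in> {1..4}" "s \<noteq> a" "s \<noteq> b" using that h(3,4) unfolding h(5)[symmetric] by auto
      then show ?thesis using ab by auto
    qed
    have z: "sum_list (map (\<lambda>s. if s \<le> 2 then 0 else 2) L) = (0::nat)"
      using LR by (induction L) auto
    have wd: "width a = 2" "width b = 2" using ab by (auto simp: width_def)
    have q: "cable_pos ?xs 3 = (if a = 3 then ?N + 1 else ?N + 3)" "cable_pos ?xs 4 = (if a = 3 then ?N + 2 else ?N + 4)"
      "cable_pos ?xs 5 = (if a = 3 then ?N + 3 else ?N + 1)" "cable_pos ?xs 6 = (if a = 3 then ?N + 4 else ?N + 2)"
      using ab C(1,2)[of 3] C(1,2)[of 4] C(1,2)[of 5] C(1,2)[of 6] wd by (auto simp: par cop)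
    have r: "rank_double ?xs 3 = (if a = 3 then 1 else 3)" "rank_double ?xs 4 = (if a = 3 then 2 else 4)"
      "rank_double ?xs 5 = (if a = 3 then 3 else 1)" "rank_double ?xs 6 = (if a = 3 then 4 else 2)"
      using ab h z by (auto simp: rank_double_before before_append before_Cons par cop)
    have r': "rank_double ?ys 3 = (if a = 3 then 3 else 1)" "rank_double ?ys 4 = (if a = 3 then 4 else 2)"
      "rank_double ?ys 5 = (if a = 3 then 1 else 3)" "rank_double ?ys 6 = (if a = 3 then 2 else 4)"
      using ab h z by (auto simp: rank_double_before before_append before_Cons par cop)
    have d: "delete ?Js (cable_pos ?xs) (rank_double ?xs) ?r = ribbon_letters f"
    proof (cases "a = 3")
      case True
      then show ?thesis unfolding wd
        by (intro delete_double_ribbon[of _ 3 4 5 6]) (use q r in auto)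
    next
      case False
      then show ?thesis unfolding wd
        by (intro delete_double_ribbon[of _ 5 6 3 4]) (use q r in auto)
    qed
    have "moves (ribbon_letters f) (rank_double ?xs l) = rank_double ?ys l" if "l \<in> {3..6}" for l
    proof -
      have "l = 3 \<or> l = 4 \<or> l = 5 \<or> l = 6" using that unfolding atLeastAtMost_iff by linarith
      moreover have "moves (ribbon_letters f) (rank_double ?xs 3) = rank_double ?ys 3" "moves (ribbon_letters f) (rank_double ?xs 4) = rank_double ?ys 4"
        "moves (ribbon_letters f) (rank_double ?xs 5) = rank_double ?ys 5" "moves (ribbon_letters f) (rank_double ?xs 6) = rank_double ?ys 6"
        unfolding r r' by (cases "a = 3"; simp add: ribbon_letters_def move_Some)+
      ultimately show ?thesis by (elim disjE) (simp_all only:)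
    qed
    then show ?thesis unfolding d by blast
  qed
  have "delete ?Js (\<lambda>l. moves (map Some ?r) (cable_pos ?xs l)) (\<lambda>l. moves (delete ?Js (cable_pos ?xs) (rank_double ?xs) ?r) (rank_double ?xs l)) v
      = delete ?Js (cable_pos ?ys) (rank_double ?ys) v"
  proof (rule delete_cong)
    fix l assume l: "l \<in> set ?Js"
    show "moves (map Some ?r) (cable_pos ?xs l) = cable_pos ?ys l" by (rule cable_pos_swap[OF h(2-4) l6[OF l]])
    have "l \<in> {3..6}" using l by auto
    then show "moves (delete ?Js (cable_pos ?xs) (rank_double ?xs) ?r) (rank_double ?xs l) = rank_double ?ys l"
      using key by blast
  qed
  then have app: "delete ?Js (cable_pos ?xs) (rank_double ?xs) (?r @ v)
      = delete ?Js (cable_pos ?xs) (rank_double ?xs) ?r @ delete ?Js (cable_pos ?ys) (rank_double ?ys) v"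
    unfolding delete_append by (simp only:)
  show "ribbon_word (delete ?Js (cable_pos ?xs) (rank_double ?xs) (?r @ v)) \<and>
    (\<forall>l\<in>{3..6}. moves (delete ?Js (cable_pos ?xs) (rank_double ?xs) (?r @ v)) (rank_double ?xs l) = rank_double (arrange ?xs ((i, f) # w)) l)"
    unfolding app arrange_split_Cons[OF h(1)]
  proof (intro conjI ballI)
    show "ribbon_word (delete ?Js (cable_pos ?xs) (rank_double ?xs) ?r @ delete ?Js (cable_pos ?ys) (rank_double ?ys) v)"
      using key IH ribbon_word_blanks ribbon_word.ribbon by metis
    fix l :: nat assume "l \<in> {3..6}"
    then show "moves (delete ?Js (cable_pos ?xs) (rank_double ?xs) ?r @ delete ?Js (cable_pos ?ys) (rank_double ?ys) v) (rank_double ?xs l)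
      = rank_double (arrange ?ys w) l"
      using key IH by (simp only: moves_simps)
  qed
next
  show "ribbon_word (delete [3, 4, 5, 6] (cable_pos xs) (rank_double xs) []) \<and>
    (\<forall>l\<in>{3..6}. moves (delete [3, 4, 5, 6] (cable_pos xs) (rank_double xs) []) (rank_double xs l) = rank_double (arrange xs []) l)" for xs
    by (simp add: ribbon_word.nil delete.simps)
qed

lemma arrange_below:
  assumes "set xs = {1..4}" "length xs = 4" "w \<in> braid_words 4" "\<And>j. 1 \<le> j \<Longrightarrow> j \<le> 4 \<Longrightarrow> \<pi> j = xs ! (j - 1)"
    and j: "1 \<le> j" "j \<le> 4"
  shows "arrangement_below \<pi> w j = arrange xs w ! (j - 1)"
  using assms(1-4)
proof (induction w arbitrary: xs \<pi>)
  case Nil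
  then show ?case using j by simp
next
  case (Cons x w)
  obtain i f where x: "x = (i, f)" by force
  have i: "1 \<le> i" "i \<le> 3" and w: "w \<in> braid_words 4" using Cons.prems(3) by (auto simp: x braid_words_def)
  obtain L a b R where sp: "xs = L @ a # b # R" "length L + 1 = i"
    "set (L @ b # a # R) = {1..4}" "length (L @ b # a # R) = 4"
    using arrangement_split[OF Cons.prems(1,2) i] by metis
  note c = cable_Cons(2)[OF Cons.prems(1,2) i Cons.prems(4) sp(1,2)]
  show ?case using Cons.IH[OF sp(3,4) w c] unfolding x arrangement_below.simps sp(1) arrange_split_Cons[OF sp(2)] .
qed

lemma arrange_pure:
  assumes "A \<in> pure_braid_words 4" shows "arrange [1, 2, 3, 4] A = [1, 2, 3, 4]"
proof (rule nth_equalityI)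
  have A: "A \<in> braid_words 4" "arrangement_below id A = id" using assms by (auto simp: pure_braid_words_def)
  have xs: "set [1, 2, 3, 4] = {1..4::nat}" "length [1, 2, 3, 4 :: nat] = 4" by auto
  have id: "id j = [1, 2, 3, 4] ! (j - 1)" if "1 \<le> j" "j \<le> 4" for j :: nat
  proof -
    have "j = 1 \<or> j = 2 \<or> j = 3 \<or> j = 4" using that by linarith
    then show ?thesis by auto
  qed
  show l: "length (arrange [1, 2, 3, 4] A) = length [1, 2, 3, 4 :: nat]" using arrange_perm[OF xs A(1)] by simp
  fix k assume "k < length (arrange [1, 2, 3, 4] A)"
  then have k: "1 \<le> Suc k" "Suc k \<le> 4" using arrange_perm[OF xs A(1)] by auto
  have "arrange [1, 2, 3, 4] A ! (Suc k - 1) = id (Suc k)"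
    by (rule arrange_below[OF xs A(1) id k, unfolded A(2), symmetric])
  also have "\<dots> = [1, 2, 3, 4] ! (Suc k - 1)" by (rule id[OF k])
  finally show "arrange [1, 2, 3, 4] A ! k = [1, 2, 3, 4] ! k" by simp
qed

section \<open>Removing whole twist regions and ribbon words\<close>

lemma untwist_cap_all:
  assumes J: "finite J" and q: "inj_on q J"
    and AB: "A \<in> J" "B \<in> J" "q A = 2" "q B = 3" "start A = 2" "start B = 2"
    and others: "\<And>j. j \<in> J \<Longrightarrow> j \<notin> {A, B} \<Longrightarrow> start j = 0"
    and m: "2 \<le> m" and n: "\<And>j. j \<in> J \<Longrightarrow> 2 * m + 4 * t < n j"
    and \<alpha>: "\<alpha> A 2 = (5/2, 0)" "\<alpha> B 2 = (5/2, 0)"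
  shows "leads_to n J (normal_form n \<alpha> (blanks m @ replicate (2 * t) (Some (2, f)) @ V) q)
    (normal_form n \<alpha> (blanks (m + 2 * t) @ V) q)"
  using m n
proof (induction t arbitrary: m)
  case 0
  then show ?case by (simp add: leads_to_refl)
next
  case (Suc t)
  have n1: "2 * m + 2 < n j" "2 * (m + 1) + 2 < n j" "2 * (m + 2) + 4 * t < n j" if "j \<in> J" for j
    using Suc.prems(2)[OF that] by simp_all
  let ?q = "Transposition.transpose 2 (2 + 1) \<circ> q"
  have 1: "leads_to n J (normal_form n \<alpha> (blanks m @ Some (2, f) # Some (2, f) # replicate (2 * t) (Some (2, f)) @ V) q)
     (normal_form n \<alpha> (blanks (m + 1) @ Some (2, f) # replicate (2 * t) (Some (2, f)) @ V) ?q)"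
    by (rule untwist_cap[OF J q AB(1,2) AB(3) _ AB(5,6) others Suc.prems(1) n1(1), where x = "5/2" and \<alpha> = \<alpha>]) (use AB \<alpha> in auto)
  have inj: "inj_on ?q J" using q by (auto simp: inj_on_def Transposition.transpose_def split: if_splits)
  have 2: "leads_to n J (normal_form n \<alpha> (blanks (m + 1) @ Some (2, f) # replicate (2 * t) (Some (2, f)) @ V) ?q)
     (normal_form n \<alpha> (blanks (m + 1 + 1) @ replicate (2 * t) (Some (2, f)) @ V) (Transposition.transpose 2 (2 + 1) \<circ> ?q))"
    by (rule untwist_cap[OF J inj AB(2,1) _ _ AB(6,5) _ _ n1(2), where x = "5/2" and \<alpha> = \<alpha>]) (use AB \<alpha> others Suc.prems(1) in auto)
  have "Transposition.transpose 2 (2 + 1) \<circ> ?q = q" by (simp add: fun_eq_iff)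
  note 12 = leads_to_trans[OF 1 2, unfolded this]
  have 3: "leads_to n J (normal_form n \<alpha> (blanks (m + 2) @ replicate (2 * t) (Some (2, f)) @ V) q)
    (normal_form n \<alpha> (blanks (m + 2 + 2 * t) @ V) q)"
    by (rule Suc.IH) (use Suc.prems(1) n1(3) in auto)
  have e: "m + 1 + 1 = m + 2" "m + 2 + 2 * t = m + 2 * Suc t"
    "replicate (2 * Suc t) (Some (2, f)) @ V = Some (2, f) # Some (2, f) # replicate (2 * t) (Some (2, f)) @ V" by simp_all
  show ?case using leads_to_trans[OF 12[unfolded e(1)] 3] unfolding e(2,3) .
qed

text \<open>
  The word is undone from its last letter upwards, since a letter can be undone if only blanks separate it
  from the minimum.
\<close>

lemma untwist_cup_all:
  assumes J: "finite J" and q: "inj_on q J"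
    and AB: "A \<in> J" "B \<in> J" "{moves U (q A), moves U (q B)} = {i, i + 1}" "n A = E" "n B = E" "cup A = cup B"
    and others: "\<And>j. j \<in> J \<Longrightarrow> j \<notin> {A, B} \<Longrightarrow> E < n j \<or> n j \<le> 2 * length U"
    and U: "2 \<le> length U" and E: "2 * length U + 2 * length W < E"
    and \<alpha>: "\<alpha> A E = (x, 0)" "\<alpha> B E = (x, 0)" "real i \<le> x" "x \<le> real i + 1"
    and W: "set W \<subseteq> {None, Some (i, True), Some (i, False)}"
  shows "leads_to n J (normal_form n \<alpha> (U @ W @ blanks m) q) (normal_form n \<alpha> (U @ blanks (length W + m)) q)"
  using W E
proof (induction W arbitrary: m rule: rev_induct)
  case Nil
  then show ?case by (simp add: leads_to_refl)
next
  case (snoc y W)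
  have W: "set W \<subseteq> {None, Some (i, True), Some (i, False)}" and E: "2 * length U + 2 * length W < E" using snoc.prems by auto
  have 2: "leads_to n J (normal_form n \<alpha> (U @ W @ blanks (m + 1)) q) (normal_form n \<alpha> (U @ blanks (length W + (m + 1))) q)"
    by (rule snoc.IH[OF W E])
  have 1: "leads_to n J (normal_form n \<alpha> ((U @ W) @ y # blanks m) q) (normal_form n \<alpha> ((U @ W) @ blanks (m + 1)) q)"
  proof (cases y)
    case None
    then show ?thesis by (simp add: leads_to_refl)
  next
    case (Some z)
    then obtain f where y: "y = Some (i, f)" using snoc.prems(1) by auto
    have swap: "{moves W p, moves W p'} = {i, i + 1}" if "{p, p'} = {i, i + 1}" for p p'
      using W that
    proof (induction W arbitrary: p p')
      case (Cons z W)
      have "{move z p, move z p'} = {i, i + 1}" using Cons.prems by (auto simp: move_Some doubleton_eq_iff)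
      then show ?case using Cons by simp
    qed simp
    have pos: "{moves (U @ W) (q A), moves (U @ W) (q B)} = {i, i + 1}" using swap[OF AB(3)] by simp
    have oth: "E < n j \<or> n j \<le> 2 * length (U @ W)" if "j \<in> J" "j \<notin> {A, B}" for j using others[OF that] by auto
    have U': "2 \<le> length (U @ W)" "2 * length (U @ W) + 2 < E" using U snoc.prems(2) by auto
    show ?thesis
    proof (cases "moves (U @ W) (q A) = i")
      case True
      then have "moves (U @ W) (q B) = i + 1" using pos by (auto simp: doubleton_eq_iff)
      then show ?thesis unfolding y
        using untwist_cup[OF J q AB(1,2) True _ AB(4-6) oth U', where \<alpha> = \<alpha> and x = x] \<alpha> by blast
    next
      case False
      then have p: "moves (U @ W) (q B) = i" "moves (U @ W) (q A) = i + 1" using pos by (auto simp: doubleton_eq_iff)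
      have oth': "E < n j \<or> n j \<le> 2 * length (U @ W)" if "j \<in> J" "j \<notin> {B, A}" for j using oth that by auto
      show ?thesis unfolding y
        using untwist_cup[OF J q AB(2,1) p AB(5,4) AB(6)[symmetric] oth' U', where \<alpha> = \<alpha> and x = x] \<alpha> by blast
    qed
  qed
  show ?case using leads_to_trans[OF 1[unfolded append_assoc] 2] by simp
qed

text \<open>
  The vertices are kept in the middle above the two strands of each cap, so that they move along when a
  ribbon crossing slides off.
\<close>

definition cap_points :: "(nat \<Rightarrow> nat) \<Rightarrow> (nat \<Rightarrow> nat \<Rightarrow> real \<times> real) \<Rightarrow> nat \<Rightarrow> nat \<Rightarrow> real \<times> real" where
  "cap_points q \<beta> j k = (if k = 0 then midpoint_of q 5 6 else if k = 2 then midpoint_of q 3 4 else \<beta> j k)"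

lemma slide_all_ribbons:
  assumes "ribbon_word Z" and m: "2 \<le> m" and n: "\<And>j. j \<in> {3, 4, 5, 6} \<Longrightarrow> 2 * m + 2 * length Z < n j" "\<And>j. j \<in> {3, 4, 5, 6} \<Longrightarrow> 2 < n j"
    and q: "q ` {3, 4} = {1, 2} \<and> q ` {5, 6} = {3, 4} \<or> q ` {3, 4} = {3, 4} \<and> q ` {5, 6} = {1, 2}"
  shows "\<exists>q'. (\<forall>l\<in>{3, 4, 5, 6}. q' l = moves Z (q l)) \<and>
    leads_to n {3, 4, 5, 6} (normal_form n (cap_points q \<beta>) (blanks m @ Z @ V) q)
      (normal_form n (cap_points q' \<beta>) (blanks (m + length Z) @ V) q')"
  using assms(1) m n(1) q
proof (induction Z arbitrary: m q)
  case nil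
  show ?case by (intro exI[of _ q]) (simp add: leads_to_refl)
next
  case (blank W)
  have "2 * Suc m + 2 * length W < n j" if "j \<in> {3, 4, 5, 6}" for j using blank.prems(2)[OF that] by simp
  from blank.IH[OF _ this blank.prems(3)] blank.prems(1) obtain q' where "\<forall>l\<in>{3, 4, 5, 6}. q' l = moves W (q l)"
    "leads_to n {3, 4, 5, 6} (normal_form n (cap_points q \<beta>) (blanks (Suc m) @ W @ V) q)
      (normal_form n (cap_points q' \<beta>) (blanks (Suc m + length W) @ V) q')" by auto
  moreover have "blanks (Suc m) @ X = blanks m @ None # X" for X by (induction m) auto
  then have "blanks (Suc m) @ W @ V = blanks m @ (None # W) @ V" by simp
  moreover have "Suc m + length W = m + length (None # W)" "moves (None # W) p = moves W p" for p by simp_all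
  ultimately show ?case unfolding append_assoc by (intro exI[of _ q']) (simp only: simp_thms)
next
  case (ribbon W f)
  have len: "length (ribbon_letters f) = 4" by (simp add: ribbon_letters_def)
  have n8: "2 * m + 8 < n j" "2 * (m + 4) + 2 * length W < n j" if "j \<in> {3, 4, 5, 6}" for j
    using ribbon.prems(2)[OF that] by (simp_all add: len)
  let ?q = "ribbon_swap \<circ> q"
  have st: "leads_to n {3, 4, 5, 6} (normal_form n (cap_points q \<beta>) (blanks m @ ribbon_letters f @ (W @ V)) q)
     (normal_form n (cap_points ?q \<beta>) (blanks (m + 4) @ (W @ V)) ?q)"
  proof (rule slide_ribbon[OF n8(1) ribbon.prems(1,3)])
    show "cap_points ?q \<beta> j (n j) = cap_points q \<beta> j (n j)" if "j \<in> {3, 4, 5, 6}" for j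
      using n(2)[OF that] by (simp add: cap_points_def)
  qed (simp_all add: cap_points_def)
  have q4: "q l \<in> {1, 2, 3, 4}" if "l \<in> {3, 4, 5, 6}" for l using ribbon.prems(3) that by auto
  have q': "?q ` {3, 4} = {1, 2} \<and> ?q ` {5, 6} = {3, 4} \<or> ?q ` {3, 4} = {3, 4} \<and> ?q ` {5, 6} = {1, 2}"
  proof -
    have s: "ribbon_swap ` {1, 2} = {3, 4}" "ribbon_swap ` {3, 4} = {1, 2}" by (auto simp: ribbon_swap_def)
    show ?thesis using ribbon.prems(3) unfolding image_comp[symmetric] by (elim disjE conjE) (simp_all only: s simp_thms)
  qed
  have "2 \<le> m + 4" by simp
  from ribbon.IH[OF this n8(2) q'] obtain q'' where q'': "\<forall>l\<in>{3, 4, 5, 6}. q'' l = moves W (?q l)"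
    "leads_to n {3, 4, 5, 6} (normal_form n (cap_points ?q \<beta>) (blanks (m + 4) @ W @ V) ?q)
      (normal_form n (cap_points q'' \<beta>) (blanks (m + 4 + length W) @ V) q'')" by blast
  show ?case
  proof (intro exI[of _ q''] conjI ballI)
    show "q'' l = moves (ribbon_letters f @ W) (q l)" if "l \<in> {3, 4, 5, 6}" for l
      using q''(1) that moves_ribbon[OF q4[OF that], of f] by auto
    have e: "m + length (ribbon_letters f @ W) = m + 4 + length W" by (simp add: len)
    show "leads_to n {3, 4, 5, 6} (normal_form n (cap_points q \<beta>) (blanks m @ (ribbon_letters f @ W) @ V) q)
      (normal_form n (cap_points q'' \<beta>) (blanks (m + length (ribbon_letters f @ W)) @ V) q'')"
      unfolding e append_assoc using leads_to_trans[OF st q''(2)] .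
  qed
qed

lemma bounded_delete:
  assumes "same_order (set Js) q r" "r ` set Js \<subseteq> {1..4}"
  shows "bounded_word (delete Js q r w)"
  using assms
proof (induction w arbitrary: q r)
  case (Cons x w)
  obtain i f where x: "x = (i, f)" by force
  have inj: "inj_on q (set Js)" using Cons.prems by (simp add: same_order_def)
  show ?case
  proof (cases "\<exists>a\<in>set Js. \<exists>b\<in>set Js. q a = i \<and> q b = i + 1")
    case True
    then obtain a b where ab: "a \<in> set Js" "b \<in> set Js" "q a = i" "q b = i + 1" by blast
    have rb: "r b = r a + 1" using same_order_adjacent[OF Cons.prems(1) ab(1,2)] ab by simp
    have r4: "1 \<le> r l" "r l \<le> 4" if "l \<in> set Js" for l using Cons.prems(2) that by auto
    have ra: "1 \<le> r a" "r a \<le> 3" using r4[OF ab(1)] r4[OF ab(2)] rb by auto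
    have "(\<lambda>l. move (Some (r a, f)) (r l)) ` set Js \<subseteq> {1..4}" using r4 ra by (auto simp: move_Some)
    then show ?thesis unfolding x delete_cross[OF ab inj]
      using Cons.IH[OF same_order_cross[OF Cons.prems(1) ab, of f]] ra by simp
  next
    case False
    show ?thesis unfolding x delete_skip[OF False]
      using Cons.IH[OF same_order_skip[OF Cons.prems(1) False, of f] Cons.prems(2)] by simp
  qed
qed simp

section \<open>The six strands of the theta graph\<close>

text \<open>
  The position of strand \<open>j\<close> below \<open>upper_braid\<close>; strands 3 and 5 end there, and
  the others continue in position \<open>lower_start j\<close> of \<open>lower_braid\<close>.
\<close>

definition upper_end :: "nat \<Rightarrow> nat" where
  "upper_end j = (if j = 4 then 5 else if j = 5 then 4 else j)"

definition lower_start :: "nat \<Rightarrow> nat" where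
  "lower_start j = (if j = 4 then 3 else if j = 6 then 4 else j)"

text \<open>
  The vertices and the braid \<open>u\<close> need the levels up to \<open>4 + 2 * length u\<close>. The
  first minimum is one level below, and the lower braid starts another level below, in accordance with
  \<open>theta_graph\<close>.
\<close>

definition stop :: "braid_word \<Rightarrow> braid_word \<Rightarrow> nat \<Rightarrow> nat" where
  "stop u v j = (if j \<in> {3, 5} then 5 + 2 * length u else 7 + 2 * length u + 2 * length v)"

definition theta_config :: "braid_word \<Rightarrow> braid_word \<Rightarrow> config" where
  "theta_config u v j k =
    (if k < 4 then (3 + (real j - 3) * ((real k - real (start j)) / (4 - real (start j))), 0)
     else if k \<le> 4 + 2 * length u then place (map Some u) j (k - 4)
     else if k = 5 + 2 * length u then (if j \<in> {3, 5} then (7/2, 0) else ((real (upper_end j) + real (lower_start j)) / 2, 0))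
     else if k < stop u v j then place (map Some v) (lower_start j) (k - (6 + 2 * length u))
     else (if j \<in> {1, 2} then 3/2 else 7/2, 0))"

lemma place_end: "place W p (2 * length W) = (real (moves W p), 0)"
  using place_append[of W "[]" p "2 * length W"] by simp

lemma labels_cases:
  assumes "j \<in> {1..6::nat}" obtains "j = 1" | "j = 2" | "j = 3" | "j = 4" | "j = 5" | "j = 6"
proof -
  have "j = 1 \<or> j = 2 \<or> j = 3 \<or> j = 4 \<or> j = 5 \<or> j = 6" using assms unfolding atLeastAtMost_iff by linarith
  then show ?thesis using that by blast
qed

text \<open>
  Keeping the strands \<open>Js\<close> and closing the gaps between them. From left to right the order of
  the strands is the same in both configurations outside the two braids, namely that of the strands
  themselves above \<open>u\<close>, that of \<open>upper_end\<close> below \<open>u\<close>, and that of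
  \<open>lower_start\<close> from there on; inside the braids \<open>delete_separated\<close> applies. The
  remaining assumptions say that the end points \<open>\<alpha>\<close> respect this order.
\<close>

lemma theta_compatible:
  fixes u v :: braid_word and \<alpha> :: "nat \<Rightarrow> nat \<Rightarrow> real \<times> real"
  defines "n \<equiv> stop u v"
  assumes u: "\<And>j. j \<in> {1..6} \<Longrightarrow> moves (map Some u) j = upper_end j" and v: "\<And>p. moves (map Some v) p = p"
    and Js: "set Js \<subseteq> {1..6}" "set Js' = set Js \<inter> {1, 2, 4, 6}"
    and r: "same_order (set Js) id r"
    and D: "D = delete Js id r u" and D': "D' = delete Js' lower_start lower_start v"
    and f: "\<And>j. j \<in> set Js' \<Longrightarrow> moves D (r j) = lower_start j"
    and so': "same_order (set Js') lower_start lower_start"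
    and top: "\<And>j. j \<in> set Js \<Longrightarrow> start j = 0 \<Longrightarrow> \<alpha> j 0 = P"
      "\<And>j. j \<in> set Js \<Longrightarrow> start j = 2 \<Longrightarrow> \<alpha> j 2 = (y, 0)"
      "1 \<in> set Js \<Longrightarrow> real (r 1) < y" "\<And>j. j \<in> set Js \<Longrightarrow> 5 \<le> j \<Longrightarrow> y < real (r j)"
    and mid: "\<And>j. j \<in> set Js \<inter> {3, 5} \<Longrightarrow> \<alpha> j (5 + 2 * length u) = (y', 0)"
      "\<And>j. set Js \<inter> {3, 5} \<noteq> {} \<Longrightarrow> j \<in> set Js \<inter> {1, 2} \<Longrightarrow> real (lower_start j) < y'"
      "\<And>j. set Js \<inter> {3, 5} \<noteq> {} \<Longrightarrow> j \<in> set Js \<inter> {4, 6} \<Longrightarrow> y' < real (lower_start j)"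
    and bot: "\<And>j. j \<in> set Js \<inter> {1, 2} \<Longrightarrow> \<alpha> j (n j) = (3/2, 0)" "\<And>j. j \<in> set Js \<inter> {4, 6} \<Longrightarrow> \<alpha> j (n j) = (7/2, 0)"
  shows "compatible n (set Js) (theta_config u v) (normal_form n \<alpha> (blanks 2 @ D @ None # D') r)"
proof (rule compatibleI)
  note One_nat_def [simp del]
  define c where "c = theta_config u v"
  define c' where "c' = normal_form n \<alpha> (blanks 2 @ D @ None # D') r"
  define E where "E = 4 + 2 * length u"
  have lD: "length D = length u" "length D' = length v" by (simp_all add: D D')
  have n35: "n 3 = E + 1" "n 5 = E + 1" by (simp_all add: n_def stop_def E_def)
  have nJ': "n j = E + 3 + 2 * length v" if "j \<in> {1, 2, 4, 6}" for j using that by (auto simp: n_def stop_def E_def)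
  have start4: "start j \<le> 2" for j by (rule start_le)
  have nE: "E < n j" for j by (simp add: n_def stop_def E_def)
  have E4: "4 \<le> E" by (simp add: E_def)
  have J': "j \<in> set Js' \<longleftrightarrow> j \<in> set Js \<and> j \<in> {1, 2, 4, 6}" for j using Js(2) by blast
  have J6: "j \<in> {1..6}" if "j \<in> set Js" for j using that Js(1) by blast
  have J35: "j \<in> {3, 5} \<or> j \<in> set Js'" if "j \<in> set Js" for j
    using J6[OF that] that unfolding J' by (auto elim: labels_cases)
  have ctop: "fst (c j k) = 3 + (real j - 3) * ((real k - real (start j)) / (4 - real (start j)))" if "k < 4" for j k
    using that by (simp add: c_def theta_config_def)
  have cE: "c j (E + 1) = (if j \<in> {3, 5} then (7/2, 0) else ((real (upper_end j) + real (lower_start j)) / 2, 0))" for j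
    by (simp add: c_def theta_config_def E_def)
  have cU: "c j k = place (map Some u) j (k - 4)" if "4 \<le> k" "k \<le> E" for j k
    using that by (simp add: c_def theta_config_def E_def)
  have cV: "c j k = place (map Some v) (lower_start j) (k - (E + 2))" if "E + 2 \<le> k" "k < n j" for j k
    using that by (simp add: c_def theta_config_def E_def n_def)
  have cEnd: "c j (n j) = (if j \<in> {1, 2} then 3/2 else 7/2, 0)" if "j \<in> set Js'" for j
    using that unfolding J' by (auto simp: c_def theta_config_def E_def n_def stop_def)
  have dtop: "c' j k = (real (r j), 0)" if "start j < k" "k \<le> 4" for j k
  proof -
    have "k \<noteq> n j" using that nE[of j] E4 by linarith
    then show ?thesis using that unfolding c'_def normal_form_def place_blanks_append
      by (cases "k < 4") (auto simp: place_append place_Cons)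
  qed
  have dstart: "c' j (start j) = \<alpha> j (start j)" for j by (simp add: c'_def normal_form_def)
  have dU: "c' j k = place D (r j) (k - 4)" if "4 \<le> k" "k \<le> E" for j k
  proof -
    have "k \<noteq> n j" "k \<noteq> start j" using that nE[of j] start4[of j] by linarith+
    then have "c' j k = place (D @ None # D') (r j) (k - 4)"
      using that unfolding c'_def normal_form_def place_blanks_append by simp
    also have "\<dots> = place D (r j) (k - 4)"
    proof (cases "k - 4 < 2 * length D")
      case False
      then have "k - 4 = 2 * length D" using that by (simp add: lD E_def)
      then show ?thesis by (simp add: place_append place_Cons place_end)
    qed (simp add: place_append)
    finally show ?thesis .
  qed
  have dV: "c' j (E + 1) = (real (lower_start j), 0) \<and> (\<forall>k. E + 2 \<le> k \<longrightarrow> k < n j \<longrightarrow> c' j k = place D' (lower_start j) (k - (E + 2)))"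
    if j: "j \<in> set Js'" for j
  proof -
    have nj: "n j = E + 3 + 2 * length v" using nJ' j J' by blast
    have 1: "c' j k = place (None # D') (lower_start j) (k - E)" if "E < k" "k < n j" for k
    proof -
      have k: "k \<noteq> n j" "k \<noteq> start j" "\<not> k < 2 * 2" "\<not> k - 4 < 2 * length D" "k - 4 - 2 * length D = k - E"
        using that start4[of j] E4 by (auto simp: E_def lD)
      have "c' j k = place (D @ None # D') (r j) (k - 4)"
        using k unfolding c'_def normal_form_def place_blanks_append by simp
      then show ?thesis unfolding place_append[of D] using k(4,5) f[OF j] by simp
    qed
    show ?thesis
    proof (intro conjI allI impI)
      show "c' j (E + 1) = (real (lower_start j), 0)" using 1[of "E + 1"] nj by (simp add: place_Cons)
      fix k assume k: "E + 2 \<le> k" "k < n j"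
      have "k - E - 2 = k - (E + 2)" by simp
      then show "c' j k = place D' (lower_start j) (k - (E + 2))" using 1[of k] k by (simp add: place_Cons)
    qed
  qed
  have dE: "c' j (E + 1) = (y', 0)" if "j \<in> set Js" "j \<in> {3, 5}" for j
  proof -
    have "E + 1 = n j" using that n35 by auto
    then have "c' j (E + 1) = \<alpha> j (E + 1)" by (simp add: c'_def normal_form_def)
    then show ?thesis using mid(1)[of j] that by (simp add: E_def)
  qed
  have dEnd: "c' j (n j) = (if j \<in> {1, 2} then 3/2 else 7/2, 0)" if "j \<in> set Js'" for j
    using bot[of j] that unfolding J' by (auto simp: c'_def normal_form_def)
  define h where "h j = moves D (r j)" for j
  have soh: "same_order (set Js) upper_end h"
  proof -
    have "same_order (set Js) (\<lambda>l. moves (map Some u) (id l)) (\<lambda>l. moves D (r l))"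
      unfolding D by (rule same_order_delete[OF r])
    moreover have "moves (map Some u) (id l) = upper_end l" if "l \<in> set Js" for l using u[OF J6[OF that]] by simp
    ultimately show ?thesis unfolding same_order_def h_def inj_on_def by (simp cong: ball_cong)
  qed
  have sog: "same_order (set Js') lower_start (\<lambda>l. moves D' (lower_start l))"
    using same_order_delete[OF so', of v] unfolding D'[symmetric] v .
  fix a b k
  assume a: "a \<in> set Js" and b: "b \<in> set Js" and ab: "a < b" and alive: "alive n a b k"
  have al: "start a \<le> k" "start b \<le> k" "k < n a" "k < n b" using alive by (auto simp: alive_def)
  have goal: "separated n c c' a b k" 
  proof -
    consider "k < 4" | "4 \<le> k" "k < E" | "k = E" | "k = E + 1" | "E + 2 \<le> k" "k < E + 2 + 2 * length v" | "E + 2 + 2 * length v \<le> k" by linarith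
    then show ?thesis
    proof cases
      case 1
      show ?thesis
      proof (rule separated_xI)
        fix \<kappa> assume "\<kappa> \<in> {k, Suc k}"
        then have \<kappa>: "\<kappa> \<le> 4" "start a \<le> \<kappa>" "start b \<le> \<kappa>" using 1 al by auto
        have ra: "r a < r b" using r a b ab unfolding same_order_def by simp
        have A: "c j \<kappa> = (3 + (real j - 3) * ((real \<kappa> - real (start j)) / (4 - real (start j))), 0)" if "start j \<le> \<kappa>" for j
        proof (cases "\<kappa> < 4")
          case True then show ?thesis by (simp add: c_def theta_config_def)
        next
          case False
          then have "\<kappa> = 4" using \<kappa>(1) by simp
          then show ?thesis using cU[of 4 j] E4 start4[of j] by simp
        qed
        have D2: "c' j 2 = (if start j = 2 then (y, 0) else (real (r j), 0))" if "j \<in> set Js" for j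
          using that top(2)[of j] dstart[of j] dtop[of j 2] by (auto simp: start_def split: if_splits)
        have D0: "c' j 0 = P" if "j \<in> set Js" "start j = 0" for j
          using that top(1)[of j] dstart[of j] by simp
        have D1: "c' j \<kappa> = (real (r j), 0)" if "start j < \<kappa>" for j using dtop[OF that \<kappa>(1)] .
        have rr: "real (r a) < real (r b)" using ra by simp
        have st: "start a = 0 \<or> start a = 2" "start b = 0 \<or> start b = 2" by (simp_all add: start_def)
        have s1: "start 1 = 0" "start 5 = 0" "start 6 = 0" "start 2 = 2" "start 3 = 2" "start 4 = 2" by (simp_all add: start_def)
        consider "\<kappa> = 0" | "\<kappa> = 1" | "\<kappa> = 2" | "2 < \<kappa>" by linarith
        then show "joined n a b \<kappa> \<and> c a \<kappa> = c b \<kappa> \<and> c' a \<kappa> = c' b \<kappa> \<or> fst (c a \<kappa>) < fst (c b \<kappa>) \<and> fst (c' a \<kappa>) < fst (c' b \<kappa>)"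
        proof cases
          case 1
          then have s: "start a = 0" "start b = 0" using \<kappa> by simp_all
          then show ?thesis using A[of a] A[of b] D0[OF a] D0[OF b] 1 by (simp add: joined_def)
        next
          case 2
          then have s: "start a = 0" "start b = 0" using \<kappa> st by auto
          have "real a < real b" using ab by simp
          then show ?thesis using A[of a] A[of b] D1[of a] D1[of b] rr unfolding 2 s by (simp add: field_simps)
        next
          case 3
          have Ca: "c a \<kappa> = (if start a = 2 then 3 else (3 + real a) / 2, 0)" and Cb: "c b \<kappa> = (if start b = 2 then 3 else (3 + real b) / 2, 0)"
            using A[OF \<kappa>(2)] A[OF \<kappa>(3)] st unfolding 3 by (auto simp: field_simps)
          consider "start a = 2" "start b = 2" | "start a = 0" "start b = 0" | "start a = 2" "start b = 0" | "start a = 0" "start b = 2"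
            using st by (elim disjE) simp_all
          then show ?thesis
          proof cases
            case 1
            then show ?thesis using Ca Cb D2[OF a] D2[OF b] unfolding 3 by (simp add: joined_def)
          next
            case 2
            then show ?thesis using Ca Cb D2[OF a] D2[OF b] rr ab unfolding 3 by simp
          next
            case p: 3
            have "5 \<le> b" using p ab by (rule_tac labels_cases[OF J6[OF b]]; rule_tac labels_cases[OF J6[OF a]]) (simp_all add: s1)
            then have "y < real (r b)" "3 < (3 + real b) / 2" using top(4)[OF b] by simp_all
            then show ?thesis using Ca Cb D2[OF a] D2[OF b] p unfolding 3 by simp
          next
            case p: 4
            have "a = 1" using p ab by (rule_tac labels_cases[OF J6[OF b]]; rule_tac labels_cases[OF J6[OF a]]) (simp_all add: s1)
            then have "real (r a) < y" "(3 + real a) / 2 < 3" using top(3) a by simp_all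
            then show ?thesis using Ca Cb D2[OF a] D2[OF b] p unfolding 3 by simp
          qed
        next
          case 4
          then have "c' a \<kappa> = (real (r a), 0)" "c' b \<kappa> = (real (r b), 0)" using D1 st by auto
          moreover have "fst (c a \<kappa>) < fst (c b \<kappa>)"
          proof -
            have "\<kappa> = 3 \<or> \<kappa> = 4" using 4 \<kappa>(1) by linarith
            then show ?thesis unfolding A[OF \<kappa>(2)] A[OF \<kappa>(3)] using ab
              by (rule_tac labels_cases[OF J6[OF b]]; rule_tac labels_cases[OF J6[OF a]]) (auto simp: s1)
          qed
          ultimately show ?thesis using rr by simp
        qed
      qed
    next
      case 2
      have k: "k - 4 < 2 * length u" "Suc k - 4 = Suc (k - 4)" using 2 by (auto simp: E_def)
      obtain l where l: "\<forall>\<kappa>\<in>{k - 4, Suc (k - 4)}. place_sep l u D a b (r a) (r b) \<kappa>"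
        using delete_separated[OF r a b _ k(1)] ab unfolding D by auto
      have "ordered_at n c c' l a b \<kappa>" if "\<kappa> \<in> {k, Suc k}" for \<kappa>
      proof -
        have \<kappa>: "4 \<le> \<kappa>" "\<kappa> \<le> E" "\<kappa> - 4 \<in> {k - 4, Suc (k - 4)}" using that 2 by auto
        have "place_sep l u D a b (r a) (r b) (\<kappa> - 4)" using l \<kappa>(3) by blast
        then show ?thesis unfolding ordered_at_def gap_def place_sep_def cU[OF \<kappa>(1,2)] dU[OF \<kappa>(1,2)] by blast
      qed
      then show ?thesis unfolding separated_def by blast
    next
      case 3
      have key: "separated n c c' x z k" if x: "x \<in> set Js" and z: "z \<in> set Js" and xz: "upper_end x < upper_end z" for x z
      proof (rule separated_xI)
        fix \<kappa> assume "\<kappa> \<in> {k, Suc k}"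
        then consider "\<kappa> = E" | "\<kappa> = E + 1" using 3 by auto
        then show "joined n x z \<kappa> \<and> c x \<kappa> = c z \<kappa> \<and> c' x \<kappa> = c' z \<kappa> \<or> fst (c x \<kappa>) < fst (c z \<kappa>) \<and> fst (c' x \<kappa>) < fst (c' z \<kappa>)"
        proof cases
          case 1
          have "c j \<kappa> = (real (upper_end j), 0)" if "j \<in> set Js" for j
            using cU[of E j] E4 u[OF J6[OF that]] place_end[of "map Some u" j] unfolding 1 by (simp add: E_def)
          moreover have "c' j \<kappa> = (real (h j), 0)" for j
            using dU[of E j] E4 place_end[of D "r j"] unfolding 1 by (simp add: E_def lD h_def)
          moreover have "h x < h z" using soh x z xz unfolding same_order_def by blast
          ultimately show ?thesis using x z xz by simp
        next
          case 2
          consider "x \<in> {3, 5}" "z \<in> {3, 5}" | "x \<in> {3, 5}" "z \<in> set Js'" | "x \<in> set Js'" "z \<in> {3, 5}" | "x \<in> set Js'" "z \<in> set Js'"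
            using J35[OF x] J35[OF z] by blast
          then show ?thesis
          proof cases
            case 1
            then have "joined n x z \<kappa>" unfolding 2 joined_def using n35 by (auto simp: cup_def)
            moreover have "c x \<kappa> = c z \<kappa>" "c' x \<kappa> = c' z \<kappa>" unfolding 2 cE dE[OF x 1(1)] dE[OF z 1(2)] using 1 by auto
            ultimately show ?thesis by blast
          next
            case p: 2
            have "z \<in> {4, 6}" using p xz unfolding J' by (auto simp: upper_end_def)
            then have "y' < real (lower_start z)" "fst (c x \<kappa>) < fst (c z \<kappa>)"
              using mid(3)[of z] p x z unfolding 2 cE by (auto simp: upper_end_def lower_start_def)
            then show ?thesis unfolding 2 using dE[OF x p(1)] dV[OF p(2)] by simp
          next
            case p: 3
            have "x \<in> {1, 2}" using p xz unfolding J' by (auto simp: upper_end_def)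
            then have "real (lower_start x) < y'" "fst (c x \<kappa>) < fst (c z \<kappa>)"
              using mid(2)[of x] p x z unfolding 2 cE by (auto simp: upper_end_def lower_start_def)
            then show ?thesis unfolding 2 using dE[OF z p(2)] dV[OF p(1)] by simp
          next
            case p: 4
            have "fst (c x \<kappa>) < fst (c z \<kappa>) \<and> lower_start x < lower_start z" using p xz unfolding 2 cE J'
              by (auto simp: upper_end_def lower_start_def)
            then show ?thesis unfolding 2 using dV[OF p(1)] dV[OF p(2)] by simp
          qed
        qed
      qed
      have "upper_end a < upper_end b \<or> upper_end b < upper_end a"
        using ab by (auto simp: upper_end_def)
      then show ?thesis using key[OF a b] key[OF b a] separated_swap[of n c c' b a k] by blast
    next
      case 4
      have p: "a \<in> set Js'" "b \<in> set Js'" using J35[OF a] J35[OF b] al 4 n35 by auto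
      have lt: "lower_start a < lower_start b \<and> upper_end a < upper_end b" using p ab unfolding J' by (auto simp: lower_start_def upper_end_def)
      have nj: "E + 2 < n a" "E + 2 < n b" using nJ' p J' by auto
      show ?thesis
      proof (rule separated_xI)
        fix \<kappa> assume "\<kappa> \<in> {k, Suc k}"
        then consider "\<kappa> = E + 1" | "\<kappa> = E + 2" using 4 by auto
        then have "fst (c a \<kappa>) < fst (c b \<kappa>) \<and> fst (c' a \<kappa>) < fst (c' b \<kappa>)"
        proof cases
          case 1
          show ?thesis using lt p dV[OF p(1)] dV[OF p(2)] unfolding 1 cE J' by auto
        next
          case 2
          show ?thesis using lt dV[OF p(1)] dV[OF p(2)] nj cV[OF _ nj(1)] cV[OF _ nj(2)] unfolding 2 by simp
        qed
        then show "joined n a b \<kappa> \<and> c a \<kappa> = c b \<kappa> \<and> c' a \<kappa> = c' b \<kappa> \<or> fst (c a \<kappa>) < fst (c b \<kappa>) \<and> fst (c' a \<kappa>) < fst (c' b \<kappa>)" by blast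
      qed
    next
      case 5
      have p: "a \<in> set Js'" "b \<in> set Js'" using J35[OF a] J35[OF b] al 5 n35 by auto
      have nj: "n a = E + 3 + 2 * length v" "n b = E + 3 + 2 * length v" using nJ' p J' by blast+
      have lt: "lower_start a < lower_start b" using p ab unfolding J' by (auto simp: lower_start_def)
      have k: "k - (E + 2) < 2 * length v" "Suc k - (E + 2) = Suc (k - (E + 2))" using 5 by auto
      obtain l where l: "\<forall>\<kappa>\<in>{k - (E + 2), Suc (k - (E + 2))}. place_sep l v D' (lower_start a) (lower_start b) (lower_start a) (lower_start b) \<kappa>"
        using delete_separated[OF so' p _ k(1)] lt unfolding D' by auto
      have "ordered_at n c c' l a b \<kappa>" if "\<kappa> \<in> {k, Suc k}" for \<kappa>
      proof -
        have \<kappa>: "E + 2 \<le> \<kappa>" "\<kappa> < n a" "\<kappa> < n b" "\<kappa> - (E + 2) \<in> {k - (E + 2), Suc (k - (E + 2))}" using that 5 nj by auto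
        have "place_sep l v D' (lower_start a) (lower_start b) (lower_start a) (lower_start b) (\<kappa> - (E + 2))" using l \<kappa>(4) by blast
        moreover have "c' a \<kappa> = place D' (lower_start a) (\<kappa> - (E + 2))" "c' b \<kappa> = place D' (lower_start b) (\<kappa> - (E + 2))"
          using dV p \<kappa> by blast+
        ultimately show ?thesis unfolding ordered_at_def gap_def place_sep_def cV[OF \<kappa>(1,2)] cV[OF \<kappa>(1,3)] by simp
      qed
      then show ?thesis unfolding separated_def by blast
    next
      case 6
      have p: "a \<in> set Js'" "b \<in> set Js'" using J35[OF a] J35[OF b] al 6 n35 by auto
      have nj: "n a = E + 3 + 2 * length v" "n b = E + 3 + 2 * length v" using nJ' p J' by blast+
      have k: "k = E + 2 + 2 * length v" using 6 al nj by simp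
      have lt: "lower_start a < lower_start b" using p ab unfolding J' by (auto simp: lower_start_def)
      show ?thesis
      proof (rule separated_xI)
        fix \<kappa> assume "\<kappa> \<in> {k, Suc k}"
        then consider "\<kappa> = k" | "\<kappa> = E + 3 + 2 * length v" using k by auto
        then show "joined n a b \<kappa> \<and> c a \<kappa> = c b \<kappa> \<and> c' a \<kappa> = c' b \<kappa> \<or> fst (c a \<kappa>) < fst (c b \<kappa>) \<and> fst (c' a \<kappa>) < fst (c' b \<kappa>)"
        proof cases
          case 1
          have e: "\<kappa> - (E + 2) = 2 * length (map Some v)" "\<kappa> - (E + 2) = 2 * length D'" "E + 2 \<le> \<kappa>" "\<kappa> < n a" "\<kappa> < n b"
            using 1 k nj by (simp_all add: lD)
          have "c a \<kappa> = (real (lower_start a), 0)" "c b \<kappa> = (real (lower_start b), 0)"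
            unfolding cV[OF e(3,4)] cV[OF e(3,5)] e(1) place_end v by simp_all
          moreover have "c' a \<kappa> = (real (moves D' (lower_start a)), 0)" "c' b \<kappa> = (real (moves D' (lower_start b)), 0)"
            using dV[OF p(1)] dV[OF p(2)] e(2-5) place_end[of D'] by metis+
          moreover have "moves D' (lower_start a) < moves D' (lower_start b)" using sog lt p unfolding same_order_def by blast
          ultimately show ?thesis using lt by simp
        next
          case 2
          have e: "\<kappa> = n a" "\<kappa> = n b" using 2 nj by simp_all
          have ca: "c a \<kappa> = (if a \<in> {1, 2} then 3/2 else 7/2, 0)" "c' a \<kappa> = (if a \<in> {1, 2} then 3/2 else 7/2, 0)"
            unfolding e(1) using cEnd[OF p(1)] dEnd[OF p(1)] by blast+
          have cb: "c b \<kappa> = (if b \<in> {1, 2} then 3/2 else 7/2, 0)" "c' b \<kappa> = (if b \<in> {1, 2} then 3/2 else 7/2, 0)"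
            unfolding e(2) using cEnd[OF p(2)] dEnd[OF p(2)] by blast+
          consider "a \<in> {1, 2}" "b \<in> {1, 2}" | "a \<in> {1, 2}" "b \<in> {4, 6}" | "a \<in> {4, 6}" "b \<in> {4, 6}"
            using p ab unfolding J' by auto
          then show ?thesis
          proof cases
            case 1
            then have "joined n a b \<kappa>" using e unfolding joined_def by (auto simp: cup_def)
            then show ?thesis using 1 ca cb by simp
          next
            case 2
            then show ?thesis using ca cb by auto
          next
            case 3
            then have "joined n a b \<kappa>" using e unfolding joined_def by (auto simp: cup_def)
            then show ?thesis using 3 ca cb by auto
          qed
        qed
      qed
    qed
  qed
  then show "separated n (theta_config u v) (normal_form n \<alpha> (blanks 2 @ D @ None # D') r) a b k" unfolding c_def c'_def .
qed

lemma compatible_refl_left: "compatible n J c c' \<Longrightarrow> compatible n J c c"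
  unfolding compatible_def separated_def ordered_at_def by blast

lemma compatible_unknot:
  assumes "compatible n J c c0" "leads_to n J c0 c1" "compatible n J c1 c1 \<Longrightarrow> is_unknot (to_S3 ` curve n J c1)"
    "finite J" "J \<noteq> {}" "\<And>j. j \<in> J \<Longrightarrow> 2 < n j"
  shows "is_unknot (to_S3 ` curve n J c)"
proof -
  have 1: "leads_to n J c c1"
    by (rule leads_to_trans[OF _ assms(2)]) (use assms(1) in \<open>auto simp: leads_to_def\<close>)
  have valid: "compatible n J c c" by (rule compatible_refl_left[OF assms(1)])
  then have "compatible n J c1 c1" using 1 compatible_steps_valid unfolding leads_to_def by blast
  from leads_to_unknot[OF 1 valid assms(4-6) assms(3)[OF this]] show ?thesis .
qed

section \<open>Letters that survive the removal of an edge\<close>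

lemma moves_pure_inverse:
  assumes "A \<in> pure_braid_words 4" shows "moves (map Some (braid_inverse A)) p = p"
proof -
  have "arrangement_below id A = id" using assms by (simp add: pure_braid_words_def)
  then have "arrangement_below id (braid_inverse A) = id" using arrangement_inverse[of id A] by simp
  then show ?thesis using arrangement_moves[of id "braid_inverse A" p] by simp
qed

lemma moves_twists: "moves (replicate (2 * m) (Some (2, f))) p = p"
  by (induction m arbitrary: p) (simp_all add: move_Some)

lemma map_full_twists: "map Some (full_twists 2 t) = replicate (2 * nat \<bar>t\<bar>) (Some (2, 0 < t))"
  by (simp add: full_twists_def)

lemma cable_pos_id: "l \<in> {1..6} \<Longrightarrow> cable_pos [1, 2, 3, 4] l = l"
  by (erule labels_cases) (simp_all add: cable_pos_def parent_def copy_def width_def)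

lemma rho_cable: "rho A = cable width id A"
proof -
  have "(\<lambda>s. if s \<in> {3, 4} then 2 else 1) = width" by (simp add: fun_eq_iff width_def)
  then show ?thesis by (simp add: rho_def)
qed

lemma id_arrangement: "1 \<le> j \<Longrightarrow> j \<le> 4 \<Longrightarrow> id j = [1, 2, 3, 4] ! (j - 1)"
proof -
  assume "1 \<le> j" "j \<le> 4"
  then have "j = 1 \<or> j = 2 \<or> j = 3 \<or> j = 4" by linarith
  then show ?thesis by auto
qed

lemma arrangement_1234: "set [1, 2, 3, 4] = {1..4::nat}" "length [1, 2, 3, 4 :: nat] = 4"
  by auto

lemma moves_rho:
  assumes "A \<in> pure_braid_words 4" "l \<in> {1..6}" shows "moves (map Some (rho A)) l = l"
proof -
  have w: "A \<in> braid_words 4" using assms(1) by (simp add: pure_braid_words_def)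
  have "moves (map Some (cable width id A)) (cable_pos [1, 2, 3, 4] l) = cable_pos (arrange [1, 2, 3, 4] A) l"
    using cable_moves[OF arrangement_1234 w id_arrangement] assms(2) by blast
  then show ?thesis unfolding arrange_pure[OF assms(1)] cable_pos_id[OF assms(2)] rho_cable .
qed

lemma braid_words_inverse: "A \<in> braid_words n \<Longrightarrow> braid_inverse A \<in> braid_words n"
  by (auto simp: braid_words_def braid_inverse_def)

lemma braid_words_append: "A \<in> braid_words n \<Longrightarrow> B \<in> braid_words n \<Longrightarrow> A @ B \<in> braid_words n"
  by (auto simp: braid_words_def)

lemma braid_words_twists: "full_twists 2 t \<in> braid_words 4"
  by (auto simp: braid_words_def full_twists_def)

lemma moves_upper:
  assumes "A \<in> pure_braid_words 4" "j \<in> {1..6}"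
  shows "moves (map Some (upper_braid A t)) j = upper_end j"
  unfolding upper_braid_def map_append moves_simps moves_rho[OF assms] map_full_twists moves_twists moves_pure_inverse[OF assms(1)]
  by (simp add: move_Some upper_end_def)

lemma moves_lower:
  assumes "A \<in> pure_braid_words 4" shows "moves (map Some (lower_braid A t)) p = p"
  unfolding lower_braid_def map_append moves_simps map_full_twists moves_twists moves_pure_inverse[OF assms] ..

lemma lower_words: "A \<in> braid_words 4 \<Longrightarrow> lower_braid A t \<in> braid_words 4"
  unfolding lower_braid_def by (intro braid_words_append braid_words_inverse braid_words_twists)

text \<open>
  A word in a single generator is determined by its exponent sum up to cancellation. This is how the
  triviality of \<open>\<phi>(A)\<close> enters.
\<close>

lemma ker_phi_writhe:
  assumes "A \<in> ker_phi" shows "writhe (keep_strands {1, 2} id (braid_inverse A)) = 0"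
proof -
  have A: "arrangement_below id A = id" and "braid_eq 2 (phi A) []" using assms by (auto simp: ker_phi_def pure_braid_words_def)
  from writhe_braid_eq[OF this(2)] have "writhe (keep_strands {1, 2} id A) = 0" by (simp add: phi_def)
  then show ?thesis using writhe_keep_inverse[of "{1, 2}" id A] unfolding A by simp
qed

text \<open>
  The full twists act on positions 2 and 3. If one of these is empty, then just one strand takes part in
  them, and moves to and fro.
\<close>

lemma delete_twists_hole:
  assumes "\<And>l. l \<in> set Js \<Longrightarrow> q l \<noteq> h" "h = 2 \<or> h = 3"
  shows "delete Js q r (replicate m (2, f)) = blanks m"
  using assms
proof (induction m arbitrary: q h)
  case (Suc m)
  have "\<not> (\<exists>a\<in>set Js. \<exists>b\<in>set Js. q a = 2 \<and> q b = 2 + 1)" using Suc.prems by auto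
  from delete_skip[OF this, of r f] have "delete Js q r (replicate (Suc m) (2, f)) = None # delete Js (\<lambda>l. move (Some (2, f)) (q l)) r (replicate m (2, f))"
    by simp
  moreover have "delete Js (\<lambda>l. move (Some (2, f)) (q l)) r (replicate m (2, f)) = blanks m"
    by (rule Suc.IH[of _ "if h = 2 then 3 else 2"]) (use Suc.prems in \<open>auto simp: move_Some split: if_splits\<close>)
  ultimately show ?case by simp
qed simp

text \<open>Four strands in four positions are determined by their order.\<close>

lemma rank_forced:
  assumes "same_order J q r" "r ` J \<subseteq> {1..4}" "{a, b, c, d} \<subseteq> J" "q a < q b" "q b < q c" "q c < q d"
  shows "r a = 1 \<and> r b = 2 \<and> r c = 3 \<and> r d = 4"
proof -
  have "r a < r b" "r b < r c" "r c < r d" using assms(1,3-6) unfolding same_order_def by blast+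
  moreover have "1 \<le> r a" "r d \<le> 4" using assms(2,3) by auto
  ultimately show ?thesis by linarith
qed

lemma delete_ranks:
  assumes "same_order (set Js) q r" "r ` set Js \<subseteq> {1..4}"
  shows "(\<lambda>l. moves (delete Js q r w) (r l)) ` set Js \<subseteq> {1..4}"
  using moves_image[OF bounded_delete[OF assms, of w]] assms(2) by blast

lemma delete_upper:
  assumes A: "A \<in> pure_braid_words 4" and Js: "set Js \<subseteq> {1..6}"
    and X: "X = delete Js (cable_pos [1, 2, 3, 4]) r (cable width id A)" "\<And>l. l \<in> set Js \<Longrightarrow> moves X (r l) = r l"
    and C: "delete Js id r [(4, False)] = C" "\<And>l. l \<in> set Js \<Longrightarrow> moves C (r l) = r1 l"
  shows "delete Js id r (upper_braid A t) = X @ C @ delete Js upper_end r1 (braid_inverse A @ full_twists 2 t)"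
proof -
  have l6: "l \<in> {1..6}" if "l \<in> set Js" for l using Js that by blast
  have "delete Js id r (rho A) = X" unfolding X(1) rho_cable
  proof (rule delete_cong)
    show "id l = cable_pos [1, 2, 3, 4] l" if "l \<in> set Js" for l
      unfolding cable_pos_id[OF l6[OF that]] by simp
  qed simp
  then have "delete Js id r (upper_braid A t) = X @ delete Js (\<lambda>l. moves (map Some (rho A)) (id l)) (\<lambda>l. moves X (r l)) ([(4, False)] @ braid_inverse A @ full_twists 2 t)"
    unfolding upper_braid_def delete_append[of Js id r "rho A"] by simp
  also have "delete Js (\<lambda>l. moves (map Some (rho A)) (id l)) (\<lambda>l. moves X (r l)) ([(4, False)] @ braid_inverse A @ full_twists 2 t)
    = delete Js id r ([(4, False)] @ braid_inverse A @ full_twists 2 t)"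
    by (rule delete_cong) (simp_all add: moves_rho[OF A l6] X(2))
  also have "\<dots> = C @ delete Js (\<lambda>l. moves (map Some [(4, False)]) (id l)) (\<lambda>l. moves C (r l)) (braid_inverse A @ full_twists 2 t)"
    unfolding delete_append[of Js id r "[(4, False)]"] C(1) ..
  also have "delete Js (\<lambda>l. moves (map Some [(4, False)]) (id l)) (\<lambda>l. moves C (r l)) (braid_inverse A @ full_twists 2 t)
    = delete Js upper_end r1 (braid_inverse A @ full_twists 2 t)"
    by (rule delete_cong) (simp_all add: move_Some upper_end_def C(2))
  finally show ?thesis .
qed

lemma stop_gt_2: "2 < stop u v j"
  by (simp add: stop_def)

text \<open>
  End points for the two knots that contain strands 1 and 2: both vertices in the middle over positions 2
  and 3, the minima in the middle under 1, 2 and 3, 4.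
\<close>

definition cap_apexes :: "nat \<Rightarrow> nat \<Rightarrow> real \<times> real" where
  "cap_apexes j k = (if k = 0 \<or> k = 2 then (5/2, 0) else if j \<in> {1, 2} then (3/2, 0) else (7/2, 0))"

section \<open>The three knots of the theta graph\<close>

text \<open>
  The word of this knot is \<open>X\<close> (which is \<open>A\<close>), a blank, \<open>M\<close> (the
  first \<open>A\<inverse>\<close>, in one generator), blanks for the first twists and the passage to the
  lower braid, then \<open>A\<inverse>\<close> and the second twists.
\<close>

lemma without_35_unknot:
  fixes t1 t2 :: int
  assumes A: "A \<in> ker_phi"
  defines "u \<equiv> upper_braid A t1" and "v \<equiv> lower_braid A t2"
  shows "compatible (stop u v) {1, 2, 4, 6} (theta_config u v) (theta_config u v) \<and>
    is_unknot (to_S3 ` curve (stop u v) {1, 2, 4, 6} (theta_config u v))"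
proof -
  note One_nat_def [simp del]
  have pA: "A \<in> pure_braid_words 4" and wA: "A \<in> braid_words 4" using A by (auto simp: ker_phi_def pure_braid_words_def)
  define Js where "Js = [1, 2, 4, 6 :: nat]"
  have sJ: "set Js = {1, 2, 4, 6}" by (simp add: Js_def)
  define r where "r = rank_single [1, 2, 3, 4]"
  have r: "r 1 = 1" "r 2 = 2" "r 4 = 3" "r 6 = 4" by (simp_all add: r_def rank_single_def parent_def)
  have ue: "upper_end 1 = 1" "upper_end 2 = 2" "upper_end 4 = 5" "upper_end 6 = 6" by (simp_all add: upper_end_def)
  have ls: "lower_start 1 = 1" "lower_start 2 = 2" "lower_start 4 = 3" "lower_start 6 = 4" by (simp_all add: lower_start_def)
  have rJ: "r ` set Js = {1..4}" by (auto simp: sJ r)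
  have so: "same_order (set Js) q r" if "q 1 < q 2" "q 2 < q 4" "q 4 < q 6" for q
  proof -
    have 4: "z \<in> {1..4}" if "r a < z" "z < r b" "a \<in> set Js" "b \<in> set Js" for a b z
    proof -
      have "r a \<in> {1..4}" "r b \<in> {1..4}" using rJ that by blast+
      then show ?thesis using that by auto
    qed
    show ?thesis unfolding same_order_def rJ
    proof (intro conjI ballI allI impI)
      show "inj_on q (set Js)" using that by (auto simp: sJ inj_on_def)
      show "q a < q b \<longleftrightarrow> r a < r b" if "a \<in> set Js" "b \<in> set Js" for a b
        using that \<open>q 1 < q 2\<close> \<open>q 2 < q 4\<close> \<open>q 4 < q 6\<close> unfolding sJ by (auto simp: r)
    qed (use 4 in blast)
  qed
  define X where "X = delete Js (cable_pos [1, 2, 3, 4]) r (cable width id A)"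
  have X: "erase X = A" "\<And>l. moves X (r l) = r l"
  proof -
    have "set Js \<subseteq> {1..6}" "inj_on parent (set Js)" "parent ` set Js = {1..4}"
      by (auto simp: sJ inj_on_def parent_def)
    from cable_single[OF this arrangement_1234 wA id_arrangement]
    show "erase X = A" "moves X (r l) = r l" for l unfolding X_def r_def arrange_pure[OF pA] by blast+
  qed
  define M where "M = delete Js upper_end r (braid_inverse A)"
  have wI: "braid_inverse A \<in> braid_words 4" by (rule braid_words_inverse[OF wA])
  have M: "set M \<subseteq> {None, Some (1, True), Some (1, False)} \<and> signs M = writhe (keep_strands {1, 2} id (braid_inverse A))"
    unfolding M_def
    by (rule delete_two[of 1 Js 2]) (use wI so[of upper_end] in \<open>auto simp: sJ ue r same_order_def\<close>)
  have trM: "trivial_word M"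
    by (rule balanced_trivial[where i = 1]) (use M ker_phi_writhe[OF A] in auto)
  have rM: "moves M (r l) = r l" if "l \<in> set Js" for l
  proof -
    have s: "same_order (set Js) upper_end r" by (rule so) (simp_all add: ue)
    have "same_order (set Js) (\<lambda>l. moves (map Some (braid_inverse A)) (upper_end l)) (\<lambda>l. moves M (r l))"
      unfolding M_def by (rule same_order_delete[OF s])
    moreover have "(\<lambda>l. moves M (r l)) ` set Js \<subseteq> {1..4}"
      unfolding M_def by (rule delete_ranks[OF s]) (simp add: rJ)
    ultimately have "moves M (r 1) = 1 \<and> moves M (r 2) = 2 \<and> moves M (r 4) = 3 \<and> moves M (r 6) = 4"
      by (rule rank_forced[where a = 1 and b = 2 and c = 4 and d = 6]) (simp_all add: moves_pure_inverse[OF pA] sJ ue)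
    then show ?thesis using that unfolding sJ by (auto simp: r)
  qed
  define s where "s = 2 * nat \<bar>t1\<bar>"
  define D where "D = X @ [None] @ M @ blanks s"
  have D: "D = delete Js id r u"
  proof -
    have "delete Js id r u = X @ [None] @ delete Js upper_end r (braid_inverse A @ full_twists 2 t1)"
      unfolding u_def
    proof (rule delete_upper[OF pA _ X_def X(2)])
      show "delete Js id r [(4, False)] = [None]"
        by (subst delete_skip) (auto simp: sJ)
    qed (auto simp: sJ)
    also have "delete Js upper_end r (braid_inverse A @ full_twists 2 t1) = M @ delete Js (\<lambda>l. moves (map Some (braid_inverse A)) (upper_end l)) (\<lambda>l. moves M (r l)) (full_twists 2 t1)"
      unfolding delete_append M_def ..
    also have "delete Js (\<lambda>l. moves (map Some (braid_inverse A)) (upper_end l)) (\<lambda>l. moves M (r l)) (full_twists 2 t1) = blanks s"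
      unfolding moves_pure_inverse[OF pA] full_twists_def s_def by (rule delete_twists_hole[where h = 3]) (auto simp: sJ ue)
    finally show ?thesis unfolding D_def by (rule sym)
  qed
  define D' where "D' = map Some (braid_inverse A) @ replicate (2 * nat \<bar>t2\<bar>) (Some (2 :: nat, 0 < t2))"
  have D': "D' = delete Js lower_start lower_start v"
  proof -
    have "delete Js lower_start lower_start v = map Some v"
      unfolding v_def by (rule delete_all[OF _ _ _ lower_words[OF wA]]) (auto simp: sJ ls inj_on_def)
    then show ?thesis unfolding D'_def v_def lower_braid_def map_append map_full_twists by simp
  qed
  have l6: "set Js \<subseteq> {1..6}" by (auto simp: sJ)
  have comp: "compatible (stop u v) (set Js) (theta_config u v) (normal_form (stop u v) cap_apexes (blanks 2 @ D @ None # D') r)"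
  proof (rule theta_compatible[OF _ _ l6 _ _ D D', where P = "(5/2, 0)" and y = "5/2" and y' = "7/2"])
    show "moves (map Some u) j = upper_end j" if "j \<in> {1..6}" for j unfolding u_def by (rule moves_upper[OF pA that])
    show "moves (map Some v) p = p" for p unfolding v_def by (rule moves_lower[OF pA])
    show "same_order (set Js) id r" by (rule so) simp_all
    show "same_order (set Js) lower_start lower_start"
      using so[of lower_start] unfolding sJ same_order_def by (simp add: ls r)
    show "moves D (r j) = lower_start j" if "j \<in> set Js" for j
    proof -
      have "moves D (r j) = r j" unfolding D_def moves_simps X(2) rM[OF that] moves_blanks by (simp add: rM[OF that])
      then show ?thesis using that unfolding sJ by (auto simp: r ls)
    qed
  qed (auto simp: sJ r ls cap_apexes_def stop_def)
  define W where "W = X @ ([None] @ M @ blanks s @ [None]) @ map Some (braid_inverse A)"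
  have trW: "trivial_word W" unfolding W_def
    by (rule sandwich_trivial[OF X(1) wA]) (intro trivial_word.append trivial_word.blank trM trivial_blanks)
  have lenW: "length W = length u + 1 + length (braid_inverse A)"
    using arg_cong[OF D, of length] by (simp add: W_def D_def)
  have lenv: "length v = length (braid_inverse A) + 2 * nat \<bar>t2\<bar>" by (simp add: v_def lower_braid_def full_twists_def)
  have nJ: "stop u v j = 7 + 2 * length u + 2 * length v" if "j \<in> {1, 2, 4, 6}" for j using that by (auto simp: stop_def)
  have inj: "inj_on r (set Js)" by (auto simp: sJ r inj_on_def)
  have e0: "blanks 2 @ D @ None # D' = blanks 2 @ W @ replicate (2 * nat \<bar>t2\<bar>) (Some (2, 0 < t2)) @ []"
    by (simp add: D_def D'_def W_def)
  have 1: "leads_to (stop u v) (set Js) (normal_form (stop u v) cap_apexes (blanks 2 @ D @ None # D') r)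
    (normal_form (stop u v) cap_apexes (blanks 2 @ blanks (length W) @ replicate (2 * nat \<bar>t2\<bar>) (Some (2, 0 < t2)) @ []) r)"
    unfolding e0
  proof (rule remove_trivial_word[OF trW _ inj rJ])
    show "2 * length (blanks 2) + 2 * length W < stop u v j" if "j \<in> set Js" for j
      using that nJ[of j] unfolding lenW lenv sJ by simp
  qed (auto simp: bounded_word_def)
  have e1: "blanks 2 @ blanks (length W) @ V = blanks (2 + length W) @ V" for V :: padded_word
    by (simp only: replicate_add append_assoc)
  have 2: "leads_to (stop u v) (set Js) (normal_form (stop u v) cap_apexes (blanks (2 + length W) @ replicate (2 * nat \<bar>t2\<bar>) (Some (2, 0 < t2)) @ []) r)
    (normal_form (stop u v) cap_apexes (blanks (2 + length W + 2 * nat \<bar>t2\<bar>) @ []) r)"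
  proof (rule untwist_cap_all[of "set Js" r 2 4])
    show "2 * (2 + length W) + 4 * nat \<bar>t2\<bar> < stop u v j" if "j \<in> set Js" for j
      using that nJ[of j] unfolding lenW lenv sJ by simp
  qed (use inj in \<open>auto simp: sJ r start_def cap_apexes_def\<close>)
  have un: "is_unknot (to_S3 ` curve (stop u v) (set Js) (normal_form (stop u v) cap_apexes (blanks (2 + length W + 2 * nat \<bar>t2\<bar>) @ []) r))"
    if valid: "compatible (stop u v) (set Js) (normal_form (stop u v) cap_apexes (blanks (2 + length W + 2 * nat \<bar>t2\<bar>) @ []) r)
      (normal_form (stop u v) cap_apexes (blanks (2 + length W + 2 * nat \<bar>t2\<bar>) @ []) r)"
    using valid unfolding sJ append_Nil2
    by (intro nested_caps_unknot) (auto simp: r cap_apexes_def stop_def)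
  have "is_unknot (to_S3 ` curve (stop u v) (set Js) (theta_config u v))"
    by (rule compatible_unknot[OF comp leads_to_trans[OF 1[unfolded e1] 2] un]) (auto simp: sJ stop_gt_2)
  then show ?thesis using compatible_refl_left[OF comp] unfolding sJ by blast
qed

text \<open>
  The word of this knot is \<open>X\<close> (which is \<open>A\<close>), a blank,
  \<open>A\<inverse>\<close>, the first twists, a blank, and a word \<open>D'\<close> in one generator for
  strands 1 and 2, which has to be removed first because it lies next to the minimum of these strands.
\<close>

lemma without_46_unknot:
  fixes t1 t2 :: int
  assumes A: "A \<in> ker_phi"
  defines "u \<equiv> upper_braid A t1" and "v \<equiv> lower_braid A t2"
  shows "compatible (stop u v) {1, 2, 3, 5} (theta_config u v) (theta_config u v) \<and>
    is_unknot (to_S3 ` curve (stop u v) {1, 2, 3, 5} (theta_config u v))"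
proof -
  note One_nat_def [simp del]
  have pA: "A \<in> pure_braid_words 4" and wA: "A \<in> braid_words 4" using A by (auto simp: ker_phi_def pure_braid_words_def)
  define Js where "Js = [1, 2, 3, 5 :: nat]"
  have sJ: "set Js = {1, 2, 3, 5}" by (simp add: Js_def)
  define r where "r = rank_single [1, 2, 3, 4]"
  have r: "r 1 = 1" "r 2 = 2" "r 3 = 3" "r 5 = 4" by (simp_all add: r_def rank_single_def parent_def)
  have ue: "upper_end 1 = 1" "upper_end 2 = 2" "upper_end 3 = 3" "upper_end 5 = 4" by (simp_all add: upper_end_def)
  have ls: "lower_start 1 = 1" "lower_start 2 = 2" by (simp_all add: lower_start_def)
  have rJ: "r ` set Js = {1..4}" by (auto simp: sJ r)
  have so: "same_order (set Js) q r" if "q 1 < q 2" "q 2 < q 3" "q 3 < q 5" for q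
  proof -
    have 4: "z \<in> {1..4}" if "r a < z" "z < r b" "a \<in> set Js" "b \<in> set Js" for a b z
    proof -
      have "r a \<in> {1..4}" "r b \<in> {1..4}" using rJ that by blast+
      then show ?thesis using that by auto
    qed
    show ?thesis unfolding same_order_def rJ
    proof (intro conjI ballI allI impI)
      show "inj_on q (set Js)" using that by (auto simp: sJ inj_on_def)
      show "q a < q b \<longleftrightarrow> r a < r b" if "a \<in> set Js" "b \<in> set Js" for a b
        using that \<open>q 1 < q 2\<close> \<open>q 2 < q 3\<close> \<open>q 3 < q 5\<close> unfolding sJ by (auto simp: r)
    qed (use 4 in blast)
  qed
  define X where "X = delete Js (cable_pos [1, 2, 3, 4]) r (cable width id A)"
  have X: "erase X = A" "\<And>l. moves X (r l) = r l"
  proof -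
    have "set Js \<subseteq> {1..6}" "inj_on parent (set Js)" "parent ` set Js = {1..4}"
      by (auto simp: sJ inj_on_def parent_def)
    from cable_single[OF this arrangement_1234 wA id_arrangement]
    show "erase X = A" "moves X (r l) = r l" for l unfolding X_def r_def arrange_pure[OF pA] by blast+
  qed
  define T where "T = replicate (2 * nat \<bar>t1\<bar>) (Some (2 :: nat, 0 < t1))"
  define D where "D = X @ [None] @ map Some (braid_inverse A) @ T"
  have wI: "braid_inverse A @ full_twists 2 t1 \<in> braid_words 4"
    by (intro braid_words_append braid_words_inverse[OF wA] braid_words_twists)
  have D: "D = delete Js id r u"
  proof -
    have "delete Js id r u = X @ [None] @ delete Js upper_end r (braid_inverse A @ full_twists 2 t1)"
      unfolding u_def
    proof (rule delete_upper[OF pA _ X_def X(2)])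
      show "delete Js id r [(4, False)] = [None]"
        by (subst delete_skip) (auto simp: sJ)
    qed (auto simp: sJ)
    also have "delete Js upper_end r (braid_inverse A @ full_twists 2 t1) = map Some (braid_inverse A @ full_twists 2 t1)"
      by (rule delete_all[OF _ _ _ wI]) (auto simp: sJ ue r inj_on_def)
    finally show ?thesis unfolding D_def T_def map_append map_full_twists by (rule sym)
  qed
  have mD: "moves D (r l) = r l" for l
    unfolding D_def T_def moves_simps X(2) moves_twists moves_pure_inverse[OF pA] by simp
  define D' where "D' = delete [1, 2] lower_start lower_start v"
  have D'1: "set D' \<subseteq> {None, Some (1, True), Some (1, False)}"
  proof -
    have "set D' \<subseteq> {None, Some (1, True), Some (1, False)} \<and> signs D' = writhe (keep_strands {1, 2} id v)"
      unfolding D'_def by (rule delete_two[of 1 _ 2]) (use lower_words[OF wA, of t2] in \<open>auto simp: ls v_def\<close>)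
    then show ?thesis by blast
  qed
  have l6: "set Js \<subseteq> {1..6}" by (auto simp: sJ)
  have comp: "compatible (stop u v) (set Js) (theta_config u v) (normal_form (stop u v) cap_apexes (blanks 2 @ D @ None # D') r)"
  proof (rule theta_compatible[OF _ _ l6 _ _ D D'_def, where P = "(5/2, 0)" and y = "5/2" and y' = "7/2"])
    show "moves (map Some u) j = upper_end j" if "j \<in> {1..6}" for j unfolding u_def by (rule moves_upper[OF pA that])
    show "moves (map Some v) p = p" for p unfolding v_def by (rule moves_lower[OF pA])
    show "same_order (set Js) id r" by (rule so) simp_all
    show "same_order (set [1, 2]) lower_start lower_start"
      by (auto simp: same_order_def ls)
    show "moves D (r j) = lower_start j" if "j \<in> set [1, 2]" for j
      using that unfolding mD by (auto simp: r ls)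
  qed (auto simp: sJ r ls cap_apexes_def stop_def)
  have lenD: "length D = length u" using arg_cong[OF D, of length] by simp
  have lenD': "length D' = length v" by (simp add: D'_def)
  have n12: "stop u v 1 = 7 + 2 * length u + 2 * length v" "stop u v 2 = 7 + 2 * length u + 2 * length v" by (simp_all add: stop_def)
  have n35: "stop u v j = 5 + 2 * length u" if "j \<in> {3, 5}" for j using that by (auto simp: stop_def)
  have nJ: "5 + 2 * length u \<le> stop u v j" for j by (simp add: stop_def)
  have inj: "inj_on r (set Js)" by (auto simp: sJ r inj_on_def)
  have e0: "blanks 2 @ D @ None # D' = (blanks 2 @ D @ [None]) @ D' @ blanks 0" by simp
  have 0: "leads_to (stop u v) (set Js) (normal_form (stop u v) cap_apexes (blanks 2 @ D @ None # D') r)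
    (normal_form (stop u v) cap_apexes ((blanks 2 @ D @ [None]) @ blanks (length D' + 0)) r)"
    unfolding e0
  proof (rule untwist_cup_all[OF _ inj, where A = 1 and B = 2 and i = 1 and x = "3/2" and E = "7 + 2 * length u + 2 * length v"])
    show "{moves (blanks 2 @ D @ [None]) (r 1), moves (blanks 2 @ D @ [None]) (r 2)} = {1, 1 + 1}"
      unfolding moves_simps moves_blanks mD by (simp add: r)
    show "7 + 2 * length u + 2 * length v < stop u v j \<or> stop u v j \<le> 2 * length (blanks 2 @ D @ [None])" if "j \<in> set Js" "j \<notin> {1, 2}" for j
      using that n35[of j] unfolding sJ by (simp add: lenD)
    show "set D' \<subseteq> {None, Some (1, True), Some (1, False)}" by (rule D'1)
  qed (simp_all add: sJ n12 lenD lenD' cap_apexes_def, simp_all add: cup_def)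
  define W where "W = X @ [None] @ map Some (braid_inverse A)"
  have trW: "trivial_word W" unfolding W_def
    by (rule sandwich_trivial[OF X(1) wA trivial_word.blank])
  have lenW: "length W + 2 * nat \<bar>t1\<bar> = length u"
    unfolding lenD[symmetric] by (simp add: W_def D_def T_def)
  have e1: "(blanks 2 @ D @ [None]) @ blanks (length D' + 0) = blanks 2 @ W @ T @ blanks (length D' + 1)"
    by (simp add: D_def W_def One_nat_def)
  have 1: "leads_to (stop u v) (set Js) (normal_form (stop u v) cap_apexes (blanks 2 @ W @ T @ blanks (length D' + 1)) r)
    (normal_form (stop u v) cap_apexes (blanks 2 @ blanks (length W) @ T @ blanks (length D' + 1)) r)"
  proof (rule remove_trivial_word[OF trW _ inj rJ])
    show "2 * length (blanks 2) + 2 * length W < stop u v j" if "j \<in> set Js" for j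
      using nJ[of j] lenW by simp
  qed (auto simp: bounded_word_def)
  have e2: "blanks 2 @ blanks (length W) @ V = blanks (2 + length W) @ V" for V :: padded_word
    by (simp only: replicate_add append_assoc)
  have 2: "leads_to (stop u v) (set Js) (normal_form (stop u v) cap_apexes (blanks (2 + length W) @ T @ blanks (length D' + 1)) r)
    (normal_form (stop u v) cap_apexes (blanks (2 + length W + 2 * nat \<bar>t1\<bar>) @ blanks (length D' + 1)) r)"
    unfolding T_def
  proof (rule untwist_cap_all[of "set Js" r 2 3])
    show "2 * (2 + length W) + 4 * nat \<bar>t1\<bar> < stop u v j" if "j \<in> set Js" for j
      using nJ[of j] lenW by simp
  qed (use inj in \<open>auto simp: sJ r start_def cap_apexes_def\<close>)
  define m where "m = 2 + length W + 2 * nat \<bar>t1\<bar> + (length D' + 1)"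
  have e3: "blanks (2 + length W + 2 * nat \<bar>t1\<bar>) @ blanks (length D' + 1) = blanks m"
    unfolding m_def replicate_add ..
  have un: "is_unknot (to_S3 ` curve (stop u v) (set Js) (normal_form (stop u v) cap_apexes (blanks m) r))"
    if valid: "compatible (stop u v) (set Js) (normal_form (stop u v) cap_apexes (blanks m) r)
      (normal_form (stop u v) cap_apexes (blanks m) r)"
    using valid unfolding sJ
    by (intro nested_caps_unknot) (auto simp: r cap_apexes_def stop_def)
  have "is_unknot (to_S3 ` curve (stop u v) (set Js) (theta_config u v))"
    by (rule compatible_unknot[OF comp leads_to_trans[OF leads_to_trans[OF 0[unfolded e1] 1[unfolded e2]] 2[unfolded e3]] un])
      (auto simp: sJ stop_gt_2)
  then show ?thesis using compatible_refl_left[OF comp] unfolding sJ by blast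
qed

text \<open>
  The word of this knot is a ribbon word \<open>Z\<close>, the crossing of strands 4 and 5, a word
  \<open>M\<close> in the strands 3 and 5, blanks, and a word \<open>D'\<close> in the strands 4 and 6.
\<close>

lemma without_12_unknot:
  fixes t1 t2 :: int
  assumes A: "A \<in> ker_phi"
  defines "u \<equiv> upper_braid A t1" and "v \<equiv> lower_braid A t2"
  shows "compatible (stop u v) {3, 4, 5, 6} (theta_config u v) (theta_config u v) \<and>
    is_unknot (to_S3 ` curve (stop u v) {3, 4, 5, 6} (theta_config u v))"
proof -
  note One_nat_def [simp del]
  have pA: "A \<in> pure_braid_words 4" and wA: "A \<in> braid_words 4" using A by (auto simp: ker_phi_def pure_braid_words_def)
  define Js where "Js = [3, 4, 5, 6 :: nat]"
  have sJ: "set Js = {3, 4, 5, 6}" by (simp add: Js_def)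
  define r where "r = rank_double [1, 2, 3, 4]"
  have r: "r 3 = 1" "r 4 = 2" "r 5 = 3" "r 6 = 4" by (simp_all add: r_def rank_double_def parent_def copy_def)
  define r1 where "r1 l = move (Some (2, False)) (r l)" for l
  have r1: "r1 3 = 1" "r1 4 = 3" "r1 5 = 2" "r1 6 = 4" by (simp_all add: r1_def r move_Some)
  have ue: "upper_end 3 = 3" "upper_end 4 = 5" "upper_end 5 = 4" "upper_end 6 = 6" by (simp_all add: upper_end_def)
  have ls: "lower_start 4 = 3" "lower_start 6 = 4" by (simp_all add: lower_start_def)
  have rJ: "r ` set Js = {1..4}" by (auto simp: sJ r)
  have r1J: "r1 ` set Js = {1..4}" by (auto simp: sJ r1)
  have contiguous: "z \<in> {1..4}" if "p ` set Js = {1..4}" "p a < z" "z < p b" "a \<in> set Js" "b \<in> set Js" for a b z and p :: "nat \<Rightarrow> nat"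
  proof -
    have "p a \<in> {1..4}" "p b \<in> {1..4}" using that(1,4,5) by blast+
    then show ?thesis using that(2,3) by auto
  qed
  have so: "same_order (set Js) id r"
    unfolding same_order_def rJ using contiguous[OF rJ] by (auto simp: sJ r)
  have so1: "same_order (set Js) upper_end r1"
    unfolding same_order_def r1J
  proof (intro conjI ballI allI impI)
    show "inj_on upper_end (set Js)" by (auto simp: sJ ue inj_on_def)
    show "upper_end a < upper_end b \<longleftrightarrow> r1 a < r1 b" if "a \<in> set Js" "b \<in> set Js" for a b
      using that unfolding sJ by (auto simp: r1 ue)
  qed (use contiguous[OF r1J] in blast)
  define Z where "Z = delete Js (cable_pos [1, 2, 3, 4]) r (cable width id A)"
  have Z: "ribbon_word Z" "\<And>l. l \<in> set Js \<Longrightarrow> moves Z (r l) = r l"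
  proof -
    have "l \<in> {3..6}" if "l \<in> set Js" for l using that by (auto simp: sJ)
    then show "ribbon_word Z" "\<And>l. l \<in> set Js \<Longrightarrow> moves Z (r l) = r l"
      using cable_double[OF arrangement_1234 wA id_arrangement] unfolding Z_def r_def Js_def arrange_pure[OF pA] by blast+
  qed
  \<comment> \<open>The numbering of the strands in \<open>delete_two\<close> is arbitrary; here the strands in positions 3 and 4 are counted as 1 and 2.\<close>
  define \<pi> where "\<pi> = Transposition.transpose 1 3 \<circ> Transposition.transpose 2 (4::nat)"
  have \<pi>: "\<pi> 3 = 1" "\<pi> 4 = 2" "inj \<pi>" by (auto simp: \<pi>_def Transposition.transpose_def inj_def split: if_splits)
  define M where "M = delete Js upper_end r1 (braid_inverse A)"
  have wI: "braid_inverse A \<in> braid_words 4" by (rule braid_words_inverse[OF wA])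
  have M1: "set M \<subseteq> {None, Some (1, True), Some (1, False)}"
  proof -
    have "inj_on upper_end (set Js)" using so1 by (simp add: same_order_def)
    then have "set M \<subseteq> {None, Some (1, True), Some (1, False)} \<and> signs M = writhe (keep_strands {1, 2} \<pi> (braid_inverse A))"
      unfolding M_def by (intro delete_two[of 3 Js 5]) (use wI \<pi> in \<open>auto simp: sJ ue r1\<close>)
    then show ?thesis by blast
  qed
  have rM: "moves M (r1 l) = r1 l" if "l \<in> set Js" for l
  proof -
    have "same_order (set Js) (\<lambda>l. moves (map Some (braid_inverse A)) (upper_end l)) (\<lambda>l. moves M (r1 l))"
      unfolding M_def by (rule same_order_delete[OF so1])
    moreover have "(\<lambda>l. moves M (r1 l)) ` set Js \<subseteq> {1..4}"
      unfolding M_def by (rule delete_ranks[OF so1]) (simp add: r1J)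
    ultimately have "moves M (r1 3) = 1 \<and> moves M (r1 5) = 2 \<and> moves M (r1 4) = 3 \<and> moves M (r1 6) = 4"
      by (rule rank_forced[where a = 3 and b = 5 and c = 4 and d = 6]) (simp_all add: moves_pure_inverse[OF pA] sJ ue)
    then show ?thesis using that unfolding sJ by (auto simp: r1)
  qed
  define s where "s = 2 * nat \<bar>t1\<bar>"
  define D where "D = Z @ [Some (2, False)] @ M @ blanks s"
  have D: "D = delete Js id r u"
  proof -
    have "delete Js id r u = Z @ [Some (2, False)] @ delete Js upper_end r1 (braid_inverse A @ full_twists 2 t1)"
      unfolding u_def
    proof (rule delete_upper[OF pA _ Z_def Z(2)])
      have "delete Js id r ((4, False) # []) = Some (r 4, False) # delete Js (\<lambda>l. move (Some (4, False)) (id l)) (\<lambda>l. move (Some (r 4, False)) (r l)) []"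
        by (rule delete_cross[of 4 Js 5]) (simp_all add: sJ)
      then show "delete Js id r [(4, False)] = [Some (2, False)]" by (simp add: r delete.simps)
    qed (auto simp: sJ r1_def)
    also have "delete Js upper_end r1 (braid_inverse A @ full_twists 2 t1) = M @ delete Js (\<lambda>l. moves (map Some (braid_inverse A)) (upper_end l)) (\<lambda>l. moves M (r1 l)) (full_twists 2 t1)"
      unfolding delete_append M_def ..
    also have "delete Js (\<lambda>l. moves (map Some (braid_inverse A)) (upper_end l)) (\<lambda>l. moves M (r1 l)) (full_twists 2 t1) = blanks s"
      unfolding moves_pure_inverse[OF pA] full_twists_def s_def by (rule delete_twists_hole[where h = 2]) (auto simp: sJ ue)
    finally show ?thesis unfolding D_def by (rule sym)
  qed
  have mD: "moves D (r l) = r1 l" if "l \<in> set Js" for l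
    unfolding D_def moves_simps Z(2)[OF that] r1_def[symmetric] rM[OF that] moves_blanks ..
  define D' where "D' = delete [4, 6] lower_start lower_start v"
  have D'1: "set D' \<subseteq> {None, Some (3, True), Some (3, False)}"
  proof -
    have "set D' \<subseteq> {None, Some (3, True), Some (3, False)} \<and> signs D' = writhe (keep_strands {1, 2} \<pi> v)"
      unfolding D'_def by (rule delete_two[of 4 _ 6]) (use lower_words[OF wA, of t2] \<pi> in \<open>auto simp: ls v_def\<close>)
    then show ?thesis by blast
  qed
  define E1 where "E1 = 5 + 2 * length u"
  define E2 where "E2 = 7 + 2 * length u + 2 * length v"
  \<comment> \<open>The minima: that of 3, 5 under positions 1, 2 and that of 4, 6 under positions 3, 4.\<close>
  define \<beta> where "\<beta> j k = (if k = E1 then (3/2, 0) else (7/2, 0) :: real \<times> real)" for j k :: nat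
  define \<alpha> where "\<alpha> = cap_points r \<beta>"
  have \<alpha>: "\<alpha> j 0 = (7/2, 0)" "\<alpha> j 2 = (3/2, 0)" "\<alpha> j E1 = (3/2, 0)" "\<alpha> j E2 = (7/2, 0)" for j
    by (simp_all add: \<alpha>_def cap_points_def midpoint_of_def r \<beta>_def E1_def E2_def)
  have n: "stop u v 3 = E1" "stop u v 5 = E1" "stop u v 4 = E2" "stop u v 6 = E2" by (simp_all add: stop_def E1_def E2_def)
  have nJ: "5 + 2 * length u \<le> stop u v j" for j by (simp add: stop_def)
  have l6: "set Js \<subseteq> {1..6}" by (auto simp: sJ)
  have comp: "compatible (stop u v) (set Js) (theta_config u v) (normal_form (stop u v) \<alpha> (blanks 2 @ D @ None # D') r)"
  proof (rule theta_compatible[OF _ _ l6 _ so D D'_def, where P = "(7/2, 0)" and y = "3/2" and y' = "3/2"])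
    show "moves (map Some u) j = upper_end j" if "j \<in> {1..6}" for j unfolding u_def by (rule moves_upper[OF pA that])
    show "moves (map Some v) p = p" for p unfolding v_def by (rule moves_lower[OF pA])
    show "same_order (set [4, 6]) lower_start lower_start"
      by (auto simp: same_order_def ls)
    show "moves D (r j) = lower_start j" if "j \<in> set [4, 6]" for j
    proof -
      have "j \<in> set Js" using that by (auto simp: sJ)
      then show ?thesis using that mD[of j] by (auto simp: r1 ls)
    qed
    show "\<alpha> j (5 + 2 * length u) = (3/2, 0)" for j using \<alpha>(3)[of j] by (simp add: E1_def)
    show "\<alpha> j (stop u v j) = (7/2, 0)" if "j \<in> set Js \<inter> {4, 6}" for j
      using that n \<alpha>(4) by auto
  qed (auto simp: sJ r ls \<alpha> start_def)
  have lenD: "length D = length u" using arg_cong[OF D, of length] by simp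
  have lenD': "length D' = length v" by (simp add: D'_def)
  have inj: "inj_on r (set Js)" by (auto simp: sJ r inj_on_def)
  have e0: "blanks 2 @ D @ None # D' = (blanks 2 @ D @ [None]) @ D' @ blanks 0" by simp
  have 0: "leads_to (stop u v) (set Js) (normal_form (stop u v) \<alpha> (blanks 2 @ D @ None # D') r)
    (normal_form (stop u v) \<alpha> ((blanks 2 @ D @ [None]) @ blanks (length D' + 0)) r)"
    unfolding e0
  proof (rule untwist_cup_all[OF _ inj, where A = 4 and B = 6 and i = 3 and x = "7/2" and E = E2])
    have "4 \<in> set Js" "6 \<in> set Js" by (simp_all add: sJ)
    then show "{moves (blanks 2 @ D @ [None]) (r 4), moves (blanks 2 @ D @ [None]) (r 6)} = {3, 3 + 1}"
      by (simp add: mD r1)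
    show "E2 < stop u v j \<or> stop u v j \<le> 2 * length (blanks 2 @ D @ [None])" if "j \<in> set Js" "j \<notin> {4, 6}" for j
      using that n unfolding sJ by (auto simp: lenD E1_def)
    show "set D' \<subseteq> {None, Some (3, True), Some (3, False)}" by (rule D'1)
  qed (simp_all add: sJ n lenD lenD' \<alpha>, simp_all add: cup_def E2_def)
  have lenZ: "length Z + 1 + length M + s = length u" unfolding lenD[symmetric] by (simp add: D_def)
  define U where "U = blanks 2 @ Z @ [Some (2, False)]"
  have e1: "(blanks 2 @ D @ [None]) @ blanks (length D' + 0) = U @ M @ blanks (s + (1 + length D'))"
  proof -
    have "[None] = blanks 1" by (simp add: One_nat_def)
    then show ?thesis by (simp only: D_def U_def append_assoc replicate_add add_0_right)
  qed
  have 1: "leads_to (stop u v) (set Js) (normal_form (stop u v) \<alpha> (U @ M @ blanks (s + (1 + length D'))) r)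
    (normal_form (stop u v) \<alpha> (U @ blanks (length M + (s + (1 + length D')))) r)"
  proof (rule untwist_cup_all[OF _ inj, where A = 3 and B = 5 and i = 1 and x = "3/2" and E = E1])
    have "3 \<in> set Js" "5 \<in> set Js" by (simp_all add: sJ)
    then show "{moves U (r 3), moves U (r 5)} = {1, 1 + 1}"
      unfolding U_def moves_simps moves_blanks using Z(2) by (simp add: r1_def[symmetric] r1)
    show "E1 < stop u v j \<or> stop u v j \<le> 2 * length U" if "j \<in> set Js" "j \<notin> {3, 5}" for j
      using that n unfolding sJ by (auto simp: E1_def E2_def)
    show "set M \<subseteq> {None, Some (1, True), Some (1, False)}" by (rule M1)
    show "2 * length U + 2 * length M < E1" using lenZ by (simp add: U_def E1_def)
    show "2 \<le> length U" by (simp add: U_def)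
  qed (simp_all add: sJ n \<alpha>, simp_all add: cup_def)
  define m' where "m' = length M + (s + (1 + length D'))"
  have e2: "U @ blanks (length M + (s + (1 + length D'))) = blanks 2 @ Z @ (Some (2, False) # blanks m')"
    by (simp add: U_def m'_def)
  have n4: "2 * 2 + 2 * length Z < stop u v j" if "j \<in> {3, 4, 5, 6}" for j using nJ[of j] lenZ by simp
  have r4: "r ` {3, 4} = {1, 2} \<and> r ` {5, 6} = {3, 4} \<or> r ` {3, 4} = {3, 4} \<and> r ` {5, 6} = {1, 2}" by (simp add: r)
  have "\<exists>r'. (\<forall>l\<in>{3, 4, 5, 6}. r' l = moves Z (r l)) \<and>
    leads_to (stop u v) {3, 4, 5, 6} (normal_form (stop u v) (cap_points r \<beta>) (blanks 2 @ Z @ (Some (2, False) # blanks m')) r)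
      (normal_form (stop u v) (cap_points r' \<beta>) (blanks (2 + length Z) @ (Some (2, False) # blanks m')) r')"
    by (rule slide_all_ribbons[OF Z(1) order_refl n4 stop_gt_2 r4])
  then obtain r' where slid: "(\<forall>l\<in>{3, 4, 5, 6}. r' l = moves Z (r l)) \<and>
    leads_to (stop u v) {3, 4, 5, 6} (normal_form (stop u v) (cap_points r \<beta>) (blanks 2 @ Z @ (Some (2, False) # blanks m')) r)
      (normal_form (stop u v) (cap_points r' \<beta>) (blanks (2 + length Z) @ (Some (2, False) # blanks m')) r')" ..
  note r' = conjunct1[OF slid] and 2 = conjunct2[OF slid]
  have r'4: "r' 3 = 1" "r' 4 = 2" "r' 5 = 3" "r' 6 = 4" using r' Z(2) by (simp_all add: sJ r)
  have un: "is_unknot (to_S3 ` curve (stop u v) (set Js) (normal_form (stop u v) (cap_points r' \<beta>) (blanks (2 + length Z) @ (Some (2, False) # blanks m')) r'))"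
    if valid: "compatible (stop u v) (set Js) (normal_form (stop u v) (cap_points r' \<beta>) (blanks (2 + length Z) @ (Some (2, False) # blanks m')) r')
      (normal_form (stop u v) (cap_points r' \<beta>) (blanks (2 + length Z) @ (Some (2, False) # blanks m')) r')"
    using valid unfolding sJ
  proof (rule side_caps_unknot[OF n(1,2,3,4) _ _ _ r'4, rotated -1])
    show "2 * (2 + length Z) + 2 < E1" using lenZ by (simp add: E1_def)
  qed (simp_all add: cap_points_def midpoint_of_def r'4 \<beta>_def, simp_all add: E1_def E2_def)
  have "is_unknot (to_S3 ` curve (stop u v) (set Js) (theta_config u v))"
    by (rule compatible_unknot[OF comp leads_to_trans[OF leads_to_trans[OF 0[unfolded e1] 1[unfolded e2]] 2[folded \<alpha>_def sJ]] un])
      (auto simp: sJ stop_gt_2)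
  then show ?thesis using compatible_refl_left[OF comp] unfolding sJ by blast
qed

section \<open>Arcs that descend from the vertices\<close>

definition descent :: "(nat \<Rightarrow> nat) \<Rightarrow> config \<Rightarrow> nat \<Rightarrow> point set" where
  "descent n c j = (\<Union>k\<in>{start j..<n j}. closed_segment (at_level c j k) (at_level c j (Suc k)))"

lemma curve_descents: "curve n J c = (\<Union>j\<in>J. descent n c j)"
  by (simp add: curve_def descent_def)

lemma descent_image:
  assumes "start j < n j"
  shows "descent n c j = level_path (at_level c j) ` {real (start j)..real (n j)}"
  using level_path_image[OF assms] by (simp add: descent_def)

lemma level_path_height: "0 \<le> t \<Longrightarrow> snd (snd (level_path (at_level c j) t)) = 2 - t / 2"
proof -
  assume t: "0 \<le> t"
  define k where "k = nat \<lfloor>t\<rfloor>"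
  have "real k \<le> t" "t \<le> real (Suc k)" using t unfolding k_def by linarith+
  then show ?thesis unfolding level_path_between[OF \<open>real k \<le> t\<close> \<open>t \<le> real (Suc k)\<close>] by (simp add: at_level_def field_simps)
qed

text \<open>
  On a pair of consecutive levels the separating form is nonnegative on the gap, and it vanishes only at a
  common end point.
\<close>

lemma separated_meet:
  assumes "separated n c c a b k" "real k \<le> t" "t \<le> real (Suc k)"
    and eq: "level_path (at_level c a) t = level_path (at_level c b) t"
  shows "t = real k \<and> joined n a b k \<or> t = real (Suc k) \<and> joined n a b (Suc k) \<or> joined n a b k \<and> joined n a b (Suc k)"
proof -
  obtain l where l: "ordered_at n c c l a b k" "ordered_at n c c l a b (Suc k)"
    using assms(1) unfolding separated_def by blast
  define u where "u = t - real k"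
  have u: "0 \<le> u" "u \<le> 1" using assms(2,3) by (simp_all add: u_def)
  have E: "(1 - u) *\<^sub>R at_level c a k + u *\<^sub>R at_level c a (Suc k) = (1 - u) *\<^sub>R at_level c b k + u *\<^sub>R at_level c b (Suc k)"
    using eq unfolding level_path_between[OF assms(2,3)] u_def .
  have "(1 - u) *\<^sub>R gap c a b k + u *\<^sub>R gap c a b (Suc k) = 0"
    using arg_cong[OF E, of fst] arg_cong[OF E, of "\<lambda>p. fst (snd p)"]
    by (intro prod_eqI) (simp_all add: at_level_def gap_def algebra_simps)
  from arg_cong[OF this, of "inner l"]
  have z: "(1 - u) * (l \<bullet> gap c a b k) + u * (l \<bullet> gap c a b (Suc k)) = 0" by (simp add: inner_add_right)
  have pos: "0 \<le> l \<bullet> gap c a b k'" "l \<bullet> gap c a b k' = 0 \<longrightarrow> joined n a b k'" if "ordered_at n c c l a b k'" for k'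
    using that unfolding ordered_at_def by auto
  have "(1 - u) * (l \<bullet> gap c a b k) = 0" "u * (l \<bullet> gap c a b (Suc k)) = 0"
    using z u pos[OF l(1)] pos[OF l(2)] mult_nonneg_nonneg[of "1 - u" "l \<bullet> gap c a b k"] mult_nonneg_nonneg[of u "l \<bullet> gap c a b (Suc k)"] by linarith+
  then have "u = 1 \<or> joined n a b k" "u = 0 \<or> joined n a b (Suc k)" using pos[OF l(1)] pos[OF l(2)] by auto
  moreover have "u = 0 \<Longrightarrow> t = real k" "u = 1 \<Longrightarrow> t = real (Suc k)" by (simp_all add: u_def)
  ultimately show ?thesis using u by (cases "u = 0"; cases "u = 1") auto
qed

lemma descents_meet:
  assumes comp: "compatible n J c c" and ab: "a \<in> J" "b \<in> J" "a \<noteq> b" and n: "\<And>j. 5 \<le> n j"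
    and p: "p \<in> descent n c a" "p \<in> descent n c b"
  shows "\<exists>k. p = at_level c a k \<and> joined n a b k"
proof -
  have sn: "start j < n j" for j using n[of j] start_le[of j] by linarith
  obtain t where t: "p = level_path (at_level c a) t" "real (start a) \<le> t" "t \<le> real (n a)"
    using p(1) unfolding descent_image[where n = n and c = c and j = a, OF sn] by auto
  obtain t' where t': "p = level_path (at_level c b) t'" "real (start b) \<le> t'" "t' \<le> real (n b)"
    using p(2) unfolding descent_image[where n = n and c = c and j = b, OF sn] by auto
  have "0 \<le> t" "0 \<le> t'" using t(2) t'(2) by linarith+
  then have "2 - t / 2 = 2 - t' / 2" using level_path_height[of t c a] level_path_height[of t' c b] t(1) t'(1) by simp
  then have tt: "t' = t" by simp
  note t' = t'[unfolded tt]
  obtain k where k: "alive n a b k" "real k \<le> t" "t \<le> real (Suc k)"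
  proof (cases "t < real (n a) \<and> t < real (n b)")
    case True
    show ?thesis
    proof (rule that)
      show "alive n a b (nat \<lfloor>t\<rfloor>)" unfolding alive_def
        using True t(2) t'(2) \<open>0 \<le> t\<close> by (auto simp: le_nat_iff nat_less_iff floor_less_iff le_floor_iff)
    qed (use \<open>0 \<le> t\<close> in linarith)+
  next
    case False
    define m where "m = min (n a) (n b)"
    have m: "5 \<le> m" "t = real m" "m \<le> n a" "m \<le> n b" using n[of a] n[of b] False t(3) t'(3) by (auto simp: m_def min_def)
    show ?thesis
    proof (rule that)
      show "alive n a b (m - 1)" unfolding alive_def using m start_le[of a] start_le[of b] by auto
    qed (use m in auto)
  qed
  have nb: "\<not> (joined n a b k \<and> joined n a b (Suc k))"
    using k(1) start_le[of a] n[of a] unfolding joined_def alive_def by auto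
  have "separated n c c a b k" by (rule compatibleD[OF comp ab k(1)])
  from separated_meet[OF this k(2,3)] t(1) t'(1) nb
  obtain k' where "t = real k'" "joined n a b k'" by metis
  then show ?thesis using t(1) level_path_real by metis
qed

text \<open>Heights decrease along a descent, so it is injective.\<close>

lemma descent_arc:
  assumes sn: "start j < n j"
  shows "\<exists>g. arc g \<and> pathstart g = at_level c j (start j) \<and> pathfinish g = at_level c j (n j) \<and> path_image g = descent n c j"
proof -
  define s m where "s = real (start j)" and "m = real (n j)"
  have sm: "s < m" "0 \<le> s" using sn by (simp_all add: s_def m_def)
  define g where "g = (\<lambda>x. level_path (at_level c j) (s + x * (m - s)))"
  define R where "R = (\<Sum>k<n j. norm (at_level c j (Suc k) - at_level c j k))"
  have "R-lipschitz_on {s..m} (level_path (at_level c j))"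
    unfolding s_def m_def
  proof (rule level_path_lipschitz)
    show "norm (at_level c j (Suc k) - at_level c j k) \<le> R" if "k < n j" for k
      unfolding R_def by (rule member_le_sum[where f = "\<lambda>k. norm (at_level c j (Suc k) - at_level c j k)"]) (use that in auto)
  qed (use sn in \<open>auto simp: R_def intro: sum_nonneg\<close>)
  then have cont: "continuous_on {s..m} (level_path (at_level c j))" by (rule lipschitz_on_continuous_on)
  have aff: "(\<lambda>x. s + x * (m - s)) ` {0..1} = {s..m}"
    using image_affinity_atLeastAtMost[of "m - s" s 0 "1::real"] sm by (simp add: mult.commute add.commute)
  have im: "g ` {0..1} = descent n c j"
    unfolding descent_image[where n = n and c = c and j = j, OF sn] s_def[symmetric] m_def[symmetric] aff[symmetric] g_def by (simp add: image_image)
  have "path g" unfolding path_def g_def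
    by (rule continuous_on_compose2[OF cont]) (auto intro!: continuous_intros simp: aff)
  moreover have "inj_on g {0..1}"
  proof (rule inj_onI)
    fix x y :: real assume xy: "x \<in> {0..1}" "y \<in> {0..1}" "g x = g y"
    have "0 \<le> s + z * (m - s)" if "z \<in> {0..1}" for z using that sm by auto
    then have "snd (snd (g z)) = 2 - (s + z * (m - s)) / 2" if "z \<in> {0..1}" for z
      using that level_path_height unfolding g_def by blast
    moreover have "A = B" if "z = 2 - A / 2" "z = 2 - B / 2" for A B z :: real using that by linarith
    ultimately have "s + x * (m - s) = s + y * (m - s)" using xy by metis
    then show "x = y" using sm by simp
  qed
  ultimately have "arc g" by (simp add: arc_def)
  moreover have "pathstart g = at_level c j (start j)" by (simp add: pathstart_def g_def s_def)
  moreover have "pathfinish g = at_level c j (n j)" by (simp add: pathfinish_def g_def m_def)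
  ultimately show ?thesis using im unfolding path_image_def by blast
qed

lemma edge_arc:
  assumes comp: "compatible n J c c" and ab: "a \<in> J" "b \<in> J" and n: "\<And>j. 5 \<le> n j"
    and st: "start a = 0" "start b = 2" and bottom: "at_level c a (n a) = at_level c b (n b)"
  shows "\<exists>g. arc g \<and> pathstart g = at_level c a 0 \<and> pathfinish g = at_level c b 2 \<and> path_image g = curve n {a, b} c"
proof -
  have sn: "start j < n j" for j using n[of j] start_le[of j] by linarith
  obtain g where g: "arc g" "pathstart g = at_level c a 0" "pathfinish g = at_level c a (n a)" "path_image g = descent n c a"
    using descent_arc[where n = n and c = c and j = a, OF sn] unfolding st by blast
  obtain h where h: "arc h" "pathstart h = at_level c b 2" "pathfinish h = at_level c b (n b)" "path_image h = descent n c b"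
    using descent_arc[where n = n and c = c and j = b, OF sn] unfolding st by blast
  have "arc (g +++ reversepath h)"
  proof (rule arc_join)
    show "path_image g \<inter> path_image (reversepath h) \<subseteq> {pathstart (reversepath h)}"
    proof
      fix p assume "p \<in> path_image g \<inter> path_image (reversepath h)"
      then have p: "p \<in> descent n c a" "p \<in> descent n c b" using g h by auto
      have "a \<noteq> b" using st by auto
      from descents_meet[OF comp ab this n p] obtain k where "p = at_level c a k" "joined n a b k" by blast
      then show "p \<in> {pathstart (reversepath h)}" using st h(3) bottom unfolding joined_def by auto
    qed
  qed (use g h bottom in \<open>auto simp: arc_reversepath\<close>)
  moreover have "path_image (g +++ reversepath h) = curve n {a, b} c"
    using g h bottom by (subst path_image_join) (auto simp: curve_descents)
  ultimately show ?thesis using g h by (intro exI[of _ "g +++ reversepath h"]) simp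
qed

section \<open>Polygonal strands of a braid diagram\<close>

lemma polyline_append:
  "xs \<noteq> [] \<Longrightarrow> ys \<noteq> [] \<Longrightarrow> polyline (xs @ ys) = polyline xs \<union> closed_segment (last xs) (hd ys) \<union> polyline ys"
proof (induction xs rule: polyline.induct)
  case (2 p)
  then obtain q zs where "ys = q # zs" by (cases ys) auto
  then show ?case by auto
next
  case (3 p q ps)
  then show ?case by auto
qed simp

lemma polyline_rev: "polyline (rev xs) = polyline xs"
proof (induction xs rule: polyline.induct)
  case (3 p q ps)
  have "polyline (rev (q # ps) @ [p]) = polyline (rev (q # ps)) \<union> closed_segment (last (rev (q # ps))) (hd [p]) \<union> polyline [p]"
    by (rule polyline_append) simp_all
  then show ?case using 3 by (auto simp: closed_segment_commute)
qed simp_all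

lemma polyline_glue:
  assumes "xs \<noteq> []" "ys \<noteq> []"
  shows "polyline (xs @ [B] @ rev ys) = polyline (xs @ [B]) \<union> polyline (ys @ [B])"
proof -
  have B: "B \<in> polyline (xs @ [B])" using assms by (simp add: polyline_append)
  have "polyline ((xs @ [B]) @ rev ys) = polyline (xs @ [B]) \<union> closed_segment B (last ys) \<union> polyline ys"
    using assms by (subst polyline_append) (simp_all add: polyline_rev hd_rev)
  moreover have "polyline (ys @ [B]) = polyline ys \<union> closed_segment (last ys) B \<union> {B}"
    using assms by (subst polyline_append) simp_all
  ultimately show ?thesis using B by (auto simp: closed_segment_commute)
qed

definition strand_point :: "braid_word \<Rightarrow> nat \<Rightarrow> real \<Rightarrow> nat \<Rightarrow> point" where
  "strand_point w p h k = (fst (place (map Some w) p k), snd (place (map Some w) p k), h - real k / 2)"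

lemma strand_ends:
  "strand w p h \<noteq> [] \<and> hd (strand w p h) = (real p, 0, h) \<and> last (strand w p h) = (real (moves (map Some w) p), 0, h - real (length w))"
proof (induction w p h rule: strand.induct)
  case (2 i f w p h)
  then show ?case by (cases "p = i"; cases "p = i + 1") (auto simp: move_Some)
qed simp

text \<open>
  At a letter that does not involve the strand, \<open>strand\<close> makes a single segment, whereas
  \<open>place\<close> subdivides it at its midpoint.
\<close>

lemma polyline_strand:
  "polyline (strand w p h) = insert (real p, 0, h) (\<Union>k<2 * length w. closed_segment (strand_point w p h k) (strand_point w p h (Suc k)))"
proof (induction w arbitrary: p h)
  case (Cons x w)
  obtain i f where x: "x = (i, f)" by force
  define q where "q = move (Some (i, f)) p"
  define P where "P = strand_point (x # w) p h"
  have P: "P 0 = (real p, 0, h)" "P (Suc 0) = (fst (halfway (Some x) p), snd (halfway (Some x) p), h - 1/2)"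
    "P (Suc (Suc k)) = strand_point w q (h - 1) k" for k
    by (simp_all add: P_def strand_point_def x q_def field_simps)
  have Q0: "strand_point w q (h - 1) 0 = (real q, 0, h - 1)" by (simp add: strand_point_def)
  have e: "{..<2 * length (x # w)} = {0, Suc 0} \<union> (\<lambda>k. Suc (Suc k)) ` {..<2 * length w}"
  proof (intro set_eqI iffI)
    fix k assume k: "k \<in> {..<2 * length (x # w)}"
    show "k \<in> {0, Suc 0} \<union> (\<lambda>k. Suc (Suc k)) ` {..<2 * length w}"
    proof (cases "k < 2")
      case True
      then show ?thesis by auto
    next
      case False
      then show ?thesis using k by (intro UnI2 image_eqI[of _ _ "k - 2"]) auto
    qed
  qed auto
  have U: "(\<Union>k<2 * length (x # w). closed_segment (P k) (P (Suc k)))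
    = closed_segment (P 0) (P (Suc 0)) \<union> closed_segment (P (Suc 0)) (real q, 0, h - 1)
      \<union> (\<Union>k<2 * length w. closed_segment (strand_point w q (h - 1) k) (strand_point w q (h - 1) (Suc k)))"
    unfolding e UN_Un image_image UN_insert UN_empty P(3) using P(3)[of 0] Q0 by auto
  have IH: "polyline (strand w q (h - 1)) = insert (real q, 0, h - 1) (\<Union>k<2 * length w. closed_segment (strand_point w q (h - 1) k) (strand_point w q (h - 1) (Suc k)))"
    by (rule Cons.IH)
  have split: "polyline (ys @ strand w q (h - 1)) = polyline ys \<union> closed_segment (last ys) (real q, 0, h - 1) \<union> polyline (strand w q (h - 1))"
    if "ys \<noteq> []" for ys using polyline_append[OF that, of "strand w q (h - 1)"] strand_ends[of w q "h - 1"] by simp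
  have "polyline (strand (x # w) p h) = closed_segment (P 0) (P (Suc 0)) \<union> closed_segment (P (Suc 0)) (real q, 0, h - 1) \<union> polyline (strand w q (h - 1))"
  proof (cases "p = i \<or> p = i + 1")
    case True
    then have "strand (x # w) p h = [P 0, P (Suc 0)] @ strand w q (h - 1)"
      unfolding P(1,2) by (auto simp: x q_def move_Some)
    then show ?thesis using split[of "[P 0, P (Suc 0)]"] by auto
  next
    case False
    then have pq: "q = p" and s: "strand (x # w) p h = [P 0] @ strand w q (h - 1)" and P1: "P (Suc 0) = (real p, 0, h - 1/2)"
      unfolding P(1,2) by (auto simp: x q_def move_Some halfway_def)
    have "P (Suc 0) = midpoint (P 0) (real q, 0, h - 1)" unfolding P1 P(1) pq by (simp add: midpoint_def field_simps)
    then have "P (Suc 0) \<in> closed_segment (P 0) (real q, 0, h - 1)" by simp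
    from Un_closed_segment[OF this] show ?thesis unfolding s using split[of "[P 0]"] by auto
  qed
  moreover have "(real q, 0, h - 1) \<in> closed_segment (P (Suc 0)) (real q, 0, h - 1)" by (rule ends_in_segment)
  moreover have "(real p, 0, h) \<in> closed_segment (P 0) (P (Suc 0))" unfolding P(1) by (rule ends_in_segment)
  ultimately show ?case unfolding IH U[unfolded P_def] unfolding P_def by blast
qed simp

section \<open>The theta graph as a union of descents\<close>

abbreviation chain :: "(nat \<Rightarrow> point) \<Rightarrow> nat \<Rightarrow> nat \<Rightarrow> point set" where
  "chain p a b \<equiv> (\<Union>k\<in>{a..<b}. closed_segment (p k) (p (Suc k)))"

lemma chain_split: "a \<le> b \<Longrightarrow> b \<le> d \<Longrightarrow> chain p a d = chain p a b \<union> chain p b d"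
  unfolding UN_Un[symmetric] by (simp add: ivl_disj_un_two(3))

lemma chain_single: "chain p a (Suc a) = closed_segment (p a) (p (Suc a))"
  by simp

lemma chain_shift:
  assumes "\<And>k. k \<le> m \<Longrightarrow> p (a + k) = p' k"
  shows "chain p a (a + m) = (\<Union>k<m. closed_segment (p' k) (p' (Suc k)))"
proof (intro set_eqI iffI)
  fix x assume "x \<in> chain p a (a + m)"
  then obtain k where k: "a \<le> k" "k < a + m" "x \<in> closed_segment (p k) (p (Suc k))" by auto
  have "p k = p' (k - a)" "p (Suc k) = p' (Suc (k - a))"
    using assms[of "k - a"] assms[of "Suc (k - a)"] k by (simp_all add: Suc_diff_le)
  then show "x \<in> (\<Union>k<m. closed_segment (p' k) (p' (Suc k)))" using k by (intro UN_I[of "k - a"]) auto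
next
  fix x assume "x \<in> (\<Union>k<m. closed_segment (p' k) (p' (Suc k)))"
  then obtain k where k: "k < m" "x \<in> closed_segment (p' k) (p' (Suc k))" by auto
  have "p (a + k) = p' k" "p (Suc (a + k)) = p' (Suc k)" using assms[of k] assms[of "Suc k"] k by simp_all
  then show "x \<in> chain p a (a + m)" using k by (intro UN_I[of "a + k"]) auto
qed

definition apex :: "nat \<Rightarrow> point" where
  "apex j = (3, 0, 2 - real (start j) / 2)"

text \<open>Above the upper braid each strand is a single segment, subdivided by the levels on the way.\<close>

lemma theta_top:
  "at_level (theta_config u v) j (start j) = apex j" "at_level (theta_config u v) j 4 = (real j, 0, 0)"
  "chain (at_level (theta_config u v) j) (start j) 4 = closed_segment (apex j) (real j, 0, 0)"
proof -
  let ?p = "at_level (theta_config u v) j"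
  have s: "start j \<le> 2" "real (start j) \<le> 2" using start_le[of j] by simp_all
  show a: "?p (start j) = apex j" using s by (simp add: at_level_def theta_config_def apex_def)
  show b: "?p 4 = (real j, 0, 0)" by (simp add: at_level_def theta_config_def)
  define d where "d = 4 - real (start j)"
  have d: "d \<noteq> 0" using s by (simp add: d_def)
  have "chain ?p (start j) 4 = closed_segment (?p (start j)) (?p 4)"
  proof (rule affine_chain)
    fix k assume k: "start j \<le> k" "k \<le> 4"
    show "?p k = (3 - (real j - 3) * real (start j) / d, 0, 2) + real k *\<^sub>R ((real j - 3) / d, 0, - 1/2)"
    proof (cases "k < 4")
      case True
      then show ?thesis by (simp add: at_level_def theta_config_def d_def[symmetric] diff_divide_distrib algebra_simps)
    next
      case False
      then have k4: "k = 4" using k by simp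
      have "3 - (real j - 3) * real (start j) / d + 4 * ((real j - 3) / d) = 3 + (real j - 3) * ((4 - real (start j)) / d)"
        by (simp add: diff_divide_distrib algebra_simps)
      also have "\<dots> = real j" using d by (simp add: d_def)
      finally show ?thesis unfolding k4 b by simp
    qed
  qed (use s in simp)
  then show "chain ?p (start j) 4 = closed_segment (apex j) (real j, 0, 0)" unfolding a b .
qed

lemma theta_upper:
  assumes "moves (map Some u) j = upper_end j"
  shows "at_level (theta_config u v) j (4 + 2 * length u) = (real (upper_end j), 0, - real (length u))"
    "insert (real j, 0, 0) (chain (at_level (theta_config u v) j) 4 (4 + 2 * length u)) = polyline (strand u j 0)"
proof -
  have p: "at_level (theta_config u v) j (4 + k) = strand_point u j 0 k" if "k \<le> 2 * length u" for k
    using that by (cases "k = 0") (simp_all add: at_level_def theta_config_def strand_point_def field_simps)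
  show "at_level (theta_config u v) j (4 + 2 * length u) = (real (upper_end j), 0, - real (length u))"
    using p[of "2 * length u"] place_end[of "map Some u" j] assms by (simp add: strand_point_def)
  show "insert (real j, 0, 0) (chain (at_level (theta_config u v) j) 4 (4 + 2 * length u)) = polyline (strand u j 0)"
  proof -
    have "chain (at_level (theta_config u v) j) 4 (4 + 2 * length u) = (\<Union>k<2 * length u. closed_segment (strand_point u j 0 k) (strand_point u j 0 (Suc k)))"
      by (rule chain_shift) (rule p)
    then show ?thesis unfolding polyline_strand by (rule arg_cong)
  qed
qed

lemma theta_lower:
  assumes "\<And>p. moves (map Some v) p = p" "j \<in> {1, 2, 4, 6}"
  shows "at_level (theta_config u v) j (6 + 2 * length u) = (real (lower_start j), 0, - real (length u) - 1)"
    "at_level (theta_config u v) j (6 + 2 * length u + 2 * length v) = (real (lower_start j), 0, - real (length u) - 1 - real (length v))"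
    "insert (real (lower_start j), 0, - real (length u) - 1) (chain (at_level (theta_config u v) j) (6 + 2 * length u) (6 + 2 * length u + 2 * length v))
      = polyline (strand v (lower_start j) (- real (length u) - 1))"
proof -
  have p: "at_level (theta_config u v) j (6 + 2 * length u + k) = strand_point v (lower_start j) (- real (length u) - 1) k" if "k \<le> 2 * length v" for k
    using that assms(2) by (auto simp: at_level_def theta_config_def strand_point_def stop_def field_simps)
  show "at_level (theta_config u v) j (6 + 2 * length u) = (real (lower_start j), 0, - real (length u) - 1)"
    using p[of 0] by (simp add: strand_point_def)
  show "at_level (theta_config u v) j (6 + 2 * length u + 2 * length v) = (real (lower_start j), 0, - real (length u) - 1 - real (length v))"
    using p[of "2 * length v"] place_end[of "map Some v" "lower_start j"] assms(1) by (simp add: strand_point_def)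
  show "insert (real (lower_start j), 0, - real (length u) - 1) (chain (at_level (theta_config u v) j) (6 + 2 * length u) (6 + 2 * length u + 2 * length v))
      = polyline (strand v (lower_start j) (- real (length u) - 1))"
  proof -
    have "chain (at_level (theta_config u v) j) (6 + 2 * length u) (6 + 2 * length u + 2 * length v)
      = (\<Union>k<2 * length v. closed_segment (strand_point v (lower_start j) (- real (length u) - 1) k) (strand_point v (lower_start j) (- real (length u) - 1) (Suc k)))"
      by (rule chain_shift) (rule p)
    then show ?thesis unfolding polyline_strand by (rule arg_cong)
  qed
qed

text \<open>
  The isolated points that \<open>polyline\<close> contributes for words without letters lie on the
  neighbouring segments.
\<close>

lemma absorb_endpoints:
  "A \<in> S \<Longrightarrow> X \<in> S \<Longrightarrow> B \<in> T \<Longrightarrow> {A} \<union> S \<union> (insert X C \<union> T \<union> {B}) = S \<union> C \<union> T"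
  "A \<in> S \<Longrightarrow> X \<in> S \<Longrightarrow> Y \<in> T \<Longrightarrow> B \<in> R \<Longrightarrow>
    {A} \<union> S \<union> (insert X C \<union> T \<union> (insert Y D \<union> R \<union> {B})) = S \<union> (C \<union> (T \<union> (D \<union> R)))"
  by blast+

lemma short_descent:
  assumes u: "moves (map Some u) j = upper_end j" and j: "j \<in> {3, 5}"
  shows "polyline ([apex j] @ strand u j 0 @ [(7/2, 0, - real (length u) - 1/2)]) = descent (stop u v) (theta_config u v) j"
    "at_level (theta_config u v) j (stop u v j) = (7/2, 0, - real (length u) - 1/2)"
proof -
  let ?p = "at_level (theta_config u v) j"
  let ?E = "4 + 2 * length u"
  have n: "stop u v j = Suc ?E" using j by (auto simp: stop_def)
  show e: "?p (stop u v j) = (7/2, 0, - real (length u) - 1/2)"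
    using j unfolding n by (auto simp: at_level_def theta_config_def field_simps)
  have "descent (stop u v) (theta_config u v) j = chain ?p (start j) 4 \<union> chain ?p 4 ?E \<union> chain ?p ?E (Suc ?E)"
    unfolding descent_def n using start_le[of j] by (subst chain_split[of _ 4], simp, simp) (subst chain_split[of 4 ?E], simp_all add: Un_assoc)
  also have "chain ?p ?E (Suc ?E) = closed_segment (real (upper_end j), 0, - real (length u)) (7/2, 0, - real (length u) - 1/2)"
    unfolding chain_single theta_upper(1)[OF u] e[unfolded n] ..
  finally have d: "descent (stop u v) (theta_config u v) j = closed_segment (apex j) (real j, 0, 0) \<union> chain ?p 4 ?E
      \<union> closed_segment (real (upper_end j), 0, - real (length u)) (7/2, 0, - real (length u) - 1/2)"
    unfolding theta_top(3) .
  have s: "strand u j 0 \<noteq> []" "hd (strand u j 0) = (real j, 0, 0)" "last (strand u j 0) = (real (upper_end j), 0, - real (length u))"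
    using strand_ends[of u j 0] u by simp_all
  have "polyline ([apex j] @ strand u j 0 @ [(7/2, 0, - real (length u) - 1/2)])
    = {apex j} \<union> closed_segment (apex j) (real j, 0, 0) \<union> (polyline (strand u j 0)
      \<union> closed_segment (real (upper_end j), 0, - real (length u)) (7/2, 0, - real (length u) - 1/2) \<union> {(7/2, 0, - real (length u) - 1/2)})"
    using s by (subst polyline_append, simp, simp) (subst polyline_append, simp_all)
  then show "polyline ([apex j] @ strand u j 0 @ [(7/2, 0, - real (length u) - 1/2)]) = descent (stop u v) (theta_config u v) j"
    unfolding d theta_upper(2)[OF u, of v, symmetric]
    by (simp only: absorb_endpoints(1)[OF ends_in_segment(1) ends_in_segment(2) ends_in_segment(2)])
qed

lemma long_descent:
  assumes u: "moves (map Some u) j = upper_end j" and v: "\<And>p. moves (map Some v) p = p" and j: "j \<in> {1, 2, 4, 6}"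
  defines "B \<equiv> (if j \<in> {1, 2} then 3/2 else 7/2, 0, - real (length u) - 1 - real (length v) - 1/2)"
  shows "polyline ([apex j] @ strand u j 0 @ strand v (lower_start j) (- real (length u) - 1) @ [B])
      = descent (stop u v) (theta_config u v) j"
    "at_level (theta_config u v) j (stop u v j) = B"
proof -
  let ?p = "at_level (theta_config u v) j"
  let ?E = "4 + 2 * length u" and ?F = "6 + 2 * length u" and ?G = "6 + 2 * length u + 2 * length v"
  define a where "a = (real (upper_end j), 0 :: real, - real (length u))"
  define b where "b = (real (lower_start j), 0 :: real, - real (length u) - 1)"
  define d where "d = (real (lower_start j), 0 :: real, - real (length u) - 1 - real (length v))"
  have n: "stop u v j = Suc ?G" using j by (auto simp: stop_def)
  show e: "?p (stop u v j) = B"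
    using j unfolding n B_def by (auto simp: at_level_def theta_config_def stop_def field_simps)
  have pa: "?p ?E = a" unfolding a_def by (rule theta_upper(1)[OF u])
  have pb: "?p ?F = b" unfolding b_def by (rule theta_lower(1)[OF v j])
  have pd: "?p ?G = d" unfolding d_def by (rule theta_lower(2)[OF v j])
  have pm: "?p (Suc ?E) = midpoint a b"
    using j unfolding a_def b_def by (auto simp: at_level_def theta_config_def midpoint_def field_simps)
  have m: "midpoint a b \<in> closed_segment a b" by simp
  have "chain ?p ?E ?F = closed_segment (?p ?E) (?p (Suc ?E)) \<union> closed_segment (?p (Suc ?E)) (?p ?F)"
  proof -
    have F: "?F = Suc (Suc ?E)" by simp
    show ?thesis unfolding F by (subst chain_split[of ?E "Suc ?E"]) (simp_all only: chain_single le_Suc_eq order_refl simp_thms)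
  qed
  then have ab: "chain ?p ?E ?F = closed_segment a b" unfolding pa pb pm Un_closed_segment[OF m] .
  have "descent (stop u v) (theta_config u v) j = chain ?p (start j) 4 \<union> (chain ?p 4 ?E \<union> (chain ?p ?E ?F \<union> (chain ?p ?F ?G \<union> chain ?p ?G (Suc ?G))))"
  proof -
    have "chain ?p (start j) (Suc ?G) = chain ?p (start j) 4 \<union> chain ?p 4 (Suc ?G)" using start_le[of j] by (intro chain_split) simp_all
    moreover have "chain ?p 4 (Suc ?G) = chain ?p 4 ?E \<union> chain ?p ?E (Suc ?G)" by (intro chain_split) simp_all
    moreover have "chain ?p ?E (Suc ?G) = chain ?p ?E ?F \<union> chain ?p ?F (Suc ?G)" by (intro chain_split) simp_all
    moreover have "chain ?p ?F (Suc ?G) = chain ?p ?F ?G \<union> chain ?p ?G (Suc ?G)" by (intro chain_split) simp_all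
    ultimately show ?thesis unfolding descent_def n by (simp only:)
  qed
  also have "chain ?p ?G (Suc ?G) = closed_segment d B"
    unfolding chain_single pd e[unfolded n] ..
  finally have D: "descent (stop u v) (theta_config u v) j = closed_segment (apex j) (real j, 0, 0) \<union> (chain ?p 4 ?E
      \<union> (closed_segment a b \<union> (chain ?p ?F ?G \<union> closed_segment d B)))"
    unfolding theta_top(3) ab .
  have s: "strand u j 0 \<noteq> []" "hd (strand u j 0) = (real j, 0, 0)" "last (strand u j 0) = a"
    using strand_ends[of u j 0] u by (simp_all add: a_def)
  let ?V = "strand v (lower_start j) (- real (length u) - 1)"
  have t: "?V \<noteq> []" "hd ?V = b" "last ?V = d"
    using strand_ends[of v "lower_start j" "- real (length u) - 1"] v by (simp_all add: b_def d_def)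
  have "polyline (?V @ [B]) = polyline ?V \<union> closed_segment d B \<union> {B}"
    using polyline_append[OF t(1), of "[B]"] t by simp
  moreover have "polyline (strand u j 0 @ (?V @ [B])) = polyline (strand u j 0) \<union> closed_segment a b \<union> polyline (?V @ [B])"
    using polyline_append[OF s(1), of "?V @ [B]"] s t by simp
  moreover have "polyline ([apex j] @ (strand u j 0 @ (?V @ [B]))) = {apex j} \<union> closed_segment (apex j) (real j, 0, 0) \<union> polyline (strand u j 0 @ (?V @ [B]))"
    using polyline_append[of "[apex j]" "strand u j 0 @ (?V @ [B])"] s by simp
  ultimately have P: "polyline ([apex j] @ (strand u j 0 @ (?V @ [B]))) = {apex j} \<union> closed_segment (apex j) (real j, 0, 0)
      \<union> (polyline (strand u j 0) \<union> closed_segment a b \<union> (polyline ?V \<union> closed_segment d B \<union> {B}))"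
    by (simp only:)
  have i: "insert (real j, 0, 0) (chain ?p 4 ?E) = polyline (strand u j 0)" "insert b (chain ?p ?F ?G) = polyline ?V"
    using theta_upper(2)[OF u, of v] theta_lower(3)[OF v j, of u] unfolding b_def by simp_all
  show "polyline ([apex j] @ strand u j 0 @ ?V @ [B]) = descent (stop u v) (theta_config u v) j"
    unfolding P D i[symmetric]
    by (rule absorb_endpoints(2)[OF ends_in_segment(1) ends_in_segment(2) ends_in_segment(2) ends_in_segment(2)])
qed

lemma theta_graph_curves:
  assumes u: "\<And>j. j \<in> {1..6} \<Longrightarrow> moves (map Some (upper_braid A t1)) j = upper_end j" and v: "\<And>p. moves (map Some (lower_braid A t2)) p = p"
  defines "c \<equiv> theta_config (upper_braid A t1) (lower_braid A t2)" and "n \<equiv> stop (upper_braid A t1) (lower_braid A t2)"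
  shows "theta_graph A t1 t2 = ((3, 0, 2), (3, 0, 1), {curve n {1, 2} c, curve n {3, 5} c, curve n {4, 6} c})"
    "\<And>e. e \<in> {curve n {1, 2} c, curve n {3, 5} c, curve n {4, 6} c} \<Longrightarrow> \<exists>ps. e = polyline ps"
    "at_level c 1 (n 1) = at_level c 2 (n 2)" "at_level c 5 (n 5) = at_level c 3 (n 3)" "at_level c 6 (n 6) = at_level c 4 (n 4)"
proof -
  note One_nat_def [simp del]
  define U where "U = upper_braid A t1"
  define V where "V = lower_braid A t2"
  let ?h = "- real (length U) - 1"
  have L: "moves (map Some U) j = upper_end j" if "j \<in> {1..6}" for j using u[OF that] by (simp add: U_def)
  have M: "moves (map Some V) p = p" for p using v by (simp add: V_def)
  have L6: "moves (map Some U) 1 = upper_end 1" "moves (map Some U) 2 = upper_end 2" "moves (map Some U) 3 = upper_end 3"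
    "moves (map Some U) 4 = upper_end 4" "moves (map Some U) 5 = upper_end 5" "moves (map Some U) 6 = upper_end 6"
    by (rule L, simp)+
  have ap: "apex 1 = (3, 0, 2)" "apex 5 = (3, 0, 2)" "apex 6 = (3, 0, 2)" "apex 2 = (3, 0, 1)" "apex 3 = (3, 0, 1)" "apex 4 = (3, 0, 1)"
    by (simp_all add: apex_def start_def)
  have ls: "lower_start 1 = 1" "lower_start 2 = 2" "lower_start 4 = 3" "lower_start 6 = 4" by (simp_all add: lower_start_def)
  have d1: "polyline ([(3, 0, 2)] @ strand U 1 0 @ strand V 1 ?h @ [(3/2, 0, ?h - real (length V) - 1/2)]) = descent (stop U V) (theta_config U V) 1"
    using long_descent(1)[OF L6(1) M] by (simp add: ap ls)
  have d2: "polyline ([(3, 0, 1)] @ strand U 2 0 @ strand V 2 ?h @ [(3/2, 0, ?h - real (length V) - 1/2)]) = descent (stop U V) (theta_config U V) 2"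
    using long_descent(1)[OF L6(2) M] by (simp add: ap ls)
  have d4: "polyline ([(3, 0, 1)] @ strand U 4 0 @ strand V 3 ?h @ [(7/2, 0, ?h - real (length V) - 1/2)]) = descent (stop U V) (theta_config U V) 4"
    using long_descent(1)[OF L6(4) M] by (simp add: ap ls)
  have d6: "polyline ([(3, 0, 2)] @ strand U 6 0 @ strand V 4 ?h @ [(7/2, 0, ?h - real (length V) - 1/2)]) = descent (stop U V) (theta_config U V) 6"
    using long_descent(1)[OF L6(6) M] by (simp add: ap ls)
  have d3: "polyline ([(3, 0, 1)] @ strand U 3 0 @ [(7/2, 0, - real (length U) - 1/2)]) = descent (stop U V) (theta_config U V) 3"
    using short_descent(1)[OF L6(3)] by (simp add: ap)
  have d5: "polyline ([(3, 0, 2)] @ strand U 5 0 @ [(7/2, 0, - real (length U) - 1/2)]) = descent (stop U V) (theta_config U V) 5"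
    using short_descent(1)[OF L6(5)] by (simp add: ap)
  define e12 where "e12 = [(3, 0, 2)] @ strand U 1 0 @ strand V 1 ?h @ [(3/2, 0, ?h - real (length V) - 1/2)]
    @ rev (strand V 2 ?h) @ rev (strand U 2 0) @ [(3, 0, 1)]"
  define e35 where "e35 = [(3, 0, 1)] @ strand U 3 0 @ [(7/2, 0, - real (length U) - 1/2)] @ rev (strand U 5 0) @ [(3, 0, 2)]"
  define e46 where "e46 = [(3, 0, 1)] @ strand U 4 0 @ strand V 3 ?h @ [(7/2, 0, ?h - real (length V) - 1/2)]
    @ rev (strand V 4 ?h) @ rev (strand U 6 0) @ [(3, 0, 2)]"
  have c: "c = theta_config U V" "n = stop U V" by (simp_all add: c_def n_def U_def V_def)
  have 12: "polyline e12 = curve n {1, 2} c"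
    using polyline_glue[of "[(3, 0, 2)] @ strand U 1 0 @ strand V 1 ?h" "[(3, 0, 1)] @ strand U 2 0 @ strand V 2 ?h" "(3/2, 0, ?h - real (length V) - 1/2)"] d1 d2
    unfolding e12_def c curve_descents by simp
  have 35: "polyline e35 = curve n {3, 5} c"
    using polyline_glue[of "[(3, 0, 1)] @ strand U 3 0" "[(3, 0, 2)] @ strand U 5 0" "(7/2, 0, - real (length U) - 1/2)"] d3 d5
    unfolding e35_def c curve_descents by simp
  have 46: "polyline e46 = curve n {4, 6} c"
    using polyline_glue[of "[(3, 0, 1)] @ strand U 4 0 @ strand V 3 ?h" "[(3, 0, 2)] @ strand U 6 0 @ strand V 4 ?h" "(7/2, 0, ?h - real (length V) - 1/2)"] d4 d6
    unfolding e46_def c curve_descents by simp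
  show "theta_graph A t1 t2 = ((3, 0, 2), (3, 0, 1), {curve n {1, 2} c, curve n {3, 5} c, curve n {4, 6} c})"
    unfolding 12[symmetric] 35[symmetric] 46[symmetric] theta_graph_def Let_def e12_def e35_def e46_def U_def V_def ..
  show "\<exists>ps. e = polyline ps" if "e \<in> {curve n {1, 2} c, curve n {3, 5} c, curve n {4, 6} c}" for e
    using that 12 35 46 by blast
  have long: "at_level c j (n j) = (if j \<in> {1, 2} then 3/2 else 7/2, 0, ?h - real (length V) - 1/2)" if "j \<in> {1, 2, 4, 6}" for j
    unfolding c by (rule long_descent(2)[OF L M that]) (use that in auto)
  have short: "at_level c j (n j) = (7/2, 0, - real (length U) - 1/2)" if "j \<in> {3, 5}" for j
    unfolding c by (rule short_descent(2)[OF L that]) (use that in auto)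
  show "at_level c 1 (n 1) = at_level c 2 (n 2)" using long[of 1] long[of 2] by simp
  show "at_level c 5 (n 5) = at_level c 3 (n 3)" using short[of 5] short[of 3] by simp
  show "at_level c 6 (n 6) = at_level c 4 (n 4)" using long[of 6] long[of 4] by simp
qed

section \<open>The theta graph is Brunnian\<close>

lemma remove_edge_union:
  assumes "e1 \<inter> e2 = {v, w}" "e1 \<inter> e3 = {v, w}"
  shows "remove_edge (v, w, {e1, e2, e3}) e1 = e2 \<union> e3"
  unfolding remove_edge.simps using assms by blast

lemma curve_Un: "curve n J c \<union> curve n J' c = curve n (J \<union> J') c"
  unfolding curve_def by blast

text \<open>
  The edges are pairwise distinct because an edge that equals another one would equal its intersection
  with it, which consists of the two vertices.
\<close>

lemma brunnianI:
  assumes vw: "v \<noteq> w" and E: "E = {e1, e2, e3}"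
    and arcs: "\<And>e. e \<in> E \<Longrightarrow> (\<exists>ps. e = polyline ps) \<and> (\<exists>g. arc g \<and> pathstart g = v \<and> pathfinish g = w \<and> path_image g = e)"
    and proper: "\<And>e. e \<in> E \<Longrightarrow> e \<noteq> {v, w}"
    and meet: "e1 \<inter> e2 = {v, w}" "e1 \<inter> e3 = {v, w}" "e2 \<inter> e3 = {v, w}"
    and unknots: "is_unknot (to_S3 ` (e2 \<union> e3))" "is_unknot (to_S3 ` (e1 \<union> e3))" "is_unknot (to_S3 ` (e1 \<union> e2))"
  shows "brunnian (v, w, E)"
proof -
  have "e1 \<noteq> e2" "e1 \<noteq> e3" "e2 \<noteq> e3"
    using meet proper[of e1] proper[of e2] E by auto
  then have "card E = 3" unfolding E by simp
  moreover have "e \<inter> e' = {v, w}" if "e \<in> E" "e' \<in> E" "e \<noteq> e'" for e e'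
    using that meet unfolding E by (elim insertE emptyE) (simp_all add: Int_commute)
  ultimately have "spatial_theta (v, w, E)" using vw arcs by simp
  moreover have "remove_edge (v, w, E) e1 = e2 \<union> e3"
    unfolding E by (rule remove_edge_union[OF meet(1,2)])
  moreover have "remove_edge (v, w, E) e2 = e1 \<union> e3"
    using remove_edge_union[of e2 e1 v w e3] meet unfolding E by (simp only: insert_commute Int_commute)
  moreover have "remove_edge (v, w, E) e3 = e1 \<union> e2"
    using remove_edge_union[of e3 e1 v w e2] meet unfolding E by (simp only: insert_commute Int_commute)
  ultimately show ?thesis using unknots unfolding brunnian_def edges.simps E by (intro conjI ballI) (simp, elim insertE emptyE, simp_all only:)
qed

theorem theorem4p1:
  fixes A :: braid_word and t1 t2 :: int
  assumes "A \<in> ker_phi"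
  shows "brunnian (theta_graph A t1 t2)"
proof -
  note One_nat_def [simp del]
  define u where "u = upper_braid A t1"
  define v where "v = lower_braid A t2"
  define n where "n = stop u v"
  define c where "c = theta_config u v"
  have A: "A \<in> pure_braid_words 4" using assms by (simp add: ker_phi_def)
  note graph = theta_graph_curves[OF moves_upper[OF A] moves_lower[OF A], where ?t1.0 = t1 and ?t2.0 = t2, folded u_def v_def, folded n_def c_def]
  note k35 = without_35_unknot[OF assms, of t1 t2, folded u_def v_def, folded n_def c_def]
    and k46 = without_46_unknot[OF assms, of t1 t2, folded u_def v_def, folded n_def c_def]
    and k12 = without_12_unknot[OF assms, of t1 t2, folded u_def v_def, folded n_def c_def]
  have n5: "5 \<le> n j" for j by (simp add: n_def stop_def)
  have comp: "compatible n {1..6} c c"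
  proof (rule compatibleI)
    fix a b k assume ab: "a \<in> {1..6}" "b \<in> {1..6}" "a < b" "alive n a b k"
    \<comment> \<open>Any two strands occur together in one of the three knots.\<close>
    have "{a, b} \<subseteq> {1, 2, 4, 6} \<or> {a, b} \<subseteq> {1, 2, 3, 5} \<or> {a, b} \<subseteq> {3, 4, 5, 6}"
      using ab(1,2) by (elim labels_cases) simp_all
    then show "separated n c c a b k"
      using compatibleD[OF conjunct1[OF k35] _ _ _ ab(4)] compatibleD[OF conjunct1[OF k46] _ _ _ ab(4)]
        compatibleD[OF conjunct1[OF k12] _ _ _ ab(4)] ab(3) by blast
  qed
  have apex: "at_level c j (start j) = apex j" for j unfolding c_def by (rule theta_top(1))
  have apexes: "apex j \<in> {(3, 0, 2), (3, 0, 1)}" for j by (simp add: apex_def start_def)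
  have level: "at_level c 1 0 = (3, 0, 2)" "at_level c 5 0 = (3, 0, 2)" "at_level c 6 0 = (3, 0, 2)"
    "at_level c 2 2 = (3, 0, 1)" "at_level c 3 2 = (3, 0, 1)" "at_level c 4 2 = (3, 0, 1)"
    using apex[of 1] apex[of 5] apex[of 6] apex[of 2] apex[of 3] apex[of 4] by (simp_all add: apex_def start_def)
  define e1 where "e1 = curve n {1, 2} c"
  define e2 where "e2 = curve n {3, 5} c"
  define e3 where "e3 = curve n {4, 6} c"
  have 1: "\<exists>g. arc g \<and> pathstart g = (3, 0, 2) \<and> pathfinish g = (3, 0, 1) \<and> path_image g = e1"
    using edge_arc[OF comp _ _ n5 _ _ graph(3)] unfolding e1_def level by (simp add: start_def)
  have 2: "\<exists>g. arc g \<and> pathstart g = (3, 0, 2) \<and> pathfinish g = (3, 0, 1) \<and> path_image g = e2"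
    using edge_arc[OF comp _ _ n5 _ _ graph(4)] unfolding e2_def level by (simp add: start_def insert_commute)
  have 3: "\<exists>g. arc g \<and> pathstart g = (3, 0, 2) \<and> pathfinish g = (3, 0, 1) \<and> path_image g = e3"
    using edge_arc[OF comp _ _ n5 _ _ graph(5)] unfolding e3_def level by (simp add: start_def insert_commute)
  have vw: "(3, 0, 2) \<in> e" "(3, 0, 1) \<in> e" if "\<exists>g. arc g \<and> pathstart g = (3, 0, 2) \<and> pathfinish g = (3, 0, 1) \<and> path_image g = e" for e :: "point set"
    using that pathstart_in_path_image pathfinish_in_path_image by metis+
  have meet: "curve n S c \<inter> curve n T c \<subseteq> {(3, 0, 2), (3, 0, 1)}"
    if "S \<subseteq> {1..6}" "T \<subseteq> {1..6}" "\<And>a b. a \<in> S \<Longrightarrow> b \<in> T \<Longrightarrow> cup a \<noteq> cup b" for S T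
  proof
    fix p assume "p \<in> curve n S c \<inter> curve n T c"
    then obtain a b where ab: "a \<in> S" "b \<in> T" "p \<in> descent n c a" "p \<in> descent n c b" unfolding curve_descents by blast
    have "a \<in> {1..6}" "b \<in> {1..6}" "a \<noteq> b" using that(1,2) that(3)[OF ab(1,2)] ab(1,2) by blast+
    from descents_meet[OF comp this n5 ab(3,4)] obtain k where k: "p = at_level c a k" "joined n a b k" by blast
    then have "k = start a" using that(3)[OF ab(1,2)] unfolding joined_def by blast
    then show "p \<in> {(3, 0, 2), (3, 0, 1)}" using k(1) apex[of a] apexes[of a] by simp
  qed
  have both: "e \<inter> e' = {(3, 0, 2), (3, 0, 1)}"
    if "e \<inter> e' \<subseteq> {(3, 0, 2), (3, 0, 1)}" "(3, 0, 2) \<in> e" "(3, 0, 1) \<in> e" "(3, 0, 2) \<in> e'" "(3, 0, 1) \<in> e'" for e e' :: "point set"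
    by (rule equalityI[OF that(1)]) (simp only: insert_subset empty_subsetI Int_iff that simp_thms)
  have "e1 \<inter> e2 = {(3, 0, 2), (3, 0, 1)}"
    by (rule both[OF _ vw[OF 1] vw[OF 2]], unfold e1_def e2_def, rule meet) (auto simp: cup_def)
  moreover have "e1 \<inter> e3 = {(3, 0, 2), (3, 0, 1)}"
    by (rule both[OF _ vw[OF 1] vw[OF 3]], unfold e1_def e3_def, rule meet) (auto simp: cup_def)
  moreover have "e2 \<inter> e3 = {(3, 0, 2), (3, 0, 1)}"
    by (rule both[OF _ vw[OF 2] vw[OF 3]], unfold e2_def e3_def, rule meet) (auto simp: cup_def)
  ultimately have meets: "e1 \<inter> e2 = {(3, 0, 2), (3, 0, 1)}" "e1 \<inter> e3 = {(3, 0, 2), (3, 0, 1)}" "e2 \<inter> e3 = {(3, 0, 2), (3, 0, 1)}"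
    by (simp_all only:)
  have proper: "curve n J c \<noteq> {(3, 0, 2), (3, 0, 1)}" if "j \<in> J" for j J
  proof
    assume eq: "curve n J c = {(3, 0, 2), (3, 0, 1)}"
    have "start j < n j" using n5[of j] start_le[of j] by linarith
    then have "at_level c j (n j) \<in> descent n c j"
      unfolding descent_image[where n = n and c = c and j = j, OF \<open>start j < n j\<close>]
      by (intro image_eqI[of _ _ "real (n j)"]) simp_all
    then have "at_level c j (n j) \<in> {(3, 0, 2), (3, 0, 1)}" using that unfolding eq[symmetric] curve_descents by blast
    then show False using n5[of j] by (auto simp: at_level_def)
  qed
  have "brunnian ((3, 0, 2), (3, 0, 1), {e1, e2, e3})"
  proof (rule brunnianI[OF _ refl _ _ meets])
    show "e \<noteq> {(3, 0, 2), (3, 0, 1)}" if "e \<in> {e1, e2, e3}" for e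
      using that proper[of 1 "{1, 2}"] proper[of 3 "{3, 5}"] proper[of 4 "{4, 6}"] unfolding e1_def e2_def e3_def by blast
    show "(\<exists>ps. e = polyline ps) \<and> (\<exists>g. arc g \<and> pathstart g = (3, 0, 2) \<and> pathfinish g = (3, 0, 1) \<and> path_image g = e)"
      if "e \<in> {e1, e2, e3}" for e
      using that 1 2 3 graph(2)[of e] unfolding e1_def[symmetric] e2_def[symmetric] e3_def[symmetric] by blast
    have "{3, 5} \<union> {4, 6} = {3, 4, 5, 6::nat}" "{1, 2} \<union> {4, 6} = {1, 2, 4, 6::nat}" "{1, 2} \<union> {3, 5} = {1, 2, 3, 5::nat}" by auto
    then show "is_unknot (to_S3 ` (e2 \<union> e3))" "is_unknot (to_S3 ` (e1 \<union> e3))" "is_unknot (to_S3 ` (e1 \<union> e2))"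
      using k12 k35 k46 unfolding e1_def e2_def e3_def curve_Un by simp_all
  qed simp
  moreover have "theta_graph A t1 t2 = ((3, 0, 2), (3, 0, 1), {e1, e2, e3})"
    unfolding e1_def e2_def e3_def by (rule graph(1))
  ultimately show ?thesis by (simp only:)
qed

end
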